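(* Let $\Pi=\{\mathcal H,\Gamma_0,\Gamma_1\}$, $\mathcal H=H^n\oplus\mathcal H'$, be a decomposing boundary triplet for $L$ with Weyl function $M(\cdot)$. Let $\tau(\cdot)\in\widetilde R(\mathcal H)$ be a Nevanlinna operator pair $\tau(\lambda)=\{(C_0(\lambda),C_1(\lambda));\mathcal K\}$ with $C_0(\lambda)=(\hat C_2(\lambda)\;\;C_0'(\lambda)):H^n\oplus\mathcal H'\to\mathcal K$, $C_1(\lambda)=(\hat C_1(\lambda)\;\;C_1'(\lambda)):H^n\oplus\mathcal H'\to\mathcal K$, and let $\tau(\lambda)=\{K_0(\lambda),K_1(\lambda);\mathcal K'\}$, $\lambda\in\mathbb C_+\cup\mathbb C_-$, be an equivalent representation of $\tau$. Then: 1) for every $\lambda\in\mathbb C_+\cup\mathbb C_-$ there exists a unique pair of operator functions $u_{j\tau}(\cdot,\lambda)\in L_2'[H^n,H]$, $j\in\{1,2\}$, obeying the equation $l[y]-\lambda y=0$ and the boundary conditions $$\big(\hat C_1(\lambda)u_{j\tau}^{(1)}(0,\lambda)+\hat C_2(\lambda)u_{j\tau}^{(2)}(0,\lambda)\big)\hat h+(C_0'(\lambda)\Gamma_0'-C_1'(\lambda)\Gamma_1')(u_{j\tau}(\cdot,\lambda)\hat h)=(-1)^{j-1}\hat C_j(\lambda)\hat h,\quad\hat h\in H^n,\ j\in\{1,2\}.$$ Moreover, $$u_{j\tau}(t,\lambda)=(-1)^{j-1}Z_0(t,\lambda)(C_0(\lambda)-C_1(\lambda)M(\lambda))^{-1}\hat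 C_j(\lambda),\qquad j\in\{1,2\},\ \lambda\in\mathbb C_+\cup\mathbb C_-,$$ where $Z_0(\cdot,\lambda):\Delta\to[\mathcal H,H]$ is the operator solution of $l[y]-\lambda y=0$ with $Z_0(t,\lambda)h=(\gamma(\lambda)h)(t)$, $h\in\mathcal H$ ($\gamma$ being the $\gamma$-field of $\Pi$); 2) the characteristic matrix $\Omega_\tau(\cdot)$ corresponding to $\tau$ satisfies $$\Omega_\tau(\mu)-\Omega_\tau^*(\lambda)=(\mu-\overline\lambda)\int_0^bU_\tau^*(t,\lambda)U_\tau(t,\mu)\,dt+\beta^*(\lambda)\big(K_0^*(\lambda)K_1(\mu)-K_1^*(\lambda)K_0(\mu)\big)\beta(\mu),\quad\mu,\lambda\in\mathbb C_+\cup\mathbb C_-,$$ where $U_\tau(t,\lambda)=(u_{2\tau}(t,\lambda)\;\;u_{1\tau}(t,\lambda)):H^n\oplus H^n\to H$ and $\beta(\lambda)\in[H^n\oplus H^n,\mathcal K']$ is $$\beta(\lambda)=\big(-(K_1(\lambda)+M(\lambda)K_0(\lambda))^{-1}M(\lambda)\upharpoonright H^n\;\;\;(K_1(\lambda)+M(\lambda)K_0(\lambda))^{-1}\upharpoonright H^n\big)$$ (the integral converging strongly as $\operatorname{s-lim}_{\eta\uparrow b}\int_0^\eta$). Moreover, the inequality $$\frac{\mathrm{Im}\,\Omega_\tau(\mu)}{\mathrm{Im}\,\mu}\ge\int_0^bU_\tau^*(t,\mu)U_\tau(t,\mu)\,dt$$ holds for all $\mu\in\mathbb C_+\cup\mathbb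 C_-$.
   Context: **Setting.** $[X,Y]$ is the set of bounded linear operators from a Hilbert space $X$ to a Hilbert space $Y$, $[X]=[X,X]$; for $T\in[X,Y]$, $0\in\rho(T)$ means $T^{-1}\in[Y,X]$; $\mathrm{Im}\,T=(T-T^* )/2i$. $\mathbb C_\pm$ are the open upper/lower half-planes. $\Delta=[0,b\rangle$ with $0<b\le\infty$ (if $b<\infty$, $b$ may or may not belong to $\Delta$), $H$ is a separable complex Hilbert space ($\dim H\le\infty$), $D=d/dt$, and $$l[y]=\sum_{k=1}^n(-1)^k\Big(D^k(p_{n-k}D^ky)-\tfrac i2\big[D^{k-1}(q_{n-k}^*D^ky)+D^k(q_{n-k}D^{k-1}y)\big]\Big)+p_ny$$ with sufficiently smooth coefficients $p_k,q_k:\Delta\to[H]$, $p_k(t)=p_k^*(t)$, $0\in\rho(p_0(t))$. Quasi-derivatives: $y^{[k]}=D^ky$ ($0\le k\le n-1$), $y^{[n]}=p_0D^ny-\frac i2q_0D^{n-1}y$, $y^{[n+k]}=-Dy^{[n+k-1]}+p_kD^{n-k}y+\frac i2(q_{k-1}^*D^{n-k+1}y-q_kD^{n-k-1}y)$ ($1\le k\le n-1$), $y^{[2n]}=-Dy^{[2n-1]}+p_ny+\frac i2q_{n-1}^*Dy=l[y]$; the same formulas apply to operator functions $Y:\Delta\to[\mathcal K,H]$. Put $y^{(1)}(t)=(y^{[0]}(t),\dots,y^{[n-1]}(t))$, $y^{(2)}(t)=(y^{[2n-1]}(t),\dots,y^{[n]}(t))$ (columns), $\widetilde y(t)=\{y^{(1)}(t),y^{(2)}(t)\}$.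 $\mathfrak H=L_2(\Delta;H)$; $L_2'[\mathcal K,H]$ is the set of $Y:\Delta\to[\mathcal K,H]$ with $Y(\cdot)h\in\mathfrak H$ for all $h\in\mathcal K$. The maximal operator $L$ has domain $\mathcal D=\{y\in\mathfrak H:\ y^{[k]}\ (0\le k\le2n-2)$ continuously differentiable, $y^{[2n-1]}$ (locally) absolutely continuous, $l[y]\in\mathfrak H\}$ and $Ly=l[y]$. Put $[y,z](t)=(y^{(1)}(t),z^{(2)}(t))-(y^{(2)}(t),z^{(1)}(t))$, $[y,z](b)=\lim_{t\uparrow b}[y,z](t)$. The minimal operator $L_0$ is the restriction of $L$ to $\{y\in\mathcal D:\widetilde y(0)=0,\ [y,z](b)=0\ \forall z\in\mathcal D\}$; $L_0^*=L$. $\mathfrak N_\lambda(L_0)=\mathrm{Ker}(L-\lambda)$. **Decomposing boundary triplet.** $\mathcal H'$ is a Hilbert space, $\mathcal H=H^n\oplus\mathcal H'$, $\Gamma_j':\mathcal D\to\mathcal H'$ are linear, $\Gamma_0y=\{y^{(2)}(0),\Gamma_0'y\}$, $\Gamma_1y=\{-y^{(1)}(0),\Gamma_1'y\}$. $\Pi=\{\mathcal H,\Gamma_0,\Gamma_1\}$ is a decomposing boundary triplet for $L$ if $(\Gamma_0'\;\Gamma_1')^\top:\mathcal D\to\mathcal H'\oplus\mathcal H'$ is surjective and $[y,z](b)=(\Gamma_1'y,\Gamma_0'z)-(\Gamma_0'y,\Gamma_1'z)$, $y,z\in\mathcal D$ (then $(\Gamma_0\;\Gamma_1)^\top$ is surjective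 onto $\mathcal H\oplus\mathcal H$ and $(Ly,z)-(y,Lz)=(\Gamma_1y,\Gamma_0z)-(\Gamma_0y,\Gamma_1z)$). For $\lambda\in\mathbb C_+\cup\mathbb C_-$: the $\gamma$-field is $\gamma(\lambda)=(\Gamma_0\upharpoonright\mathfrak N_\lambda(L_0))^{-1}\in[\mathcal H,\mathfrak H]$, the Weyl function $M(\lambda)\in[\mathcal H]$ is given by $\Gamma_1y=M(\lambda)\Gamma_0y$, $y\in\mathfrak N_\lambda(L_0)$. **Class $\widetilde R(\mathcal H)$.** It consists of the equivalence classes $\tau(\lambda)=\{(C_0(\lambda),C_1(\lambda));\mathcal K\}$ of pairs of holomorphic functions $C_0,C_1:\mathbb C_+\cup\mathbb C_-\to[\mathcal H,\mathcal K]$ such that $(C_0(\lambda)\;C_1(\lambda))$ is surjective, $\mathrm{Im}\lambda\cdot\mathrm{Im}(C_1(\lambda)C_0^*(\lambda))\ge0$, $0\in\rho(C_0(\lambda)-i\,\mathrm{sgn}(\mathrm{Im}\lambda)C_1(\lambda))$ and $C_1(\lambda)C_0^*(\overline\lambda)-C_0(\lambda)C_1^*(\overline\lambda)=0$. Pairs differing by left multiplication by a holomorphic family of isomorphisms are identified, and $\tau(\lambda)$ is identified with the linear relation $\{\{h_0,h_1\}\in\mathcal H\oplus\mathcal H:C_0(\lambda)h_0+C_1(\lambda)h_1=0\}$. An equivalent representation $\tau(\lambda)=\{K_0(\lambda),K_1(\lambda);\mathcal K'\}$ means: $K_j:\mathbb C_+\cup\mathbb C_-\to[\mathcal K',\mathcal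 H]$ are holomorphic, $\mathrm{Ker}K_0(\lambda)\cap\mathrm{Ker}K_1(\lambda)=\{0\}$ and $\tau(\lambda)=\{\{K_0(\lambda)h,K_1(\lambda)h\}:h\in\mathcal K'\}$. The operators $C_0-C_1M$ and $K_1+MK_0$ are boundedly invertible, and $(\tau+M)^{-1}=-(C_0-C_1M)^{-1}C_1=K_0(K_1+MK_0)^{-1}\in[\mathcal H]$. **Characteristic matrix.** $\Omega_\tau(\lambda)=P_{H^n\oplus H^n}\widetilde\Omega_\tau(\lambda)\upharpoonright(H^n\oplus H^n)$, $\lambda\in\mathbb C_+\cup\mathbb C_-$, where (omitting $\lambda$) $$\widetilde\Omega_\tau=\begin{pmatrix}M-M(\tau+M)^{-1}M&-\frac12I_{\mathcal H}+M(\tau+M)^{-1}\\-\frac12I_{\mathcal H}+(\tau+M)^{-1}M&-(\tau+M)^{-1}\end{pmatrix}\in[\mathcal H\oplus\mathcal H].$$ *)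

theory Defs
  imports "HOL-Analysis.Analysis"
begin

section \<open>Complex Hilbert spaces\<close>

class scaleC =
  fixes scaleC :: "complex \<Rightarrow> 'a \<Rightarrow> 'a"  (infixr "*\<^sub>C" 75)

class complex_vector = real_vector + scaleC +
  assumes scaleC_add_right: "c *\<^sub>C (x + y) = c *\<^sub>C x + c *\<^sub>C y"
    and scaleC_add_left: "(c + d) *\<^sub>C x = c *\<^sub>C x + d *\<^sub>C x"
    and scaleC_scaleC: "c *\<^sub>C d *\<^sub>C x = (c * d) *\<^sub>C x"
    and scaleC_of_real: "complex_of_real r *\<^sub>C x = r *\<^sub>R x"

text \<open>The scalar product is linear in its first argument. The real inner product of the library is
  its real part, so that norm and topology are those of the complex scalar product.\<close>

class complex_hilbert = complex_vector + real_inner + banach +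
  fixes cinner :: "'a \<Rightarrow> 'a \<Rightarrow> complex"
  assumes cinner_commute: "cinner x y = cnj (cinner y x)"
    and cinner_add_left: "cinner (x + y) z = cinner x z + cinner y z"
    and cinner_scaleC_left: "cinner (c *\<^sub>C x) y = c * cinner x y"
    and Re_cinner: "Re (cinner x y) = inner x y"

lemma cinner_self: "cinner x x = complex_of_real ((norm x)\<^sup>2)" for x :: "'a::complex_hilbert"
proof -
  have "Im (cinner x x) = 0"
    using arg_cong[OF cinner_commute[of x x], of Im] by simp
  then show ?thesis
    by (simp add: complex_eq_iff Re_cinner power2_norm_eq_inner)
qed

lemma norm_scaleC: "norm (c *\<^sub>C x) = cmod c * norm x" for x :: "'a::complex_hilbert"
proof -
  have "cinner (c *\<^sub>C x) (c *\<^sub>C x) = (c * cnj c) * cinner x x"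
    using cinner_commute[of x "c *\<^sub>C x"] cinner_commute[of x x]
    by (simp add: cinner_scaleC_left)
  then have "complex_of_real ((norm (c *\<^sub>C x))\<^sup>2) = complex_of_real ((cmod c * norm x)\<^sup>2)"
    by (simp add: cinner_self complex_norm_square[symmetric] power_mult_distrib)
  then have "(norm (c *\<^sub>C x))\<^sup>2 = (cmod c * norm x)\<^sup>2"
    using of_real_eq_iff by blast
  then show ?thesis
    by (simp add: power2_eq_iff_nonneg)
qed

lemma scaleC_scaleR: "c *\<^sub>C r *\<^sub>R x = r *\<^sub>R c *\<^sub>C x" for x :: "'a::complex_vector"
  by (simp add: scaleC_scaleC mult.commute flip: scaleC_of_real)

lemma bounded_linear_scaleC: "bounded_linear (\<lambda>x::'a::complex_hilbert. c *\<^sub>C x)"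
  by (rule bounded_linear_intro[where K = "cmod c"])
    (simp_all add: scaleC_add_right scaleC_scaleR norm_scaleC mult.commute)

lemma scaleC_zero_right [simp]: "c *\<^sub>C (0::'a::complex_vector) = 0"
  using scaleC_add_right[of c 0 "0::'a"] by simp

lemma scaleC_minus_right: "c *\<^sub>C (- x) = - (c *\<^sub>C x)" for x :: "'a::complex_vector"
  using scaleC_add_right[of c x "- x"] by (simp add: minus_unique)

lemma scaleC_diff_right: "c *\<^sub>C (x - y) = c *\<^sub>C x - c *\<^sub>C y" for x :: "'a::complex_vector"
  using scaleC_add_right[of c x "- y"] by (simp add: scaleC_minus_right)

instantiation prod :: (complex_hilbert, complex_hilbert) complex_hilbert
begin
definition scaleC_prod :: "complex \<Rightarrow> 'a \<times> 'b \<Rightarrow> 'a \<times> 'b"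
  where "scaleC_prod c x = (c *\<^sub>C fst x, c *\<^sub>C snd x)"
definition cinner_prod :: "'a \<times> 'b \<Rightarrow> 'a \<times> 'b \<Rightarrow> complex"
  where "cinner_prod x y = cinner (fst x) (fst y) + cinner (snd x) (snd y)"
instance
proof
  fix x y :: "'a \<times> 'b"
  show "cinner x y = cnj (cinner y x)"
    unfolding cinner_prod_def complex_cnj_add
    by (simp flip: cinner_commute)
qed (auto simp: scaleC_prod_def cinner_prod_def prod_eq_iff scaleC_add_right scaleC_add_left
      scaleC_scaleC scaleC_of_real cinner_add_left cinner_scaleC_left Re_cinner inner_prod_def
      algebra_simps)
end

instantiation vec :: (complex_hilbert, finite) complex_hilbert
begin
definition scaleC_vec :: "complex \<Rightarrow> ('a, 'b) vec \<Rightarrow> ('a, 'b) vec"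
  where "scaleC_vec c x = (\<chi> i. c *\<^sub>C (x $ i))"
definition cinner_vec :: "('a, 'b) vec \<Rightarrow> ('a, 'b) vec \<Rightarrow> complex"
  where "cinner_vec x y = (\<Sum>i\<in>UNIV. cinner (x $ i) (y $ i))"
instance
proof
  fix x y :: "('a, 'b) vec"
  show "cinner x y = cnj (cinner y x)"
    unfolding cinner_vec_def cnj_sum
    by (simp flip: cinner_commute)
qed (auto simp: scaleC_vec_def cinner_vec_def vec_eq_iff scaleC_add_right scaleC_add_left
      scaleC_scaleC scaleC_of_real cinner_add_left cinner_scaleC_left Re_cinner inner_vec_def
      sum.distrib sum_distrib_left)
end


section \<open>Bounded operators between Hilbert spaces\<close>

typedef (overloaded) ('a, 'b) cblinfun  ("(_ \<Rightarrow>\<^sub>C\<^sub>L /_)" [22, 21] 21) =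
  "{T :: 'a::complex_hilbert \<Rightarrow>\<^sub>L 'b::complex_hilbert. \<forall>c x. T (c *\<^sub>C x) = c *\<^sub>C T x}"
  by (rule exI[of _ 0]) simp

setup_lifting type_definition_cblinfun

lift_definition cblinfun_apply :: "('a::complex_hilbert \<Rightarrow>\<^sub>C\<^sub>L 'b::complex_hilbert) \<Rightarrow> 'a \<Rightarrow> 'b"
    (infixr "*\<^sub>V" 70)
  is blinfun_apply .

instantiation cblinfun :: (complex_hilbert, complex_hilbert) real_normed_vector
begin
lift_definition norm_cblinfun :: "('a \<Rightarrow>\<^sub>C\<^sub>L 'b) \<Rightarrow> real" is norm .
lift_definition zero_cblinfun :: "'a \<Rightarrow>\<^sub>C\<^sub>L 'b" is 0 by simp
lift_definition plus_cblinfun :: "('a \<Rightarrow>\<^sub>C\<^sub>L 'b) \<Rightarrow> ('a \<Rightarrow>\<^sub>C\<^sub>L 'b) \<Rightarrow> ('a \<Rightarrow>\<^sub>C\<^sub>L 'b)" is "(+)"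
  by (simp add: blinfun.add_left scaleC_add_right)
lift_definition minus_cblinfun :: "('a \<Rightarrow>\<^sub>C\<^sub>L 'b) \<Rightarrow> ('a \<Rightarrow>\<^sub>C\<^sub>L 'b) \<Rightarrow> ('a \<Rightarrow>\<^sub>C\<^sub>L 'b)" is "(-)"
  by (simp add: blinfun.diff_left scaleC_diff_right)
lift_definition uminus_cblinfun :: "('a \<Rightarrow>\<^sub>C\<^sub>L 'b) \<Rightarrow> ('a \<Rightarrow>\<^sub>C\<^sub>L 'b)" is uminus
  by (simp add: blinfun.minus_left scaleC_minus_right)
lift_definition scaleR_cblinfun :: "real \<Rightarrow> ('a \<Rightarrow>\<^sub>C\<^sub>L 'b) \<Rightarrow> ('a \<Rightarrow>\<^sub>C\<^sub>L 'b)" is scaleR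
  by (simp add: blinfun.scaleR_left scaleC_scaleR)
definition dist_cblinfun :: "('a \<Rightarrow>\<^sub>C\<^sub>L 'b) \<Rightarrow> ('a \<Rightarrow>\<^sub>C\<^sub>L 'b) \<Rightarrow> real"
  where "dist_cblinfun S T = norm (S - T)"
definition sgn_cblinfun :: "('a \<Rightarrow>\<^sub>C\<^sub>L 'b) \<Rightarrow> ('a \<Rightarrow>\<^sub>C\<^sub>L 'b)"
  where "sgn_cblinfun T = inverse (norm T) *\<^sub>R T"
definition uniformity_cblinfun :: "(('a \<Rightarrow>\<^sub>C\<^sub>L 'b) \<times> ('a \<Rightarrow>\<^sub>C\<^sub>L 'b)) filter"
  where "uniformity_cblinfun = (INF e\<in>{0<..}. principal {(x, y). dist x y < e})"
definition open_cblinfun :: "('a \<Rightarrow>\<^sub>C\<^sub>L 'b) set \<Rightarrow> bool"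
  where "open_cblinfun U \<longleftrightarrow> (\<forall>x\<in>U. \<forall>\<^sub>F (x', y) in uniformity. x' = x \<longrightarrow> y \<in> U)"
instance
proof
  fix r s :: real and S T U :: "'a \<Rightarrow>\<^sub>C\<^sub>L 'b"
  show "S + T + U = S + (T + U)" by transfer (rule add.assoc)
  show "S + T = T + S" by transfer (rule add.commute)
  show "0 + S = S" by transfer simp
  show "- S + S = 0" by transfer simp
  show "S - T = S + - T" by transfer simp
  show "r *\<^sub>R (S + T) = r *\<^sub>R S + r *\<^sub>R T" by transfer (rule scaleR_add_right)
  show "(r + s) *\<^sub>R S = r *\<^sub>R S + s *\<^sub>R S" by transfer (rule scaleR_add_left)
  show "r *\<^sub>R s *\<^sub>R S = (r * s) *\<^sub>R S" by transfer simp
  show "1 *\<^sub>R S = S" by transfer simp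
  show "(norm S = 0) = (S = 0)" by transfer simp
  show "norm (S + T) \<le> norm S + norm T" by transfer (rule norm_triangle_ineq)
  show "norm (r *\<^sub>R S) = \<bar>r\<bar> * norm S" by transfer simp
qed (simp_all add: dist_cblinfun_def sgn_cblinfun_def uniformity_cblinfun_def open_cblinfun_def)
end

instantiation cblinfun :: (complex_hilbert, complex_hilbert) complex_vector
begin
lift_definition scaleC_cblinfun :: "complex \<Rightarrow> ('a \<Rightarrow>\<^sub>C\<^sub>L 'b) \<Rightarrow> ('a \<Rightarrow>\<^sub>C\<^sub>L 'b)"
  is "\<lambda>c T. Blinfun (\<lambda>x. c *\<^sub>C blinfun_apply T x)"
  by (simp add: bounded_linear_Blinfun_apply bounded_linear_compose[OF bounded_linear_scaleC]
      blinfun.bounded_linear_right scaleC_scaleC mult.commute)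
instance
proof
  have *: "blinfun_apply (Blinfun (\<lambda>x. c *\<^sub>C blinfun_apply T x)) x = c *\<^sub>C T x"
    for c x and T :: "'a \<Rightarrow>\<^sub>L 'b"
    by (simp add: bounded_linear_Blinfun_apply bounded_linear_compose[OF bounded_linear_scaleC]
        blinfun.bounded_linear_right)
  fix c d :: complex and r :: real and S T :: "'a \<Rightarrow>\<^sub>C\<^sub>L 'b"
  show "c *\<^sub>C (S + T) = c *\<^sub>C S + c *\<^sub>C T"
    by transfer (rule blinfun_eqI, simp only: *, simp only: * blinfun.add_left scaleC_add_right)
  show "(c + d) *\<^sub>C S = c *\<^sub>C S + d *\<^sub>C S"
    by transfer (rule blinfun_eqI, simp only: *, simp only: * blinfun.add_left scaleC_add_left)
  show "c *\<^sub>C d *\<^sub>C S = (c * d) *\<^sub>C S"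
    by transfer (rule blinfun_eqI, simp only: *, simp only: * scaleC_scaleC)
  show "complex_of_real r *\<^sub>C S = r *\<^sub>R S"
    by transfer (rule blinfun_eqI, simp only: *, simp only: * blinfun.scaleR_left scaleC_of_real)
qed
end

lift_definition cblinfun_id :: "'a::complex_hilbert \<Rightarrow>\<^sub>C\<^sub>L 'a" is id_blinfun
  by simp

lift_definition cblinfun_compose ::
    "('b::complex_hilbert \<Rightarrow>\<^sub>C\<^sub>L 'c::complex_hilbert) \<Rightarrow> ('a::complex_hilbert \<Rightarrow>\<^sub>C\<^sub>L 'b) \<Rightarrow> ('a \<Rightarrow>\<^sub>C\<^sub>L 'c)"
    (infixl "o\<^sub>C\<^sub>L" 67)
  is blinfun_compose by simp

text \<open>Operators between direct sums: projections, embeddings, and block operators built from them.\<close>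

lift_definition fst_op :: "('a::complex_hilbert \<times> 'b::complex_hilbert) \<Rightarrow>\<^sub>C\<^sub>L 'a" is fst_blinfun
  by (simp add: fst_blinfun.rep_eq scaleC_prod_def)

lift_definition snd_op :: "('a::complex_hilbert \<times> 'b::complex_hilbert) \<Rightarrow>\<^sub>C\<^sub>L 'b" is snd_blinfun
  by (simp add: snd_blinfun.rep_eq scaleC_prod_def)

lift_definition inl_op :: "'a::complex_hilbert \<Rightarrow>\<^sub>C\<^sub>L ('a \<times> 'b::complex_hilbert)"
  is "Blinfun (\<lambda>x. (x, 0))"
  by (simp add: bounded_linear_Blinfun_apply bounded_linear_Pair bounded_linear_ident
      bounded_linear_zero scaleC_prod_def)

lift_definition inr_op :: "'b::complex_hilbert \<Rightarrow>\<^sub>C\<^sub>L ('a::complex_hilbert \<times> 'b)"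
  is "Blinfun (\<lambda>y. (0, y))"
  by (simp add: bounded_linear_Blinfun_apply bounded_linear_Pair bounded_linear_ident
      bounded_linear_zero scaleC_prod_def)

lemma bounded_linear_axis:
  "bounded_linear (axis i :: 'a::real_normed_vector \<Rightarrow> ('a, 'n::finite) vec)"
proof (rule bounded_linear_intro[where K = 1])
  fix x :: 'a
  have "norm (axis i x :: ('a, 'n) vec) = norm x"
    unfolding norm_vec_def L2_set_def axis_def by (simp add: if_distrib[of norm] if_distrib[of "\<lambda>x. x\<^sup>2"] cong: if_cong)
  then show "norm (axis i x :: ('a, 'n) vec) \<le> norm x * 1" by simp
qed (simp_all add: vec_eq_iff axis_def)

lift_definition axis_op :: "'n::finite \<Rightarrow> 'a::complex_hilbert \<Rightarrow>\<^sub>C\<^sub>L ('a, 'n) vec"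
  is "\<lambda>i. Blinfun (axis i)"
  by (simp add: bounded_linear_Blinfun_apply bounded_linear_axis vec_eq_iff axis_def scaleC_vec_def)

definition row_op :: "('a::complex_hilbert \<Rightarrow>\<^sub>C\<^sub>L 'c::complex_hilbert) \<Rightarrow> ('b::complex_hilbert \<Rightarrow>\<^sub>C\<^sub>L 'c)
    \<Rightarrow> ('a \<times> 'b) \<Rightarrow>\<^sub>C\<^sub>L 'c"
  where "row_op A B = A o\<^sub>C\<^sub>L fst_op + B o\<^sub>C\<^sub>L snd_op"

definition block_op :: "('a::complex_hilbert \<Rightarrow>\<^sub>C\<^sub>L 'c::complex_hilbert) \<Rightarrow> ('b::complex_hilbert \<Rightarrow>\<^sub>C\<^sub>L 'c)
    \<Rightarrow> ('a \<Rightarrow>\<^sub>C\<^sub>L 'd::complex_hilbert) \<Rightarrow> ('b \<Rightarrow>\<^sub>C\<^sub>L 'd) \<Rightarrow> ('a \<times> 'b) \<Rightarrow>\<^sub>C\<^sub>L ('c \<times> 'd)"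
  where "block_op A B C D = inl_op o\<^sub>C\<^sub>L row_op A B + inr_op o\<^sub>C\<^sub>L row_op C D"

definition column_op :: "('n::finite \<Rightarrow> 'k::complex_hilbert \<Rightarrow>\<^sub>C\<^sub>L 'h::complex_hilbert)
    \<Rightarrow> 'k \<Rightarrow>\<^sub>C\<^sub>L ('h, 'n) vec"
  where "column_op A = (\<Sum>i\<in>UNIV. axis_op i o\<^sub>C\<^sub>L A i)"

definition adj :: "('a::complex_hilbert \<Rightarrow>\<^sub>C\<^sub>L 'b::complex_hilbert) \<Rightarrow> ('b \<Rightarrow>\<^sub>C\<^sub>L 'a)"
  where "adj T = (THE S. \<forall>x y. cinner (T *\<^sub>V x) y = cinner x (S *\<^sub>V y))"

text \<open>\<open>invertible_op T\<close> is \<open>0 \<in> \<rho>(T)\<close>.\<close>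

definition invertible_op :: "('a::complex_hilbert \<Rightarrow>\<^sub>C\<^sub>L 'b::complex_hilbert) \<Rightarrow> bool"
  where "invertible_op T \<longleftrightarrow> (\<exists>S. S o\<^sub>C\<^sub>L T = cblinfun_id \<and> T o\<^sub>C\<^sub>L S = cblinfun_id)"

definition inv_op :: "('a::complex_hilbert \<Rightarrow>\<^sub>C\<^sub>L 'b::complex_hilbert) \<Rightarrow> ('b \<Rightarrow>\<^sub>C\<^sub>L 'a)"
  where "inv_op T = (THE S. S o\<^sub>C\<^sub>L T = cblinfun_id \<and> T o\<^sub>C\<^sub>L S = cblinfun_id)"

definition Im_op :: "('a::complex_hilbert \<Rightarrow>\<^sub>C\<^sub>L 'a) \<Rightarrow> ('a \<Rightarrow>\<^sub>C\<^sub>L 'a)"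
  where "Im_op T = (1 / (2 * \<i>)) *\<^sub>C (T - adj T)"

definition op_le :: "('a::complex_hilbert \<Rightarrow>\<^sub>C\<^sub>L 'a) \<Rightarrow> ('a \<Rightarrow>\<^sub>C\<^sub>L 'a) \<Rightarrow> bool"  (infix "\<le>\<^sub>o\<^sub>p" 50)
  where "S \<le>\<^sub>o\<^sub>p T \<longleftrightarrow> (\<forall>x. Im (cinner ((T - S) *\<^sub>V x) x) = 0 \<and> 0 \<le> Re (cinner ((T - S) *\<^sub>V x) x))"

definition nonreal :: "complex set"
  where "nonreal = {z. 0 < Im z} \<union> {z. Im z < 0}"

definition op_holomorphic_on ::
    "(complex \<Rightarrow> 'a::complex_hilbert \<Rightarrow>\<^sub>C\<^sub>L 'b::complex_hilbert) \<Rightarrow> complex set \<Rightarrow> bool"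
  where "op_holomorphic_on F S \<longleftrightarrow> (\<forall>z\<in>S. \<exists>F'. (F has_derivative (\<lambda>w. w *\<^sub>C F')) (at z within S))"


section \<open>Functions on the interval\<close>

text \<open>\<open>\<Delta> = [0, b\<rangle>\<close> with \<open>0 < b \<le> \<infinity>\<close>, where a finite \<open>b\<close> may or may not belong to \<open>\<Delta>\<close>.\<close>

definition is_Delta :: "real set \<Rightarrow> ereal \<Rightarrow> bool"
  where "is_Delta \<Delta> b \<longleftrightarrow> 0 < b \<and>
    (\<Delta> = {t. 0 \<le> t \<and> ereal t < b} \<or> (b < \<infinity> \<and> \<Delta> = {t. 0 \<le> t \<and> ereal t \<le> b}))"

definition up_to :: "ereal \<Rightarrow> real filter"
  where "up_to b = (if b = \<infinity> then at_top else at_left (real_of_ereal b))"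

text \<open>Derivatives are relative to \<open>\<Delta>\<close>, hence one-sided at its end points.\<close>

definition Dx :: "real set \<Rightarrow> nat \<Rightarrow> (real \<Rightarrow> 'v::real_normed_vector) \<Rightarrow> real \<Rightarrow> 'v"
  where "Dx \<Delta> k f = ((\<lambda>g t. vector_derivative g (at t within \<Delta>)) ^^ k) f"

definition Ck_on :: "real set \<Rightarrow> nat \<Rightarrow> (real \<Rightarrow> 'v::real_normed_vector) \<Rightarrow> bool"
  where "Ck_on \<Delta> m f \<longleftrightarrow> (\<forall>j<m. \<forall>t\<in>\<Delta>. Dx \<Delta> j f differentiable (at t within \<Delta>)) \<and>
    (\<forall>j\<le>m. continuous_on \<Delta> (Dx \<Delta> j f))"

definition abs_cont_on :: "real \<Rightarrow> real \<Rightarrow> (real \<Rightarrow> 'v::real_normed_vector) \<Rightarrow> bool"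
  where "abs_cont_on c d f \<longleftrightarrow> (\<forall>\<epsilon>>0. \<exists>\<delta>>0. \<forall>(N::nat) \<alpha> \<beta>.
    (\<forall>i<N. c \<le> \<alpha> i \<and> \<alpha> i \<le> \<beta> i \<and> \<beta> i \<le> d) \<and>
    (\<forall>i<N. \<forall>j<N. i \<noteq> j \<longrightarrow> {\<alpha> i<..<\<beta> i} \<inter> {\<alpha> j<..<\<beta> j} = {}) \<and>
    (\<Sum>i<N. \<beta> i - \<alpha> i) < \<delta> \<longrightarrow> (\<Sum>i<N. norm (f (\<beta> i) - f (\<alpha> i))) < \<epsilon>)"

definition loc_abs_cont_on :: "real set \<Rightarrow> (real \<Rightarrow> 'v::real_normed_vector) \<Rightarrow> bool"
  where "loc_abs_cont_on \<Delta> f \<longleftrightarrow> (\<forall>c\<in>\<Delta>. \<forall>d\<in>\<Delta>. abs_cont_on c d f)"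

definition square_integrable ::
    "real set \<Rightarrow> (real \<Rightarrow> 'h::{complex_hilbert, second_countable_topology}) \<Rightarrow> bool"
  where "square_integrable \<Delta> y \<longleftrightarrow> y \<in> borel_measurable (lebesgue_on \<Delta>) \<and>
    integrable (lebesgue_on \<Delta>) (\<lambda>t. (norm (y t))\<^sup>2)"

definition L2' :: "real set \<Rightarrow>
    (real \<Rightarrow> 'k::complex_hilbert \<Rightarrow>\<^sub>C\<^sub>L 'h::{complex_hilbert, second_countable_topology}) set"
  where "L2' \<Delta> = {Y. \<forall>h. square_integrable \<Delta> (\<lambda>t. Y t *\<^sub>V h)}"

text \<open>\<open>J\<close> is the strong limit of \<open>\<integral>\<^sub>0\<^sup>\<eta> F(t) dt\<close> as \<open>\<eta> \<up> b\<close>.\<close>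

definition has_strong_integral ::
    "(real \<Rightarrow> 'a::complex_hilbert \<Rightarrow>\<^sub>C\<^sub>L 'b::complex_hilbert) \<Rightarrow> ereal \<Rightarrow> ('a \<Rightarrow>\<^sub>C\<^sub>L 'b) \<Rightarrow> bool"
  where "has_strong_integral F b J \<longleftrightarrow> (\<exists>I.
    (\<forall>\<eta>\<ge>0. ereal \<eta> < b \<longrightarrow> (F has_integral I \<eta>) {0..\<eta>}) \<and>
    (\<forall>h. ((\<lambda>\<eta>. I \<eta> *\<^sub>V h) \<longlongrightarrow> J *\<^sub>V h) (up_to b)))"


section \<open>The differential expression\<close>

definition coefficients_ok :: "real set \<Rightarrow> nat \<Rightarrow> (nat \<Rightarrow> real \<Rightarrow> 'h::complex_hilbert \<Rightarrow>\<^sub>C\<^sub>L 'h)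
    \<Rightarrow> (nat \<Rightarrow> real \<Rightarrow> 'h \<Rightarrow>\<^sub>C\<^sub>L 'h) \<Rightarrow> bool"
  where "coefficients_ok \<Delta> n p q \<longleftrightarrow>
    (\<forall>k\<le>n. Ck_on \<Delta> (n - k) (p k)) \<and> (\<forall>k<n. Ck_on \<Delta> (n - k) (q k)) \<and>
    (\<forall>k\<le>n. \<forall>t\<in>\<Delta>. adj (p k t) = p k t) \<and> (\<forall>t\<in>\<Delta>. invertible_op (p 0 t))"

text \<open>The parameter \<open>act\<close> is the action of the coefficients: application \<open>(*\<^sub>V)\<close> for vector functions
  \<open>y : \<Delta> \<rightarrow> H\<close> and composition \<open>(o\<^sub>C\<^sub>L)\<close> for operator functions \<open>Y : \<Delta> \<rightarrow> [K, H]\<close>.\<close>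

definition l_expr :: "(('h::complex_hilbert \<Rightarrow>\<^sub>C\<^sub>L 'h) \<Rightarrow> 'v \<Rightarrow> 'v::{real_normed_vector, complex_vector})
    \<Rightarrow> real set \<Rightarrow> nat \<Rightarrow> (nat \<Rightarrow> real \<Rightarrow> 'h \<Rightarrow>\<^sub>C\<^sub>L 'h) \<Rightarrow> (nat \<Rightarrow> real \<Rightarrow> 'h \<Rightarrow>\<^sub>C\<^sub>L 'h)
    \<Rightarrow> (real \<Rightarrow> 'v) \<Rightarrow> real \<Rightarrow> 'v"
  where "l_expr act \<Delta> n p q y t =
    (\<Sum>k=1..n. (-1) ^ k *\<^sub>R
      (Dx \<Delta> k (\<lambda>s. act (p (n - k) s) (Dx \<Delta> k y s)) t
       - (\<i> / 2) *\<^sub>C (Dx \<Delta> (k - 1) (\<lambda>s. act (adj (q (n - k) s)) (Dx \<Delta> k y s)) t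
                   + Dx \<Delta> k (\<lambda>s. act (q (n - k) s) (Dx \<Delta> (k - 1) y s)) t)))
    + act (p n t) (y t)"

text \<open>Quasi-derivatives of order \<open>0, \<dots>, 2n - 1\<close>. In the last case the order \<open>Suc m\<close> is \<open>n + k\<close>.\<close>

fun quasi_deriv :: "(('h::complex_hilbert \<Rightarrow>\<^sub>C\<^sub>L 'h) \<Rightarrow> 'v \<Rightarrow> 'v::{real_normed_vector, complex_vector})
    \<Rightarrow> real set \<Rightarrow> nat \<Rightarrow> (nat \<Rightarrow> real \<Rightarrow> 'h \<Rightarrow>\<^sub>C\<^sub>L 'h) \<Rightarrow> (nat \<Rightarrow> real \<Rightarrow> 'h \<Rightarrow>\<^sub>C\<^sub>L 'h)
    \<Rightarrow> (real \<Rightarrow> 'v) \<Rightarrow> nat \<Rightarrow> real \<Rightarrow> 'v"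
  where
    "quasi_deriv act \<Delta> n p q y 0 = y"
  | "quasi_deriv act \<Delta> n p q y (Suc m) =
      (if Suc m < n then Dx \<Delta> (Suc m) y
       else if Suc m = n then
         (\<lambda>t. act (p 0 t) (Dx \<Delta> n y t) - (\<i> / 2) *\<^sub>C act (q 0 t) (Dx \<Delta> (n - 1) y t))
       else let k = Suc m - n in
         (\<lambda>t. - Dx \<Delta> 1 (quasi_deriv act \<Delta> n p q y m) t + act (p k t) (Dx \<Delta> (n - k) y t)
            + (\<i> / 2) *\<^sub>C (act (adj (q (k - 1) t)) (Dx \<Delta> (n - k + 1) y t)
                          - act (q k t) (Dx \<Delta> (n - k - 1) y t))))"

text \<open>Position \<open>0, \<dots>, n - 1\<close> of a coordinate of \<open>H\<^sup>n\<close>; the coordinates are indexed by a finite linearly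
  ordered type with \<open>n\<close> elements.\<close>

definition pos :: "'n::{finite, linorder} \<Rightarrow> nat"
  where "pos i = card {j. j < i}"

definition qd1 :: "real set \<Rightarrow> (nat \<Rightarrow> real \<Rightarrow> 'h::complex_hilbert \<Rightarrow>\<^sub>C\<^sub>L 'h)
    \<Rightarrow> (nat \<Rightarrow> real \<Rightarrow> 'h \<Rightarrow>\<^sub>C\<^sub>L 'h) \<Rightarrow> (real \<Rightarrow> 'h) \<Rightarrow> real \<Rightarrow> ('h, 'n::{finite, linorder}) vec"
  where "qd1 \<Delta> p q y t = (\<chi> i. quasi_deriv (*\<^sub>V) \<Delta> CARD('n) p q y (pos i) t)"

definition qd2 :: "real set \<Rightarrow> (nat \<Rightarrow> real \<Rightarrow> 'h::complex_hilbert \<Rightarrow>\<^sub>C\<^sub>L 'h)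
    \<Rightarrow> (nat \<Rightarrow> real \<Rightarrow> 'h \<Rightarrow>\<^sub>C\<^sub>L 'h) \<Rightarrow> (real \<Rightarrow> 'h) \<Rightarrow> real \<Rightarrow> ('h, 'n::{finite, linorder}) vec"
  where "qd2 \<Delta> p q y t = (\<chi> i. quasi_deriv (*\<^sub>V) \<Delta> CARD('n) p q y (2 * CARD('n) - 1 - pos i) t)"

definition qd1_op :: "real set \<Rightarrow> (nat \<Rightarrow> real \<Rightarrow> 'h::complex_hilbert \<Rightarrow>\<^sub>C\<^sub>L 'h)
    \<Rightarrow> (nat \<Rightarrow> real \<Rightarrow> 'h \<Rightarrow>\<^sub>C\<^sub>L 'h) \<Rightarrow> (real \<Rightarrow> 'k::complex_hilbert \<Rightarrow>\<^sub>C\<^sub>L 'h) \<Rightarrow> real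
    \<Rightarrow> 'k \<Rightarrow>\<^sub>C\<^sub>L ('h, 'n::{finite, linorder}) vec"
  where "qd1_op \<Delta> p q Y t = column_op (\<lambda>i. quasi_deriv (o\<^sub>C\<^sub>L) \<Delta> CARD('n) p q Y (pos i) t)"

definition qd2_op :: "real set \<Rightarrow> (nat \<Rightarrow> real \<Rightarrow> 'h::complex_hilbert \<Rightarrow>\<^sub>C\<^sub>L 'h)
    \<Rightarrow> (nat \<Rightarrow> real \<Rightarrow> 'h \<Rightarrow>\<^sub>C\<^sub>L 'h) \<Rightarrow> (real \<Rightarrow> 'k::complex_hilbert \<Rightarrow>\<^sub>C\<^sub>L 'h) \<Rightarrow> real
    \<Rightarrow> 'k \<Rightarrow>\<^sub>C\<^sub>L ('h, 'n::{finite, linorder}) vec"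
  where "qd2_op \<Delta> p q Y t =
    column_op (\<lambda>i. quasi_deriv (o\<^sub>C\<^sub>L) \<Delta> CARD('n) p q Y (2 * CARD('n) - 1 - pos i) t)"

text \<open>Functions on \<open>\<Delta>\<close> are represented by functions on the real line that vanish off \<open>\<Delta>\<close>. For
  absolutely continuous functions with values in a Hilbert space the almost everywhere
  differentiability required in the domain of the maximal operator is automatic; it says that
  \<open>l[y]\<close> is defined almost everywhere.\<close>

definition max_dom :: "real set \<Rightarrow> nat
    \<Rightarrow> (nat \<Rightarrow> real \<Rightarrow> 'h::{complex_hilbert, second_countable_topology} \<Rightarrow>\<^sub>C\<^sub>L 'h)
    \<Rightarrow> (nat \<Rightarrow> real \<Rightarrow> 'h \<Rightarrow>\<^sub>C\<^sub>L 'h) \<Rightarrow> (real \<Rightarrow> 'h) set"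
  where "max_dom \<Delta> n p q = {y. (\<forall>t. t \<notin> \<Delta> \<longrightarrow> y t = 0) \<and> square_integrable \<Delta> y \<and>
    (\<forall>k\<le>2 * n - 2. Ck_on \<Delta> 1 (quasi_deriv (*\<^sub>V) \<Delta> n p q y k)) \<and>
    loc_abs_cont_on \<Delta> (quasi_deriv (*\<^sub>V) \<Delta> n p q y (2 * n - 1)) \<and>
    (AE t in lebesgue_on \<Delta>. quasi_deriv (*\<^sub>V) \<Delta> n p q y (2 * n - 1) differentiable (at t within \<Delta>)) \<and>
    square_integrable \<Delta> (l_expr (*\<^sub>V) \<Delta> n p q y)}"

text \<open>\<open>\<NN>\<^sub>z(L\<^sub>0) = Ker (L - z)\<close> for the maximal operator \<open>L\<close>.\<close>

definition defect :: "real set \<Rightarrow> nat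
    \<Rightarrow> (nat \<Rightarrow> real \<Rightarrow> 'h::{complex_hilbert, second_countable_topology} \<Rightarrow>\<^sub>C\<^sub>L 'h)
    \<Rightarrow> (nat \<Rightarrow> real \<Rightarrow> 'h \<Rightarrow>\<^sub>C\<^sub>L 'h) \<Rightarrow> complex \<Rightarrow> (real \<Rightarrow> 'h) set"
  where "defect \<Delta> n p q z = {y \<in> max_dom \<Delta> n p q.
    (AE t in lebesgue_on \<Delta>. l_expr (*\<^sub>V) \<Delta> n p q y t = z *\<^sub>C y t)}"

definition op_solution :: "real set \<Rightarrow> nat \<Rightarrow> (nat \<Rightarrow> real \<Rightarrow> 'h::complex_hilbert \<Rightarrow>\<^sub>C\<^sub>L 'h)
    \<Rightarrow> (nat \<Rightarrow> real \<Rightarrow> 'h \<Rightarrow>\<^sub>C\<^sub>L 'h) \<Rightarrow> complex \<Rightarrow> (real \<Rightarrow> 'k::complex_hilbert \<Rightarrow>\<^sub>C\<^sub>L 'h) \<Rightarrow> bool"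
  where "op_solution \<Delta> n p q z Y \<longleftrightarrow> (\<forall>t. t \<notin> \<Delta> \<longrightarrow> Y t = 0) \<and>
    (\<forall>k\<le>2 * n - 1. Ck_on \<Delta> 1 (quasi_deriv (o\<^sub>C\<^sub>L) \<Delta> n p q Y k)) \<and>
    (\<forall>t\<in>\<Delta>. l_expr (o\<^sub>C\<^sub>L) \<Delta> n p q Y t - z *\<^sub>C Y t = 0)"


section \<open>Decomposing boundary triplets\<close>

definition bracket :: "'n::{finite, linorder} itself \<Rightarrow> real set
    \<Rightarrow> (nat \<Rightarrow> real \<Rightarrow> 'h::complex_hilbert \<Rightarrow>\<^sub>C\<^sub>L 'h) \<Rightarrow> (nat \<Rightarrow> real \<Rightarrow> 'h \<Rightarrow>\<^sub>C\<^sub>L 'h)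
    \<Rightarrow> (real \<Rightarrow> 'h) \<Rightarrow> (real \<Rightarrow> 'h) \<Rightarrow> real \<Rightarrow> complex"
  where "bracket _ \<Delta> p q y z t =
    cinner (qd1 \<Delta> p q y t :: ('h, 'n) vec) (qd2 \<Delta> p q z t)
    - cinner (qd2 \<Delta> p q y t :: ('h, 'n) vec) (qd1 \<Delta> p q z t)"

text \<open>The order of the differential expression is \<open>2n\<close> with \<open>n = CARD('n)\<close>.\<close>

definition decomposing_triplet :: "'n::{finite, linorder} itself \<Rightarrow> real set \<Rightarrow> ereal
    \<Rightarrow> (nat \<Rightarrow> real \<Rightarrow> 'h::{complex_hilbert, second_countable_topology} \<Rightarrow>\<^sub>C\<^sub>L 'h)
    \<Rightarrow> (nat \<Rightarrow> real \<Rightarrow> 'h \<Rightarrow>\<^sub>C\<^sub>L 'h)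
    \<Rightarrow> ((real \<Rightarrow> 'h) \<Rightarrow> 'g::complex_hilbert) \<Rightarrow> ((real \<Rightarrow> 'h) \<Rightarrow> 'g) \<Rightarrow> bool"
  where "decomposing_triplet N \<Delta> b p q \<Gamma>0' \<Gamma>1' \<longleftrightarrow>
    (let \<D> = max_dom \<Delta> CARD('n) p q in
      (\<forall>\<Gamma>\<in>{\<Gamma>0', \<Gamma>1'}. \<forall>y\<in>\<D>. \<forall>z\<in>\<D>. \<forall>c.
         \<Gamma> (\<lambda>t. y t + z t) = \<Gamma> y + \<Gamma> z \<and> \<Gamma> (\<lambda>t. c *\<^sub>C y t) = c *\<^sub>C \<Gamma> y) \<and>
      (\<lambda>y. (\<Gamma>0' y, \<Gamma>1' y)) ` \<D> = UNIV \<and>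
      (\<forall>y\<in>\<D>. \<forall>z\<in>\<D>.
         (bracket N \<Delta> p q y z \<longlongrightarrow> cinner (\<Gamma>1' y) (\<Gamma>0' z) - cinner (\<Gamma>0' y) (\<Gamma>1' z)) (up_to b)))"

definition Gamma0 :: "real set \<Rightarrow> (nat \<Rightarrow> real \<Rightarrow> 'h::complex_hilbert \<Rightarrow>\<^sub>C\<^sub>L 'h)
    \<Rightarrow> (nat \<Rightarrow> real \<Rightarrow> 'h \<Rightarrow>\<^sub>C\<^sub>L 'h) \<Rightarrow> ((real \<Rightarrow> 'h) \<Rightarrow> 'g::complex_hilbert)
    \<Rightarrow> (real \<Rightarrow> 'h) \<Rightarrow> ('h, 'n::{finite, linorder}) vec \<times> 'g"
  where "Gamma0 \<Delta> p q \<Gamma>0' y = (qd2 \<Delta> p q y 0, \<Gamma>0' y)"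

definition Gamma1 :: "real set \<Rightarrow> (nat \<Rightarrow> real \<Rightarrow> 'h::complex_hilbert \<Rightarrow>\<^sub>C\<^sub>L 'h)
    \<Rightarrow> (nat \<Rightarrow> real \<Rightarrow> 'h \<Rightarrow>\<^sub>C\<^sub>L 'h) \<Rightarrow> ((real \<Rightarrow> 'h) \<Rightarrow> 'g::complex_hilbert)
    \<Rightarrow> (real \<Rightarrow> 'h) \<Rightarrow> ('h, 'n::{finite, linorder}) vec \<times> 'g"
  where "Gamma1 \<Delta> p q \<Gamma>1' y = (- qd1 \<Delta> p q y 0, \<Gamma>1' y)"

definition gamma_field :: "real set
    \<Rightarrow> (nat \<Rightarrow> real \<Rightarrow> 'h::{complex_hilbert, second_countable_topology} \<Rightarrow>\<^sub>C\<^sub>L 'h)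
    \<Rightarrow> (nat \<Rightarrow> real \<Rightarrow> 'h \<Rightarrow>\<^sub>C\<^sub>L 'h) \<Rightarrow> ((real \<Rightarrow> 'h) \<Rightarrow> 'g::complex_hilbert) \<Rightarrow> complex
    \<Rightarrow> ('h, 'n::{finite, linorder}) vec \<times> 'g \<Rightarrow> (real \<Rightarrow> 'h)"
  where "gamma_field \<Delta> p q \<Gamma>0' z =
    the_inv_into (defect \<Delta> CARD('n) p q z) (Gamma0 \<Delta> p q \<Gamma>0')"

definition weyl :: "real set
    \<Rightarrow> (nat \<Rightarrow> real \<Rightarrow> 'h::{complex_hilbert, second_countable_topology} \<Rightarrow>\<^sub>C\<^sub>L 'h)
    \<Rightarrow> (nat \<Rightarrow> real \<Rightarrow> 'h \<Rightarrow>\<^sub>C\<^sub>L 'h) \<Rightarrow> ((real \<Rightarrow> 'h) \<Rightarrow> 'g::complex_hilbert) \<Rightarrow> ((real \<Rightarrow> 'h) \<Rightarrow> 'g)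
    \<Rightarrow> complex \<Rightarrow> (('h, 'n::{finite, linorder}) vec \<times> 'g) \<Rightarrow>\<^sub>C\<^sub>L (('h, 'n) vec \<times> 'g)"
  where "weyl \<Delta> p q \<Gamma>0' \<Gamma>1' z =
    (THE M. \<forall>y\<in>defect \<Delta> CARD('n) p q z. Gamma1 \<Delta> p q \<Gamma>1' y = M *\<^sub>V Gamma0 \<Delta> p q \<Gamma>0' y)"

definition Z0 :: "real set
    \<Rightarrow> (nat \<Rightarrow> real \<Rightarrow> 'h::{complex_hilbert, second_countable_topology} \<Rightarrow>\<^sub>C\<^sub>L 'h)
    \<Rightarrow> (nat \<Rightarrow> real \<Rightarrow> 'h \<Rightarrow>\<^sub>C\<^sub>L 'h) \<Rightarrow> ((real \<Rightarrow> 'h) \<Rightarrow> 'g::complex_hilbert) \<Rightarrow> complex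
    \<Rightarrow> real \<Rightarrow> (('h, 'n::{finite, linorder}) vec \<times> 'g) \<Rightarrow>\<^sub>C\<^sub>L 'h"
  where "Z0 \<Delta> p q \<Gamma>0' z = (THE Z. op_solution \<Delta> CARD('n) p q z Z \<and>
    (\<forall>t\<in>\<Delta>. \<forall>h. Z t *\<^sub>V h = gamma_field \<Delta> p q \<Gamma>0' z h t))"


section \<open>Nevanlinna operator pairs and the characteristic matrix\<close>

definition nevanlinna_pair :: "(complex \<Rightarrow> 'H::complex_hilbert \<Rightarrow>\<^sub>C\<^sub>L 'k::complex_hilbert)
    \<Rightarrow> (complex \<Rightarrow> 'H \<Rightarrow>\<^sub>C\<^sub>L 'k) \<Rightarrow> bool"
  where "nevanlinna_pair C0 C1 \<longleftrightarrow>
    op_holomorphic_on C0 nonreal \<and> op_holomorphic_on C1 nonreal \<and>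
    (\<forall>z\<in>nonreal.
      surj ((*\<^sub>V) (row_op (C0 z) (C1 z))) \<and>
      0 \<le>\<^sub>o\<^sub>p Im z *\<^sub>R Im_op (C1 z o\<^sub>C\<^sub>L adj (C0 z)) \<and>
      invertible_op (C0 z - (\<i> * complex_of_real (sgn (Im z))) *\<^sub>C C1 z) \<and>
      C1 z o\<^sub>C\<^sub>L adj (C0 (cnj z)) - C0 z o\<^sub>C\<^sub>L adj (C1 (cnj z)) = 0)"

definition pair_rel :: "('H::complex_hilbert \<Rightarrow>\<^sub>C\<^sub>L 'k::complex_hilbert) \<Rightarrow> ('H \<Rightarrow>\<^sub>C\<^sub>L 'k) \<Rightarrow> ('H \<times> 'H) set"
  where "pair_rel C0 C1 = {(h0, h1). C0 *\<^sub>V h0 + C1 *\<^sub>V h1 = 0}"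

definition equiv_repr :: "(complex \<Rightarrow> ('H::complex_hilbert \<times> 'H) set)
    \<Rightarrow> (complex \<Rightarrow> 'k::complex_hilbert \<Rightarrow>\<^sub>C\<^sub>L 'H) \<Rightarrow> (complex \<Rightarrow> 'k \<Rightarrow>\<^sub>C\<^sub>L 'H) \<Rightarrow> bool"
  where "equiv_repr \<tau> K0 K1 \<longleftrightarrow>
    op_holomorphic_on K0 nonreal \<and> op_holomorphic_on K1 nonreal \<and>
    (\<forall>z\<in>nonreal. {h. K0 z *\<^sub>V h = 0} \<inter> {h. K1 z *\<^sub>V h = 0} = {0} \<and>
      \<tau> z = range (\<lambda>h. (K0 z *\<^sub>V h, K1 z *\<^sub>V h)))"

text \<open>\<open>(\<tau> + M)\<^sup>-\<^sup>1\<close> for a linear relation \<open>\<tau>\<close>: the operator whose graph is the inverse of the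
  relation \<open>{{h\<^sub>0, h\<^sub>1 + M h\<^sub>0} : {h\<^sub>0, h\<^sub>1} \<in> \<tau>}\<close>.\<close>

definition rel_plus_inv :: "('H::complex_hilbert \<times> 'H) set \<Rightarrow> ('H \<Rightarrow>\<^sub>C\<^sub>L 'H) \<Rightarrow> ('H \<Rightarrow>\<^sub>C\<^sub>L 'H)"
  where "rel_plus_inv \<tau> M =
    (THE T. {(h0, h1 + M *\<^sub>V h0) | h0 h1. (h0, h1) \<in> \<tau>}\<inverse> = range (\<lambda>h. (h, T *\<^sub>V h)))"

definition Omega_tilde :: "('H::complex_hilbert \<times> 'H) set \<Rightarrow> ('H \<Rightarrow>\<^sub>C\<^sub>L 'H) \<Rightarrow> ('H \<times> 'H) \<Rightarrow>\<^sub>C\<^sub>L ('H \<times> 'H)"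
  where "Omega_tilde \<tau> M = (let R = rel_plus_inv \<tau> M in
    block_op (M - M o\<^sub>C\<^sub>L R o\<^sub>C\<^sub>L M) (- (1/2) *\<^sub>R cblinfun_id + M o\<^sub>C\<^sub>L R)
             (- (1/2) *\<^sub>R cblinfun_id + R o\<^sub>C\<^sub>L M) (- R))"

text \<open>The compression of the preceding operator to the first components of \<open>(X \<oplus> Y) \<oplus> (X \<oplus> Y)\<close>.\<close>

definition char_matrix :: "(('x::complex_hilbert \<times> 'y::complex_hilbert) \<times> ('x \<times> 'y)) set
    \<Rightarrow> (('x \<times> 'y) \<Rightarrow>\<^sub>C\<^sub>L ('x \<times> 'y)) \<Rightarrow> ('x \<times> 'x) \<Rightarrow>\<^sub>C\<^sub>L ('x \<times> 'x)"
  where "char_matrix \<tau> M =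
    block_op fst_op 0 0 fst_op o\<^sub>C\<^sub>L Omega_tilde \<tau> M o\<^sub>C\<^sub>L block_op inl_op 0 0 inl_op"

definition tau_solution :: "real set
    \<Rightarrow> (nat \<Rightarrow> real \<Rightarrow> 'h::{complex_hilbert, second_countable_topology} \<Rightarrow>\<^sub>C\<^sub>L 'h)
    \<Rightarrow> (nat \<Rightarrow> real \<Rightarrow> 'h \<Rightarrow>\<^sub>C\<^sub>L 'h) \<Rightarrow> ((real \<Rightarrow> 'h) \<Rightarrow> 'g::complex_hilbert) \<Rightarrow> ((real \<Rightarrow> 'h) \<Rightarrow> 'g)
    \<Rightarrow> (nat \<Rightarrow> complex \<Rightarrow> ('h, 'n::{finite, linorder}) vec \<Rightarrow>\<^sub>C\<^sub>L 'k::complex_hilbert)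
    \<Rightarrow> (complex \<Rightarrow> 'g \<Rightarrow>\<^sub>C\<^sub>L 'k) \<Rightarrow> (complex \<Rightarrow> 'g \<Rightarrow>\<^sub>C\<^sub>L 'k)
    \<Rightarrow> nat \<Rightarrow> complex \<Rightarrow> (real \<Rightarrow> ('h, 'n) vec \<Rightarrow>\<^sub>C\<^sub>L 'h) \<Rightarrow> bool"
  where "tau_solution \<Delta> p q \<Gamma>0' \<Gamma>1' Ch C0' C1' j z u \<longleftrightarrow>
    u \<in> L2' \<Delta> \<and> op_solution \<Delta> CARD('n) p q z u \<and>
    (\<forall>h. (Ch 1 z o\<^sub>C\<^sub>L qd1_op \<Delta> p q u 0 + Ch 2 z o\<^sub>C\<^sub>L qd2_op \<Delta> p q u 0) *\<^sub>V h
         + (C0' z *\<^sub>V \<Gamma>0' (\<lambda>t. u t *\<^sub>V h) - C1' z *\<^sub>V \<Gamma>1' (\<lambda>t. u t *\<^sub>V h))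
       = (-1) ^ (j - 1) *\<^sub>R (Ch j z *\<^sub>V h))"

end

theory Submission
  imports Defs
begin

text \<open>Put \<open>T = C\<^sub>0 - C\<^sub>1 M\<close>. For \<open>y \<in> \<NN>\<^sub>\<lambda>(L\<^sub>0)\<close> the boundary condition of assertion 1) reads
  \<open>C\<^sub>0 \<Gamma>\<^sub>0 y - C\<^sub>1 \<Gamma>\<^sub>1 y = T \<Gamma>\<^sub>0 y = (-1)\<^sup>j\<^sup>-\<^sup>1 C\<^sub>j h\<close>, and \<open>T\<close> is invertible because \<open>Im M\<close> is uniformly definite
  while the pair is dissipative. Hence \<open>\<Gamma>\<^sub>0 y\<close>, and with it \<open>y\<close>, is determined. With \<open>k = \<beta> a\<close> this gives
  \<open>U\<^sub>\<tau> a = Z\<^sub>0 g\<close> for \<open>g = - K\<^sub>0 k - (a\<^sub>1, 0)\<close>, where \<open>M g = K\<^sub>1 k - (a\<^sub>2, 0)\<close>. Green's identity turns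
  \<open>(\<mu> - \<lambda>\<^sup>*) (U\<^sub>\<tau>(\<mu>) a, U\<^sub>\<tau>(\<lambda>) c)\<close> into \<open>(M g, g') - (g, M' g')\<close>, which is a purely algebraic expression in \<open>\<Omega>\<^sub>\<tau>\<close>
  and \<open>\<beta>\<close>; the inequality is the dissipativity of \<open>\<tau>\<close>.

  That \<open>\<Gamma>\<^sub>0\<close> maps the defect space onto \<open>\<H>\<close> is not assumed. Its range is closed by uniform boundedness and
  because a solution is controlled by its \<open>L\<^sub>2\<close> norm on an initial interval. If \<open>h\<close> is orthogonal to the range,
  take \<open>y\<close> with \<open>\<Gamma>\<^sub>0 y = 0\<close>, \<open>\<Gamma>\<^sub>1 y = h\<close> and change it on \<open>[0, \<eta>]\<close>, keeping its boundary values, so that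
  \<open>(L - \<lambda>\<^sup>*) y\<close> becomes there a solution of the conjugate equation; as \<open>\<eta> \<up> b\<close> the modified elements tend to
  \<open>0\<close> and Green's identity forces \<open>h = 0\<close>.\<close>

section \<open>Complex Hilbert spaces and bounded operators\<close>

text \<open>The \<open>gamma_field\<close>, the Weyl function and \<open>Z0\<close> are definite
  descriptions, so existence, uniqueness and boundedness behind them must be extracted from two
  facts only: surjectivity of the primed boundary maps and the limit of the bracket at b. The second
  obstacle is that H may be infinite-dimensional, so bounded sequences of initial data need not have
  convergent subsequences. The substitute for compactness is that the fundamental solution is
  continuous in operator norm: solutions with bounded initial data are equicontinuous on compact
  segments. For this reason the differential expression is treated for vector and operator functions
  at once. Square integrable functions are functions here and not classes, so limits of solutions
  are not taken in an abstract L2 space but as limits of their initial data. The same choice makes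
  null sets visible: \<open>l[y]\<close> is meaningful almost everywhere for elements of the maximal
  domain, but at every point for solutions.\<close>

lemma cinner_add_right: "cinner x (y + z) = cinner x y + cinner x z"
  by (metis cinner_add_left cinner_commute complex_cnj_add)

lemma cinner_scaleC_right: "cinner x (c *\<^sub>C y) = cnj c * cinner x y"
  by (metis cinner_scaleC_left cinner_commute complex_cnj_mult)

lemma cinner_zero_left [simp]: "cinner 0 x = 0"
  using cinner_add_left[of 0 0 x] by simp

lemma cinner_zero_right [simp]: "cinner x 0 = 0"
  using cinner_add_right[of x 0 0] by simp

lemma cinner_minus_left: "cinner (- x) y = - cinner x y"
  using cinner_add_left[of x "- x" y] by (simp add: eq_neg_iff_add_eq_0 add.commute)

lemma cinner_minus_right: "cinner x (- y) = - cinner x y"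
  using cinner_add_right[of x y "- y"] by (simp add: eq_neg_iff_add_eq_0 add.commute)

lemma cinner_diff_left: "cinner (x - y) z = cinner x z - cinner y z"
  using cinner_add_left[of x "- y" z] by (simp add: cinner_minus_left)

lemma cinner_diff_right: "cinner x (y - z) = cinner x y - cinner x z"
  using cinner_add_right[of x y "- z"] by (simp add: cinner_minus_right)

lemma cinner_scaleR_left: "cinner (r *\<^sub>R x) y = of_real r * cinner x y"
  by (metis cinner_scaleC_left scaleC_of_real)

lemma cinner_scaleR_right: "cinner x (r *\<^sub>R y) = of_real r * cinner x y"
  by (metis cinner_scaleC_right scaleC_of_real complex_cnj_complex_of_real)

text \<open>Rotating by \<open>cnj (sgn w)\<close> makes the product real and equal to
  \<open>cmod w\<close>. This turns the Cauchy-Schwarz inequality of the real inner product into the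
  complex one.\<close>

lemma Re_le_cmod_aux: assumes "\<And>c. cmod c = 1 \<Longrightarrow> Re (c * w) \<le> B" shows "cmod w \<le> B"
proof (cases "w = 0")
  case True then show ?thesis using assms[of 1] by simp
next
  case False
  have "cmod (cnj (sgn w)) = 1" using False by (simp add: norm_sgn)
  moreover have "cnj (sgn w) * w = of_real (cmod w)"
    using False by (simp add: sgn_eq field_simps complex_norm_square[symmetric] power2_eq_square flip: of_real_mult)
  ultimately show ?thesis using assms[of "cnj (sgn w)"] by simp
qed

lemma cmod_cinner_le: "cmod (cinner x y) \<le> norm x * norm y"
proof (rule Re_le_cmod_aux)
  fix c :: complex assume c: "cmod c = 1"
  have "Re (c * cinner x y) = inner (c *\<^sub>C x) y" by (simp add: cinner_scaleC_left flip: Re_cinner)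
  also have "\<dots> \<le> norm (c *\<^sub>C x) * norm y" by (rule norm_cauchy_schwarz)
  finally show "Re (c * cinner x y) \<le> norm x * norm y" using c by (simp add: norm_scaleC)
qed

lemma bounded_bilinear_cinner: "bounded_bilinear cinner"
proof
  show "\<exists>K. \<forall>a b. norm (cinner a b) \<le> norm a * norm b * K"
    using cmod_cinner_le by (metis mult.right_neutral)
qed (simp_all add: cinner_add_left cinner_add_right cinner_scaleR_left cinner_scaleR_right scaleR_conv_of_real)

lemma norm_add_sq: "(norm (x + y))\<^sup>2 = (norm x)\<^sup>2 + 2 * Re (cinner x y) + (norm y)\<^sup>2"
  by (simp add: Re_cinner power2_norm_eq_inner inner_add_left inner_add_right inner_commute)

lemma cinner_ext: assumes "\<And>z. cinner x z = cinner y z" shows "x = y"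
proof -
  have "cinner (x - y) (x - y) = 0" using assms by (simp add: cinner_diff_left)
  then show ?thesis by (simp add: cinner_self)
qed

lemma cinner_ext_right: assumes "\<And>z. cinner z x = cinner z y" shows "x = y"
  by (rule cinner_ext) (metis assms cinner_commute)

lemma scaleC_one [simp]: "1 *\<^sub>C x = x" for x :: "'a::complex_vector"
  using scaleC_of_real[of 1 x] by simp

lemma scaleC_zero_left [simp]: "0 *\<^sub>C x = 0" for x :: "'a::complex_vector"
  using scaleC_of_real[of 0 x] by simp

lemma scaleC_minus_left: "(- c) *\<^sub>C x = - (c *\<^sub>C x)" for x :: "'a::complex_vector"
  using scaleC_add_left[of c "- c" x] by (simp add: eq_neg_iff_add_eq_0 add.commute)

section \<open>Calculus of complex-linear bounded operators\<close>

lemma cblinfun_add_right: "T *\<^sub>V (x + y) = T *\<^sub>V x + T *\<^sub>V y"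
  by transfer (rule blinfun.add_right)
lemma cblinfun_diff_right: "T *\<^sub>V (x - y) = T *\<^sub>V x - T *\<^sub>V y"
  by transfer (rule blinfun.diff_right)
lemma cblinfun_minus_right: "T *\<^sub>V (- x) = - (T *\<^sub>V x)"
  by transfer (rule blinfun.minus_right)
lemma cblinfun_zero_right [simp]: "T *\<^sub>V 0 = 0"
  by transfer simp
lemma cblinfun_scaleR_right: "T *\<^sub>V (r *\<^sub>R x) = r *\<^sub>R (T *\<^sub>V x)"
  by transfer (rule blinfun.scaleR_right)
lemma cblinfun_scaleC_right: "T *\<^sub>V (c *\<^sub>C x) = c *\<^sub>C (T *\<^sub>V x)"
  by transfer simp
lemma cblinfun_add_left: "(S + T) *\<^sub>V x = S *\<^sub>V x + T *\<^sub>V x"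
  by transfer (rule blinfun.add_left)
lemma cblinfun_diff_left: "(S - T) *\<^sub>V x = S *\<^sub>V x - T *\<^sub>V x"
  by transfer (rule blinfun.diff_left)
lemma cblinfun_minus_left: "(- T) *\<^sub>V x = - (T *\<^sub>V x)"
  by transfer (rule blinfun.minus_left)
lemma cblinfun_zero_left [simp]: "0 *\<^sub>V x = 0"
  by transfer simp
lemma cblinfun_scaleR_left: "(r *\<^sub>R T) *\<^sub>V x = r *\<^sub>R (T *\<^sub>V x)"
  by transfer (rule blinfun.scaleR_left)
lemma cblinfun_scaleC_left: "(c *\<^sub>C T) *\<^sub>V x = c *\<^sub>C (T *\<^sub>V x)"
  by transfer (simp add: bounded_linear_Blinfun_apply bounded_linear_compose[OF bounded_linear_scaleC]
        blinfun.bounded_linear_right)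
lemma cblinfun_id_apply [simp]: "cblinfun_id *\<^sub>V x = x"
  by transfer simp
lemma cblinfun_compose_apply [simp]: "(S o\<^sub>C\<^sub>L T) *\<^sub>V x = S *\<^sub>V (T *\<^sub>V x)"
  by transfer simp
lemma fst_op_apply [simp]: "fst_op *\<^sub>V x = fst x"
  by transfer simp
lemma snd_op_apply [simp]: "snd_op *\<^sub>V x = snd x"
  by transfer simp
lemma inl_op_apply [simp]: "inl_op *\<^sub>V x = (x, 0)"
  by transfer (simp add: bounded_linear_Blinfun_apply bounded_linear_Pair bounded_linear_ident bounded_linear_zero)
lemma inr_op_apply [simp]: "inr_op *\<^sub>V x = (0, x)"
  by transfer (simp add: bounded_linear_Blinfun_apply bounded_linear_Pair bounded_linear_ident bounded_linear_zero)
lemma row_op_apply [simp]: "row_op A B *\<^sub>V x = A *\<^sub>V fst x + B *\<^sub>V snd x"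
  by (simp add: row_op_def cblinfun_add_left)
lemma block_op_apply [simp]:
  "block_op A B C D *\<^sub>V x = (A *\<^sub>V fst x + B *\<^sub>V snd x, C *\<^sub>V fst x + D *\<^sub>V snd x)"
  by (simp add: block_op_def cblinfun_add_left)
lemma axis_op_apply [simp]: "axis_op i *\<^sub>V x = axis i x"
  by transfer (simp add: bounded_linear_Blinfun_apply bounded_linear_axis)

lemmas cblinfun_linear = cblinfun_add_right cblinfun_diff_right cblinfun_minus_right
  cblinfun_scaleR_right cblinfun_scaleC_right cblinfun_add_left cblinfun_diff_left cblinfun_minus_left
  cblinfun_scaleR_left cblinfun_scaleC_left

lemmas cinner_linear = cinner_add_left cinner_add_right cinner_diff_left cinner_diff_right
  cinner_minus_left cinner_minus_right cinner_scaleC_left cinner_scaleC_right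
  cinner_scaleR_left cinner_scaleR_right

lemma cblinfun_eqI: "(\<And>x. S *\<^sub>V x = T *\<^sub>V x) \<Longrightarrow> S = T"
  by transfer (rule blinfun_eqI)

lemma cblinfun_sum_left: "(\<Sum>i\<in>A. f i) *\<^sub>V x = (\<Sum>i\<in>A. f i *\<^sub>V x)"
  by (induction A rule: infinite_finite_induct) (auto simp: cblinfun_add_left)

lemma column_op_apply [simp]: "(column_op A *\<^sub>V x) $ i = A i *\<^sub>V x"
  by (simp add: column_op_def cblinfun_sum_left axis_def if_distrib cong: if_cong)

lemma norm_cblinfun_apply: "norm (T *\<^sub>V x) \<le> norm T * norm x"
  by transfer (rule norm_blinfun)

lemma norm_cblinfun_bound: "0 \<le> B \<Longrightarrow> (\<And>x. norm (T *\<^sub>V x) \<le> B * norm x) \<Longrightarrow> norm T \<le> B"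
  by transfer (rule norm_blinfun_bound)

lemma norm_cblinfun_compose: "norm (S o\<^sub>C\<^sub>L T) \<le> norm S * norm T"
  by transfer (rule norm_blinfun_compose)

lemma norm_scaleC_cblinfun: "norm (c *\<^sub>C T) = cmod c * norm (T :: 'a::complex_hilbert \<Rightarrow>\<^sub>C\<^sub>L 'b::complex_hilbert)"
proof -
  have le: "norm (c *\<^sub>C T) \<le> cmod c * norm T" for c and T :: "'a \<Rightarrow>\<^sub>C\<^sub>L 'b"
    by (rule norm_cblinfun_bound)
      (use mult_left_mono[OF norm_cblinfun_apply, of "cmod c"] in \<open>auto simp: cblinfun_scaleC_left norm_scaleC mult.assoc\<close>)
  show ?thesis
  proof (cases "c = 0")
    case False
    have "norm T = norm (inverse c *\<^sub>C c *\<^sub>C T)" using False by (simp add: scaleC_scaleC)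
    also have "\<dots> \<le> cmod (inverse c) * norm (c *\<^sub>C T)" by (rule le)
    finally have "cmod c * norm T \<le> norm (c *\<^sub>C T)" using False by (simp add: norm_inverse norm_divide field_simps)
    with le[of c T] show ?thesis by simp
  qed simp
qed

lemma bounded_bilinear_cblinfun_apply: "bounded_bilinear (*\<^sub>V)"
  by standard (auto simp: cblinfun_linear intro!: exI[of _ 1] norm_cblinfun_apply)

lemma bounded_bilinear_cblinfun_compose: "bounded_bilinear (o\<^sub>C\<^sub>L)"
  by standard (auto simp: cblinfun_linear intro!: exI[of _ 1] norm_cblinfun_compose cblinfun_eqI)

lemma cblinfun_compose_linear:
  "(S + S') o\<^sub>C\<^sub>L T = S o\<^sub>C\<^sub>L T + S' o\<^sub>C\<^sub>L T" "(c *\<^sub>C S) o\<^sub>C\<^sub>L T = c *\<^sub>C (S o\<^sub>C\<^sub>L T)" "S o\<^sub>C\<^sub>L (c *\<^sub>C T) = c *\<^sub>C (S o\<^sub>C\<^sub>L T)"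
  by (auto intro!: cblinfun_eqI simp: cblinfun_linear)

lemma cblinfun_compose_assoc: "(R o\<^sub>C\<^sub>L S) o\<^sub>C\<^sub>L T = R o\<^sub>C\<^sub>L (S o\<^sub>C\<^sub>L T)"
  by (rule cblinfun_eqI) simp

lemma cblinfun_id_compose [simp]: "cblinfun_id o\<^sub>C\<^sub>L T = T" "T o\<^sub>C\<^sub>L cblinfun_id = T"
  by (auto intro: cblinfun_eqI)

lemma cblinfun_of_fun:
  assumes "bounded_linear f" "\<And>c x. f (c *\<^sub>C x) = c *\<^sub>C f x"
  obtains T where "\<And>x. T *\<^sub>V x = f x"
proof
  fix x
  have "Blinfun f \<in> {T. \<forall>c x. blinfun_apply T (c *\<^sub>C x) = c *\<^sub>C blinfun_apply T x}"
    using assms by (simp add: bounded_linear_Blinfun_apply)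
  then show "Abs_cblinfun (Blinfun f) *\<^sub>V x = f x"
    using assms(1) by (simp add: cblinfun_apply.rep_eq Abs_cblinfun_inverse bounded_linear_Blinfun_apply)
qed

text \<open>The complex-linear operators are closed in the complete space of real-linear ones,
  because complex homogeneity passes to pointwise limits. Completeness is needed to integrate
  operator functions and to solve differential equations for them.\<close>

instance cblinfun :: (complex_hilbert, complex_hilbert) banach
proof
  fix X :: "nat \<Rightarrow> 'a \<Rightarrow>\<^sub>C\<^sub>L 'b" assume "Cauchy X"
  have norm_Rep: "norm (Rep_cblinfun S - Rep_cblinfun T) = norm (S - T)" for S T :: "'a \<Rightarrow>\<^sub>C\<^sub>L 'b"
    by (simp only: norm_cblinfun.rep_eq minus_cblinfun.rep_eq)
  have "Cauchy (\<lambda>n. Rep_cblinfun (X n))"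
    using \<open>Cauchy X\<close> unfolding Cauchy_def dist_norm norm_Rep .
  then obtain L where L: "(\<lambda>n. Rep_cblinfun (X n)) \<longlonglongrightarrow> L"
    unfolding Cauchy_convergent_iff convergent_def by blast
  have lim: "(\<lambda>n. X n *\<^sub>V x) \<longlonglongrightarrow> blinfun_apply L x" for x
    using bounded_bilinear.tendsto[OF bounded_bilinear_blinfun_apply L tendsto_const[of x]]
    by (simp only: cblinfun_apply.rep_eq)
  have hom: "blinfun_apply L (c *\<^sub>C x) = c *\<^sub>C blinfun_apply L x" for c x
    by (rule LIMSEQ_unique[OF lim[of "c *\<^sub>C x"]])
      (simp only: cblinfun_scaleC_right bounded_linear.tendsto[OF bounded_linear_scaleC lim])
  obtain T where "\<And>x. T *\<^sub>V x = blinfun_apply L x"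
    using cblinfun_of_fun[OF blinfun.bounded_linear_right hom] by metis
  then have T: "Rep_cblinfun T = L"
    by (intro blinfun_eqI) (simp only: cblinfun_apply.rep_eq)
  have "X \<longlonglongrightarrow> T"
    using L unfolding T[symmetric] LIMSEQ_def dist_norm norm_Rep .
  then show "convergent X" by (rule convergentI)
qed

text \<open>Minimising \<open>B x x - 2 Re \<phi> x\<close> over a closed subspace gives the Riesz representation theorem,
  orthogonal projections and the Lax--Milgram theorem at once.\<close>

lemma form_representation:
  fixes B :: "'a::complex_hilbert \<Rightarrow> 'a \<Rightarrow> complex" and \<phi> :: "'a \<Rightarrow> complex"
  assumes S: "closed S" "0 \<in> S" "\<And>x y. x \<in> S \<Longrightarrow> y \<in> S \<Longrightarrow> x + y \<in> S" "\<And>c x. x \<in> S \<Longrightarrow> c *\<^sub>C x \<in> S"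
    and B: "\<And>x y z. B (x + y) z = B x z + B y z" "\<And>c x y. B (c *\<^sub>C x) y = c * B x y"
      "\<And>x y. B x y = cnj (B y x)" "\<And>x y. cmod (B x y) \<le> K * norm x * norm y"
      "0 < \<kappa>" "\<And>x. \<kappa> * (norm x)\<^sup>2 \<le> Re (B x x)"
    and \<phi>: "\<And>x y. \<phi> (x + y) = \<phi> x + \<phi> y" "\<And>c x. \<phi> (c *\<^sub>C x) = cnj c * \<phi> x" "\<And>x. cmod (\<phi> x) \<le> N * norm x"
  obtains x where "x \<in> S" "\<And>y. y \<in> S \<Longrightarrow> B x y = \<phi> y"
proof -
  define J where "J x = Re (B x x) - 2 * Re (\<phi> x)" for x
  have B_right: "B x (y + z) = B x y + B x z" "B x (c *\<^sub>C y) = cnj c * B x y" for x y z c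
    by (metis B(1) B(3) complex_cnj_add, metis B(2) B(3) complex_cnj_mult)
  have B_expand: "Re (B (x + y) (x + y)) = Re (B x x) + 2 * Re (B x y) + Re (B y y)" for x y
  proof -
    have "Re (B y x) = Re (B x y)" using B(3)[of y x] by simp
    then show ?thesis by (simp add: B(1) B_right)
  qed
  \<comment> \<open>Completing the square in \<open>norm x\<close>, with minimum at
    \<open>N / \<kappa>\<close>.\<close>
  have lower: "- N\<^sup>2 / \<kappa> \<le> J x" for x
  proof -
    have "J x \<ge> \<kappa> * (norm x)\<^sup>2 - 2 * (N * norm x)"
      using B(6)[of x] \<phi>(3)[of x] complex_Re_le_cmod[of "\<phi> x"] by (simp add: J_def)
    moreover have "\<kappa> * (norm x - N / \<kappa>)\<^sup>2 = \<kappa> * (norm x)\<^sup>2 - 2 * (N * norm x) + N\<^sup>2 / \<kappa>"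
      using \<open>0 < \<kappa>\<close> by (simp add: power2_eq_square algebra_simps)
    then have "0 \<le> \<kappa> * (norm x)\<^sup>2 - 2 * (N * norm x) + N\<^sup>2 / \<kappa>"
      using \<open>0 < \<kappa>\<close> by (metis mult_nonneg_nonneg order_less_imp_le zero_le_power2)
    ultimately show ?thesis by simp
  qed
  define d where "d = Inf (J ` S)"
  have bdd: "bdd_below (J ` S)" using lower by (auto intro!: bdd_belowI)
  have d_le: "d \<le> J x" if "x \<in> S" for x
    unfolding d_def using that bdd by (auto intro!: cInf_lower)
  have "\<exists>x\<in>S. J x < d + 1 / Suc n" for n
    using cInf_lessD[of "J ` S" "d + 1 / Suc n"] S(2) by (auto simp: d_def)
  then obtain X where X: "\<And>n. X n \<in> S" "\<And>n. J (X n) < d + 1 / Suc n" by metis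
  \<comment> \<open>The parallelogram law for B: the midpoint of x and y lies in S, where J is at
    least d, so near-minimisers are close to each other.\<close>
  have par: "\<kappa> * (norm (x - y))\<^sup>2 \<le> 2 * (J x - d) + 2 * (J y - d)" if "x \<in> S" "y \<in> S" for x y
  proof -
    have mid: "(1/2) *\<^sub>C (x + y) \<in> S" using that S by blast
    have neg: "B (- y) z = - B y z" "B z (- y) = - B z y" for y z
      using B(2)[of "-1" y z] B_right(2)[of z "-1" y] by (simp_all add: scaleC_minus_left)
    have "J ((1/2) *\<^sub>C (x + y)) = Re (B (x + y) (x + y)) / 4 - Re (\<phi> x) - Re (\<phi> y)"
      by (simp add: J_def B(2) B_right(2) \<phi>) (simp add: field_simps)
    moreover have "Re (B (x - y) (x - y)) = Re (B x x) - 2 * Re (B x y) + Re (B y y)"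
      using B_expand[of x "- y"] by (simp add: neg)
    ultimately have "2 * J x + 2 * J y = 4 * J ((1/2) *\<^sub>C (x + y)) + Re (B (x - y) (x - y))"
      using B_expand[of x y] by (simp add: J_def, simp add: field_simps)
    with d_le[OF mid] B(6)[of "x - y"] show ?thesis by simp
  qed
  have "Cauchy X"
  proof (rule metric_CauchyI)
    fix e :: real assume "0 < e"
    then have "0 < \<kappa> * e\<^sup>2 / 4" using \<open>0 < \<kappa>\<close> by simp
    then obtain M where M: "inverse (Suc M) < \<kappa> * e\<^sup>2 / 4" using reals_Archimedean by blast
    have small: "J (X n) - d < \<kappa> * e\<^sup>2 / 4" if "n \<ge> M" for n
    proof -
      have "1 / real (Suc n) \<le> 1 / real (Suc M)" using that by (simp add: frac_le)
      then show ?thesis using X(2)[of n] M by (simp add: inverse_eq_divide)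
    qed
    show "\<exists>M. \<forall>m\<ge>M. \<forall>n\<ge>M. dist (X m) (X n) < e"
    proof (intro exI allI impI)
      fix m n assume "m \<ge> M" "n \<ge> M"
      then have "\<kappa> * (norm (X m - X n))\<^sup>2 < \<kappa> * e\<^sup>2"
        using par[OF X(1) X(1), of m n] small[of m] small[of n] by simp
      then show "dist (X m) (X n) < e"
        using \<open>0 < \<kappa>\<close> \<open>0 < e\<close> by (simp add: dist_norm power_less_imp_less_base)
    qed
  qed
  then obtain x where x: "X \<longlonglongrightarrow> x" using Cauchy_convergent_iff convergent_def by blast
  have "x \<in> S" using S(1) X(1) x closed_sequentially by blast
  have step: "Re (B x y) = Re (\<phi> y)" if "y \<in> S" for y
  proof -
    have dir: "- (Re (B x y) - Re (\<phi> y)) \<le> 0" if y: "y \<in> S" for y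
    proof -
      \<comment> \<open>The variation is performed on the minimising sequence with error
        \<open>1 / Suc n\<close>; only \<open>B u y\<close> with fixed y has to pass to the limit,
        not J.\<close>
      have lin: "0 \<le> J (X n + r *\<^sub>C y) - d" for n and r :: real
        using d_le[of "X n + r *\<^sub>C y"] S X(1) y by auto
      have J_exp: "J (X n + r *\<^sub>C y) = J (X n) + 2 * r * (Re (B (X n) y) - Re (\<phi> y)) + r\<^sup>2 * Re (B y y)" for n and r :: real
        by (simp add: J_def B_expand B(2) B_right(2) \<phi> power2_eq_square algebra_simps)
      have lim: "(\<lambda>n. B (X n) y) \<longlonglongrightarrow> B x y"
      proof -
        have "bounded_linear (\<lambda>u. B u y)"
          by (rule bounded_linear_intro[where K = "K * norm y"])
            (use B(1,4) B(2)[of "complex_of_real _"] in \<open>auto simp: scaleC_of_real scaleR_conv_of_real mult.assoc mult.left_commute mult.commute\<close>)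
        then show ?thesis using x bounded_linear.tendsto by blast
      qed
      have ineq: "0 \<le> 2 * r * (Re (B x y) - Re (\<phi> y)) + r\<^sup>2 * Re (B y y)" for r :: real
      proof (rule LIMSEQ_le_const)
        show "(\<lambda>n. 1 / real (Suc n) + 2 * r * (Re (B (X n) y) - Re (\<phi> y)) + r\<^sup>2 * Re (B y y))
            \<longlonglongrightarrow> 2 * r * (Re (B x y) - Re (\<phi> y)) + r\<^sup>2 * Re (B y y)"
          using tendsto_add[OF LIMSEQ_inverse_real_of_nat tendsto_add[OF tendsto_mult_left[OF tendsto_diff[OF tendsto_Re[OF lim] tendsto_const]] tendsto_const]]
          by (simp add: inverse_eq_divide add.assoc)
        show "\<exists>N. \<forall>n\<ge>N. 0 \<le> 1 / real (Suc n) + 2 * r * (Re (B (X n) y) - Re (\<phi> y)) + r\<^sup>2 * Re (B y y)"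
        proof (intro exI allI impI)
          fix n
          show "0 \<le> 1 / real (Suc n) + 2 * r * (Re (B (X n) y) - Re (\<phi> y)) + r\<^sup>2 * Re (B y y)"
            using lin[of n r] X(2)[of n] J_exp[of n r] by linarith
        qed
      qed
      show ?thesis
      proof (rule ccontr)
        assume "\<not> ?thesis"
        then have neg: "Re (B x y) - Re (\<phi> y) < 0" by simp
        \<comment> \<open>\<open>a / b\<close> is the step length for which the linear term
          outweighs the quadratic one. The added 1 keeps b positive.\<close>
        define a where "a = - (Re (B x y) - Re (\<phi> y))"
        define b where "b = Re (B y y) + 1"
        have "0 \<le> Re (B y y)" using B(6)[of y] \<open>0 < \<kappa>\<close> by (smt (verit) mult_nonneg_nonneg zero_le_power2)
        then have ab: "0 < a" "0 < b" using neg by (auto simp: a_def b_def)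
        have "(a / b)\<^sup>2 * Re (B y y) \<le> (a / b)\<^sup>2 * b" by (rule mult_left_mono) (auto simp: b_def)
        also have "\<dots> = (a / b) * a" using ab by (simp add: power2_eq_square)
        finally have "0 \<le> 2 * (a / b) * (- a) + (a / b) * a" using ineq[of "a / b"] by (simp add: a_def)
        then have "(a / b) * a \<le> 0" by simp
        then show False using ab by (simp add: mult_le_0_iff divide_le_0_iff)
      qed
    qed
    have neg: "B x (- y) = - B x y" "\<phi> (- y) = - \<phi> y"
      using B_right(2)[of x "-1" y] \<phi>(2)[of "-1" y] by (simp_all add: scaleC_minus_left)
    have "- y \<in> S" using S(4)[OF that, of "-1"] by (simp add: scaleC_minus_left)
    then show ?thesis using dir[OF that] dir[of "- y"] by (simp add: neg)
  qed
  have "B x y = \<phi> y" if "y \<in> S" for y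
  proof (rule complex_eqI)
    show "Re (B x y) = Re (\<phi> y)" by (rule step[OF that])
    \<comment> \<open>The imaginary part at y is the real part at \<open>\<i> *\<^sub>C y\<close>,
      up to sign on both sides.\<close>
    show "Im (B x y) = Im (\<phi> y)"
      using step[OF S(4)[OF that, of "\<i>"]] by (simp add: B_right(2) \<phi>(2))
  qed
  with \<open>x \<in> S\<close> show thesis by (rule that)
qed

lemma riesz_antilinear:
  fixes \<phi> :: "'a::complex_hilbert \<Rightarrow> complex"
  assumes "\<And>x y. \<phi> (x + y) = \<phi> x + \<phi> y" "\<And>c x. \<phi> (c *\<^sub>C x) = cnj c * \<phi> x" "\<And>x. cmod (\<phi> x) \<le> N * norm x"
  obtains x where "\<And>y. cinner x y = \<phi> y"
  by (rule form_representation[of UNIV cinner 1 1 \<phi> N])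
    (use assms cmod_cinner_le in \<open>auto simp: cinner_linear cinner_self simp flip: cinner_commute\<close>)

text \<open>The projection x of h to S represents the functional \<open>cinner h\<close> on S; then
  h - x is orthogonal to S and vanishes by assumption.\<close>

lemma dense_closed_subspace:
  fixes S :: "'a::complex_hilbert set"
  assumes S: "closed S" "0 \<in> S" "\<And>x y. x \<in> S \<Longrightarrow> y \<in> S \<Longrightarrow> x + y \<in> S" "\<And>c x. x \<in> S \<Longrightarrow> c *\<^sub>C x \<in> S"
    and perp: "\<And>h. (\<And>x. x \<in> S \<Longrightarrow> cinner h x = 0) \<Longrightarrow> h = 0"
  shows "S = UNIV"
proof -
  have "h \<in> S" for h
  proof (rule form_representation[of S cinner 1 1 "cinner h" "norm h"])
    fix x assume x: "x \<in> S" "\<And>y. y \<in> S \<Longrightarrow> cinner x y = cinner h y"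
    then have "h - x = 0" by (intro perp) (simp add: cinner_diff_left)
    then show ?thesis using x by simp
  qed (use S cmod_cinner_le in \<open>auto simp: cinner_linear cinner_self simp flip: cinner_commute\<close>)
  then show ?thesis by auto
qed

text \<open>Riesz representation in the second argument for each fixed first one. It supplies the
  adjoints and later the weakly defined integral of the products of solutions.\<close>

lemma form_operator:
  fixes F :: "'a::complex_hilbert \<Rightarrow> 'b::complex_hilbert \<Rightarrow> complex"
  assumes "\<And>x x' y. F (x + x') y = F x y + F x' y" "\<And>c x y. F (c *\<^sub>C x) y = c * F x y"
    and "\<And>x y y'. F x (y + y') = F x y + F x y'" "\<And>c x y. F x (c *\<^sub>C y) = cnj c * F x y"
    and "\<And>x y. cmod (F x y) \<le> K * norm x * norm y" "0 \<le> K"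
  obtains T where "\<And>x y. cinner (T *\<^sub>V x) y = F x y"
proof -
  have "\<exists>f. \<forall>y. cinner f y = F x y" for x
    by (rule riesz_antilinear[of "F x" "K * norm x"]) (use assms in auto)
  then obtain f where f: "\<And>x y. cinner (f x) y = F x y" by metis
  have sc: "f (c *\<^sub>C x) = c *\<^sub>C f x" for c x
    by (rule cinner_ext) (simp add: f assms cinner_linear)
  have Kx: "0 \<le> K * norm x" for x using \<open>0 \<le> K\<close> by simp
  have "bounded_linear f"
  proof (rule bounded_linear_intro[where K = K])
    show "f (x + y) = f x + f y" for x y by (rule cinner_ext) (simp add: f assms cinner_linear)
    show "f (r *\<^sub>R x) = r *\<^sub>R f x" for r x by (simp add: sc flip: scaleC_of_real)
    show "norm (f x) \<le> norm x * K" for x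
    proof -
      have "norm (f x) * norm (f x) \<le> (K * norm x) * norm (f x)"
        using assms(5)[of x "f x"] by (simp add: f[symmetric] cinner_self power2_eq_square norm_mult)
      then show ?thesis
        using Kx[of x] by (cases "f x = 0") (auto simp: mult.commute)
    qed
  qed
  then show thesis using cblinfun_of_fun[OF _ sc] f that by metis
qed

section \<open>Adjoints and inverses\<close>

lemma adj_unique:
  assumes "\<And>x y. cinner (T *\<^sub>V x) y = cinner x (S *\<^sub>V y)" shows "adj T = S"
  unfolding adj_def
proof (rule the_equality)
  show "\<forall>x y. cinner (T *\<^sub>V x) y = cinner x (S *\<^sub>V y)" using assms by simp
  fix R assume R: "\<forall>x y. cinner (T *\<^sub>V x) y = cinner x (R *\<^sub>V y)"
  show "R = S"
    by (rule cblinfun_eqI, rule cinner_ext_right) (simp flip: R[rule_format] assms)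
qed

text \<open>The existence half of the description in \<open>adj\<close>: the form
  \<open>cinner y (T *\<^sub>V x)\<close> is bounded and is therefore given by an operator.\<close>

lemma cinner_adj: "cinner (T *\<^sub>V x) y = cinner x (adj T *\<^sub>V y)"
proof -
  obtain S where S: "\<And>y x. cinner (S *\<^sub>V y) x = cinner y (T *\<^sub>V x)"
  proof (rule form_operator[of "\<lambda>y x. cinner y (T *\<^sub>V x)" "norm T"])
    show "cmod (cinner x (T *\<^sub>V y)) \<le> norm T * norm x * norm y" for x y
      using order_trans[OF cmod_cinner_le mult_left_mono[OF norm_cblinfun_apply]]
      by (metis mult.assoc mult.commute norm_ge_zero)
    fix S assume "\<And>y x. cinner (S *\<^sub>V y) x = cinner y (T *\<^sub>V x)"
    then show thesis by (rule that)
  qed (simp_all add: cinner_linear cblinfun_linear)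
  have "adj T = S" by (rule adj_unique) (metis S cinner_commute)
  then show ?thesis by (metis S cinner_commute)
qed

lemma cinner_adj_left: "cinner (adj T *\<^sub>V x) y = cinner x (T *\<^sub>V y)"
  by (metis cinner_adj cinner_commute)

lemma adj_adj [simp]: "adj (adj T) = T"
  by (rule adj_unique) (simp add: cinner_adj_left)

lemma norm_adj [simp]: "norm (adj T) = norm T"
proof -
  \<comment> \<open>Stated with fresh type variables, because it is used both for T and for its
    adjoint.\<close>
  have le: "norm (adj T) \<le> norm T" for T :: "'c::complex_hilbert \<Rightarrow>\<^sub>C\<^sub>L 'd::complex_hilbert"
  proof (rule norm_cblinfun_bound)
    fix x
    have "norm (adj T *\<^sub>V x) * norm (adj T *\<^sub>V x) = Re (cinner (T *\<^sub>V (adj T *\<^sub>V x)) x)"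
      by (simp add: cinner_adj cinner_self power2_eq_square)
    also have "\<dots> \<le> norm (T *\<^sub>V (adj T *\<^sub>V x)) * norm x"
      using complex_Re_le_cmod cmod_cinner_le order_trans by blast
    also have "\<dots> \<le> (norm T * norm x) * norm (adj T *\<^sub>V x)"
      using mult_right_mono[OF norm_cblinfun_apply] by (metis mult.assoc mult.commute norm_ge_zero)
    finally show "norm (adj T *\<^sub>V x) \<le> norm T * norm x"
      by (metis mult_right_le_imp_le norm_ge_zero mult_nonneg_nonneg order_le_less)
  qed simp
  show ?thesis using le[of T] le[of "adj T"] by simp
qed

lemma adj_add: "adj (S + T) = adj S + adj T"
  by (rule adj_unique) (simp add: cblinfun_linear cinner_linear cinner_adj)
lemma adj_diff: "adj (S - T) = adj S - adj T"
  by (rule adj_unique) (simp add: cblinfun_linear cinner_linear cinner_adj)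
lemma adj_scaleC: "adj (c *\<^sub>C T) = cnj c *\<^sub>C adj T"
  by (rule adj_unique) (simp add: cblinfun_linear cinner_linear cinner_adj)
lemma adj_scaleR: "adj (r *\<^sub>R T) = r *\<^sub>R adj T"
  by (rule adj_unique) (simp add: cblinfun_linear cinner_linear cinner_adj)
lemma adj_compose: "adj (S o\<^sub>C\<^sub>L T) = adj T o\<^sub>C\<^sub>L adj S"
  by (rule adj_unique) (simp add: cinner_adj)

lemma bounded_linear_adj: "bounded_linear adj"
  by (rule bounded_linear_intro[where K = 1]) (simp_all add: adj_add adj_scaleR)

lemma inv_op_unique:
  assumes "S o\<^sub>C\<^sub>L T = cblinfun_id" "T o\<^sub>C\<^sub>L S = cblinfun_id" shows "inv_op T = S"
  unfolding inv_op_def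
proof (rule the_equality)
  fix R assume R: "R o\<^sub>C\<^sub>L T = cblinfun_id \<and> T o\<^sub>C\<^sub>L R = cblinfun_id"
  have "R = R o\<^sub>C\<^sub>L (T o\<^sub>C\<^sub>L S)" by (simp add: assms)
  also have "\<dots> = S" using R by (simp add: cblinfun_compose_assoc[symmetric])
  finally show "R = S" .
qed (use assms in simp)

lemma inv_op_apply:
  assumes "invertible_op T"
  shows "inv_op T *\<^sub>V (T *\<^sub>V x) = x" "T *\<^sub>V (inv_op T *\<^sub>V y) = y"
proof -
  obtain S where "S o\<^sub>C\<^sub>L T = cblinfun_id" "T o\<^sub>C\<^sub>L S = cblinfun_id"
    using assms unfolding invertible_op_def by blast
  then have "inv_op T o\<^sub>C\<^sub>L T = cblinfun_id" "T o\<^sub>C\<^sub>L inv_op T = cblinfun_id"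
    by (simp_all add: inv_op_unique)
  then show "inv_op T *\<^sub>V (T *\<^sub>V x) = x" "T *\<^sub>V (inv_op T *\<^sub>V y) = y"
    by (metis cblinfun_compose_apply cblinfun_id_apply)+
qed

lemma invertible_opI:
  assumes "\<And>x. S *\<^sub>V (T *\<^sub>V x) = x" "\<And>y. T *\<^sub>V (S *\<^sub>V y) = y"
  shows "invertible_op T"
  unfolding invertible_op_def using assms by (intro exI[of _ S] conjI cblinfun_eqI) simp_all

text \<open>Surjectivity by least squares: if x solves the normal equations for the right-hand side
  y, then \<open>w = T x - y\<close> is orthogonal to the range of T, in particular to T w, and
  coercivity forces w = 0. The lower bound gives injectivity and a bounded inverse.\<close>

lemma coercive_invertible:
  fixes T :: "'a::complex_hilbert \<Rightarrow>\<^sub>C\<^sub>L 'a"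
  assumes "0 < c" and coercive: "\<And>x. c * (norm x)\<^sup>2 \<le> Re (cinner (T *\<^sub>V x) x)"
  shows "invertible_op T"
proof -
  have below: "c * norm x \<le> norm (T *\<^sub>V x)" for x
  proof (cases "x = 0")
    case False
    have "c * norm x * norm x \<le> norm (T *\<^sub>V x) * norm x"
      using coercive[of x] complex_Re_le_cmod[of "cinner (T *\<^sub>V x) x"] cmod_cinner_le[of "T *\<^sub>V x" x]
      by (simp add: power2_eq_square)
    then show ?thesis using False by simp
  qed simp
  have "\<exists>x. T *\<^sub>V x = y" for y
  proof (rule form_representation[of UNIV "\<lambda>x z. cinner (T *\<^sub>V x) (T *\<^sub>V z)" "norm T * norm T" "c\<^sup>2" "\<lambda>z. cinner y (T *\<^sub>V z)" "norm y * norm T"])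
    show "cmod (cinner (T *\<^sub>V x) (T *\<^sub>V z)) \<le> norm T * norm T * norm x * norm z" for x z
    proof -
      have "cmod (cinner (T *\<^sub>V x) (T *\<^sub>V z)) \<le> norm (T *\<^sub>V x) * norm (T *\<^sub>V z)" by (rule cmod_cinner_le)
      also have "\<dots> \<le> (norm T * norm x) * (norm T * norm z)"
        by (intro mult_mono norm_cblinfun_apply) auto
      finally show ?thesis by (simp add: mult_ac)
    qed
    show "c\<^sup>2 * (norm x)\<^sup>2 \<le> Re (cinner (T *\<^sub>V x) (T *\<^sub>V x))" for x
      using power_mono[OF below[of x], of 2] \<open>0 < c\<close> by (simp add: cinner_self power_mult_distrib)
    show "cmod (cinner y (T *\<^sub>V z)) \<le> norm y * norm T * norm z" for z
      using order_trans[OF cmod_cinner_le mult_left_mono[OF norm_cblinfun_apply]]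
      by (metis mult.assoc norm_ge_zero)
    show "cinner (T *\<^sub>V x) (T *\<^sub>V z) = cnj (cinner (T *\<^sub>V z) (T *\<^sub>V x))" for x z by (rule cinner_commute)
    fix x assume x: "\<And>z. z \<in> UNIV \<Longrightarrow> cinner (T *\<^sub>V x) (T *\<^sub>V z) = cinner y (T *\<^sub>V z)"
    define w where "w = T *\<^sub>V x - y"
    have "cinner (T *\<^sub>V w) w = 0"
      using x[of w] by (metis UNIV_I cinner_commute cinner_diff_left complex_cnj_zero eq_iff_diff_eq_0 w_def)
    then have "c * (norm w)\<^sup>2 \<le> 0" using coercive[of w] by simp
    then have "w = 0" using \<open>0 < c\<close> by (simp add: mult_le_0_iff)
    then show ?thesis by (auto simp: w_def)
  qed (use \<open>0 < c\<close> in \<open>simp_all add: cinner_linear cblinfun_linear\<close>)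
  then obtain s where s: "\<And>y. T *\<^sub>V s y = y" by metis
  have inj: "x = z" if "T *\<^sub>V x = T *\<^sub>V z" for x z
    using below[of "x - z"] that \<open>0 < c\<close> by (simp add: cblinfun_linear mult_le_0_iff)
  have "bounded_linear s"
  proof (rule bounded_linear_intro[where K = "1 / c"])
    show "norm (s y) \<le> norm y * (1 / c)" for y using below[of "s y"] \<open>0 < c\<close> by (simp add: s field_simps)
    show "s (x + y) = s x + s y" for x y by (rule inj) (simp add: s cblinfun_linear)
    show "s (r *\<^sub>R x) = r *\<^sub>R s x" for r x by (rule inj) (simp add: s cblinfun_linear)
  qed
  moreover have "s (c *\<^sub>C x) = c *\<^sub>C s x" for c x by (rule inj) (simp add: s cblinfun_linear)
  ultimately obtain S where "\<And>y. S *\<^sub>V y = s y"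
    using cblinfun_of_fun[of s] by metis
  then have S: "T *\<^sub>V (S *\<^sub>V y) = y" for y by (simp add: s)
  show ?thesis by (rule invertible_opI[of S], rule inj, rule S, rule S)
qed

text \<open>The uniform boundedness principle, by Sokal's gliding hump argument.\<close>

lemma uniform_boundedness:
  fixes S :: "'a::complex_hilbert set"
  assumes weak: "\<And>x. \<exists>C. \<forall>y\<in>S. cmod (cinner x y) \<le> C"
  shows "\<exists>B\<ge>0. \<forall>y\<in>S. norm y \<le> B"
proof (rule ccontr)
  assume "\<not> ?thesis"
  \<comment> \<open>The rate 4 beats the weights \<open>(1/3) ^ n\<close> given to the humps: half
    of \<open>(4/3) ^ n\<close> survives in the end, which is unbounded.\<close>
  then have "\<exists>y\<in>S. 4 ^ n < norm y" for n :: nat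
    by (metis not_le zero_le_power zero_le_numeral)
  then obtain Y where Y: "\<And>n. Y n \<in> S" "\<And>n::nat. 4 ^ n < norm (Y n)" by metis
  have Ypos: "0 < norm (Y n)" for n using Y(2)[of n] by (meson less_trans zero_less_numeral zero_less_power)
  define v where "v n = ((1/3) ^ n / norm (Y n)) *\<^sub>R Y n" for n
  have nv: "norm (v n) = (1/3) ^ n" for n using Ypos[of n] by (simp add: v_def)
  have cv: "cmod (cinner (v n) (Y n)) = (1/3) ^ n * norm (Y n)" for n
    using Ypos[of n] by (simp add: v_def cinner_linear cinner_self norm_mult norm_divide norm_power power2_eq_square)
  \<comment> \<open>The pairings of X n + v n and X n - v n with Y n differ by twice the pairing of
    v n, so one of the two signs gives at least the full hump.\<close>
  define \<sigma> where "\<sigma> x n = (if cmod (cinner (x + v n) (Y n)) \<ge> (1/3) ^ n * norm (Y n) then v n else - v n)" for x n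
  define X where "X = rec_nat 0 (\<lambda>n x. x + \<sigma> x n)"
  have XS: "X (Suc n) = X n + \<sigma> (X n) n" for n by (simp add: X_def)
  have hump: "(1/3) ^ n * norm (Y n) \<le> cmod (cinner (X (Suc n)) (Y n))" for n
  proof -
    have "2 * cinner (v n) (Y n) = cinner (X n + v n) (Y n) - cinner (X n - v n) (Y n)"
      by (simp add: cinner_linear)
    then have "2 * ((1/3) ^ n * norm (Y n)) \<le> cmod (cinner (X n + v n) (Y n)) + cmod (cinner (X n - v n) (Y n))"
      using norm_triangle_ineq4 cv by (metis norm_mult norm_numeral)
    then show ?thesis by (auto simp: XS \<sigma>_def)
  qed
  have n\<sigma>: "norm (\<sigma> (X n) n) = (1/3) ^ n" for n by (simp add: \<sigma>_def nv)
  have Xsum: "X n = (\<Sum>i<n. \<sigma> (X i) i)" for n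
    by (induction n) (auto simp: XS, simp add: X_def)
  have summ: "summable (\<lambda>i. norm (\<sigma> (X i) i))" by (simp add: n\<sigma>)
  define x where "x = (\<Sum>i. \<sigma> (X i) i)"
  \<comment> \<open>The geometric tail after stage n is half of \<open>(1/3) ^ n\<close>, so later
    terms destroy at most half of the n-th hump.\<close>
  have tail: "norm (x - X (Suc n)) \<le> (1/2) * (1/3) ^ n" for n
  proof -
    have s1: "summable (\<lambda>i. norm (\<sigma> (X (i + Suc n)) (i + Suc n)))" using summ summable_ignore_initial_segment by blast
    have "x - X (Suc n) = (\<Sum>i. \<sigma> (X (i + Suc n)) (i + Suc n))"
      using suminf_split_initial_segment[OF summable_norm_cancel[OF summ], of "Suc n"] by (simp only: x_def Xsum[of "Suc n"]) simp
    also have "norm \<dots> \<le> (\<Sum>i. norm (\<sigma> (X (i + Suc n)) (i + Suc n)))" by (rule summable_norm[OF s1])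
    also have "\<dots> = (\<Sum>i. (1/3) ^ Suc n * (1/3) ^ i)" by (simp only: n\<sigma>) (simp add: power_add mult_ac)
    also have "\<dots> = (1/3) ^ Suc n * (\<Sum>i. (1/3) ^ i)" by (rule suminf_mult) simp
    also have "(\<Sum>i. (1/3::real) ^ i) = 3 / 2" by (subst suminf_geometric) auto
    finally show ?thesis by simp
  qed
  obtain C where C: "\<And>n. cmod (cinner x (Y n)) \<le> C" using weak[of x] Y(1) by blast
  have "(1/2) * (4/3) ^ n \<le> C" for n
  proof -
    have "cmod (cinner (x - X (Suc n)) (Y n)) \<le> (1/2) * (1/3) ^ n * norm (Y n)"
      using cmod_cinner_le tail[of n] by (meson mult_right_mono norm_ge_zero order_trans)
    moreover have "cmod (cinner (X (Suc n)) (Y n)) \<le> cmod (cinner x (Y n)) + cmod (cinner (x - X (Suc n)) (Y n))"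
      using norm_triangle_ineq4[of "cinner x (Y n)" "cinner (x - X (Suc n)) (Y n)"] by (simp add: cinner_linear)
    ultimately have "(1/2) * (1/3) ^ n * norm (Y n) \<le> C" using hump[of n] C[of n] by linarith
    moreover have "(1/2) * (1/3) ^ n * 4 ^ n \<le> (1/2) * (1/3) ^ n * norm (Y n)"
      using Y(2)[of n] by (intro mult_left_mono) auto
    moreover have "(1/2) * (4/3::real) ^ n = (1/2) * (1/3) ^ n * 4 ^ n" by (simp add: power_divide)
    ultimately show ?thesis by linarith
  qed
  then have "(4/3) ^ n \<le> 2 * C" for n by (simp add: mult.commute field_simps)
  moreover obtain n where "2 * C < (4/3) ^ n" using real_arch_pow[of "4/3" "2 * C"] by auto
  ultimately show False by (meson not_le)
qed

text \<open>The bounded inverse theorem from uniform boundedness. As every x is some T k, the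
  vectors y with \<open>norm (adj T *\<^sub>V y) \<le> 1\<close> are weakly bounded, hence bounded.
  So the adjoint is bounded below, T composed with its adjoint is coercive, and this gives a bounded
  right inverse of T.\<close>

lemma bijective_invertible:
  fixes T :: "'a::complex_hilbert \<Rightarrow>\<^sub>C\<^sub>L 'b::complex_hilbert"
  assumes "inj ((*\<^sub>V) T)" "surj ((*\<^sub>V) T)"
  shows "invertible_op T"
proof -
  have "\<exists>B\<ge>0. \<forall>y\<in>{y. norm (adj T *\<^sub>V y) \<le> 1}. norm y \<le> B"
  proof (rule uniform_boundedness)
    fix x
    obtain k where k: "x = T *\<^sub>V k" using assms(2) by (metis surjD)
    have "cmod (cinner x y) \<le> norm k" if "norm (adj T *\<^sub>V y) \<le> 1" for y
      using cmod_cinner_le[of k "adj T *\<^sub>V y"] mult_left_mono[OF that norm_ge_zero[of k]]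
      by (simp add: k cinner_adj)
    then show "\<exists>C. \<forall>y\<in>{y. norm (adj T *\<^sub>V y) \<le> 1}. cmod (cinner x y) \<le> C" by blast
  qed
  then obtain B where "0 \<le> B" and B: "\<And>y. norm (adj T *\<^sub>V y) \<le> 1 \<Longrightarrow> norm y \<le> B" by blast
  have below: "norm y \<le> (B + 1) * norm (adj T *\<^sub>V y)" for y
  proof (cases "adj T *\<^sub>V y = 0")
    \<comment> \<open>Every multiple of y then lies in the bounded set, which puts the norm of y
      below every positive e.\<close>
    case True
    have "norm y \<le> e" if "0 < e" for e
    proof -
      have "norm (adj T *\<^sub>V ((B / e) *\<^sub>R y)) \<le> 1" using True by (simp add: cblinfun_linear)
      then have "norm ((B / e) *\<^sub>R y) \<le> B" by (rule B)
      moreover have "norm ((2 * (B + 1) / e) *\<^sub>R y) \<le> B" using True by (intro B) (simp add: cblinfun_linear)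
      ultimately show ?thesis using that \<open>0 \<le> B\<close>
        by (simp add: field_simps) (smt (verit) mult_left_mono mult_right_mono norm_ge_zero mult_nonneg_nonneg)
    qed
    then have "norm y \<le> 0" by (meson field_le_epsilon le_less_linear dense order.strict_trans2 not_less)
    then show ?thesis using True by simp
  next
    case False
    have "norm ((1 / norm (adj T *\<^sub>V y)) *\<^sub>R y) \<le> B" using False by (intro B) (simp add: cblinfun_linear)
    then have "norm y \<le> B * norm (adj T *\<^sub>V y)" using False by (simp add: field_simps)
    then show ?thesis by (smt (verit) mult_right_mono norm_ge_zero)
  qed
  have "invertible_op (T o\<^sub>C\<^sub>L adj T)"
  proof (rule coercive_invertible[where c = "1 / (B + 1)\<^sup>2"])
    show "1 / (B + 1)\<^sup>2 * (norm y)\<^sup>2 \<le> Re (cinner ((T o\<^sub>C\<^sub>L adj T) *\<^sub>V y) y)" for y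
      using power_mono[OF below[of y] norm_ge_zero, of 2] \<open>0 \<le> B\<close> unfolding power_mult_distrib
      by (simp add: cinner_adj cinner_self divide_le_eq mult.commute)
  qed (use \<open>0 \<le> B\<close> in simp)
  then have r: "T *\<^sub>V (adj T *\<^sub>V (inv_op (T o\<^sub>C\<^sub>L adj T) *\<^sub>V y)) = y" for y
    using inv_op_apply(2)[of "T o\<^sub>C\<^sub>L adj T" y] by simp
  show ?thesis
    by (rule invertible_opI[of "adj T o\<^sub>C\<^sub>L inv_op (T o\<^sub>C\<^sub>L adj T)"])
      (use r in \<open>auto intro: injD[OF assms(1)]\<close>)
qed



section \<open>Nevanlinna pairs and the characteristic matrix\<close>

lemma cinner_Im_op: "cinner (Im_op A *\<^sub>V y) y = of_real (Im (cinner (A *\<^sub>V y) y))"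
proof -
  have "cinner (adj A *\<^sub>V y) y = cnj (cinner (A *\<^sub>V y) y)"
    by (subst cinner_adj_left) (rule cinner_commute)
  then have "cinner (Im_op A *\<^sub>V y) y = (cinner (A *\<^sub>V y) y - cnj (cinner (A *\<^sub>V y) y)) / (2 * \<i>)"
    by (simp add: Im_op_def cblinfun_linear cinner_linear)
  then show ?thesis by (simp add: complex_diff_cnj complex_eq_iff)
qed

lemma invertible_op_inj: "invertible_op T \<Longrightarrow> T *\<^sub>V x = 0 \<Longrightarrow> x = 0"
  by (metis inv_op_apply(1) cblinfun_zero_right)

text \<open>A pair frozen at one nonreal point, with s the sign of its imaginary part, so that both
  half-planes are treated at once. Dissipativity is expressed through the adjoints, as the quadratic
  form of the operator inequality gives it.\<close>

locale nevanlinna_point =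
  fixes C0 C1 :: "'H::complex_hilbert \<Rightarrow>\<^sub>C\<^sub>L 'k::complex_hilbert" and s :: real
  assumes s_sq: "s * s = 1"
    and dissipative: "\<And>y. 0 \<le> s * Im (cinner (adj C0 *\<^sub>V y) (adj C1 *\<^sub>V y))"
    and invertible: "invertible_op (C0 - (\<i> * of_real s) *\<^sub>C C1)"
begin

lemma is_mult: "(\<i> * complex_of_real s) * (\<i> * of_real s) = -1" "complex_of_real s * of_real s = 1"
proof -
  show *: "complex_of_real s * of_real s = 1" using s_sq by (metis of_real_1 of_real_mult)
  then show "(\<i> * complex_of_real s) * (\<i> * of_real s) = -1"
    by (simp add: algebra_simps)
qed

text \<open>The Cayley transform \<open>(C\<^sub>0 - i s C\<^sub>1)\<^sup>-\<^sup>1 (C\<^sub>0 + i s C\<^sub>1)\<close> of the pair is a contraction.\<close>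

lemma cayley:
  "\<exists>V. (\<forall>x. (C0 - (\<i> * of_real s) *\<^sub>C C1) *\<^sub>V (V *\<^sub>V x) = C0 *\<^sub>V x + (\<i> * of_real s) *\<^sub>C (C1 *\<^sub>V x)) \<and>
    (\<forall>x. norm (V *\<^sub>V x) \<le> norm x)"
proof -
  let ?R = "C0 - (\<i> * of_real s) *\<^sub>C C1" and ?Q = "C0 + (\<i> * of_real s) *\<^sub>C C1"
  define V where "V = inv_op ?R o\<^sub>C\<^sub>L ?Q"
  have V: "?R *\<^sub>V (V *\<^sub>V x) = ?Q *\<^sub>V x" for x
    by (simp only: V_def cblinfun_compose_apply inv_op_apply(2)[OF invertible])
  \<comment> \<open>The two squared norms differ only in the sign of the cross term, whose real part
    is nonnegative by dissipativity.\<close>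
  have QR: "norm (adj ?Q *\<^sub>V y) \<le> norm (adj ?R *\<^sub>V y)" for y
  proof -
    let ?u = "adj C0 *\<^sub>V y" and ?v = "(\<i> * of_real s) *\<^sub>C (adj C1 *\<^sub>V y)"
    have "Re (cinner ?u ?v) = s * Im (cinner ?u (adj C1 *\<^sub>V y))" by (simp add: cinner_linear)
    then have "0 \<le> Re (cinner ?u ?v)" using dissipative by simp
    then have "(norm (?u + - ?v))\<^sup>2 \<le> (norm (?u + ?v))\<^sup>2"
      unfolding norm_add_sq by (simp add: cinner_linear)
    moreover have "adj ?Q *\<^sub>V y = ?u + - ?v" "adj ?R *\<^sub>V y = ?u + ?v"
      by (simp_all add: adj_add adj_diff adj_scaleC cblinfun_linear scaleC_minus_left)
    ultimately show ?thesis by (metis power2_le_imp_le norm_ge_zero)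
  qed
  \<comment> \<open>Dissipativity speaks of the adjoints of the pair, so the contraction property is
    first proved for the adjoint of V.\<close>
  have "norm (adj V) \<le> 1"
  proof (rule norm_cblinfun_bound)
    fix y
    have "adj ?R *\<^sub>V (adj (inv_op ?R) *\<^sub>V y) = y"
      by (rule cinner_ext) (simp only: cinner_adj_left inv_op_apply(1)[OF invertible])
    then show "norm (adj V *\<^sub>V y) \<le> 1 * norm y"
      using QR[of "adj (inv_op ?R) *\<^sub>V y"] by (simp add: V_def adj_compose)
  qed simp
  then have "norm (V *\<^sub>V x) \<le> norm x" for x
    using norm_cblinfun_apply[of V x] mult_right_mono[of "norm V" 1 "norm x"] by simp
  then show ?thesis
    by (intro exI[of _ V] conjI allI) (simp_all only: V cblinfun_add_left cblinfun_scaleC_left)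
qed

text \<open>Passes from the pair, where the sign condition concerns adjoints, to the relation it
  defines. Elements of the relation satisfy \<open>h0 + \<i> s h1 = - V (h0 - \<i> s h1)\<close>
  with the Cayley transform V. As V is a contraction, comparing the norms of both sides gives the
  sign.\<close>

lemma relation_dissipative:
  assumes h: "C0 *\<^sub>V h0 + C1 *\<^sub>V h1 = 0"
  shows "0 \<le> s * Im (cinner h1 h0)"
proof -
  obtain V where V: "\<And>x. (C0 - (\<i> * of_real s) *\<^sub>C C1) *\<^sub>V (V *\<^sub>V x) = C0 *\<^sub>V x + (\<i> * of_real s) *\<^sub>C (C1 *\<^sub>V x)"
    "\<And>x. norm (V *\<^sub>V x) \<le> norm x" using cayley by blast
  let ?g = "(\<i> * of_real s) *\<^sub>C h1"
  have "(C0 - (\<i> * of_real s) *\<^sub>C C1) *\<^sub>V (h0 + ?g + V *\<^sub>V (h0 - ?g)) = 2 *\<^sub>R (C0 *\<^sub>V h0 + C1 *\<^sub>V h1)"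
    unfolding cblinfun_add_right[of _ "h0 + ?g"] V(1)
    by (simp add: cblinfun_linear scaleC_add_right scaleC_diff_right scaleC_scaleC is_mult scaleC_minus_left scaleR_2 mult.assoc algebra_simps)
  then have "h0 + ?g + V *\<^sub>V (h0 - ?g) = 0"
    using invertible_op_inj[OF invertible] h by simp
  then have "norm (h0 + ?g) = norm (V *\<^sub>V (h0 - ?g))"
    by (metis add_eq_0_iff norm_minus_cancel)
  then have "norm (h0 + ?g) \<le> norm (h0 + - ?g)" using V(2) by simp
  then have "(norm (h0 + ?g))\<^sup>2 \<le> (norm (h0 + - ?g))\<^sup>2" by (rule power_mono) simp
  then have "Re (cinner h0 ?g) \<le> 0" unfolding norm_add_sq by (simp add: cinner_linear)
  then have "s * Im (cinner h0 h1) \<le> 0" by (simp add: cinner_linear)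
  then show ?thesis using cinner_commute[of h1 h0] by simp
qed

text \<open>With R the denominator of the Cayley transform V, \<open>S = 1 - \<i> s M\<close> and
  \<open>Q = 1 + \<i> s M\<close>, one has
  \<open>2 (C0 - C1 M) = R (1 + V Q S\<^sup>-\<^sup>1) S\<close>. Uniform definiteness of Im M makes
  \<open>Q S\<^sup>-\<^sup>1\<close> a strict contraction, so all three factors are
  invertible.\<close>

lemma invertible_minus_Weyl:
  assumes "0 < c" and M: "\<And>x. c * (norm x)\<^sup>2 \<le> s * Im (cinner (M *\<^sub>V x) x)"
  shows "invertible_op (C0 - C1 o\<^sub>C\<^sub>L M)"
proof -
  obtain V where V: "\<And>x. (C0 - (\<i> * of_real s) *\<^sub>C C1) *\<^sub>V (V *\<^sub>V x) = C0 *\<^sub>V x + (\<i> * of_real s) *\<^sub>C (C1 *\<^sub>V x)"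
    "\<And>x. norm (V *\<^sub>V x) \<le> norm x" using cayley by blast
  let ?R = "C0 - (\<i> * of_real s) *\<^sub>C C1"
  define S where "S = cblinfun_id - (\<i> * of_real s) *\<^sub>C M"
  define Q where "Q = cblinfun_id + (\<i> * of_real s) *\<^sub>C M"
  have S: "invertible_op S"
  proof (rule coercive_invertible)
    show "1 * (norm x)\<^sup>2 \<le> Re (cinner (S *\<^sub>V x) x)" for x
      using M[of x] \<open>0 < c\<close> order_trans[of 0 "c * (norm x)\<^sup>2" "s * Im (cinner (M *\<^sub>V x) x)"]
      by (simp add: S_def cblinfun_linear cinner_linear cinner_self)
  qed simp
  have diff: "(norm (Q *\<^sub>V x))\<^sup>2 \<le> (norm (S *\<^sub>V x))\<^sup>2 - 4 * c * (norm x)\<^sup>2" for x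
  proof -
    let ?m = "(\<i> * of_real s) *\<^sub>C (M *\<^sub>V x)"
    have "(norm (S *\<^sub>V x))\<^sup>2 - (norm (Q *\<^sub>V x))\<^sup>2 = (norm (x + - ?m))\<^sup>2 - (norm (x + ?m))\<^sup>2"
      by (simp add: S_def Q_def cblinfun_linear)
    also have "\<dots> = - 4 * Re (cinner x ?m)"
      unfolding norm_add_sq by (simp add: cinner_linear)
    also have "\<dots> = 4 * (s * Im (cinner (M *\<^sub>V x) x))"
      using cinner_commute[of x "M *\<^sub>V x"] by (simp add: cinner_linear)
    finally show ?thesis using M[of x] by simp
  qed
  define m where "m = norm S + 1"
  have "0 < m" by (simp add: m_def add_nonneg_pos)
  \<comment> \<open>Combines the bound \<open>diff\<close> with
    \<open>norm (S *\<^sub>V x) \<le> m * norm x\<close>. The maximum with 0 keeps the radicand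
    nonnegative.\<close>
  define \<theta> where "\<theta> = sqrt (max 0 (1 - 4 * c / m\<^sup>2))"
  have \<theta>: "0 \<le> \<theta>" "\<theta> < 1" using \<open>0 < c\<close> \<open>0 < m\<close> by (auto simp: \<theta>_def)
  have QS: "norm (Q *\<^sub>V x) \<le> \<theta> * norm (S *\<^sub>V x)" for x
  proof -
    have "norm (S *\<^sub>V x) \<le> m * norm x"
      using norm_cblinfun_apply[of S x] by (simp add: m_def distrib_right add_increasing2)
    then have "(norm (S *\<^sub>V x))\<^sup>2 \<le> m\<^sup>2 * (norm x)\<^sup>2"
      using power_mono[of "norm (S *\<^sub>V x)" "m * norm x" 2] by (simp add: power_mult_distrib)
    then have "4 * c / m\<^sup>2 * (norm (S *\<^sub>V x))\<^sup>2 \<le> 4 * c / m\<^sup>2 * (m\<^sup>2 * (norm x)\<^sup>2)"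
      using \<open>0 < c\<close> by (intro mult_left_mono) auto
    also have "\<dots> = 4 * c * (norm x)\<^sup>2" using \<open>0 < m\<close> by simp
    finally have "(norm (Q *\<^sub>V x))\<^sup>2 \<le> (1 - 4 * c / m\<^sup>2) * (norm (S *\<^sub>V x))\<^sup>2"
      using diff[of x] by (simp add: left_diff_distrib)
    also have "\<dots> \<le> max 0 (1 - 4 * c / m\<^sup>2) * (norm (S *\<^sub>V x))\<^sup>2"
      by (intro mult_right_mono) auto
    finally show ?thesis
      using real_le_rsqrt real_sqrt_mult by (metis \<theta>_def norm_ge_zero real_sqrt_abs abs_of_nonneg)
  qed
  define N where "N = cblinfun_id + (V o\<^sub>C\<^sub>L Q o\<^sub>C\<^sub>L inv_op S)"
  have N: "invertible_op N"
  proof (rule coercive_invertible[where c = "1 - \<theta>"])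
    show "(1 - \<theta>) * (norm x)\<^sup>2 \<le> Re (cinner (N *\<^sub>V x) x)" for x
    proof -
      let ?w = "V *\<^sub>V (Q *\<^sub>V (inv_op S *\<^sub>V x))"
      have "norm ?w \<le> \<theta> * norm x"
        using order_trans[OF V(2) QS[of "inv_op S *\<^sub>V x"]] by (simp add: inv_op_apply(2)[OF S])
      then have "cmod (cinner ?w x) \<le> \<theta> * norm x * norm x"
        using order_trans[OF cmod_cinner_le mult_right_mono] norm_ge_zero by metis
      then have "- Re (cinner ?w x) \<le> \<theta> * norm x * norm x"
        using abs_Re_le_cmod[of "cinner ?w x"] by linarith
      then show ?thesis
        by (simp add: N_def cblinfun_linear cinner_linear cinner_self power2_eq_square algebra_simps)
    qed
  qed (use \<theta> in simp)
  have T: "2 *\<^sub>R ((C0 - C1 o\<^sub>C\<^sub>L M) *\<^sub>V x) = ?R *\<^sub>V (N *\<^sub>V (S *\<^sub>V x))" for x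
  proof -
    have "N *\<^sub>V (S *\<^sub>V x) = S *\<^sub>V x + V *\<^sub>V (Q *\<^sub>V x)"
      by (simp add: N_def cblinfun_add_left inv_op_apply(1)[OF S])
    then have "?R *\<^sub>V (N *\<^sub>V (S *\<^sub>V x)) = ?R *\<^sub>V (S *\<^sub>V x) + (C0 *\<^sub>V (Q *\<^sub>V x) + (\<i> * of_real s) *\<^sub>C (C1 *\<^sub>V (Q *\<^sub>V x)))"
      by (simp only: cblinfun_add_right V(1))
    show ?thesis
      unfolding \<open>?R *\<^sub>V (N *\<^sub>V (S *\<^sub>V x)) = _\<close>
      by (simp add: S_def Q_def cblinfun_linear scaleC_add_right scaleC_diff_right scaleC_scaleC is_mult scaleC_minus_left scaleR_2 algebra_simps)
  qed
  show ?thesis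
  proof (rule bijective_invertible)
    show "inj ((*\<^sub>V) (C0 - C1 o\<^sub>C\<^sub>L M))"
    proof (rule injI)
      fix x y assume "(C0 - C1 o\<^sub>C\<^sub>L M) *\<^sub>V x = (C0 - C1 o\<^sub>C\<^sub>L M) *\<^sub>V y"
      then have "?R *\<^sub>V (N *\<^sub>V (S *\<^sub>V x)) = ?R *\<^sub>V (N *\<^sub>V (S *\<^sub>V y))" by (simp only: T[symmetric])
      then show "x = y" by (metis inv_op_apply(1) invertible N S)
    qed
    show "surj ((*\<^sub>V) (C0 - C1 o\<^sub>C\<^sub>L M))"
    proof (rule surjI)
      fix y
      let ?x = "inv_op S *\<^sub>V (inv_op N *\<^sub>V (inv_op ?R *\<^sub>V (2 *\<^sub>R y)))"
      have "2 *\<^sub>R ((C0 - C1 o\<^sub>C\<^sub>L M) *\<^sub>V ?x) = 2 *\<^sub>R y"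
        by (simp only: T inv_op_apply(2)[OF S] inv_op_apply(2)[OF N] inv_op_apply(2)[OF invertible])
      then show "(C0 - C1 o\<^sub>C\<^sub>L M) *\<^sub>V ?x = y" by simp
    qed
  qed
qed

end

lemma nevanlinna_pointI:
  assumes "nevanlinna_pair C0 C1" "z \<in> nonreal"
  shows "nevanlinna_point (C0 z) (C1 z) (sgn (Im z))"
proof
  have z: "Im z \<noteq> 0" using assms(2) by (auto simp: nonreal_def)
  then show "sgn (Im z) * sgn (Im z) = 1" by (simp add: sgn_mult_self_eq)
  have "0 \<le>\<^sub>o\<^sub>p Im z *\<^sub>R Im_op (C1 z o\<^sub>C\<^sub>L adj (C0 z))"
    and inv: "invertible_op (C0 z - (\<i> * complex_of_real (sgn (Im z))) *\<^sub>C C1 z)"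
    using assms unfolding nevanlinna_pair_def by blast+
  moreover have Im_form: "cinner (Im_op (C1 z o\<^sub>C\<^sub>L adj (C0 z)) *\<^sub>V y) y = of_real (Im (cinner (adj (C0 z) *\<^sub>V y) (adj (C1 z) *\<^sub>V y)))" for y
    by (simp only: cinner_Im_op cblinfun_compose_apply cinner_adj[of "C1 z"])
  ultimately have "0 \<le> Im z * Im (cinner (adj (C0 z) *\<^sub>V y) (adj (C1 z) *\<^sub>V y))" for y
    unfolding op_le_def by (simp add: cblinfun_linear cinner_linear Im_form)
  then show "0 \<le> sgn (Im z) * Im (cinner (adj (C0 z) *\<^sub>V y) (adj (C1 z) *\<^sub>V y))" for y
    using z by (metis mult_less_0_iff not_le sgn_greater sgn_less zero_le_mult_iff)
  show "invertible_op (C0 z - (\<i> * complex_of_real (sgn (Im z))) *\<^sub>C C1 z)" by (rule inv)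
qed

text \<open>Transfers invertibility from the description of the relation as a kernel to its
  description as a range. A kernel vector k has \<open>K1 k = - M K0 k\<close>, which puts K0 k into
  the kernel of \<open>C0 - C1 M\<close>. For surjectivity the pair \<open>(h0, y - M h0)\<close>
  belongs to the relation when h0 solves \<open>(C0 - C1 M) h0 = - C1 y\<close>, and its parameter
  is mapped to y.\<close>

lemma invertible_plus_Weyl:
  fixes K0 K1 :: "'k::complex_hilbert \<Rightarrow>\<^sub>C\<^sub>L 'H::complex_hilbert" and C0 C1 :: "'H \<Rightarrow>\<^sub>C\<^sub>L 'l::complex_hilbert"
  assumes T: "invertible_op (C0 - C1 o\<^sub>C\<^sub>L M)"
    and rel: "pair_rel C0 C1 = range (\<lambda>k. (K0 *\<^sub>V k, K1 *\<^sub>V k))"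
    and ker: "\<And>k. K0 *\<^sub>V k = 0 \<Longrightarrow> K1 *\<^sub>V k = 0 \<Longrightarrow> k = 0"
  shows "invertible_op (K1 + M o\<^sub>C\<^sub>L K0)"
proof (rule bijective_invertible)
  have in_rel: "C0 *\<^sub>V (K0 *\<^sub>V k) + C1 *\<^sub>V (K1 *\<^sub>V k) = 0" for k
    using rel unfolding pair_rel_def by blast
  have zero: "k = 0" if "(K1 + M o\<^sub>C\<^sub>L K0) *\<^sub>V k = 0" for k
  proof (rule ker)
    have K1: "K1 *\<^sub>V k = - (M *\<^sub>V (K0 *\<^sub>V k))" using that by (simp add: cblinfun_linear eq_neg_iff_add_eq_0)
    then have "(C0 - C1 o\<^sub>C\<^sub>L M) *\<^sub>V (K0 *\<^sub>V k) = 0" using in_rel[of k] by (simp add: cblinfun_linear)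
    then show "K0 *\<^sub>V k = 0" by (rule invertible_op_inj[OF T])
    then show "K1 *\<^sub>V k = 0" using K1 by simp
  qed
  show "inj ((*\<^sub>V) (K1 + M o\<^sub>C\<^sub>L K0))"
  proof (rule injI)
    fix x y assume "(K1 + M o\<^sub>C\<^sub>L K0) *\<^sub>V x = (K1 + M o\<^sub>C\<^sub>L K0) *\<^sub>V y"
    then have "(K1 + M o\<^sub>C\<^sub>L K0) *\<^sub>V (x - y) = 0" by (metis cblinfun_diff_right right_minus_eq)
    then have "x - y = 0" by (rule zero)
    then show "x = y" by simp
  qed
  have "\<exists>k. (K1 + M o\<^sub>C\<^sub>L K0) *\<^sub>V k = y" for y
  proof -
    define h0 where "h0 = - (inv_op (C0 - C1 o\<^sub>C\<^sub>L M) *\<^sub>V (C1 *\<^sub>V y))"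
    have "(C0 - C1 o\<^sub>C\<^sub>L M) *\<^sub>V h0 = - (C1 *\<^sub>V y)"
      by (simp only: h0_def cblinfun_minus_right inv_op_apply(2)[OF T])
    then have "C0 *\<^sub>V h0 + C1 *\<^sub>V (y - M *\<^sub>V h0) = 0" by (simp add: cblinfun_linear algebra_simps)
    then have "(h0, y - M *\<^sub>V h0) \<in> range (\<lambda>k. (K0 *\<^sub>V k, K1 *\<^sub>V k))" by (simp add: pair_rel_def flip: rel)
    then obtain k where "h0 = K0 *\<^sub>V k" "y - M *\<^sub>V h0 = K1 *\<^sub>V k" by auto
    then show ?thesis by (intro exI[of _ k]) (simp add: cblinfun_linear flip: \<open>y - M *\<^sub>V h0 = K1 *\<^sub>V k\<close>)
  qed
  then show "surj ((*\<^sub>V) (K1 + M o\<^sub>C\<^sub>L K0))" by (metis surjI)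
qed

section \<open>The characteristic matrix in terms of the parametrised relation\<close>

lemma rel_plus_inv_eq:
  assumes E: "invertible_op (K1 + M o\<^sub>C\<^sub>L K0)"
    and rel: "\<tau> = range (\<lambda>k. (K0 *\<^sub>V k, K1 *\<^sub>V k))"
  shows "rel_plus_inv \<tau> M = K0 o\<^sub>C\<^sub>L inv_op (K1 + M o\<^sub>C\<^sub>L K0)"
  unfolding rel_plus_inv_def
proof (rule the_equality)
  let ?G = "K0 o\<^sub>C\<^sub>L inv_op (K1 + M o\<^sub>C\<^sub>L K0)"
  have 1: "(K1 *\<^sub>V k + M *\<^sub>V (K0 *\<^sub>V k), K0 *\<^sub>V k) = (\<lambda>h. (h, ?G *\<^sub>V h)) ((K1 + M o\<^sub>C\<^sub>L K0) *\<^sub>V k)" for k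
    by (simp add: inv_op_apply(1)[OF E]) (simp add: cblinfun_linear)
  have 2: "(h, ?G *\<^sub>V h) = (K1 *\<^sub>V k + M *\<^sub>V (K0 *\<^sub>V k), K0 *\<^sub>V k)" if "k = inv_op (K1 + M o\<^sub>C\<^sub>L K0) *\<^sub>V h" for h k
    using inv_op_apply(2)[OF E, of h] by (simp add: that cblinfun_linear)
  show *: "{(h0, h1 + M *\<^sub>V h0) | h0 h1. (h0, h1) \<in> \<tau>}\<inverse> = range (\<lambda>h. (h, ?G *\<^sub>V h))"
  proof (intro set_eqI iffI)
    fix x assume "x \<in> {(h0, h1 + M *\<^sub>V h0) | h0 h1. (h0, h1) \<in> \<tau>}\<inverse>"
    then obtain k where k: "x = (K1 *\<^sub>V k + M *\<^sub>V (K0 *\<^sub>V k), K0 *\<^sub>V k)" unfolding rel by auto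
    show "x \<in> range (\<lambda>h. (h, ?G *\<^sub>V h))" unfolding k by (subst 1) (rule rangeI)
  next
    fix x assume "x \<in> range (\<lambda>h. (h, ?G *\<^sub>V h))"
    then obtain k where "x = (K1 *\<^sub>V k + M *\<^sub>V (K0 *\<^sub>V k), K0 *\<^sub>V k)" using 2 by blast
    then show "x \<in> {(h0, h1 + M *\<^sub>V h0) | h0 h1. (h0, h1) \<in> \<tau>}\<inverse>" unfolding rel by auto
  qed
  fix T assume "{(h0, h1 + M *\<^sub>V h0) | h0 h1. (h0, h1) \<in> \<tau>}\<inverse> = range (\<lambda>h. (h, T *\<^sub>V h))"
  with * have eq: "range (\<lambda>h. (h, T *\<^sub>V h)) = range (\<lambda>h. (h, ?G *\<^sub>V h))" by simp
  show "T = ?G"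
  proof (rule cblinfun_eqI)
    fix x
    have "(x, T *\<^sub>V x) \<in> range (\<lambda>h. (h, ?G *\<^sub>V h))" unfolding eq[symmetric] by blast
    then show "T *\<^sub>V x = ?G *\<^sub>V x" by auto
  qed
qed

text \<open>One vector k carries all the information: both components of the characteristic matrix
  at \<open>(a1, a2)\<close> are read off from K0 k and K1 k. The second equation shows that
  \<open>- K0 k - (a1, 0)\<close> and \<open>K1 k - (a2, 0)\<close> can serve as the two boundary
  values of one solution.\<close>

lemma char_matrix_apply:
  fixes M :: "('x::complex_hilbert \<times> 'y::complex_hilbert) \<Rightarrow>\<^sub>C\<^sub>L ('x \<times> 'y)"
  assumes E: "invertible_op (K1 + M o\<^sub>C\<^sub>L K0)"
    and rel: "\<tau> = range (\<lambda>k. (K0 *\<^sub>V k, K1 *\<^sub>V k))"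
    and k: "k = inv_op (K1 + M o\<^sub>C\<^sub>L K0) *\<^sub>V ((a2, 0) - M *\<^sub>V (a1, 0))"
  shows "char_matrix \<tau> M *\<^sub>V (a1, a2) = ((1/2) *\<^sub>R a2 - fst (K1 *\<^sub>V k), - ((1/2) *\<^sub>R a1) - fst (K0 *\<^sub>V k))"
    and "M *\<^sub>V (- (K0 *\<^sub>V k) - (a1, 0)) = K1 *\<^sub>V k - (a2, 0)"
proof -
  let ?R = "K0 o\<^sub>C\<^sub>L inv_op (K1 + M o\<^sub>C\<^sub>L K0)"
  have "(K1 + M o\<^sub>C\<^sub>L K0) *\<^sub>V k = (a2, 0) - M *\<^sub>V (a1, 0)" unfolding k by (rule inv_op_apply(2)[OF E])
  then have Ek: "M *\<^sub>V (K0 *\<^sub>V k) = (a2, 0) - M *\<^sub>V (a1, 0) - K1 *\<^sub>V k"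
    by (simp add: cblinfun_linear algebra_simps)
  then show "M *\<^sub>V (- (K0 *\<^sub>V k) - (a1, 0)) = K1 *\<^sub>V k - (a2, 0)"
    by (simp add: cblinfun_diff_right cblinfun_minus_right)
  have Rk: "?R *\<^sub>V (a2, 0) = K0 *\<^sub>V k + ?R *\<^sub>V (M *\<^sub>V (a1, 0))"
    by (simp add: k cblinfun_diff_right)
  have fstM: "fst (M *\<^sub>V (K0 *\<^sub>V k)) = a2 - fst (M *\<^sub>V (a1, 0)) - fst (K1 *\<^sub>V k)" by (simp add: Ek)
  show "char_matrix \<tau> M *\<^sub>V (a1, a2) = ((1/2) *\<^sub>R a2 - fst (K1 *\<^sub>V k), - ((1/2) *\<^sub>R a1) - fst (K0 *\<^sub>V k))"
    unfolding char_matrix_def Omega_tilde_def Let_def rel_plus_inv_eq[OF E rel]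
    using Rk fstM scaleR_half_double[of a2]
    by (simp add: cblinfun_linear algebra_simps flip: scaleR_add_left)
qed

text \<open>Inserting g and M g in the form \<open>(M g, g') - (g, M' g')\<close> and adding the K
  terms cancels everything quadratic in k and k'. What remains are the mixed terms and
  \<open>(a2, b1) - (a1, b2)\<close>, and the latter is what the two halves of the identity in the
  characteristic matrix add up to.\<close>

lemma char_matrix_identity:
  fixes M M' :: "('x::complex_hilbert \<times> 'y::complex_hilbert) \<Rightarrow>\<^sub>C\<^sub>L ('x \<times> 'y)"
  assumes E: "invertible_op (K1 + M o\<^sub>C\<^sub>L K0)" "invertible_op (K1' + M' o\<^sub>C\<^sub>L K0')"
    and rel: "\<tau> = range (\<lambda>k. (K0 *\<^sub>V k, K1 *\<^sub>V k))" "\<tau>' = range (\<lambda>k. (K0' *\<^sub>V k, K1' *\<^sub>V k))"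
    and k: "k = inv_op (K1 + M o\<^sub>C\<^sub>L K0) *\<^sub>V ((snd a, 0) - M *\<^sub>V (fst a, 0))"
      "k' = inv_op (K1' + M' o\<^sub>C\<^sub>L K0') *\<^sub>V ((snd b, 0) - M' *\<^sub>V (fst b, 0))"
    and g: "g = - (K0 *\<^sub>V k) - (fst a, 0)" "g' = - (K0' *\<^sub>V k') - (fst b, 0)"
  shows "cinner (char_matrix \<tau> M *\<^sub>V a) b - cinner a (char_matrix \<tau>' M' *\<^sub>V b) =
    cinner (M *\<^sub>V g) g' - cinner g (M' *\<^sub>V g')
    + cinner (K1 *\<^sub>V k) (K0' *\<^sub>V k') - cinner (K0 *\<^sub>V k) (K1' *\<^sub>V k')"
proof -
  obtain a1 a2 b1 b2 where ab: "a = (a1, a2)" "b = (b1, b2)" by fastforce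
  note 1 = char_matrix_apply[OF E(1) rel(1) k(1)[unfolded ab fst_conv snd_conv]]
  note 2 = char_matrix_apply[OF E(2) rel(2) k(2)[unfolded ab fst_conv snd_conv]]
  note M = 1(2)[folded g(1)[unfolded ab fst_conv]] 2(2)[folded g(2)[unfolded ab fst_conv]]
  show ?thesis
    unfolding M 1(1)[folded ab] 2(1)[folded ab] unfolding g ab
    by (simp add: 1(1) 2(1) cinner_linear cinner_prod_def)
qed

text \<open>Identifies the boundary data \<open>(C0 - C1 M)\<^sup>-\<^sup>1 (C1 y - C0 x)\<close>
  coming from the boundary conditions with the vector in terms of k that occurs in the
  characteristic matrix.\<close>

lemma relation_solve:
  assumes T: "invertible_op (C0 - C1 o\<^sub>C\<^sub>L M)" and rel: "C0 *\<^sub>V (K0 *\<^sub>V k) + C1 *\<^sub>V (K1 *\<^sub>V k) = 0"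
    and M: "M *\<^sub>V (- (K0 *\<^sub>V k) - x) = K1 *\<^sub>V k - y"
  shows "inv_op (C0 - C1 o\<^sub>C\<^sub>L M) *\<^sub>V (C1 *\<^sub>V y - C0 *\<^sub>V x) = - (K0 *\<^sub>V k) - x"
proof -
  let ?g = "- (K0 *\<^sub>V k) - x"
  have "(C0 - C1 o\<^sub>C\<^sub>L M) *\<^sub>V ?g = C0 *\<^sub>V ?g - C1 *\<^sub>V (M *\<^sub>V ?g)" by (simp add: cblinfun_diff_left)
  also have "\<dots> = C1 *\<^sub>V y - C0 *\<^sub>V x - (C0 *\<^sub>V (K0 *\<^sub>V k) + C1 *\<^sub>V (K1 *\<^sub>V k))"
    unfolding M by (simp add: cblinfun_diff_right cblinfun_minus_right)
  finally have "(C0 - C1 o\<^sub>C\<^sub>L M) *\<^sub>V ?g = C1 *\<^sub>V y - C0 *\<^sub>V x" using rel by simp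
  then show ?thesis using inv_op_apply(1)[OF T, of ?g] by simp
qed



section \<open>Differentiation on the interval\<close>

lemma Dx_0 [simp]: "Dx \<Delta> 0 f = f"
  by (simp add: Dx_def)

lemma Dx_Suc: "Dx \<Delta> (Suc k) f t = vector_derivative (Dx \<Delta> k f) (at t within \<Delta>)"
  by (simp add: Dx_def)

lemma Dx_Dx: "Dx \<Delta> j (Dx \<Delta> k f) = Dx \<Delta> (j + k) f"
  by (simp add: Dx_def funpow_add)

lemma Dx_cong:
  assumes "\<And>t. t \<in> \<Delta> \<Longrightarrow> f t = g t" "t \<in> \<Delta>"
  shows "Dx \<Delta> k f t = Dx \<Delta> k g t"
  using assms(2)
proof (induction k arbitrary: t)
  case (Suc k)
  have "(Dx \<Delta> k f has_vector_derivative d) (at t within \<Delta>) \<longleftrightarrow> (Dx \<Delta> k g has_vector_derivative d) (at t within \<Delta>)" for d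
    using Suc by (intro iffI; elim has_vector_derivative_transform[rotated 2]) auto
  then show ?case by (simp add: Dx_Suc vector_derivative_def)
qed (use assms in simp)

lemma Ck_on_0: "Ck_on \<Delta> 0 f \<longleftrightarrow> continuous_on \<Delta> f"
  by (simp add: Ck_on_def)

text \<open>The recursion on which all inductions over the order rest; the definition lists all
  derivatives at once.\<close>

lemma Ck_on_Suc:
  "Ck_on \<Delta> (Suc m) f \<longleftrightarrow> (\<forall>t\<in>\<Delta>. f differentiable (at t within \<Delta>)) \<and> Ck_on \<Delta> m (Dx \<Delta> 1 f)"
proof (intro iffI conjI ballI)
  assume A: "Ck_on \<Delta> (Suc m) f"
  show "f differentiable (at t within \<Delta>)" if "t \<in> \<Delta>" for t
  proof -
    have "Dx \<Delta> 0 f differentiable (at t within \<Delta>)" using A that unfolding Ck_on_def by blast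
    then show ?thesis by simp
  qed
  show "Ck_on \<Delta> m (Dx \<Delta> 1 f)" using A unfolding Ck_on_def Dx_Dx by auto
next
  assume B: "(\<forall>t\<in>\<Delta>. f differentiable (at t within \<Delta>)) \<and> Ck_on \<Delta> m (Dx \<Delta> 1 f)"
  then have B': "\<forall>j<m. \<forall>t\<in>\<Delta>. Dx \<Delta> (Suc j) f differentiable (at t within \<Delta>)" "\<forall>j\<le>m. continuous_on \<Delta> (Dx \<Delta> (Suc j) f)"
    unfolding Ck_on_def Dx_Dx by simp_all
  have c: "continuous_on \<Delta> f"
    using B by (simp add: continuous_on_eq_continuous_within differentiable_imp_continuous_within)
  show "Ck_on \<Delta> (Suc m) f"
    unfolding Ck_on_def
  proof (intro conjI allI impI ballI)
    show "Dx \<Delta> j f differentiable (at t within \<Delta>)" if "j < Suc m" "t \<in> \<Delta>" for j t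
      using that B B'(1) by (cases j) auto
    show "continuous_on \<Delta> (Dx \<Delta> j f)" if "j \<le> Suc m" for j
      using that c B'(2) by (cases j) auto
  qed
qed

lemma Ck_on_mono: "Ck_on \<Delta> m f \<Longrightarrow> k \<le> m \<Longrightarrow> Ck_on \<Delta> k f"
  by (auto simp: Ck_on_def)

lemma Ck_on_continuous: "Ck_on \<Delta> m f \<Longrightarrow> continuous_on \<Delta> f"
  using Ck_on_mono[of \<Delta> m f 0] by (simp add: Ck_on_0)

lemma Ck_on_cong:
  assumes "\<And>t. t \<in> \<Delta> \<Longrightarrow> f t = g t" "Ck_on \<Delta> m f" shows "Ck_on \<Delta> m g"
proof -
  have eq: "\<And>j t. t \<in> \<Delta> \<Longrightarrow> Dx \<Delta> j f t = Dx \<Delta> j g t" using Dx_cong assms(1) by blast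
  have "continuous_on \<Delta> (Dx \<Delta> j g)" if "j \<le> m" for j
    by (rule continuous_on_eq[of \<Delta> "Dx \<Delta> j f"]) (use assms(2) that eq in \<open>simp_all add: Ck_on_def\<close>)
  moreover have "Dx \<Delta> j g differentiable (at t within \<Delta>)" if "j < m" "t \<in> \<Delta>" for j t
    using assms(2) that differentiable_transform_within[of "Dx \<Delta> j f" t \<Delta> 1 "Dx \<Delta> j g"] eq
    unfolding Ck_on_def by auto
  ultimately show ?thesis unfolding Ck_on_def by blast
qed

lemma Ck_on_Dx: "Ck_on \<Delta> (m + k) f \<Longrightarrow> Ck_on \<Delta> m (Dx \<Delta> k f)"
  unfolding Ck_on_def Dx_Dx by auto

lemma Ck_on_from_Dx: "(\<And>j. j < k \<Longrightarrow> Ck_on \<Delta> 1 (Dx \<Delta> j f)) \<Longrightarrow> Ck_on \<Delta> m (Dx \<Delta> k f) \<Longrightarrow> Ck_on \<Delta> (m + k) f"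
proof (induction k arbitrary: m)
  case (Suc k)
  have "Ck_on \<Delta> (Suc 0) (Dx \<Delta> k f)" using Suc.prems(1)[of k] by simp
  then have "Ck_on \<Delta> (Suc m) (Dx \<Delta> k f)"
    using Suc.prems(2) unfolding Ck_on_Suc Dx_Dx by simp
  then show ?case using Suc.IH[of "Suc m"] Suc.prems(1) by simp
qed simp

section \<open>The interval and derivatives relative to it\<close>

locale half_open_interval =
  fixes \<Delta> :: "real set" and b :: ereal
  assumes is_Delta: "is_Delta \<Delta> b"
begin

lemma Delta_cases: obtains (inf) "\<Delta> = {0..}" "b = \<infinity>" | (op) r where "0 < r" "b = ereal r" "\<Delta> = {0..<r}"
  | (cl) r where "0 < r" "b = ereal r" "\<Delta> = {0..r}"
proof (cases b)
  case (real r)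
  then show ?thesis using is_Delta op cl unfolding is_Delta_def
    by (auto simp: atLeastLessThan_def atLeastAtMost_def atLeast_def lessThan_def atMost_def Int_def)
next
  case PInf
  then show ?thesis using is_Delta inf unfolding is_Delta_def by (auto simp: atLeast_def)
next
  case MInf
  then show ?thesis using is_Delta unfolding is_Delta_def by simp
qed

lemma zero_in: "0 \<in> \<Delta>" by (cases rule: Delta_cases) auto
lemma nonneg: "t \<in> \<Delta> \<Longrightarrow> 0 \<le> t" by (cases rule: Delta_cases) auto
lemma down: "t \<in> \<Delta> \<Longrightarrow> 0 \<le> s \<Longrightarrow> s \<le> t \<Longrightarrow> s \<in> \<Delta>" by (cases rule: Delta_cases) auto
lemma segment: "t \<in> \<Delta> \<Longrightarrow> {0..t} \<subseteq> \<Delta>" using down by auto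
lemma positive_in: obtains e where "0 < e" "e \<in> \<Delta>" "ereal e < b"
proof (cases rule: Delta_cases)
  case inf then show ?thesis using that[of 1] by simp
next
  case (op r) then show ?thesis using that[of "r/2"] by simp
next
  case (cl r) then show ?thesis using that[of "r/2"] by simp
qed
lemma less_b_in: "0 \<le> t \<Longrightarrow> ereal t < b \<Longrightarrow> t \<in> \<Delta>" by (cases rule: Delta_cases) auto

text \<open>Relative derivatives are unique because the interval is connected and not a single
  point, so each of its points is a limit point.\<close>

lemma at_ne_bot: assumes "t \<in> \<Delta>" shows "at t within \<Delta> \<noteq> bot"
proof -
  obtain e where "0 < e" "e \<in> \<Delta>" by (rule positive_in)
  have "connected \<Delta>" by (cases rule: Delta_cases) auto
  then have "t islimpt \<Delta>"
    using connected_imp_perfect[of \<Delta> t] assms zero_in \<open>0 < e\<close> \<open>e \<in> \<Delta>\<close> by (metis less_irrefl singletonD)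
  then show ?thesis by (simp add: trivial_limit_within)
qed

text \<open>Replaces the possibly noncompact interval by a compact segment with the same filter at
  t. If no larger point exists, t is the right end point and the interval itself is the
  segment.\<close>

lemma within_segment: assumes "t \<in> \<Delta>" obtains \<eta> where "\<eta> \<in> \<Delta>" "t \<le> \<eta>" "at t within \<Delta> = at t within {0..\<eta>}"
proof (cases "\<exists>\<eta>\<in>\<Delta>. t < \<eta>")
  case True
  then obtain \<eta> where \<eta>: "\<eta> \<in> \<Delta>" "t < \<eta>" by blast
  have "\<Delta> \<inter> {..<\<eta>} = {0..\<eta>} \<inter> {..<\<eta>}" using segment[OF \<eta>(1)] nonneg by force
  then have "at t within \<Delta> = at t within {0..\<eta>}"
    using \<eta>(2) by (intro at_within_nhd[of t "{..<\<eta>}"]) simp_all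
  then show ?thesis using \<eta> that[of \<eta>] by simp
next
  case False
  have "\<Delta> = {0..t}"
    by (intro subset_antisym segment[OF assms] subsetI) (use False nonneg in \<open>auto simp: not_less\<close>)
  then show ?thesis using assms that[of t] by simp
qed

lemma continuous_on_segments: assumes "\<And>\<eta>. \<eta> \<in> \<Delta> \<Longrightarrow> continuous_on {0..\<eta>} f" shows "continuous_on \<Delta> f"
  unfolding continuous_on_eq_continuous_within
proof
  fix t assume t: "t \<in> \<Delta>"
  obtain \<eta> where \<eta>: "\<eta> \<in> \<Delta>" "t \<le> \<eta>" "at t within \<Delta> = at t within {0..\<eta>}" by (rule within_segment[OF t])
  then show "continuous (at t within \<Delta>) f"
    using assms[OF \<eta>(1)] t nonneg unfolding continuous_on_eq_continuous_within \<eta>(3) by simp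
qed

lemma Dx1_eq: "(f has_vector_derivative d) (at t within \<Delta>) \<Longrightarrow> t \<in> \<Delta> \<Longrightarrow> Dx \<Delta> 1 f t = d"
  using vector_derivative_within[OF at_ne_bot] by (simp add: Dx_Suc)

lemma Dx_has_derivative:
  "f differentiable (at t within \<Delta>) \<Longrightarrow> (f has_vector_derivative Dx \<Delta> 1 f t) (at t within \<Delta>)"
  by (simp add: Dx_Suc vector_derivative_works)

lemma Ck_on_SucI:
  assumes "\<And>t. t \<in> \<Delta> \<Longrightarrow> (f has_vector_derivative g t) (at t within \<Delta>)" "Ck_on \<Delta> m g"
  shows "Ck_on \<Delta> (Suc m) f"
  unfolding Ck_on_Suc
proof
  show "\<forall>t\<in>\<Delta>. f differentiable (at t within \<Delta>)"
    using assms(1) differentiableI_vector by blast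
  show "Ck_on \<Delta> m (Dx \<Delta> 1 f)"
    by (rule Ck_on_cong[OF _ assms(2)]) (use Dx1_eq[OF assms(1)] in simp)
qed

lemma Ck_on_SucD:
  assumes "Ck_on \<Delta> (Suc m) f" "t \<in> \<Delta>" shows "(f has_vector_derivative Dx \<Delta> 1 f t) (at t within \<Delta>)"
  using assms Dx_has_derivative unfolding Ck_on_Suc by blast

lemma Ck_on_const: "Ck_on \<Delta> m (\<lambda>t. c)"
  by (induction m arbitrary: c) (auto simp: Ck_on_0 intro: Ck_on_SucI[of _ "\<lambda>t. 0"])

lemma Ck_on_add: "Ck_on \<Delta> m f \<Longrightarrow> Ck_on \<Delta> m g \<Longrightarrow> Ck_on \<Delta> m (\<lambda>t. f t + g t)"
proof (induction m arbitrary: f g)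
  case (Suc m)
  show ?case
  proof (rule Ck_on_SucI)
    show "((\<lambda>t. f t + g t) has_vector_derivative Dx \<Delta> 1 f t + Dx \<Delta> 1 g t) (at t within \<Delta>)" if "t \<in> \<Delta>" for t
      by (rule has_vector_derivative_add) (use Suc.prems that Ck_on_SucD in auto)
    show "Ck_on \<Delta> m (\<lambda>t. Dx \<Delta> 1 f t + Dx \<Delta> 1 g t)"
      by (rule Suc.IH) (use Suc.prems in \<open>auto simp: Ck_on_Suc\<close>)
  qed
qed (simp add: Ck_on_0 continuous_on_add)

lemma Ck_on_linear: "bounded_linear L \<Longrightarrow> Ck_on \<Delta> m f \<Longrightarrow> Ck_on \<Delta> m (\<lambda>t. L (f t))"
proof (induction m arbitrary: f)
  case (Suc m)
  show ?case
  proof (rule Ck_on_SucI)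
    show "((\<lambda>t. L (f t)) has_vector_derivative L (Dx \<Delta> 1 f t)) (at t within \<Delta>)" if "t \<in> \<Delta>" for t
      using bounded_linear.has_vector_derivative[OF Suc.prems(1) Ck_on_SucD[OF Suc.prems(2) that]] .
    show "Ck_on \<Delta> m (\<lambda>t. L (Dx \<Delta> 1 f t))"
      by (rule Suc.IH) (use Suc.prems in \<open>auto simp: Ck_on_Suc\<close>)
  qed
qed (simp add: Ck_on_0 linear_continuous_on_compose bounded_linear.continuous_on)

lemma Ck_on_minus: "Ck_on \<Delta> m f \<Longrightarrow> Ck_on \<Delta> m (\<lambda>t. - f t)"
  by (rule Ck_on_linear) (rule bounded_linear_minus[OF bounded_linear_ident])

lemma Ck_on_diff: "Ck_on \<Delta> m f \<Longrightarrow> Ck_on \<Delta> m g \<Longrightarrow> Ck_on \<Delta> m (\<lambda>t. f t - g t)"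
  using Ck_on_add[OF _ Ck_on_minus, of m f g] by simp

lemma Ck_on_bilinear:
  assumes "bounded_bilinear h"
  shows "Ck_on \<Delta> m f \<Longrightarrow> Ck_on \<Delta> m g \<Longrightarrow> Ck_on \<Delta> m (\<lambda>t. h (f t) (g t))"
proof (induction m arbitrary: f g)
  case 0
  then show ?case using bounded_bilinear.continuous_on[OF assms] by (simp add: Ck_on_0)
next
  case (Suc m)
  show ?case
  proof (rule Ck_on_SucI)
    show "((\<lambda>t. h (f t) (g t)) has_vector_derivative h (f t) (Dx \<Delta> 1 g t) + h (Dx \<Delta> 1 f t) (g t)) (at t within \<Delta>)"
      if "t \<in> \<Delta>" for t
      by (rule bounded_bilinear.has_vector_derivative[OF assms]) (use Suc.prems that Ck_on_SucD in auto)
    have "Ck_on \<Delta> m f" "Ck_on \<Delta> m g" using Suc.prems Ck_on_mono le_SucI by blast+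
    moreover have "Ck_on \<Delta> m (Dx \<Delta> 1 f)" "Ck_on \<Delta> m (Dx \<Delta> 1 g)" using Suc.prems by (auto simp: Ck_on_Suc)
    ultimately show "Ck_on \<Delta> m (\<lambda>t. h (f t) (Dx \<Delta> 1 g t) + h (Dx \<Delta> 1 f t) (g t))"
      by (intro Ck_on_add Suc.IH)
  qed
qed

text \<open>A k-th derivative at t alone, on top of order k - 1 on the whole interval. For elements
  of the maximal domain the last quasi-derivative is differentiable only almost everywhere, so l
  must be computed pointwise.\<close>

definition derivable_at :: "nat \<Rightarrow> real \<Rightarrow> (real \<Rightarrow> 'v::real_normed_vector) \<Rightarrow> bool"
  where "derivable_at k t f \<longleftrightarrow> k = 0 \<or> Ck_on \<Delta> (k - 1) f \<and> Dx \<Delta> (k - 1) f differentiable (at t within \<Delta>)"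

lemma Ck_on_derivable_at: "Ck_on \<Delta> k f \<Longrightarrow> t \<in> \<Delta> \<Longrightarrow> derivable_at k t f"
  unfolding derivable_at_def Ck_on_def by (cases k) auto

lemma Dx_linear:
  assumes L: "bounded_linear L" and f: "derivable_at k t f" and t: "t \<in> \<Delta>"
  shows "Dx \<Delta> k (\<lambda>t. L (f t)) t = L (Dx \<Delta> k f t)"
  using f t
proof (induction k arbitrary: t)
  case (Suc k)
  have f: "Ck_on \<Delta> k f" "Dx \<Delta> k f differentiable (at t within \<Delta>)" using Suc.prems by (auto simp: derivable_at_def)
  have "((\<lambda>t. L (Dx \<Delta> k f t)) has_vector_derivative L (Dx \<Delta> (Suc k) f t)) (at t within \<Delta>)"
    unfolding Dx_Suc using f(2) by (intro bounded_linear.has_vector_derivative[OF L]) (simp flip: vector_derivative_works)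
  then have "(Dx \<Delta> k (\<lambda>t. L (f t)) has_vector_derivative L (Dx \<Delta> (Suc k) f t)) (at t within \<Delta>)"
    by (rule has_vector_derivative_transform[rotated 2])
      (use Suc.prems Suc.IH Ck_on_derivable_at[OF f(1)] in auto)
  then show ?case unfolding Dx_Suc[of _ _ "\<lambda>t. L (f t)"]
    using vector_derivative_within[OF at_ne_bot] Suc.prems by blast
qed simp

lemma Dx_add:
  assumes f: "derivable_at k t f" "derivable_at k t g" and t: "t \<in> \<Delta>"
  shows "Dx \<Delta> k (\<lambda>t. f t + g t) t = Dx \<Delta> k f t + Dx \<Delta> k g t" (is ?eq)
    and "derivable_at k t (\<lambda>t. f t + g t)"
proof -
  have "?eq \<and> derivable_at k t (\<lambda>t. f t + g t)"
    using f t
  proof (induction k arbitrary: t)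
    case (Suc k)
    have f: "Ck_on \<Delta> k f" "Dx \<Delta> k f differentiable (at t within \<Delta>)"
      and g: "Ck_on \<Delta> k g" "Dx \<Delta> k g differentiable (at t within \<Delta>)" using Suc.prems by (auto simp: derivable_at_def)
    have "((\<lambda>t. Dx \<Delta> k f t + Dx \<Delta> k g t) has_vector_derivative Dx \<Delta> (Suc k) f t + Dx \<Delta> (Suc k) g t) (at t within \<Delta>)"
      unfolding Dx_Suc using f(2) g(2) by (intro has_vector_derivative_add) (simp_all flip: vector_derivative_works)
    then have *: "(Dx \<Delta> k (\<lambda>t. f t + g t) has_vector_derivative Dx \<Delta> (Suc k) f t + Dx \<Delta> (Suc k) g t) (at t within \<Delta>)"
      by (rule has_vector_derivative_transform[rotated 2])
        (use Suc.prems Suc.IH Ck_on_derivable_at[OF f(1)] Ck_on_derivable_at[OF g(1)] in auto)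
    then have "Dx \<Delta> (Suc k) (\<lambda>t. f t + g t) t = Dx \<Delta> (Suc k) f t + Dx \<Delta> (Suc k) g t"
      unfolding Dx_Suc[of _ _ "\<lambda>t. f t + g t"]
      using vector_derivative_within[OF at_ne_bot] Suc.prems by blast
    then show ?case using * Ck_on_add[OF f(1) g(1)] differentiableI_vector by (auto simp: derivable_at_def)
  qed (simp add: derivable_at_def)
  then show ?eq "derivable_at k t (\<lambda>t. f t + g t)" by blast+
qed

lemma derivable_at_linear:
  assumes L: "bounded_linear L" and f: "derivable_at k t f" and t: "t \<in> \<Delta>"
  shows "derivable_at k t (\<lambda>t. L (f t))"
proof (cases k)
  case (Suc m)
  then have f: "Ck_on \<Delta> m f" "Dx \<Delta> m f differentiable (at t within \<Delta>)" using assms by (auto simp: derivable_at_def)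
  have "(\<lambda>t. L (Dx \<Delta> m f t)) differentiable (at t within \<Delta>)"
    using bounded_linear.has_vector_derivative[OF L] f(2) by (meson differentiableI_vector vector_derivative_works)
  then have "Dx \<Delta> m (\<lambda>t. L (f t)) differentiable (at t within \<Delta>)"
    using Dx_linear[OF L Ck_on_derivable_at[OF f(1)]] t
    by (intro differentiable_transform_within[of "\<lambda>t. L (Dx \<Delta> m f t)" t \<Delta> 1 "Dx \<Delta> m (\<lambda>t. L (f t))"]) auto
  then show ?thesis using Suc Ck_on_linear[OF L f(1)] by (simp add: derivable_at_def)
qed (simp add: derivable_at_def)

lemma has_integral_derivative:
  fixes f :: "real \<Rightarrow> 'v::banach"
  assumes "\<And>t. t \<in> \<Delta> \<Longrightarrow> (f has_vector_derivative f' t) (at t within \<Delta>)" "\<eta> \<in> \<Delta>"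
  shows "(f' has_integral f \<eta> - f 0) {0..\<eta>}"
proof (rule fundamental_theorem_of_calculus)
  show "0 \<le> \<eta>" using assms nonneg by blast
  show "(f has_vector_derivative f' t) (at t within {0..\<eta>})" if "t \<in> {0..\<eta>}" for t
    using has_vector_derivative_within_subset[OF assms(1)] segment assms(2) that by blast
qed

lemma integral_derivative:
  fixes f :: "real \<Rightarrow> 'v::banach"
  assumes "continuous_on \<Delta> f" "t \<in> \<Delta>"
  shows "((\<lambda>u. integral {0..u} f) has_vector_derivative f t) (at t within \<Delta>)"
proof -
  obtain \<eta> where \<eta>: "\<eta> \<in> \<Delta>" "t \<le> \<eta>" "at t within \<Delta> = at t within {0..\<eta>}" by (rule within_segment[OF assms(2)])
  show ?thesis unfolding \<eta>(3)
    by (rule integral_has_vector_derivative)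
      (use assms(2) \<eta>(2) nonneg continuous_on_subset[OF assms(1) segment[OF \<eta>(1)]] in auto)
qed

end

section \<open>Systems of differential equations\<close>

lemma power_over_fact_tendsto: "(\<lambda>i. B * x ^ i / fact i) \<longlonglongrightarrow> 0" for x :: real
  using tendsto_mult_right_zero[OF summable_LIMSEQ_zero[OF summable_exp[of x]], of B]
  by (simp add: field_simps)

text \<open>States are sequences of which the first m entries matter; the Lipschitz bound makes F
  ignore the others. Continuity in t is required only along continuous curves, which is all that
  Picard iteration uses.\<close>

locale lipschitz_system = half_open_interval +
  fixes m :: nat and F :: "nat \<Rightarrow> real \<Rightarrow> (nat \<Rightarrow> 'v::banach) \<Rightarrow> 'v"
  assumes lipschitz: "\<And>\<eta>. \<eta> \<in> \<Delta> \<Longrightarrow> \<exists>K\<ge>0. \<forall>t\<in>{0..\<eta>}. \<forall>k<m. \<forall>x y. norm (F k t x - F k t y) \<le> K * (\<Sum>j<m. norm (x j - y j))"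
    and continuous: "\<And>\<eta> X k. \<eta> \<in> \<Delta> \<Longrightarrow> k < m \<Longrightarrow> (\<And>j. j < m \<Longrightarrow> continuous_on {0..\<eta>} (X j)) \<Longrightarrow>
      continuous_on {0..\<eta>} (\<lambda>t. F k t (\<lambda>j. X j t))"
begin

lemma continuous_Delta:
  assumes "k < m" "\<And>j. j < m \<Longrightarrow> continuous_on \<Delta> (X j)"
  shows "continuous_on \<Delta> (\<lambda>t. F k t (\<lambda>j. X j t))"
proof (rule continuous_on_segments)
  fix \<eta> assume \<eta>: "\<eta> \<in> \<Delta>"
  show "continuous_on {0..\<eta>} (\<lambda>t. F k t (\<lambda>j. X j t))"
    using continuous_on_subset[OF assms(2) segment[OF \<eta>]] by (intro continuous[OF \<eta> assms(1)])
qed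

text \<open>One integration turns the bound with exponent i into that with exponent i + 1. Both
  uniqueness and convergence of the iteration rest on it.\<close>

lemma picard_step:
  fixes K B :: real
  assumes \<eta>: "\<eta> \<in> \<Delta>" and K: "0 \<le> K" "\<forall>t\<in>{0..\<eta>}. \<forall>k<m. \<forall>x y. norm (F k t x - F k t y) \<le> K * (\<Sum>j<m. norm (x j - y j))"
    and cont: "\<And>j. j < m \<Longrightarrow> continuous_on \<Delta> (X j)" "\<And>j. j < m \<Longrightarrow> continuous_on \<Delta> (Y j)"
    and le: "\<And>j s. j < m \<Longrightarrow> s \<in> {0..\<eta>} \<Longrightarrow> norm (X j s - Y j s) \<le> B * (m * K * s) ^ i / fact i"
    and k: "k < m" and t: "t \<in> {0..\<eta>}"
  shows "norm (integral {0..t} (\<lambda>s. F k s (\<lambda>j. X j s)) - integral {0..t} (\<lambda>s. F k s (\<lambda>j. Y j s)))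
    \<le> B * (m * K * t) ^ Suc i / fact (Suc i)"
proof -
  have tD: "t \<in> \<Delta>" using segment[OF \<eta>] t by blast
  have c: "continuous_on {0..t} (\<lambda>s. F k s (\<lambda>j. X j s))" "continuous_on {0..t} (\<lambda>s. F k s (\<lambda>j. Y j s))"
    using continuous_on_subset[OF continuous_Delta[OF k] segment[OF tD]] cont by auto
  let ?g = "\<lambda>s. B * (m * K) ^ Suc i * s ^ i / fact i"
  have "((\<lambda>s. B * (m * K) ^ Suc i * s ^ Suc i / fact (Suc i)) has_real_derivative ?g s) (at s within {0..t})" for s
    by (rule derivative_eq_intros refl | simp add: field_simps del: fact_Suc power_Suc)+ (simp add: field_simps)
  then have "(?g has_integral B * (m * K) ^ Suc i * t ^ Suc i / fact (Suc i) - B * (m * K) ^ Suc i * 0 ^ Suc i / fact (Suc i)) {0..t}"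
    using t by (intro fundamental_theorem_of_calculus) (auto simp: has_real_derivative_iff_has_vector_derivative)
  then have g: "(?g has_integral B * (m * K * t) ^ Suc i / fact (Suc i)) {0..t}"
    by (simp add: power_mult_distrib mult_ac)
  have "norm (integral {0..t} (\<lambda>s. F k s (\<lambda>j. X j s) - F k s (\<lambda>j. Y j s))) \<le> integral {0..t} ?g"
  proof (rule integral_norm_bound_integral)
    show "(\<lambda>s. F k s (\<lambda>j. X j s) - F k s (\<lambda>j. Y j s)) integrable_on {0..t}"
      by (intro integrable_continuous_interval continuous_on_diff c)
    show "?g integrable_on {0..t}" using g by blast
    fix s assume s: "s \<in> {0..t}"
    have "norm (F k s (\<lambda>j. X j s) - F k s (\<lambda>j. Y j s)) \<le> K * (\<Sum>j<m. norm (X j s - Y j s))"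
      using K(2) k s t by auto
    also have "\<dots> \<le> K * (\<Sum>j<m. B * (m * K * s) ^ i / fact i)"
      using le s t K(1) by (intro mult_left_mono sum_mono) auto
    also have "\<dots> = ?g s" by (simp add: power_mult_distrib mult_ac)
    finally show "norm (F k s (\<lambda>j. X j s) - F k s (\<lambda>j. Y j s)) \<le> ?g s" .
  qed
  also have "integral {0..t} ?g = B * (m * K * t) ^ Suc i / fact (Suc i)" using g by (rule integral_unique)
  also have "integral {0..t} (\<lambda>s. F k s (\<lambda>j. X j s) - F k s (\<lambda>j. Y j s)) = integral {0..t} (\<lambda>s. F k s (\<lambda>j. X j s)) - integral {0..t} (\<lambda>s. F k s (\<lambda>j. Y j s))"
    by (intro integral_diff integrable_continuous_interval c)
  finally show ?thesis .
qed

lemma family_bound: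
  assumes "\<eta> \<in> \<Delta>" "\<And>j. j < m \<Longrightarrow> continuous_on \<Delta> (f j :: real \<Rightarrow> 'c::real_normed_vector)"
  obtains B where "\<And>j s. j < m \<Longrightarrow> s \<in> {0..\<eta>} \<Longrightarrow> norm (f j s) \<le> B"
proof -
  have "\<exists>B. \<forall>s\<in>{0..\<eta>}. norm (f j s) \<le> B" if "j < m" for j
  proof -
    have "compact (f j ` {0..\<eta>})"
      by (rule compact_continuous_image[OF continuous_on_subset[OF assms(2)[OF that] segment[OF assms(1)]]]) simp
    then show ?thesis by (auto dest!: compact_imp_bounded simp: bounded_iff)
  qed
  then obtain B where B: "\<And>j s. j < m \<Longrightarrow> s \<in> {0..\<eta>} \<Longrightarrow> norm (f j s) \<le> B j" by metis
  have "norm (f j s) \<le> (\<Sum>j<m. max 0 (B j))" if "j < m" "s \<in> {0..\<eta>}" for j s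
  proof -
    have "max 0 (B j) \<le> (\<Sum>j<m. max 0 (B j))" by (rule member_le_sum) (use that in auto)
    then show ?thesis using B[OF that] by linarith
  qed
  then show ?thesis by (rule that)
qed

text \<open>Two solutions with the same initial value are reproduced by the integral equation, so
  their difference obeys the Picard bound of every order, and these bounds tend to 0.\<close>

lemma solution_unique:
  assumes der: "\<And>k t. k < m \<Longrightarrow> t \<in> \<Delta> \<Longrightarrow> (X k has_vector_derivative F k t (\<lambda>j. X j t)) (at t within \<Delta>)"
      "\<And>k t. k < m \<Longrightarrow> t \<in> \<Delta> \<Longrightarrow> (Y k has_vector_derivative F k t (\<lambda>j. Y j t)) (at t within \<Delta>)"
    and init: "\<And>k. k < m \<Longrightarrow> X k 0 = Y k 0" and k: "k < m" and t: "t \<in> \<Delta>"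
  shows "X k t = Y k t"
proof -
  have cont: "continuous_on \<Delta> (X j)" "continuous_on \<Delta> (Y j)" if "j < m" for j
    by (rule continuous_on_vector_derivative, erule der(1)[OF that])
      (rule continuous_on_vector_derivative, erule der(2)[OF that])
  obtain K where K: "0 \<le> K" "\<forall>s\<in>{0..t}. \<forall>k<m. \<forall>x y. norm (F k s x - F k s y) \<le> K * (\<Sum>j<m. norm (x j - y j))"
    using lipschitz[OF t] by blast
  obtain B where B: "\<And>j s. j < m \<Longrightarrow> s \<in> {0..t} \<Longrightarrow> norm (X j s - Y j s) \<le> B"
    by (rule family_bound[OF t, of "\<lambda>j s. X j s - Y j s"]) (auto intro: continuous_on_diff cont)
  have int: "X k s - Y k s = integral {0..s} (\<lambda>s. F k s (\<lambda>j. X j s)) - integral {0..s} (\<lambda>s. F k s (\<lambda>j. Y j s))"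
    if "k < m" "s \<in> \<Delta>" for k s
    using has_integral_derivative[OF der(1)[OF that(1)] that(2)] has_integral_derivative[OF der(2)[OF that(1)] that(2)] init[OF that(1)]
    by (auto dest!: integral_unique)
  have bound: "norm (X j s - Y j s) \<le> B * (m * K * s) ^ i / fact i" if "j < m" "s \<in> {0..t}" for i j s
    using that
  proof (induction i arbitrary: j s)
    case 0 then show ?case using B by simp
  next
    case (Suc i)
    have "s \<in> \<Delta>" using Suc.prems segment[OF t] by blast
    show ?case unfolding int[OF Suc.prems(1) \<open>s \<in> \<Delta>\<close>]
      by (rule picard_step[OF t K(1) K(2)]) (use Suc cont in auto)
  qed
  have "norm (X k t - Y k t) \<le> 0"
    by (rule LIMSEQ_le_const[OF power_over_fact_tendsto[of B "m * K * t"]])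
      (use bound[OF k] t nonneg in auto)
  then show ?thesis by simp
qed

section \<open>Picard iteration\<close>

primrec picard :: "(nat \<Rightarrow> 'v) \<Rightarrow> nat \<Rightarrow> nat \<Rightarrow> real \<Rightarrow> 'v" where
  "picard c 0 = (\<lambda>k t. c k)"
| "picard c (Suc i) = (\<lambda>k t. c k + integral {0..t} (\<lambda>s. F k s (\<lambda>j. picard c i j s)))"

lemma picard_continuous: "k < m \<Longrightarrow> continuous_on \<Delta> (picard c i k)"
proof (induction i arbitrary: k)
  case (Suc i)
  have "((\<lambda>t. integral {0..t} (\<lambda>s. F k s (\<lambda>j. picard c i j s))) has_vector_derivative F k t (\<lambda>j. picard c i j t)) (at t within \<Delta>)" if "t \<in> \<Delta>" for t
    by (rule integral_derivative[OF continuous_Delta[OF Suc.prems Suc.IH] that])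
  then have "continuous_on \<Delta> (\<lambda>t. integral {0..t} (\<lambda>s. F k s (\<lambda>j. picard c i j s)))"
    by (rule continuous_on_vector_derivative)
  then show ?case by (simp add: continuous_on_add)
qed simp

text \<open>The limit of the iterates, written as a telescoping series so that the Weierstrass test
  gives uniform convergence on segments.\<close>

definition flow :: "(nat \<Rightarrow> 'v) \<Rightarrow> nat \<Rightarrow> real \<Rightarrow> 'v"
  where "flow c k t = c k + (\<Sum>i. picard c (Suc i) k t - picard c i k t)"

lemma picard_uniform_limit:
  assumes \<eta>: "\<eta> \<in> \<Delta>" and k: "k < m"
  shows "uniform_limit {0..\<eta>} (\<lambda>i. picard c i k) (flow c k) sequentially"
proof -
  obtain K where K: "0 \<le> K" "\<forall>s\<in>{0..\<eta>}. \<forall>k<m. \<forall>x y. norm (F k s x - F k s y) \<le> K * (\<Sum>j<m. norm (x j - y j))"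
    using lipschitz[OF \<eta>] by blast
  obtain B where B: "\<And>j s. j < m \<Longrightarrow> s \<in> {0..\<eta>} \<Longrightarrow> norm (picard c (Suc 0) j s - picard c 0 j s) \<le> B"
    by (rule family_bound[OF \<eta>, of "\<lambda>j s. picard c (Suc 0) j s - picard c 0 j s"])
      (auto intro!: continuous_on_diff picard_continuous simp del: picard.simps)
  have bound: "norm (picard c (Suc i) j s - picard c i j s) \<le> B * (m * K * s) ^ i / fact i" if "j < m" "s \<in> {0..\<eta>}" for i j s
    using that
  proof (induction i arbitrary: j s)
    case 0 then show ?case using B by (simp del: picard.simps)
  next
    case (Suc i)
    have "picard c (Suc (Suc i)) j s - picard c (Suc i) j s = integral {0..s} (\<lambda>s. F j s (\<lambda>j. picard c (Suc i) j s)) - integral {0..s} (\<lambda>s. F j s (\<lambda>j. picard c i j s))"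
      by simp
    also have "norm \<dots> \<le> B * (m * K * s) ^ Suc i / fact (Suc i)"
      by (rule picard_step[OF \<eta> K(1) K(2)]) (use Suc picard_continuous in blast)+
    finally show ?case .
  qed
  have "0 \<le> B" using B[OF k, of 0] nonneg[OF \<eta>] norm_ge_zero order_trans by fastforce
  have "uniform_limit {0..\<eta>} (\<lambda>n t. \<Sum>i<n. picard c (Suc i) k t - picard c i k t) (\<lambda>t. \<Sum>i. picard c (Suc i) k t - picard c i k t) sequentially"
  proof (rule Weierstrass_m_test)
    show "norm (picard c (Suc i) k s - picard c i k s) \<le> B * ((m * K * \<eta>) ^ i / fact i)" if "s \<in> {0..\<eta>}" for i s
    proof -
      have "(m * K * s) ^ i \<le> (m * K * \<eta>) ^ i" using that K(1) by (intro power_mono mult_left_mono) auto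
      then have "B * (m * K * s) ^ i / fact i \<le> B * (m * K * \<eta>) ^ i / fact i"
        using \<open>0 \<le> B\<close> by (intro divide_right_mono mult_left_mono) auto
      then show ?thesis using bound[OF k that, of i] by simp
    qed
    show "summable (\<lambda>i. B * ((m * K * \<eta>) ^ i / fact i))"
      using summable_mult[OF summable_exp[of "m * K * \<eta>"], of B] by (simp add: field_simps)
  qed
  then have "uniform_limit {0..\<eta>} (\<lambda>n t. c k + (\<Sum>i<n. picard c (Suc i) k t - picard c i k t)) (flow c k) sequentially"
    unfolding flow_def by (intro uniform_limit_intros)
  moreover have "c k + (\<Sum>i<n. picard c (Suc i) k t - picard c i k t) = picard c n k t" for n t
    using sum_lessThan_telescope[of "\<lambda>i. picard c i k t" n] by simp
  ultimately show ?thesis by simp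
qed

lemma flow_continuous: assumes "k < m" shows "continuous_on \<Delta> (flow c k)"
proof (rule continuous_on_segments)
  fix \<eta> assume \<eta>: "\<eta> \<in> \<Delta>"
  show "continuous_on {0..\<eta>} (flow c k)"
    by (rule uniform_limit_theorem[OF _ picard_uniform_limit[OF \<eta> assms]])
      (auto intro!: always_eventually continuous_on_subset[OF picard_continuous[OF assms] segment[OF \<eta>]])
qed

lemma flow_integral:
  assumes k: "k < m" and t: "t \<in> \<Delta>"
  shows "flow c k t = c k + integral {0..t} (\<lambda>s. F k s (\<lambda>j. flow c j s))"
proof -
  obtain K where K: "0 \<le> K" "\<forall>s\<in>{0..t}. \<forall>k<m. \<forall>x y. norm (F k s x - F k s y) \<le> K * (\<Sum>j<m. norm (x j - y j))"
    using lipschitz[OF t] by blast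
  have "uniform_limit {0..t} (\<lambda>i s. F k s (\<lambda>j. picard c i j s)) (\<lambda>s. F k s (\<lambda>j. flow c j s)) sequentially"
  proof (rule uniform_limitI)
    fix e :: real assume "0 < e"
    \<comment> \<open>The added 1 makes the denominator positive and the final estimate
      strict.\<close>
    define d where "d = e / (K * m + 1)"
    have "0 < K * m + 1" using K(1) by (simp add: add_nonneg_pos)
    then have "0 < d" using \<open>0 < e\<close> by (simp add: d_def)
    have "\<forall>\<^sub>F i in sequentially. \<forall>j\<in>{..<m}. \<forall>s\<in>{0..t}. dist (picard c i j s) (flow c j s) < d"
      using uniform_limitD[OF picard_uniform_limit[OF t] \<open>0 < d\<close>] by (intro eventually_ball_finite) auto
    then show "\<forall>\<^sub>F i in sequentially. \<forall>s\<in>{0..t}. dist (F k s (\<lambda>j. picard c i j s)) (F k s (\<lambda>j. flow c j s)) < e"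
    proof (rule eventually_mono, intro ballI)
      fix i s assume *: "\<forall>j\<in>{..<m}. \<forall>s\<in>{0..t}. dist (picard c i j s) (flow c j s) < d" and s: "s \<in> {0..t}"
      have "norm (F k s (\<lambda>j. picard c i j s) - F k s (\<lambda>j. flow c j s)) \<le> K * (\<Sum>j<m. norm (picard c i j s - flow c j s))"
        using K(2) k s by blast
      also have "\<dots> \<le> K * (\<Sum>j<m. d)"
        using * s K(1) by (intro mult_left_mono sum_mono) (auto simp: dist_norm less_imp_le)
      also have "\<dots> = (K * m) * d" by simp
      also have "\<dots> < (K * m + 1) * d" using \<open>0 < d\<close> by (intro mult_strict_right_mono) auto
      also have "\<dots> = e" using \<open>0 < K * m + 1\<close> by (simp add: d_def)
      finally show "dist (F k s (\<lambda>j. picard c i j s)) (F k s (\<lambda>j. flow c j s)) < e" by (simp add: dist_norm)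
    qed
  qed
  then obtain I J where IJ: "\<And>i. ((\<lambda>s. F k s (\<lambda>j. picard c i j s)) has_integral I i) {0..t}"
      "((\<lambda>s. F k s (\<lambda>j. flow c j s)) has_integral J) {0..t}" "I \<longlonglongrightarrow> J"
  proof (rule uniform_limit_integral)
    show "continuous_on {0..t} (\<lambda>s. F k s (\<lambda>j. picard c i j s))" for i
      by (rule continuous_on_subset[OF continuous_Delta[OF k picard_continuous] segment[OF t]])
  qed auto
  have "(\<lambda>i. picard c (Suc i) k t) \<longlonglongrightarrow> c k + J"
    using IJ(3) by (simp add: integral_unique[OF IJ(1)] tendsto_add)
  moreover have "(\<lambda>i. picard c (Suc i) k t) \<longlonglongrightarrow> flow c k t"
    using tendsto_uniform_limitI[OF picard_uniform_limit[OF t k], of t] nonneg[OF t] by (intro LIMSEQ_Suc) simp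
  ultimately show ?thesis using LIMSEQ_unique integral_unique[OF IJ(2)] by metis
qed

lemma flow_derivative:
  assumes k: "k < m" and t: "t \<in> \<Delta>"
  shows "(flow c k has_vector_derivative F k t (\<lambda>j. flow c j t)) (at t within \<Delta>)"
proof -
  have "((\<lambda>t. c k + integral {0..t} (\<lambda>s. F k s (\<lambda>j. flow c j s))) has_vector_derivative 0 + F k t (\<lambda>j. flow c j t)) (at t within \<Delta>)"
    by (intro has_vector_derivative_add has_vector_derivative_const integral_derivative continuous_Delta k t flow_continuous)
  then show ?thesis
    by (rule has_vector_derivative_transform[rotated 2, THEN has_vector_derivative_eq_rhs]) (use t flow_integral[OF k] in auto)
qed

lemma flow_initial: "k < m \<Longrightarrow> flow c k 0 = c k"
  using flow_integral[of k 0 c] zero_in by simp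

end

text \<open>The system is solved backwards from \<open>\<eta>\<close>.\<close>

lemma (in lipschitz_system) flow_surjective:
  assumes \<eta>: "\<eta> \<in> \<Delta>" "0 < \<eta>"
  obtains c where "\<And>k. k < m \<Longrightarrow> flow c k \<eta> = d k"
proof -
  interpret R: lipschitz_system "{0..\<eta>}" "ereal \<eta>" m "\<lambda>k s x. - F k (\<eta> - s) x"
  proof
    show "is_Delta {0..\<eta>} (ereal \<eta>)" using \<eta> by (auto simp: is_Delta_def)
    fix \<xi> assume \<xi>: "\<xi> \<in> {0..\<eta>}"
    obtain K where K: "0 \<le> K" "\<forall>s\<in>{0..\<eta>}. \<forall>k<m. \<forall>x y. norm (F k s x - F k s y) \<le> K * (\<Sum>j<m. norm (x j - y j))"
      using lipschitz[OF \<eta>(1)] by blast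
    then show "\<exists>K\<ge>0. \<forall>t\<in>{0..\<xi>}. \<forall>k<m. \<forall>x y. norm (- F k (\<eta> - t) x - - F k (\<eta> - t) y) \<le> K * (\<Sum>j<m. norm (x j - y j))"
      using \<xi> by (intro exI[of _ K]) (simp add: norm_minus_commute)
    fix X :: "nat \<Rightarrow> real \<Rightarrow> 'v" and k assume k: "k < m" and X: "\<And>j. j < m \<Longrightarrow> continuous_on {0..\<xi>} (X j)"
    \<comment> \<open>The curve is given only up to \<open>\<xi>\<close>, while continuity of F in
      the original time is needed on a segment reaching \<open>\<eta>\<close>. Freezing the curve at
      \<open>\<xi>\<close> extends it.\<close>
    have "continuous_on {0..\<eta>} (\<lambda>t. F k t (\<lambda>j. X j (min \<xi> (\<eta> - t))))"
      by (rule continuous[OF \<eta>(1) k], rule continuous_on_compose2[OF X]) (use \<xi> in \<open>auto intro!: continuous_intros\<close>)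
    then have "continuous_on {0..\<xi>} (\<lambda>s. F k (\<eta> - s) (\<lambda>j. X j (min \<xi> (\<eta> - (\<eta> - s)))))"
      by (rule continuous_on_compose2[where f = "\<lambda>s. \<eta> - s"]) (use \<xi> in \<open>auto intro!: continuous_intros\<close>)
    then have "continuous_on {0..\<xi>} (\<lambda>s. F k (\<eta> - s) (\<lambda>j. X j s))"
      by (rule continuous_on_eq) simp
    then show "continuous_on {0..\<xi>} (\<lambda>t. - F k (\<eta> - t) (\<lambda>j. X j t))"
      by (rule continuous_on_minus)
  qed
  \<comment> \<open>The reversed solution lives on the segment, so uniqueness is needed for the
    system restricted to it.\<close>
  interpret S: lipschitz_system "{0..\<eta>}" "ereal \<eta>" m F
  proof
    fix \<xi> assume "\<xi> \<in> {0..\<eta>}"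
    then have "\<xi> \<in> \<Delta>" using segment[OF \<eta>(1)] by blast
    then show "\<exists>K\<ge>0. \<forall>t\<in>{0..\<xi>}. \<forall>k<m. \<forall>x y. norm (F k t x - F k t y) \<le> K * (\<Sum>j<m. norm (x j - y j))"
      by (rule lipschitz)
    show "continuous_on {0..\<xi>} (\<lambda>t. F k t (\<lambda>j. X j t))" if "k < m" "\<And>j. j < m \<Longrightarrow> continuous_on {0..\<xi>} (X j)" for X k
      by (rule continuous[OF \<open>\<xi> \<in> \<Delta>\<close> that])
  qed
  define Z where "Z k t = R.flow d k (\<eta> - t)" for k t
  have Z: "(Z k has_vector_derivative F k t (\<lambda>j. Z j t)) (at t within {0..\<eta>})" if "k < m" "t \<in> {0..\<eta>}" for k t
  proof -
    have "(R.flow d k has_vector_derivative - F k (\<eta> - (\<eta> - t)) (\<lambda>j. R.flow d j (\<eta> - t))) (at (\<eta> - t) within (\<lambda>t. \<eta> - t) ` {0..\<eta>})"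
      using R.flow_derivative[of k "\<eta> - t" d] that by simp
    moreover have "((\<lambda>t. \<eta> - t) has_vector_derivative - 1) (at t within {0..\<eta>})"
      by (auto intro!: derivative_eq_intros)
    ultimately have "((R.flow d k \<circ> (\<lambda>t. \<eta> - t)) has_vector_derivative (- 1) *\<^sub>R (- F k (\<eta> - (\<eta> - t)) (\<lambda>j. R.flow d j (\<eta> - t)))) (at t within {0..\<eta>})"
      by (rule vector_diff_chain_within[rotated])
    then show ?thesis by (simp add: Z_def[abs_def] o_def)
  qed
  let ?c = "\<lambda>k. Z k 0"
  have "flow ?c k \<eta> = d k" if "k < m" for k
  proof -
    have "flow ?c k \<eta> = Z k \<eta>"
    proof (rule S.solution_unique[OF _ Z])
      show "(flow ?c k has_vector_derivative F k t (\<lambda>j. flow ?c j t)) (at t within {0..\<eta>})" if "k < m" "t \<in> {0..\<eta>}" for k t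
        using has_vector_derivative_within_subset[OF flow_derivative segment[OF \<eta>(1)]] that segment[OF \<eta>(1)] by blast
    qed (use that flow_initial \<eta> in auto)
    then show ?thesis using R.flow_initial[OF that] by (simp add: Z_def)
  qed
  then show thesis by (rule that)
qed



section \<open>Quasi-derivatives and the first order system\<close>

text \<open>Difference quotients are the convenient form for the derivative of an inverse, where
  products of operators converge factor by factor.\<close>

lemma has_vector_derivative_quotient:
  "(f has_vector_derivative D) (at x within S) \<longleftrightarrow> ((\<lambda>y. (f y - f x) /\<^sub>R (y - x)) \<longlongrightarrow> D) (at x within S)"
proof -
  have eq: "norm ((f y - f x) - (y - x) *\<^sub>R D) / norm (y - x) = norm ((f y - f x) /\<^sub>R (y - x) - D)" if "y \<noteq> x" for y
  proof -
    have "(f y - f x) - (y - x) *\<^sub>R D = (y - x) *\<^sub>R ((f y - f x) /\<^sub>R (y - x) - D)"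
      using that by (simp add: scaleR_diff_right)
    then show ?thesis using that by simp
  qed
  have "(f has_vector_derivative D) (at x within S) \<longleftrightarrow>
      ((\<lambda>y. norm ((f y - f x) - (y - x) *\<^sub>R D) / norm (y - x)) \<longlongrightarrow> 0) (at x within S)"
    unfolding has_vector_derivative_def has_derivative_iff_norm
    by (simp add: bounded_linear_scaleR_left)
  also have "\<dots> \<longleftrightarrow> ((\<lambda>y. norm ((f y - f x) /\<^sub>R (y - x) - D)) \<longlongrightarrow> 0) (at x within S)"
    by (rule tendsto_cong) (use eq in \<open>auto simp: eventually_at_filter\<close>)
  also have "\<dots> \<longleftrightarrow> ((\<lambda>y. (f y - f x) /\<^sub>R (y - x)) \<longlongrightarrow> D) (at x within S)"
    unfolding tendsto_norm_zero_iff by (rule LIM_zero_iff)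
  finally show ?thesis .
qed

lemma inv_op_diff:
  assumes "invertible_op S" "invertible_op T"
  shows "inv_op S - inv_op T = - ((inv_op S o\<^sub>C\<^sub>L (S - T)) o\<^sub>C\<^sub>L inv_op T)"
  by (rule cblinfun_eqI) (simp add: cblinfun_linear inv_op_apply assms)

lemma inv_op_tendsto:
  fixes A :: "real \<Rightarrow> 'a::complex_hilbert \<Rightarrow>\<^sub>C\<^sub>L 'b::complex_hilbert"
  assumes A: "(A \<longlongrightarrow> A t) (at t within S)" and inv: "\<And>s. s \<in> S \<Longrightarrow> invertible_op (A s)" "invertible_op (A t)"
  shows "((\<lambda>s. inv_op (A s)) \<longlongrightarrow> inv_op (A t)) (at t within S)"
proof -
  define N where "N = norm (inv_op (A t)) + 1"
  have "0 < N" by (simp add: N_def add_nonneg_pos)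
  have bound: "norm (inv_op (A s) - inv_op (A t)) \<le> 2 * N\<^sup>2 * norm (A s - A t)" if s: "s \<in> S" "norm (A s - A t) < 1 / (2 * N)" for s
  proof -
    let ?d = "norm (A s - A t)"
    have "norm (inv_op (A s) - inv_op (A t)) \<le> norm (inv_op (A s)) * ?d * norm (inv_op (A t))"
      unfolding inv_op_diff[OF inv(1)[OF s(1)] inv(2)] norm_minus_cancel
      by (rule order_trans[OF norm_cblinfun_compose mult_right_mono[OF norm_cblinfun_compose norm_ge_zero]])
    also have "\<dots> \<le> norm (inv_op (A s)) * ?d * N" by (intro mult_left_mono) (auto simp: N_def)
    finally have 1: "norm (inv_op (A s) - inv_op (A t)) \<le> norm (inv_op (A s)) * ?d * N" .
    \<comment> \<open>Absorption: the first estimate bounds \<open>norm (inv_op (A s))\<close> by N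
      plus half of itself, hence by 2 N.\<close>
    have "norm (inv_op (A s)) * (?d * N) \<le> norm (inv_op (A s)) * (1 / 2)"
      using s(2) \<open>0 < N\<close> by (intro mult_left_mono) (auto simp: field_simps)
    moreover have "norm (inv_op (A s)) \<le> norm (inv_op (A t)) + norm (inv_op (A s) - inv_op (A t))"
      by (metis norm_triangle_sub)
    moreover have "norm (inv_op (A t)) \<le> N" by (simp add: N_def)
    ultimately have "norm (inv_op (A s)) \<le> 2 * N" using 1[unfolded mult.assoc] by linarith
    then have "norm (inv_op (A s)) * (?d * N) \<le> (2 * N) * (?d * N)" using \<open>0 < N\<close> by (intro mult_right_mono) auto
    then show ?thesis using 1 by (simp add: power2_eq_square mult_ac)
  qed
  have A0: "((\<lambda>s. norm (A s - A t)) \<longlongrightarrow> 0) (at t within S)" using A by (simp add: tendsto_norm_zero_iff LIM_zero_iff)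
  have "((\<lambda>s. inv_op (A s) - inv_op (A t)) \<longlongrightarrow> 0) (at t within S)"
  proof (rule Lim_null_comparison)
    show "((\<lambda>s. 2 * N\<^sup>2 * norm (A s - A t)) \<longlongrightarrow> 0) (at t within S)" by (rule tendsto_mult_right_zero[OF A0])
    have "\<forall>\<^sub>F s in at t within S. norm (A s - A t) < 1 / (2 * N)"
      using order_tendstoD(2)[OF A0] \<open>0 < N\<close> by simp
    moreover have "\<forall>\<^sub>F s in at t within S. s \<in> S" by (simp add: eventually_at_filter)
    ultimately show "\<forall>\<^sub>F s in at t within S. norm (inv_op (A s) - inv_op (A t)) \<le> 2 * N\<^sup>2 * norm (A s - A t)"
      by eventually_elim (rule bound)
  qed
  then show ?thesis by (simp add: LIM_zero_iff)
qed

lemma bounded_linear_scaleC_cblinfun: "bounded_linear (\<lambda>T::'a::complex_hilbert \<Rightarrow>\<^sub>C\<^sub>L 'b::complex_hilbert. c *\<^sub>C T)"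
  by (rule bounded_linear_intro[where K = "cmod c"])
    (simp_all add: scaleC_add_right scaleC_scaleR norm_scaleC_cblinfun mult.commute)

context half_open_interval
begin

text \<open>The derivative of the inverse is
  \<open>- A\<^sup>-\<^sup>1 A' A\<^sup>-\<^sup>1\<close>, which reduces one order to the preceding
  one.\<close>

lemma Ck_on_inv_op:
  fixes A :: "real \<Rightarrow> 'a::complex_hilbert \<Rightarrow>\<^sub>C\<^sub>L 'b::complex_hilbert"
  assumes inv: "\<And>t. t \<in> \<Delta> \<Longrightarrow> invertible_op (A t)"
  shows "Ck_on \<Delta> m A \<Longrightarrow> Ck_on \<Delta> m (\<lambda>t. inv_op (A t))"
proof (induction m)
  case 0
  then show ?case
    using inv_op_tendsto inv unfolding Ck_on_0 continuous_on_def by blast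
next
  case (Suc m)
  have IH: "Ck_on \<Delta> m (\<lambda>t. inv_op (A t))" using Suc Ck_on_mono le_SucI by blast
  have A_cont: "(A \<longlongrightarrow> A t) (at t within \<Delta>)" if "t \<in> \<Delta>" for t
    using Ck_on_continuous[OF Suc.prems] that by (simp add: continuous_on_def)
  let ?D = "\<lambda>t. - ((inv_op (A t) o\<^sub>C\<^sub>L Dx \<Delta> 1 A t) o\<^sub>C\<^sub>L inv_op (A t))"
  show ?case
  proof (rule Ck_on_SucI)
    fix t assume t: "t \<in> \<Delta>"
    have lim: "((\<lambda>s. inv_op (A s)) \<longlongrightarrow> inv_op (A t)) (at t within \<Delta>)"
      by (rule inv_op_tendsto[OF A_cont[OF t]]) (use inv t in auto)
    have quot: "((\<lambda>s. (A s - A t) /\<^sub>R (s - t)) \<longlongrightarrow> Dx \<Delta> 1 A t) (at t within \<Delta>)"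
      using Ck_on_SucD[OF Suc.prems t] by (simp add: has_vector_derivative_quotient)
    have "((\<lambda>s. - ((inv_op (A s) o\<^sub>C\<^sub>L ((A s - A t) /\<^sub>R (s - t))) o\<^sub>C\<^sub>L inv_op (A t))) \<longlongrightarrow> ?D t) (at t within \<Delta>)"
      by (intro tendsto_minus bounded_bilinear.tendsto[OF bounded_bilinear_cblinfun_compose] lim quot tendsto_const)
    then show "((\<lambda>t. inv_op (A t)) has_vector_derivative ?D t) (at t within \<Delta>)"
      unfolding has_vector_derivative_quotient
    proof (rule Lim_transform_eventually)
      have "(inv_op (A s) - inv_op (A t)) /\<^sub>R (s - t) = - ((inv_op (A s) o\<^sub>C\<^sub>L ((A s - A t) /\<^sub>R (s - t))) o\<^sub>C\<^sub>L inv_op (A t))" if "s \<in> \<Delta>" for s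
        unfolding inv_op_diff[OF inv[OF that] inv[OF t]]
        by (rule cblinfun_eqI) (simp add: cblinfun_linear)
      then show "\<forall>\<^sub>F s in at t within \<Delta>. - ((inv_op (A s) o\<^sub>C\<^sub>L ((A s - A t) /\<^sub>R (s - t))) o\<^sub>C\<^sub>L inv_op (A t)) = (inv_op (A s) - inv_op (A t)) /\<^sub>R (s - t)"
        by (simp add: eventually_at_filter)
    qed
  next
    show "Ck_on \<Delta> m ?D"
      by (intro Ck_on_minus Ck_on_bilinear[OF bounded_bilinear_cblinfun_compose] IH)
        (use Suc.prems in \<open>simp add: Ck_on_Suc\<close>)
  qed
qed

end

text \<open>The common properties of applying an operator to a vector and composing it with an
  operator, so that one theory serves vector and operator functions.\<close>

locale differential_expression = half_open_interval +
  fixes act :: "('h::complex_hilbert \<Rightarrow>\<^sub>C\<^sub>L 'h) \<Rightarrow> 'v::{banach, complex_vector} \<Rightarrow> 'v" and n :: nat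
    and p q :: "nat \<Rightarrow> real \<Rightarrow> 'h \<Rightarrow>\<^sub>C\<^sub>L 'h"
  assumes bilinear: "bounded_bilinear act"
    and act_compose: "\<And>S T v. act S (act T v) = act (S o\<^sub>C\<^sub>L T) v"
    and act_id: "\<And>v. act cblinfun_id v = v"
    and act_scaleC: "\<And>c T v. c *\<^sub>C act T v = act (c *\<^sub>C T) v"
    and coefficients: "coefficients_ok \<Delta> n p q"
    and n_pos: "0 < n"
begin

abbreviation Q :: "(real \<Rightarrow> 'v) \<Rightarrow> nat \<Rightarrow> real \<Rightarrow> 'v" where "Q \<equiv> quasi_deriv act \<Delta> n p q"
abbreviation l :: "(real \<Rightarrow> 'v) \<Rightarrow> real \<Rightarrow> 'v" where "l \<equiv> l_expr act \<Delta> n p q"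

lemma bounded_linear_act: "bounded_linear (act T)"
  by (rule bounded_bilinear.bounded_linear_right[OF bilinear])

text \<open>The class of values does not relate the norm to complex multiples; boundedness of
  scaling holds because it is the action of a multiple of the identity.\<close>

lemma bounded_linear_scaleC_v: "bounded_linear (\<lambda>v::'v. c *\<^sub>C v)"
proof -
  have "act (c *\<^sub>C cblinfun_id) = (\<lambda>v. c *\<^sub>C v)" by (auto simp: act_id fun_eq_iff simp flip: act_scaleC)
  then show ?thesis using bounded_linear_act[of "c *\<^sub>C cblinfun_id"] by metis
qed

lemma p_Ck: "k \<le> n \<Longrightarrow> m \<le> k \<Longrightarrow> Ck_on \<Delta> m (p (n - k))"
  using coefficients Ck_on_mono[of \<Delta> k "p (n - k)" m] unfolding coefficients_ok_def
  by (metis diff_diff_cancel diff_le_self)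

lemma q_Ck: "0 < k \<Longrightarrow> k \<le> n \<Longrightarrow> m \<le> k \<Longrightarrow> Ck_on \<Delta> m (\<lambda>t. (\<i> / 2) *\<^sub>C q (n - k) t)"
    "0 < k \<Longrightarrow> k \<le> n \<Longrightarrow> m \<le> k \<Longrightarrow> Ck_on \<Delta> m (\<lambda>t. (\<i> / 2) *\<^sub>C adj (q (n - k) t))"
proof -
  assume k: "0 < k" "k \<le> n" "m \<le> k"
  then have "Ck_on \<Delta> k (q (n - k))"
    using coefficients unfolding coefficients_ok_def by (metis diff_diff_cancel diff_less n_pos)
  then have q: "Ck_on \<Delta> m (q (n - k))" using Ck_on_mono k(3) by blast
  show "Ck_on \<Delta> m (\<lambda>t. (\<i> / 2) *\<^sub>C q (n - k) t)" by (rule Ck_on_linear[OF bounded_linear_scaleC_cblinfun q])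
  show "Ck_on \<Delta> m (\<lambda>t. (\<i> / 2) *\<^sub>C adj (q (n - k) t))"
    by (rule Ck_on_linear[OF bounded_linear_scaleC_cblinfun Ck_on_linear[OF bounded_linear_adj q]])
qed

lemma p0_invertible: "t \<in> \<Delta> \<Longrightarrow> invertible_op (p 0 t)"
  using coefficients unfolding coefficients_ok_def by blast

lemma p0_inv_Ck: "m \<le> n \<Longrightarrow> Ck_on \<Delta> m (\<lambda>t. inv_op (p 0 t))"
  using Ck_on_inv_op[OF p0_invertible, where m = m] p_Ck[of n m] by simp

lemma p0_inv_act: "t \<in> \<Delta> \<Longrightarrow> act (inv_op (p 0 t)) (act (p 0 t) v) = v" "t \<in> \<Delta> \<Longrightarrow> act (p 0 t) (act (inv_op (p 0 t)) v) = v"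
proof -
  assume t: "t \<in> \<Delta>"
  have "inv_op (p 0 t) o\<^sub>C\<^sub>L p 0 t = cblinfun_id" "p 0 t o\<^sub>C\<^sub>L inv_op (p 0 t) = cblinfun_id"
    by (rule cblinfun_eqI, simp add: inv_op_apply[OF p0_invertible[OF t]])+
  then show "act (inv_op (p 0 t)) (act (p 0 t) v) = v" "act (p 0 t) (act (inv_op (p 0 t)) v) = v"
    by (simp_all add: act_compose act_id)
qed

text \<open>The state \<open>x\<close> carries the values of the quasi-derivatives. \<open>top\<close> recovers \<open>D\<^sup>n y\<close> from it and
  \<open>low\<close> all the derivatives \<open>D\<^sup>k y\<close>, \<open>k \<le> n\<close>.\<close>

definition top :: "real \<Rightarrow> (nat \<Rightarrow> 'v) \<Rightarrow> 'v"
  where "top t x = act (inv_op (p 0 t)) (x n + act ((\<i> / 2) *\<^sub>C q 0 t) (x (n - 1)))"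

definition low :: "nat \<Rightarrow> real \<Rightarrow> (nat \<Rightarrow> 'v) \<Rightarrow> 'v"
  where "low k t x = (if k < n then x k else top t x)"

text \<open>The derivative-free part of the quasi-derivative of order 2n - k, that is, without the
  derivative of the preceding quasi-derivative. Counting from the top makes the index agree with the
  order of the derivative of y; \<open>bulk n\<close> is the whole quasi-derivative of order n, and
  \<open>bulk 0\<close> belongs to \<open>l[y]\<close>. The case distinctions remove the q terms
  that are absent for k = n and k = 0.\<close>

definition bulk :: "nat \<Rightarrow> real \<Rightarrow> (nat \<Rightarrow> 'v) \<Rightarrow> 'v"
  where "bulk k t d = act (p (n - k) t) (d k)
    + (if k < n then act ((\<i> / 2) *\<^sub>C adj (q (n - Suc k) t)) (d (Suc k)) else 0)
    - (if 0 < k then act ((\<i> / 2) *\<^sub>C q (n - k) t) (d (k - 1)) else 0)"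

text \<open>The first order system without the spectral term. In the last equation the nonexistent
  next state is replaced by 0, so there \<open>rhs\<close> stands for the derivative of the last
  quasi-derivative plus \<open>l[y]\<close>.\<close>

definition rhs :: "nat \<Rightarrow> real \<Rightarrow> (nat \<Rightarrow> 'v) \<Rightarrow> 'v"
  where "rhs k t x = (if Suc k < n then x (Suc k) else if Suc k = n then top t x
    else bulk (2 * n - 1 - k) t (\<lambda>i. low i t x) - (if Suc k < 2 * n then x (Suc k) else 0))"

lemma Q_low: "k < n \<Longrightarrow> Q y k = Dx \<Delta> k y"
  by (cases k) auto

lemma Q_n: "Q y n t = bulk n t (\<lambda>i. Dx \<Delta> i y t)"
proof -
  obtain m where m: "n = Suc m" using n_pos gr0_conv_Suc by blast
  have "Q y (Suc m) t = act (p 0 t) (Dx \<Delta> n y t) - (\<i> / 2) *\<^sub>C act (q 0 t) (Dx \<Delta> (n - 1) y t)"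
    using m by (simp only: quasi_deriv.simps) simp
  then show ?thesis using n_pos by (simp add: bulk_def act_scaleC flip: m)
qed

lemma Q_high:
  assumes "0 < k" "k < n"
  shows "Q y (2 * n - k) t = bulk k t (\<lambda>i. Dx \<Delta> i y t) - Dx \<Delta> 1 (Q y (2 * n - Suc k)) t"
proof -
  have gen: "Q y (Suc m) t = - Dx \<Delta> 1 (Q y m) t + act (p (Suc m - n) t) (Dx \<Delta> (n - (Suc m - n)) y t)
      + (\<i> / 2) *\<^sub>C (act (adj (q (Suc m - n - 1) t)) (Dx \<Delta> (n - (Suc m - n) + 1) y t)
                    - act (q (Suc m - n) t) (Dx \<Delta> (n - (Suc m - n) - 1) y t))" if "n \<le> m" for m
    using that by (simp add: Let_def)
  have m: "n \<le> 2 * n - Suc k" "Suc (2 * n - Suc k) = 2 * n - k" "2 * n - k - n = n - k" "n - (n - k) = k" "n - k - 1 = n - Suc k"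
    using assms by auto
  show ?thesis
    using assms gen[OF m(1), unfolded m(2), unfolded m(3), unfolded m(4,5)]
    by (simp add: bulk_def scaleC_diff_right act_scaleC)
qed

lemma bulk_Ck:
  assumes y: "\<And>i. i \<le> (if k < n then Suc k else n) \<Longrightarrow> Ck_on \<Delta> m (Dx \<Delta> i y)" and m: "m \<le> k" "k \<le> n"
  shows "Ck_on \<Delta> m (\<lambda>t. bulk k t (\<lambda>i. Dx \<Delta> i y t))"
proof -
  have "Ck_on \<Delta> m (\<lambda>t. act (p (n - k) t) (Dx \<Delta> k y t))"
    using assms by (intro Ck_on_bilinear[OF bilinear] p_Ck y) auto
  moreover have "Ck_on \<Delta> m (\<lambda>t. act ((\<i> / 2) *\<^sub>C adj (q (n - Suc k) t)) (Dx \<Delta> (Suc k) y t))" if "k < n"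
    using assms that by (intro Ck_on_bilinear[OF bilinear] q_Ck y) auto
  moreover have "Ck_on \<Delta> m (\<lambda>t. act ((\<i> / 2) *\<^sub>C q (n - k) t) (Dx \<Delta> (k - 1) y t))" if "0 < k"
    using assms that by (intro Ck_on_bilinear[OF bilinear] q_Ck y) auto
  ultimately show ?thesis
    unfolding bulk_def by (cases "k < n"; cases "0 < k") (auto intro!: Ck_on_diff Ck_on_add)
qed

text \<open>Continuous differentiability of the quasi-derivatives is bootstrapped to ordinary
  regularity of y, one order at a time: what is known about y enters the lower-order terms, makes
  the quasi-derivative of order n smoother, and inverting p 0 passes this on to the n-th
  derivative.\<close>

lemma regular_Ck:
  assumes Q: "\<And>i. i \<le> 2 * n - 2 \<Longrightarrow> Ck_on \<Delta> 1 (Q y i)"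
  shows "Ck_on \<Delta> (2 * n - 1) y"
proof -
  have low: "Ck_on \<Delta> 1 (Dx \<Delta> i y)" if "i < n" for i using Q[of i] that Q_low[of i y] by simp
  have "Ck_on \<Delta> (n + j) y" if "j \<le> n - 1" for j
    using that
  proof (induction j)
    case 0
    show ?case
      using Ck_on_from_Dx[of "n - 1" \<Delta> y 1] low n_pos by simp
  next
    case (Suc j)
    then have y: "Ck_on \<Delta> (n + j) y" by simp
    \<comment> \<open>Downwards from order n + j, where the hypothesis gives one derivative, to
      order n, gaining one derivative at each step.\<close>
    have step: "Ck_on \<Delta> (j + 1 - i) (Q y (n + i))" if "i \<le> j" for i
      using that
    proof (induction i rule: inc_induct)
      case base
      show ?case using Q[of "n + j"] Suc.prems by simp
    next
      case (step i)
      let ?k = "n - Suc i"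
      have k: "0 < ?k" "?k < n" "2 * n - ?k = n + Suc i" "2 * n - Suc ?k = n + i" using step Suc.prems by auto
      have der: "(Q y (n + i) has_vector_derivative bulk ?k t (\<lambda>i. Dx \<Delta> i y t) - Q y (n + Suc i) t) (at t within \<Delta>)" if "t \<in> \<Delta>" for t
      proof -
        have "Ck_on \<Delta> (Suc 0) (Q y (n + i))" using Q[of "n + i"] step Suc.prems by simp
        then have "(Q y (n + i) has_vector_derivative Dx \<Delta> 1 (Q y (n + i)) t) (at t within \<Delta>)" by (rule Ck_on_SucD[OF _ that])
        moreover have "bulk ?k t (\<lambda>i. Dx \<Delta> i y t) - Q y (n + Suc i) t = Dx \<Delta> 1 (Q y (n + i)) t"
          by (simp only: Q_high[OF k(1,2), of y t, unfolded k(3,4)]) simp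
        ultimately show ?thesis by (simp only:)
      qed
      have "Ck_on \<Delta> (j - i) (\<lambda>t. bulk ?k t (\<lambda>i. Dx \<Delta> i y t))"
      proof (rule bulk_Ck)
        show "Ck_on \<Delta> (j - i) (Dx \<Delta> m y)" if "m \<le> (if ?k < n then Suc ?k else n)" for m
          by (rule Ck_on_Dx[OF Ck_on_mono[OF y]]) (use that step Suc.prems in \<open>auto split: if_splits\<close>)
      qed (use step Suc.prems in auto)
      then have "Ck_on \<Delta> (j - i) (\<lambda>t. bulk ?k t (\<lambda>i. Dx \<Delta> i y t) - Q y (n + Suc i) t)"
        using step.IH by (intro Ck_on_diff) simp_all
      then show ?case using Ck_on_SucI[OF der] step.hyps by (simp add: Suc_diff_le)
    qed
    have "Ck_on \<Delta> (Suc j) (\<lambda>t. act (inv_op (p 0 t)) (Q y n t + act ((\<i> / 2) *\<^sub>C q (n - n) t) (Dx \<Delta> (n - 1) y t)))"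
    proof (intro Ck_on_bilinear[OF bilinear] Ck_on_add p0_inv_Ck q_Ck)
      show "Ck_on \<Delta> (Suc j) (Q y n)" using step[of 0] by simp
      show "Ck_on \<Delta> (Suc j) (Dx \<Delta> (n - 1) y)" by (rule Ck_on_Dx[OF Ck_on_mono[OF y]]) (use n_pos in auto)
    qed (use Suc.prems n_pos in auto)
    then have "Ck_on \<Delta> (Suc j) (Dx \<Delta> n y)"
    proof (rule Ck_on_cong[rotated])
      show "act (inv_op (p 0 t)) (Q y n t + act ((\<i> / 2) *\<^sub>C q (n - n) t) (Dx \<Delta> (n - 1) y t)) = Dx \<Delta> n y t" if "t \<in> \<Delta>" for t
        using n_pos by (simp add: Q_n bulk_def p0_inv_act[OF that])
    qed
    then show ?case using Ck_on_from_Dx[of n \<Delta> y "Suc j"] low by (simp add: add.commute)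
  qed
  from this[of "n - 1"] show ?thesis using n_pos by (simp add: mult_2)
qed

text \<open>\<open>l[y]\<close> in terms of quasi-derivatives, at a single point: only there is \<open>y\<^sup>[\<^sup>2\<^sup>n\<^sup>-\<^sup>1\<^sup>]\<close> assumed differentiable.\<close>

lemma l_eq:
  assumes Q: "\<And>i. i \<le> 2 * n - 2 \<Longrightarrow> Ck_on \<Delta> 1 (Q y i)"
    and t: "t \<in> \<Delta>" and diff: "Q y (2 * n - 1) differentiable (at t within \<Delta>)"
  shows "l y t = bulk 0 t (\<lambda>i. Dx \<Delta> i y t) - Dx \<Delta> 1 (Q y (2 * n - 1)) t"
proof -
  define e where "e k t = bulk k t (\<lambda>i. Dx \<Delta> i y t)" for k t
  have y: "Ck_on \<Delta> (2 * n - 1) y" by (rule regular_Ck[OF Q])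
  have Dy: "Ck_on \<Delta> m (Dx \<Delta> i y)" if "m + i \<le> 2 * n - 1" for m i
    by (rule Ck_on_Dx[OF Ck_on_mono[OF y that]])
  have e_Ck: "Ck_on \<Delta> k (e k)" if "k < n" for k
    unfolding e_def by (rule bulk_Ck) (use that Dy in \<open>auto split: if_splits\<close>)
  have en_Ck: "Ck_on \<Delta> (n - 1) (e n)"
    unfolding e_def by (rule bulk_Ck) (use Dy in auto)
  \<comment> \<open>Unfolding the recursion of the quasi-derivatives gives an alternating sum, which
    l must reproduce after one more differentiation.\<close>
  have expansion: "Q y (2 * n - k) s = (\<Sum>m=k..n. (-1) ^ (m - k) *\<^sub>R Dx \<Delta> (m - k) (e m) s)"
    if "1 \<le> k" "k \<le> n" "s \<in> \<Delta>" for k s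
    using that(2,1,3)
  proof (induction k arbitrary: s rule: inc_induct)
    case base
    then show ?case by (simp add: mult_2 e_def Q_n)
  next
    case (step k)
    have *: "(Q y (2 * n - Suc k) has_vector_derivative (\<Sum>m=Suc k..n. (-1) ^ (m - Suc k) *\<^sub>R Dx \<Delta> (m - k) (e m) s)) (at s within \<Delta>)"
    proof (rule has_vector_derivative_transform[OF _ step.IH])
      show "((\<lambda>s. \<Sum>m=Suc k..n. (-1) ^ (m - Suc k) *\<^sub>R Dx \<Delta> (m - Suc k) (e m) s) has_vector_derivative
          (\<Sum>m=Suc k..n. (-1) ^ (m - Suc k) *\<^sub>R Dx \<Delta> (m - k) (e m) s)) (at s within \<Delta>)"
      proof (rule has_vector_derivative_sum)
        fix m assume m: "m \<in> {Suc k..n}"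
        have "Ck_on \<Delta> (Suc (m - Suc k)) (e m)"
          using e_Ck[of m] en_Ck m step.prems by (cases "m = n") (auto intro: Ck_on_mono)
        then have "Ck_on \<Delta> (Suc 0) (Dx \<Delta> (m - Suc k) (e m))" using Ck_on_Dx[of \<Delta> "Suc 0"] by simp
        from Ck_on_SucD[OF this step.prems(2)]
        have "(Dx \<Delta> (m - Suc k) (e m) has_vector_derivative Dx \<Delta> (m - k) (e m) s) (at s within \<Delta>)"
          using m by (simp add: Dx_Dx Suc_diff_Suc Suc_diff_le)
        then show "((\<lambda>s. (-1) ^ (m - Suc k) *\<^sub>R Dx \<Delta> (m - Suc k) (e m) s) has_vector_derivative
            (-1) ^ (m - Suc k) *\<^sub>R Dx \<Delta> (m - k) (e m) s) (at s within \<Delta>)"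
          by (rule bounded_linear.has_vector_derivative[OF bounded_linear_scaleR_right])
      qed
    qed (use step.prems in auto)
    have "Q y (2 * n - k) s = e k s - (\<Sum>m=Suc k..n. (-1) ^ (m - Suc k) *\<^sub>R Dx \<Delta> (m - k) (e m) s)"
      using Q_high[of k y s] step Dx1_eq[OF * step.prems(2)] by (simp add: e_def)
    also have "\<dots> = e k s + (\<Sum>m=Suc k..n. (-1) ^ (m - k) *\<^sub>R Dx \<Delta> (m - k) (e m) s)"
    proof -
      have "- ((-1) ^ (m - Suc k) *\<^sub>R v) = (-1) ^ (m - k) *\<^sub>R v" if "m \<in> {Suc k..n}" for m and v :: 'v
      proof -
        have "m - k = Suc (m - Suc k)" using that by auto
        then show ?thesis by simp
      qed
      then show ?thesis by (simp add: sum_negf[symmetric])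
    qed
    also have "\<dots> = (\<Sum>m=k..n. (-1) ^ (m - k) *\<^sub>R Dx \<Delta> (m - k) (e m) s)"
      using step by (subst (2) sum.atLeast_Suc_atMost) auto
    finally show ?case .
  qed
  have exp1: "Q y (2 * n - 1) s = (\<Sum>m=1..n. (-1) ^ (m - 1) *\<^sub>R Dx \<Delta> (m - 1) (e m) s)" if "s \<in> \<Delta>" for s
    using expansion[of 1 s] n_pos that by simp
  have d_low: "Dx \<Delta> (m - 1) (e m) differentiable (at t within \<Delta>)" if "1 \<le> m" "m < n" for m
    using e_Ck[OF that(2)] that t unfolding Ck_on_def by auto
  \<comment> \<open>At t only the whole alternating sum is known to be differentiable. Solving it
    for the term with m = n, whose companions are smooth enough, shows that this term is
    differentiable too.\<close>
  have "(\<lambda>s. (-1) ^ (n - 1) *\<^sub>R (Q y (2 * n - 1) s - (\<Sum>m=1..<n. (-1) ^ (m - 1) *\<^sub>R Dx \<Delta> (m - 1) (e m) s))) differentiable (at t within \<Delta>)"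
    by (intro differentiable_scaleR differentiable_diff differentiable_sum diff differentiable_const) (use d_low in auto)
  then have d_n: "Dx \<Delta> (n - 1) (e n) differentiable (at t within \<Delta>)"
  proof (rule differentiable_transform_within[of _ t \<Delta> 1])
    fix s assume "s \<in> \<Delta>"
    have "{1..n} = insert n {1..<n}" using n_pos by auto
    then have "Q y (2 * n - 1) s = (-1) ^ (n - 1) *\<^sub>R Dx \<Delta> (n - 1) (e n) s + (\<Sum>m=1..<n. (-1) ^ (m - 1) *\<^sub>R Dx \<Delta> (m - 1) (e m) s)"
      unfolding exp1[OF \<open>s \<in> \<Delta>\<close>] by simp
    then show "(-1) ^ (n - 1) *\<^sub>R (Q y (2 * n - 1) s - (\<Sum>m=1..<n. (-1) ^ (m - 1) *\<^sub>R Dx \<Delta> (m - 1) (e m) s)) = Dx \<Delta> (n - 1) (e n) s"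
      by (simp add: power_mult_distrib[symmetric] flip: power_add)
  qed (use t in auto)
  have d_at: "derivable_at m t (e m)" if "m \<le> n" for m
    using that Ck_on_derivable_at[OF e_Ck t] d_n en_Ck by (cases "m = n") (auto simp: derivable_at_def)
  have "(Q y (2 * n - 1) has_vector_derivative (\<Sum>m=1..n. (-1) ^ (m - 1) *\<^sub>R Dx \<Delta> m (e m) t)) (at t within \<Delta>)"
  proof (rule has_vector_derivative_transform[OF t exp1])
    show "((\<lambda>s. \<Sum>m=1..n. (-1) ^ (m - 1) *\<^sub>R Dx \<Delta> (m - 1) (e m) s) has_vector_derivative
        (\<Sum>m=1..n. (-1) ^ (m - 1) *\<^sub>R Dx \<Delta> m (e m) t)) (at t within \<Delta>)"
    proof (rule has_vector_derivative_sum)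
      fix m assume m: "m \<in> {1..n}"
      then have "Dx \<Delta> (m - 1) (e m) differentiable (at t within \<Delta>)" using d_low d_n by (cases "m = n") auto
      from Dx_has_derivative[OF this] have "(Dx \<Delta> (m - 1) (e m) has_vector_derivative Dx \<Delta> m (e m) t) (at t within \<Delta>)"
        using m by (simp add: Dx_Dx)
      then show "((\<lambda>s. (-1) ^ (m - 1) *\<^sub>R Dx \<Delta> (m - 1) (e m) s) has_vector_derivative (-1) ^ (m - 1) *\<^sub>R Dx \<Delta> m (e m) t) (at t within \<Delta>)"
        by (rule bounded_linear.has_vector_derivative[OF bounded_linear_scaleR_right])
    qed
  qed
  then have D1: "Dx \<Delta> 1 (Q y (2 * n - 1)) t = (\<Sum>m=1..n. (-1) ^ (m - 1) *\<^sub>R Dx \<Delta> m (e m) t)" by (rule Dx1_eq[OF _ t])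
  \<comment> \<open>The definition of l differentiates the p term and the two q terms separately,
    while the quasi-derivatives contain them combined in e; the pieces must be separated before the
    derivatives are compared.\<close>
  define ea eb ec where "ea k s = act (p (n - k) s) (Dx \<Delta> k y s)" and "eb k s = act ((\<i> / 2) *\<^sub>C q (n - k) s) (Dx \<Delta> (k - 1) y s)"
    and "ec k s = act ((\<i> / 2) *\<^sub>C adj (q (n - k) s)) (Dx \<Delta> k y s)" for k s
  have eb_Ck: "Ck_on \<Delta> k (eb k)" if "0 < k" "k \<le> n" for k
    unfolding eb_def by (intro Ck_on_bilinear[OF bilinear] q_Ck Dy) (use that in auto)
  have ec_Ck: "Ck_on \<Delta> (k - 1) (ec k)" if "0 < k" "k \<le> n" for k
    unfolding ec_def by (intro Ck_on_bilinear[OF bilinear] q_Ck Dy) (use that in auto)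
  have ea_Ck: "Ck_on \<Delta> k (ea k)" if "k < n" for k
    unfolding ea_def by (intro Ck_on_bilinear[OF bilinear] p_Ck Dy) (use that in auto)
  \<comment> \<open>For k = n the leading p term alone has no known regularity of order n; it
    inherits it from e n and the q term.\<close>
  have ea_at: "derivable_at k t (ea k)" if "k \<le> n" for k
  proof (cases "k < n")
    case False
    then have k: "k = n" using that by simp
    have "derivable_at n t (\<lambda>s. e n s + eb n s)"
      using Dx_add(2)[OF d_at[of n] Ck_on_derivable_at[OF eb_Ck[of n] t] t] n_pos by simp
    moreover have "(\<lambda>s. e n s + eb n s) = ea n" using n_pos by (auto simp: e_def bulk_def ea_def eb_def)
    ultimately show ?thesis by (simp add: k)
  qed (rule Ck_on_derivable_at[OF ea_Ck t])
  have De: "Dx \<Delta> k (e k) t = Dx \<Delta> k (ea k) t + (if k < n then Dx \<Delta> k (ec (Suc k)) t else 0) - (if 0 < k then Dx \<Delta> k (eb k) t else 0)"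
    if "k \<le> n" for k
  proof -
    define f where "f s = (if k < n then ec (Suc k) s else 0)" for s
    define g where "g s = (if 0 < k then eb k s else 0)" for s
    have f: "derivable_at k t f" "Dx \<Delta> k f t = (if k < n then Dx \<Delta> k (ec (Suc k)) t else 0)"
    proof -
      have "Dx \<Delta> k (\<lambda>s. 0 *\<^sub>R (0::'v)) t = 0 *\<^sub>R Dx \<Delta> k (\<lambda>s. 0::'v) t"
        by (rule Dx_linear[OF bounded_linear_scaleR_right Ck_on_derivable_at[OF Ck_on_const t] t])
      then have "Dx \<Delta> k (\<lambda>s. 0::'v) t = 0" by simp
      then show "derivable_at k t f" "Dx \<Delta> k f t = (if k < n then Dx \<Delta> k (ec (Suc k)) t else 0)"
        using Ck_on_derivable_at[OF Ck_on_const t, of k "0::'v"] Ck_on_derivable_at[OF ec_Ck[of "Suc k"] t]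
        by (cases "k < n"; simp add: f_def[abs_def])+
    qed
    have g: "derivable_at k t (\<lambda>s. - g s)" "Dx \<Delta> k (\<lambda>s. - g s) t = - (if 0 < k then Dx \<Delta> k (eb k) t else 0)"
    proof -
      have lin: "bounded_linear (\<lambda>v::'v. - v)" by (rule bounded_linear_minus[OF bounded_linear_ident])
      show "derivable_at k t (\<lambda>s. - g s)"
        using derivable_at_linear[OF lin Ck_on_derivable_at[OF eb_Ck[of k] t] t] that by (cases "0 < k") (auto simp: g_def[abs_def] derivable_at_def)
      show "Dx \<Delta> k (\<lambda>s. - g s) t = - (if 0 < k then Dx \<Delta> k (eb k) t else 0)"
        using Dx_linear[OF lin Ck_on_derivable_at[OF eb_Ck[of k] t] t] that by (cases "0 < k") (auto simp: g_def[abs_def])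
    qed
    have "e k = (\<lambda>s. (ea k s + f s) + - g s)"
      by (auto simp: e_def bulk_def ea_def f_def g_def eb_def ec_def)
    then show ?thesis
      using Dx_add[OF Dx_add(2)[OF ea_at[OF that] f(1) t] g(1) t] Dx_add(1)[OF ea_at[OF that] f(1) t]
      by (simp add: f(2) g(2))
  qed
  have "l y t = (\<Sum>k=1..n. (-1) ^ k *\<^sub>R (Dx \<Delta> k (ea k) t - (Dx \<Delta> (k - 1) (ec k) t + Dx \<Delta> k (eb k) t))) + ea 0 t"
    unfolding l_expr_def
  proof (intro arg_cong2[where f = "(+)"] sum.cong refl arg_cong2[where f = "(*\<^sub>R)"] arg_cong2[where f = "(-)"])
    fix k assume k: "k \<in> {1..n}"
    have 1: "(\<i> / 2) *\<^sub>C Dx \<Delta> (k - 1) (\<lambda>s. act (adj (q (n - k) s)) (Dx \<Delta> k y s)) t = Dx \<Delta> (k - 1) (ec k) t"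
    proof -
      have "Ck_on \<Delta> (k - 1) (\<lambda>s. act (adj (q (n - k) s)) (Dx \<Delta> k y s))"
        using Ck_on_linear[OF bounded_linear_scaleC_v ec_Ck[of k], of "2 / \<i>"] k
        by (simp add: ec_def[abs_def] act_scaleC scaleC_scaleC)
      from Dx_linear[OF bounded_linear_scaleC_v Ck_on_derivable_at[OF this t] t, of "\<i> / 2"]
      show ?thesis by (simp add: ec_def[abs_def] act_scaleC)
    qed
    have 2: "(\<i> / 2) *\<^sub>C Dx \<Delta> k (\<lambda>s. act (q (n - k) s) (Dx \<Delta> (k - 1) y s)) t = Dx \<Delta> k (eb k) t"
    proof -
      have "Ck_on \<Delta> k (\<lambda>s. act (q (n - k) s) (Dx \<Delta> (k - 1) y s))"
        using Ck_on_linear[OF bounded_linear_scaleC_v eb_Ck[of k], of "2 / \<i>"] k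
        by (simp add: eb_def[abs_def] act_scaleC scaleC_scaleC)
      from Dx_linear[OF bounded_linear_scaleC_v Ck_on_derivable_at[OF this t] t, of "\<i> / 2"]
      show ?thesis by (simp add: eb_def[abs_def] act_scaleC)
    qed
    show "(\<i> / 2) *\<^sub>C (Dx \<Delta> (k - 1) (\<lambda>s. act (adj (q (n - k) s)) (Dx \<Delta> k y s)) t + Dx \<Delta> k (\<lambda>s. act (q (n - k) s) (Dx \<Delta> (k - 1) y s)) t)
        = Dx \<Delta> (k - 1) (ec k) t + Dx \<Delta> k (eb k) t"
      unfolding scaleC_add_right 1 2 ..
  qed (simp_all add: ea_def[abs_def])
  also have "\<dots> = (\<Sum>k\<le>n. (-1) ^ k *\<^sub>R Dx \<Delta> k (e k) t)"
  proof -
    have "(\<Sum>k\<le>n. (-1) ^ k *\<^sub>R Dx \<Delta> k (e k) t) =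
        (\<Sum>k\<le>n. (-1) ^ k *\<^sub>R Dx \<Delta> k (ea k) t) + (\<Sum>k\<le>n. (-1) ^ k *\<^sub>R (if k < n then Dx \<Delta> k (ec (Suc k)) t else 0))
        - (\<Sum>k\<le>n. (-1) ^ k *\<^sub>R (if 0 < k then Dx \<Delta> k (eb k) t else 0))"
      by (simp add: De scaleR_add_right scaleR_diff_right sum.distrib sum_subtractf)
    also have "(\<Sum>k\<le>n. (-1) ^ k *\<^sub>R Dx \<Delta> k (ea k) t) = ea 0 t + (\<Sum>k=1..n. (-1) ^ k *\<^sub>R Dx \<Delta> k (ea k) t)"
      by (simp add: atMost_atLeast0 sum.atLeast_Suc_atMost)
    also have "(\<Sum>k\<le>n. (-1) ^ k *\<^sub>R (if 0 < k then Dx \<Delta> k (eb k) t else 0)) = (\<Sum>k=1..n. (-1) ^ k *\<^sub>R Dx \<Delta> k (eb k) t)"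
      by (simp add: atMost_atLeast0 sum.atLeast_Suc_atMost)
    also have "(\<Sum>k\<le>n. (-1) ^ k *\<^sub>R (if k < n then Dx \<Delta> k (ec (Suc k)) t else 0)) = (\<Sum>k<n. (-1) ^ k *\<^sub>R Dx \<Delta> k (ec (Suc k)) t)"
      by (simp add: lessThan_Suc_atMost[symmetric])
    \<comment> \<open>The adjoint q terms sit one index lower in the quasi-derivatives than in l;
      the shift of the index changes the sign.\<close>
    also have "\<dots> = - (\<Sum>k=1..n. (-1) ^ k *\<^sub>R Dx \<Delta> (k - 1) (ec k) t)"
      unfolding One_nat_def by (subst sum.atLeast1_atMost_eq) (simp add: sum_negf)
    finally show ?thesis by (simp add: sum.distrib sum_subtractf scaleR_add_right scaleR_diff_right)
  qed
  also have "\<dots> = e 0 t + (\<Sum>k=1..n. (-1) ^ k *\<^sub>R Dx \<Delta> k (e k) t)"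
    by (simp add: atMost_atLeast0 sum.atLeast_Suc_atMost)
  also have "(\<Sum>k=1..n. (-1) ^ k *\<^sub>R Dx \<Delta> k (e k) t) = - (\<Sum>m=1..n. (-1) ^ (m - 1) *\<^sub>R Dx \<Delta> m (e m) t)"
  proof -
    have "(-1) ^ k *\<^sub>R v = - ((-1) ^ (k - 1) *\<^sub>R v)" if "k \<in> {1..n}" for k and v :: 'v
      using that by (cases k) auto
    then show ?thesis by (simp add: sum_negf[symmetric])
  qed
  finally show ?thesis unfolding D1 by (simp add: e_def)
qed

end



section \<open>Solutions\<close>

context differential_expression
begin

lemma bulk_cong: "k \<le> n \<Longrightarrow> (\<And>i. i \<le> n \<Longrightarrow> d i = d' i) \<Longrightarrow> bulk k t d = bulk k t d'"
  by (simp add: bulk_def)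

lemma Dx_top:
  assumes "t \<in> \<Delta>" shows "Dx \<Delta> n y t = top t (\<lambda>i. Q y i t)"
  using n_pos p0_inv_act(1)[OF assms, of "Dx \<Delta> n y t"] by (simp add: top_def Q_low Q_n bulk_def)

lemma Dx_low: "t \<in> \<Delta> \<Longrightarrow> k \<le> n \<Longrightarrow> Dx \<Delta> k y t = low k t (\<lambda>i. Q y i t)"
  using Dx_top by (cases "k = n") (auto simp: low_def Q_low)

lemma bulk_low:
  assumes "t \<in> \<Delta>" "k \<le> n"
  shows "bulk k t (\<lambda>i. Dx \<Delta> i y t) = bulk k t (\<lambda>i. low i t (\<lambda>i. Q y i t))"
  by (rule bulk_cong[OF assms(2)]) (rule Dx_low[OF assms(1)])

definition regular :: "(real \<Rightarrow> 'v) \<Rightarrow> bool"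
  where "regular y \<longleftrightarrow> (\<forall>k\<le>2 * n - 2. Ck_on \<Delta> 1 (Q y k)) \<and> continuous_on \<Delta> (Q y (2 * n - 1))"

lemma Q_derivative:
  assumes y: "regular y" and t: "t \<in> \<Delta>" and k: "Suc k < 2 * n"
  shows "(Q y k has_vector_derivative rhs k t (\<lambda>i. Q y i t)) (at t within \<Delta>)"
proof -
  have "Ck_on \<Delta> (Suc 0) (Q y k)" using y k by (simp add: regular_def)
  note der = Ck_on_SucD[OF this t]
  consider "Suc k < n" | "Suc k = n" | "n \<le> k" by linarith
  then have "Dx \<Delta> 1 (Q y k) t = rhs k t (\<lambda>i. Q y i t)"
  proof cases
    case 3
    then have k': "0 < 2 * n - Suc k" "2 * n - Suc k < n" "2 * n - (2 * n - Suc k) = Suc k" "2 * n - Suc (2 * n - Suc k) = k" "2 * n - Suc k \<le> n" using k by auto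
    show ?thesis
      using Q_high[OF k'(1,2), of y t] 3 k bulk_low[OF t k'(5), of y] unfolding k'(3,4) by (simp add: rhs_def)
  qed (use Dx_top[OF t, of y] n_pos in \<open>simp_all add: rhs_def Q_low Dx_Dx del: quasi_deriv.simps\<close>)
  then show ?thesis using der by simp
qed

lemma Q_last_derivative:
  assumes y: "regular y" and t: "t \<in> \<Delta>" and diff: "Q y (2 * n - 1) differentiable (at t within \<Delta>)"
  shows "(Q y (2 * n - 1) has_vector_derivative rhs (2 * n - 1) t (\<lambda>i. Q y i t) - l y t) (at t within \<Delta>)"
proof -
  have "l y t = bulk 0 t (\<lambda>i. low i t (\<lambda>i. Q y i t)) - Dx \<Delta> 1 (Q y (2 * n - 1)) t"
    using l_eq[OF _ t diff] y bulk_low[OF t, of 0 y] unfolding regular_def by simp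
  then have "Dx \<Delta> 1 (Q y (2 * n - 1)) t = rhs (2 * n - 1) t (\<lambda>i. Q y i t) - l y t"
    using n_pos by (simp add: rhs_def)
  then show ?thesis using Dx_has_derivative[OF diff] by simp
qed

text \<open>The converse of \<open>Q_derivative\<close>: a state obeying all equations but the last
  consists of the quasi-derivatives of its component 0. Quasi-derivatives of sums, multiples and
  glued functions are computed through this instead of by differentiation.\<close>

lemma state_Q:
  assumes Y: "\<And>k t. Suc k < 2 * n \<Longrightarrow> t \<in> \<Delta> \<Longrightarrow> (Y k has_vector_derivative rhs k t (\<lambda>i. Y i t)) (at t within \<Delta>)"
    and k: "k < 2 * n" and t: "t \<in> \<Delta>"
  shows "Q (Y 0) k t = Y k t"
proof -
  have D: "Dx \<Delta> k (Y 0) t = Y k t" if "k < n" "t \<in> \<Delta>" for k t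
    using that
  proof (induction k arbitrary: t)
    case (Suc k)
    have "Dx \<Delta> (Suc k) (Y 0) t = Dx \<Delta> 1 (Dx \<Delta> k (Y 0)) t" by (simp add: Dx_Dx)
    also have "\<dots> = Dx \<Delta> 1 (Y k) t" by (rule Dx_cong) (use Suc in auto)
    also have "\<dots> = rhs k t (\<lambda>i. Y i t)" by (rule Dx1_eq[OF Y]) (use Suc.prems in auto)
    finally show ?case using Suc.prems by (simp add: rhs_def)
  qed simp
  have top: "Dx \<Delta> n (Y 0) t = top t (\<lambda>i. Y i t)" if "t \<in> \<Delta>" for t
  proof -
    have "Dx \<Delta> n (Y 0) t = Dx \<Delta> 1 (Dx \<Delta> (n - 1) (Y 0)) t" using n_pos by (simp add: Dx_Dx)
    also have "\<dots> = Dx \<Delta> 1 (Y (n - 1)) t" by (rule Dx_cong) (use D that n_pos in auto)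
    also have "\<dots> = rhs (n - 1) t (\<lambda>i. Y i t)" by (rule Dx1_eq[OF Y]) (use that n_pos in auto)
    finally show ?thesis using n_pos by (simp add: rhs_def)
  qed
  have bulk_Y: "bulk k t (\<lambda>i. Dx \<Delta> i (Y 0) t) = bulk k t (\<lambda>i. low i t (\<lambda>i. Y i t))" if "k \<le> n" "t \<in> \<Delta>" for k t
    by (rule bulk_cong[OF that(1)]) (use D top that(2) in \<open>auto simp: low_def not_less\<close>)
  show ?thesis
  proof (cases "k < n")
    case True
    then show ?thesis using D t by (simp add: Q_low)
  next
    case False
    then have "n \<le> k" by simp
    then show ?thesis
      using k t
    proof (induction k arbitrary: t rule: dec_induct)
      case base
      have "Q (Y 0) n t = bulk n t (\<lambda>i. low i t (\<lambda>i. Y i t))" using bulk_Y[of n t] base by (simp add: Q_n)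
      also have "\<dots> = Y n t"
        using n_pos p0_inv_act(2)[OF base(2)] by (simp add: bulk_def low_def top_def)
      finally show ?case .
    next
      case (step k)
      then have k': "0 < 2 * n - Suc k" "2 * n - Suc k < n" "2 * n - (2 * n - Suc k) = Suc k" "2 * n - Suc (2 * n - Suc k) = k" "2 * n - Suc k \<le> n" by auto
      have "Dx \<Delta> 1 (Q (Y 0) k) t = Dx \<Delta> 1 (Y k) t" by (rule Dx_cong) (use step in auto)
      also have "\<dots> = rhs k t (\<lambda>i. Y i t)" by (rule Dx1_eq[OF Y]) (use step.prems in auto)
      finally show ?case
        using Q_high[OF k'(1,2), of "Y 0" t] step bulk_Y[OF k'(5) step.prems(2)] unfolding k'(3,4) by (simp add: rhs_def)
    qed
  qed
qed

text \<open>The two requirements of \<open>lipschitz_system\<close> in a form closed under the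
  operations from which \<open>rhs\<close> is built.\<close>

definition admissible :: "(real \<Rightarrow> (nat \<Rightarrow> 'v) \<Rightarrow> 'v) \<Rightarrow> bool"
  where "admissible G \<longleftrightarrow> (\<forall>\<eta>\<in>\<Delta>.
    (\<exists>K\<ge>0. \<forall>t\<in>{0..\<eta>}. \<forall>x y. norm (G t x - G t y) \<le> K * (\<Sum>j<2 * n. norm (x j - y j))) \<and>
    (\<forall>X. (\<forall>j<2 * n. continuous_on {0..\<eta>} (X j)) \<longrightarrow> continuous_on {0..\<eta>} (\<lambda>t. G t (\<lambda>j. X j t))))"

lemma admissible_proj: "k < 2 * n \<Longrightarrow> admissible (\<lambda>t x. x k)"
  unfolding admissible_def by (auto intro!: exI[of _ 1] member_le_sum)

lemma admissible_fun: "continuous_on \<Delta> f \<Longrightarrow> admissible (\<lambda>t x. f t)"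
  unfolding admissible_def using continuous_on_subset[OF _ segment] by (auto intro!: exI[of _ 0])

lemma admissible_add:
  assumes "admissible G" "admissible G'" shows "admissible (\<lambda>t x. G t x + G' t x)"
  unfolding admissible_def
proof (intro ballI conjI allI impI)
  fix \<eta> assume \<eta>: "\<eta> \<in> \<Delta>"
  obtain K where K: "0 \<le> K" "\<And>t x y. t \<in> {0..\<eta>} \<Longrightarrow> norm (G t x - G t y) \<le> K * (\<Sum>j<2 * n. norm (x j - y j))"
    using assms(1) \<eta> unfolding admissible_def by meson
  obtain K' where K': "0 \<le> K'" "\<And>t x y. t \<in> {0..\<eta>} \<Longrightarrow> norm (G' t x - G' t y) \<le> K' * (\<Sum>j<2 * n. norm (x j - y j))"
    using assms(2) \<eta> unfolding admissible_def by meson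
  have "norm (G t x + G' t x - (G t y + G' t y)) \<le> (K + K') * (\<Sum>j<2 * n. norm (x j - y j))" if "t \<in> {0..\<eta>}" for t x y
    using norm_triangle_ineq[of "G t x - G t y" "G' t x - G' t y"] K(2)[OF that, of x y] K'(2)[OF that, of x y]
    by (simp add: algebra_simps)
  then show "\<exists>K\<ge>0. \<forall>t\<in>{0..\<eta>}. \<forall>x y. norm (G t x + G' t x - (G t y + G' t y)) \<le> K * (\<Sum>j<2 * n. norm (x j - y j))"
    using K(1) K'(1) by (intro exI[of _ "K + K'"]) simp
  fix X :: "nat \<Rightarrow> real \<Rightarrow> 'v" assume "\<forall>j<2 * n. continuous_on {0..\<eta>} (X j)"
  then show "continuous_on {0..\<eta>} (\<lambda>t. G t (\<lambda>j. X j t) + G' t (\<lambda>j. X j t))"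
    using assms \<eta> unfolding admissible_def by (intro continuous_on_add) blast+
qed

lemma admissible_act:
  assumes A: "continuous_on \<Delta> A" and G: "admissible G" shows "admissible (\<lambda>t x. act (A t) (G t x))"
  unfolding admissible_def
proof (intro ballI conjI allI impI)
  fix \<eta> assume \<eta>: "\<eta> \<in> \<Delta>"
  obtain K where K: "0 \<le> K" "\<And>t x y. t \<in> {0..\<eta>} \<Longrightarrow> norm (G t x - G t y) \<le> K * (\<Sum>j<2 * n. norm (x j - y j))"
    using G \<eta> unfolding admissible_def by meson
  have A': "continuous_on {0..\<eta>} A" by (rule continuous_on_subset[OF A segment[OF \<eta>]])
  then have "bounded (A ` {0..\<eta>})" by (intro compact_imp_bounded compact_continuous_image) auto
  then obtain N where "\<forall>T\<in>A ` {0..\<eta>}. norm T \<le> N" unfolding bounded_iff by blast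
  then have N: "norm (A t) \<le> N" if "t \<in> {0..\<eta>}" for t using that by simp
  obtain C where C: "0 \<le> C" "\<And>T v. norm (act T v) \<le> norm T * norm v * C"
    using bounded_bilinear.nonneg_bounded[OF bilinear] by blast
  have N0: "0 \<le> N" using order_trans[OF norm_ge_zero N[of 0]] nonneg[OF \<eta>] by simp
  have "norm (act (A t) (G t x) - act (A t) (G t y)) \<le> (N * K * C) * (\<Sum>j<2 * n. norm (x j - y j))" if "t \<in> {0..\<eta>}" for t x y
  proof -
    have "norm (act (A t) (G t x) - act (A t) (G t y)) \<le> norm (A t) * norm (G t x - G t y) * C"
      using C(2)[of "A t" "G t x - G t y"] by (simp add: bounded_bilinear.diff_right[OF bilinear])
    also have "\<dots> \<le> N * (K * (\<Sum>j<2 * n. norm (x j - y j))) * C"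
      using C(1) N[OF that] K(2)[OF that] N0 by (intro mult_right_mono mult_mono) auto
    finally show ?thesis by (simp add: mult_ac)
  qed
  then show "\<exists>K\<ge>0. \<forall>t\<in>{0..\<eta>}. \<forall>x y. norm (act (A t) (G t x) - act (A t) (G t y)) \<le> K * (\<Sum>j<2 * n. norm (x j - y j))"
    using K(1) C(1) N0 by (intro exI[of _ "N * K * C"]) simp
  fix X :: "nat \<Rightarrow> real \<Rightarrow> 'v" assume "\<forall>j<2 * n. continuous_on {0..\<eta>} (X j)"
  then have "continuous_on {0..\<eta>} (\<lambda>t. G t (\<lambda>j. X j t))" using G \<eta> unfolding admissible_def by blast
  with A' show "continuous_on {0..\<eta>} (\<lambda>t. act (A t) (G t (\<lambda>j. X j t)))"
    by (rule bounded_bilinear.continuous_on[OF bilinear])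
qed

lemma admissible_scaleC: "admissible G \<Longrightarrow> admissible (\<lambda>t x. c *\<^sub>C G t x)"
  using admissible_act[of "\<lambda>t. c *\<^sub>C cblinfun_id" G] by (simp add: act_id flip: act_scaleC)

lemma admissible_diff: "admissible G \<Longrightarrow> admissible G' \<Longrightarrow> admissible (\<lambda>t x. G t x - G' t x)"
  using admissible_add[of G "\<lambda>t x. (-1) *\<^sub>C G' t x"] admissible_scaleC[of G' "-1"]
  by (simp add: scaleC_minus_left)

lemma coefficient_continuous:
  "k \<le> n \<Longrightarrow> continuous_on \<Delta> (p (n - k))"
  "0 < k \<Longrightarrow> k \<le> n \<Longrightarrow> continuous_on \<Delta> (\<lambda>t. (\<i> / 2) *\<^sub>C q (n - k) t)"
  "0 < k \<Longrightarrow> k \<le> n \<Longrightarrow> continuous_on \<Delta> (\<lambda>t. (\<i> / 2) *\<^sub>C adj (q (n - k) t))"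
  "continuous_on \<Delta> (\<lambda>t. inv_op (p 0 t))"
  using p_Ck[of k 0] q_Ck[of k 0] p0_inv_Ck[of 0] by (simp_all add: Ck_on_0)

lemma admissible_top: "admissible top"
  unfolding top_def using coefficient_continuous(2)[of n] n_pos
  by (intro admissible_act admissible_add admissible_proj coefficient_continuous(4)) auto

lemma admissible_low: "k \<le> n \<Longrightarrow> admissible (low k)"
  unfolding low_def using admissible_top n_pos by (cases "k < n") (auto simp: admissible_proj)

lemma admissible_bulk: 
  assumes "k \<le> n" shows "admissible (\<lambda>t x. bulk k t (\<lambda>i. low i t x))"
proof -
  have z: "admissible (\<lambda>t x. 0)" by (rule admissible_fun) simp
  have 1: "admissible (\<lambda>t x. if k < n then act ((\<i> / 2) *\<^sub>C adj (q (n - Suc k) t)) (low (Suc k) t x) else 0)"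
    using z by (cases "k < n") (auto intro!: admissible_act coefficient_continuous admissible_low)
  have 2: "admissible (\<lambda>t x. if 0 < k then act ((\<i> / 2) *\<^sub>C q (n - k) t) (low (k - 1) t x) else 0)"
    using z assms by (cases "0 < k") (auto intro!: admissible_act coefficient_continuous admissible_low)
  show ?thesis unfolding bulk_def
    by (intro admissible_diff admissible_add 1 2 admissible_act coefficient_continuous admissible_low assms)
qed

lemma admissible_rhs: assumes "k < 2 * n" shows "admissible (rhs k)"
proof -
  have z: "admissible (\<lambda>t x. 0)" by (rule admissible_fun) simp
  consider "Suc k < n" | "Suc k = n" | "n \<le> k" by linarith
  then show ?thesis
  proof cases
    case 1
    then have "rhs k = (\<lambda>t x. x (Suc k))" by (intro ext) (simp add: rhs_def)
    then show ?thesis using admissible_proj[of "Suc k"] 1 by simp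
  next
    case 2
    then have "rhs k = top" by (intro ext) (simp add: rhs_def)
    then show ?thesis using admissible_top by simp
  next
    case 3
    have "admissible (\<lambda>t x. if Suc k < 2 * n then x (Suc k) else 0)"
      using z admissible_proj by (cases "Suc k < 2 * n") auto
    then have "admissible (\<lambda>t x. bulk (2 * n - 1 - k) t (\<lambda>i. low i t x) - (if Suc k < 2 * n then x (Suc k) else 0))"
      using 3 by (intro admissible_diff admissible_bulk) auto
    moreover have "rhs k = (\<lambda>t x. bulk (2 * n - 1 - k) t (\<lambda>i. low i t x) - (if Suc k < 2 * n then x (Suc k) else 0))"
      using 3 by (intro ext) (simp add: rhs_def)
    ultimately show ?thesis by simp
  qed
qed

text \<open>The system for \<open>l[y] = z y + f\<close>: only the last equation, in which
  \<open>l[y]\<close> occurs, receives the inhomogeneity.\<close>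

definition field :: "complex \<Rightarrow> (real \<Rightarrow> 'v) \<Rightarrow> nat \<Rightarrow> real \<Rightarrow> (nat \<Rightarrow> 'v) \<Rightarrow> 'v"
  where "field z f k t x = rhs k t x - (if Suc k = 2 * n then z *\<^sub>C x 0 + f t else 0)"

lemma lipschitz_field: assumes f: "continuous_on \<Delta> f" shows "lipschitz_system \<Delta> b (2 * n) (field z f)"
proof -
  have adm: "admissible (field z f k)" if "k < 2 * n" for k
  proof -
    have "admissible (\<lambda>t x. if Suc k = 2 * n then z *\<^sub>C x 0 + f t else 0)"
      using n_pos admissible_fun[of "\<lambda>t. 0"] f
      by (cases "Suc k = 2 * n") (auto intro!: admissible_add admissible_scaleC admissible_proj admissible_fun)
    then show ?thesis unfolding field_def by (intro admissible_diff admissible_rhs[OF that])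
  qed
  show ?thesis
  proof
    fix \<eta> assume \<eta>: "\<eta> \<in> \<Delta>"
    let ?S = "\<lambda>x y. \<Sum>j<2 * n. norm (x j - y j :: 'v)"
    have "\<forall>k\<in>{..<2 * n}. \<exists>K. 0 \<le> K \<and> (\<forall>t\<in>{0..\<eta>}. \<forall>x y. norm (field z f k t x - field z f k t y) \<le> K * ?S x y)"
      using adm \<eta> unfolding admissible_def by blast
    from bchoice[OF this] obtain K where K: "\<And>k. k < 2 * n \<Longrightarrow> 0 \<le> K k"
      "\<And>k t x y. k < 2 * n \<Longrightarrow> t \<in> {0..\<eta>} \<Longrightarrow> norm (field z f k t x - field z f k t y) \<le> K k * ?S x y"
      by blast
    have "norm (field z f k t x - field z f k t y) \<le> (\<Sum>k<2 * n. K k) * ?S x y" if "k < 2 * n" "t \<in> {0..\<eta>}" for k t x y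
    proof -
      have "K k \<le> (\<Sum>k<2 * n. K k)" by (rule member_le_sum) (use that K(1) in auto)
      then have "K k * ?S x y \<le> (\<Sum>k<2 * n. K k) * ?S x y" by (intro mult_right_mono sum_nonneg) auto
      then show ?thesis using K(2)[OF that, of x y] by linarith
    qed
    then show "\<exists>K\<ge>0. \<forall>t\<in>{0..\<eta>}. \<forall>k<2 * n. \<forall>x y. norm (field z f k t x - field z f k t y) \<le> K * ?S x y"
      using K(1) by (intro exI[of _ "\<Sum>k<2 * n. K k"] conjI sum_nonneg) simp_all
    show "continuous_on {0..\<eta>} (\<lambda>t. field z f k t (\<lambda>j. X j t))"
      if "k < 2 * n" "\<And>j. j < 2 * n \<Longrightarrow> continuous_on {0..\<eta>} (X j)" for k X
      using adm[OF that(1)] \<eta> that(2) unfolding admissible_def by blast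
  qed
qed

definition solution :: "complex \<Rightarrow> (real \<Rightarrow> 'v) \<Rightarrow> (real \<Rightarrow> 'v) \<Rightarrow> bool"
  where "solution z f y \<longleftrightarrow> (\<forall>t. t \<notin> \<Delta> \<longrightarrow> y t = 0) \<and> (\<forall>k<2 * n. Ck_on \<Delta> 1 (Q y k)) \<and>
    (\<forall>t\<in>\<Delta>. l y t = z *\<^sub>C y t + f t)"

lemma solution_regular: "solution z f y \<Longrightarrow> regular y"
proof -
  assume y: "solution z f y"
  have k: "2 * n - 1 < 2 * n" using n_pos by simp
  show ?thesis unfolding regular_def
    using y Ck_on_continuous[of \<Delta> 1 "Q y (2 * n - 1)"] k unfolding solution_def by simp
qed

lemma solution_derivative:
  assumes y: "solution z f y" and k: "k < 2 * n" and t: "t \<in> \<Delta>"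
  shows "(Q y k has_vector_derivative field z f k t (\<lambda>i. Q y i t)) (at t within \<Delta>)"
proof (cases "Suc k < 2 * n")
  case True
  then show ?thesis using Q_derivative[OF solution_regular[OF y] t True] by (simp add: field_def)
next
  case False
  then have k: "k = 2 * n - 1" "Suc (2 * n - 1) = 2 * n" "Suc (2 * n - Suc 0) = 2 * n" using k by auto
  have "Ck_on \<Delta> (Suc 0) (Q y (2 * n - 1))" using y n_pos by (simp add: solution_def)
  then have "Q y (2 * n - 1) differentiable (at t within \<Delta>)" using t by (simp add: Ck_on_Suc)
  from Q_last_derivative[OF solution_regular[OF y] t this] show ?thesis
    using y t by (simp add: field_def k solution_def)
qed

text \<open>Existence for the equation of order 2n is reduced to that for the system: components of
  a state solution are automatically the quasi-derivatives, and the last equation then says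
  \<open>l[y] = z y + f\<close> at every point.\<close>

lemma state_solution:
  assumes Y: "\<And>k t. k < 2 * n \<Longrightarrow> t \<in> \<Delta> \<Longrightarrow> (Y k has_vector_derivative field z f k t (\<lambda>i. Y i t)) (at t within \<Delta>)"
    and f: "continuous_on \<Delta> f" and off: "\<And>t. t \<notin> \<Delta> \<Longrightarrow> Y 0 t = 0"
  shows "solution z f (Y 0)" and "\<And>k t. k < 2 * n \<Longrightarrow> t \<in> \<Delta> \<Longrightarrow> Q (Y 0) k t = Y k t"
proof -
  interpret lipschitz_system \<Delta> b "2 * n" "field z f" by (rule lipschitz_field[OF f])
  show Q_eq: "Q (Y 0) k t = Y k t" if "k < 2 * n" "t \<in> \<Delta>" for k t
  proof (rule state_Q[OF _ that])
    show "(Y k has_vector_derivative rhs k t (\<lambda>i. Y i t)) (at t within \<Delta>)" if "Suc k < 2 * n" "t \<in> \<Delta>" for k t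
      using Y[of k t] that by (simp add: field_def)
  qed
  have Q_der: "(Q (Y 0) k has_vector_derivative field z f k t (\<lambda>i. Y i t)) (at t within \<Delta>)" if "k < 2 * n" "t \<in> \<Delta>" for k t
    by (rule has_vector_derivative_transform[OF that(2) Q_eq Y]) (use that in auto)
  have contY: "continuous_on \<Delta> (Y k)" if "k < 2 * n" for k
    by (rule continuous_on_vector_derivative, erule Y[OF that])
  have C1: "Ck_on \<Delta> 1 (Q (Y 0) k)" if "k < 2 * n" for k
    unfolding One_nat_def
    by (rule Ck_on_SucI[OF Q_der[OF that]]) (use continuous_Delta[OF that contY] in \<open>auto simp: Ck_on_0\<close>)
  have "2 * n - 1 < 2 * n" using n_pos by simp
  then have reg: "regular (Y 0)"
    unfolding regular_def using C1 Ck_on_continuous[OF C1[of "2 * n - 1"]] by simp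
  have "l (Y 0) t = z *\<^sub>C Y 0 t + f t" if t: "t \<in> \<Delta>" for t
  proof -
    have k: "2 * n - 1 < 2 * n" "Suc (2 * n - 1) = 2 * n" "Suc (2 * n - Suc 0) = 2 * n" using n_pos by auto
    have d: "Q (Y 0) (2 * n - 1) differentiable (at t within \<Delta>)"
      using Q_der[OF k(1) t] differentiableI_vector by blast
    have "Dx \<Delta> 1 (Q (Y 0) (2 * n - 1)) t = rhs (2 * n - 1) t (\<lambda>i. Q (Y 0) i t) - l (Y 0) t"
      by (rule Dx1_eq[OF Q_last_derivative[OF reg t d] t])
    moreover have "Dx \<Delta> 1 (Q (Y 0) (2 * n - 1)) t = field z f (2 * n - 1) t (\<lambda>i. Y i t)"
      by (rule Dx1_eq[OF Q_der[OF k(1) t] t])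
    moreover have "rhs (2 * n - 1) t (\<lambda>i. Q (Y 0) i t) = rhs (2 * n - 1) t (\<lambda>i. Y i t)"
      using n_pos Q_eq[OF _ t] by (auto simp: rhs_def low_def top_def intro!: bulk_cong)
    ultimately have "rhs (2 * n - 1) t (\<lambda>i. Y i t) - l (Y 0) t = rhs (2 * n - 1) t (\<lambda>i. Y i t) - (z *\<^sub>C Y 0 t + f t)"
      by (simp only: field_def k(2) if_True simp_thms)
    then show ?thesis by (simp only: diff_left_imp_eq)
  qed
  then show "solution z f (Y 0)" unfolding solution_def using off C1 by blast
qed

lemma solution_exists:
  assumes f: "continuous_on \<Delta> f"
  obtains y where "solution z f y" "\<And>k. k < 2 * n \<Longrightarrow> Q y k 0 = c k"
proof -
  interpret lipschitz_system \<Delta> b "2 * n" "field z f" by (rule lipschitz_field[OF f])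
  define Y where "Y k t = (if t \<in> \<Delta> then flow c k t else 0)" for k t
  have Y: "(Y k has_vector_derivative field z f k t (\<lambda>i. Y i t)) (at t within \<Delta>)" if "k < 2 * n" "t \<in> \<Delta>" for k t
  proof (rule has_vector_derivative_transform[OF that(2)])
    show "(flow c k has_vector_derivative field z f k t (\<lambda>i. Y i t)) (at t within \<Delta>)"
      using flow_derivative[OF that, of c] that by (simp add: Y_def)
  qed (simp add: Y_def)
  have "solution z f (Y 0)" by (rule state_solution(1)[OF Y f]) (auto simp: Y_def)
  moreover have "Q (Y 0) k 0 = c k" if "k < 2 * n" for k
    using state_solution(2)[OF Y f _ that zero_in] flow_initial[OF that] zero_in by (simp add: Y_def)
  ultimately show ?thesis by (rule that)
qed

lemma solution_eq:
  assumes f: "continuous_on \<Delta> f" and y: "solution z f y" "solution z f w"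
    and init: "\<And>k. k < 2 * n \<Longrightarrow> Q y k 0 = Q w k 0" and k: "k < 2 * n" and t: "t \<in> \<Delta>"
  shows "Q y k t = Q w k t"
proof -
  interpret lipschitz_system \<Delta> b "2 * n" "field z f" by (rule lipschitz_field[OF f])
  show ?thesis by (rule solution_unique[OF solution_derivative[OF y(1)] solution_derivative[OF y(2)] init k t])
qed

lemma solution_fun_eq:
  assumes "continuous_on \<Delta> f" "solution z f y" "solution z f w"
    and "\<And>k. k < 2 * n \<Longrightarrow> Q y k 0 = Q w k 0"
  shows "y = w"
proof
  fix t
  show "y t = w t"
    using solution_eq[OF assms, of 0 t] n_pos assms(2,3) by (cases "t \<in> \<Delta>") (auto simp: solution_def)
qed

text \<open>Data are prescribed at an interior or right end point; the flow from 0 to that point is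
  onto.\<close>

lemma solution_onto:
  assumes f: "continuous_on \<Delta> f" and \<eta>: "\<eta> \<in> \<Delta>" "0 < \<eta>"
  obtains y where "solution z f y" "\<And>k. k < 2 * n \<Longrightarrow> Q y k \<eta> = d k"
proof -
  interpret lipschitz_system \<Delta> b "2 * n" "field z f" by (rule lipschitz_field[OF f])
  obtain c where c: "\<And>k. k < 2 * n \<Longrightarrow> flow c k \<eta> = d k" by (rule flow_surjective[OF \<eta>, of d]) blast
  obtain y where y: "solution z f y" "\<And>k. k < 2 * n \<Longrightarrow> Q y k 0 = c k" by (rule solution_exists[OF f, of z c]) blast
  have "Q y k \<eta> = flow c k \<eta>" if "k < 2 * n" for k
    by (rule solution_unique[OF solution_derivative[OF y(1)] flow_derivative _ that \<eta>(1)]) (use y(2) flow_initial in auto)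
  then show thesis using that[OF y(1)] c by simp
qed

section \<open>Linearity of the system and of the expression\<close>

lemma act_scaleC_right: "act T (c *\<^sub>C v) = c *\<^sub>C act T v"
proof -
  have "act T (c *\<^sub>C v) = act T (act (c *\<^sub>C cblinfun_id) v)" by (simp add: act_id flip: act_scaleC)
  also have "\<dots> = act (c *\<^sub>C T) v" by (simp add: act_compose cblinfun_compose_linear)
  finally show ?thesis by (simp add: act_scaleC)
qed

lemmas act_linear = bounded_bilinear.add_right[OF bilinear] act_scaleC_right
  bounded_bilinear.zero_right[OF bilinear]

lemma top_linear:
  "top t (\<lambda>i. x i + y i) = top t x + top t y" "top t (\<lambda>i. c *\<^sub>C x i) = c *\<^sub>C top t x"
  by (simp_all add: top_def act_linear scaleC_add_right)

lemma low_linear: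
  "low k t (\<lambda>i. x i + y i) = low k t x + low k t y" "low k t (\<lambda>i. c *\<^sub>C x i) = c *\<^sub>C low k t x"
  by (simp_all add: low_def top_linear)

lemma bulk_linear:
  "bulk k t (\<lambda>i. x i + y i) = bulk k t x + bulk k t y" "bulk k t (\<lambda>i. c *\<^sub>C x i) = c *\<^sub>C bulk k t x"
  by (simp_all add: bulk_def act_linear scaleC_add_right scaleC_diff_right)

lemma rhs_add: "rhs k t (\<lambda>i. x i + y i) = rhs k t x + rhs k t y"
  by (simp add: rhs_def low_linear(1) bulk_linear(1) top_linear(1))

lemma rhs_scaleC: "rhs k t (\<lambda>i. c *\<^sub>C x i) = c *\<^sub>C rhs k t x"
  by (simp add: rhs_def low_linear(2) bulk_linear(2) top_linear(2) scaleC_diff_right)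

lemma regular_add:
  assumes y: "regular y" "regular w"
  shows "\<And>k t. k < 2 * n \<Longrightarrow> t \<in> \<Delta> \<Longrightarrow> Q (\<lambda>t. y t + w t) k t = Q y k t + Q w k t" and "regular (\<lambda>t. y t + w t)"
proof -
  let ?Y = "\<lambda>k t. Q y k t + Q w k t"
  have Y: "(?Y k has_vector_derivative rhs k t (\<lambda>i. ?Y i t)) (at t within \<Delta>)" if "Suc k < 2 * n" "t \<in> \<Delta>" for k t
    unfolding rhs_add using that by (intro has_vector_derivative_add Q_derivative y)
  show eq: "Q (\<lambda>t. y t + w t) k t = ?Y k t" if "k < 2 * n" "t \<in> \<Delta>" for k t
    using state_Q[of ?Y, OF Y that] by simp
  show "regular (\<lambda>t. y t + w t)"
    unfolding regular_def
  proof (intro conjI allI impI)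
    fix k assume k: "k \<le> 2 * n - 2"
    show "Ck_on \<Delta> 1 (Q (\<lambda>t. y t + w t) k)"
      by (rule Ck_on_cong[OF eq[symmetric] Ck_on_add]) (use k y n_pos in \<open>auto simp: regular_def\<close>)
  next
    show "continuous_on \<Delta> (Q (\<lambda>t. y t + w t) (2 * n - 1))"
      by (rule continuous_on_eq[OF _ eq[symmetric]]) (use y n_pos in \<open>auto simp: regular_def intro: continuous_on_add\<close>)
  qed
qed

lemma regular_scaleC:
  assumes y: "regular y"
  shows "\<And>k t. k < 2 * n \<Longrightarrow> t \<in> \<Delta> \<Longrightarrow> Q (\<lambda>t. c *\<^sub>C y t) k t = c *\<^sub>C Q y k t" and "regular (\<lambda>t. c *\<^sub>C y t)"
proof -
  let ?Y = "\<lambda>k t. c *\<^sub>C Q y k t"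
  have Y: "(?Y k has_vector_derivative rhs k t (\<lambda>i. ?Y i t)) (at t within \<Delta>)" if "Suc k < 2 * n" "t \<in> \<Delta>" for k t
    unfolding rhs_scaleC using that
    by (intro bounded_linear.has_vector_derivative[OF bounded_linear_scaleC_v] Q_derivative y)
  show eq: "Q (\<lambda>t. c *\<^sub>C y t) k t = ?Y k t" if "k < 2 * n" "t \<in> \<Delta>" for k t
    using state_Q[of ?Y, OF Y that] by simp
  show "regular (\<lambda>t. c *\<^sub>C y t)"
    unfolding regular_def
  proof (intro conjI allI impI)
    fix k assume k: "k \<le> 2 * n - 2"
    show "Ck_on \<Delta> 1 (Q (\<lambda>t. c *\<^sub>C y t) k)"
      by (rule Ck_on_cong[OF eq[symmetric] Ck_on_linear[OF bounded_linear_scaleC_v]]) (use k y n_pos in \<open>auto simp: regular_def\<close>)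
  next
    show "continuous_on \<Delta> (Q (\<lambda>t. c *\<^sub>C y t) (2 * n - 1))"
      by (rule continuous_on_eq[OF _ eq[symmetric]])
        (use y n_pos in \<open>auto simp: regular_def intro: bounded_linear.continuous_on[OF bounded_linear_scaleC_v]\<close>)
  qed
qed

lemma l_last:
  assumes "regular y" "t \<in> \<Delta>" "(Q y (2 * n - 1) has_vector_derivative d) (at t within \<Delta>)"
  shows "l y t = rhs (2 * n - 1) t (\<lambda>i. Q y i t) - d"
  using Dx1_eq[OF assms(3,2)] Dx1_eq[OF Q_last_derivative[OF assms(1,2) differentiableI_vector[OF assms(3)]] assms(2)] by simp

lemma rhs_cong: "(\<And>i. i < 2 * n \<Longrightarrow> x i = y i) \<Longrightarrow> k < 2 * n \<Longrightarrow> rhs k t x = rhs k t y"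
  using n_pos by (auto simp: rhs_def low_def top_def intro!: bulk_cong)

text \<open>Additivity is claimed only where both last quasi-derivatives are differentiable;
  elsewhere l is built from derivatives that need not exist.\<close>

lemma l_add:
  assumes y: "regular y" "regular w" and t: "t \<in> \<Delta>"
    and d: "Q y (2 * n - 1) differentiable (at t within \<Delta>)" "Q w (2 * n - 1) differentiable (at t within \<Delta>)"
  shows "l (\<lambda>t. y t + w t) t = l y t + l w t" "Q (\<lambda>t. y t + w t) (2 * n - 1) differentiable (at t within \<Delta>)"
proof -
  have k: "2 * n - 1 < 2 * n" using n_pos by simp
  have "((\<lambda>t. Q y (2 * n - 1) t + Q w (2 * n - 1) t) has_vector_derivative
      (rhs (2 * n - 1) t (\<lambda>i. Q y i t) - l y t) + (rhs (2 * n - 1) t (\<lambda>i. Q w i t) - l w t)) (at t within \<Delta>)"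
    by (intro has_vector_derivative_add Q_last_derivative y t d)
  then have *: "(Q (\<lambda>t. y t + w t) (2 * n - 1) has_vector_derivative
      (rhs (2 * n - 1) t (\<lambda>i. Q y i t) - l y t) + (rhs (2 * n - 1) t (\<lambda>i. Q w i t) - l w t)) (at t within \<Delta>)"
    by (rule has_vector_derivative_transform[OF t regular_add(1)[OF y k], rotated])
  then show "Q (\<lambda>t. y t + w t) (2 * n - 1) differentiable (at t within \<Delta>)" by (rule differentiableI_vector)
  have "rhs (2 * n - 1) t (\<lambda>i. Q (\<lambda>t. y t + w t) i t) = rhs (2 * n - 1) t (\<lambda>i. Q y i t + Q w i t)"
    by (rule rhs_cong[OF regular_add(1)[OF y _ t] k])
  then show "l (\<lambda>t. y t + w t) t = l y t + l w t"
    using l_last[OF regular_add(2)[OF y] t *] by (simp add: rhs_add)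
qed

lemma solution_add:
  assumes "continuous_on \<Delta> f" "continuous_on \<Delta> g" "solution z f y" "solution z g w"
  shows "solution z (\<lambda>t. f t + g t) (\<lambda>t. y t + w t)"
proof -
  let ?Y = "\<lambda>k t. if t \<in> \<Delta> then Q y k t + Q w k t else 0"
  have Y: "(?Y k has_vector_derivative field z (\<lambda>t. f t + g t) k t (\<lambda>i. ?Y i t)) (at t within \<Delta>)" if "k < 2 * n" "t \<in> \<Delta>" for k t
  proof (rule has_vector_derivative_transform[OF that(2)])
    have "field z (\<lambda>t. f t + g t) k t (\<lambda>i. ?Y i t) = field z f k t (\<lambda>i. Q y i t) + field z g k t (\<lambda>i. Q w i t)"
      using that by (simp add: field_def rhs_add scaleC_add_right)
    then show "((\<lambda>t. Q y k t + Q w k t) has_vector_derivative field z (\<lambda>t. f t + g t) k t (\<lambda>i. ?Y i t)) (at t within \<Delta>)"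
      by (simp only:) (intro has_vector_derivative_add solution_derivative assms that)
  qed simp
  have "?Y 0 = (\<lambda>t. y t + w t)" using assms(3,4) by (auto simp: solution_def)
  then show ?thesis using state_solution(1)[of ?Y, OF Y continuous_on_add[OF assms(1,2)]] by simp
qed

lemma solution_scaleC:
  assumes "continuous_on \<Delta> f" "solution z f y"
  shows "solution z (\<lambda>t. c *\<^sub>C f t) (\<lambda>t. c *\<^sub>C y t)"
proof -
  let ?Y = "\<lambda>k t. if t \<in> \<Delta> then c *\<^sub>C Q y k t else 0"
  have Y: "(?Y k has_vector_derivative field z (\<lambda>t. c *\<^sub>C f t) k t (\<lambda>i. ?Y i t)) (at t within \<Delta>)" if "k < 2 * n" "t \<in> \<Delta>" for k t
  proof (rule has_vector_derivative_transform[OF that(2)])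
    have "field z (\<lambda>t. c *\<^sub>C f t) k t (\<lambda>i. ?Y i t) = c *\<^sub>C field z f k t (\<lambda>i. Q y i t)"
      using that by (simp add: field_def rhs_scaleC scaleC_add_right scaleC_diff_right scaleC_scaleC mult.commute)
    then show "((\<lambda>t. c *\<^sub>C Q y k t) has_vector_derivative field z (\<lambda>t. c *\<^sub>C f t) k t (\<lambda>i. ?Y i t)) (at t within \<Delta>)"
      by (simp only:) (intro bounded_linear.has_vector_derivative[OF bounded_linear_scaleC_v] solution_derivative assms that)
  qed simp
  have "?Y 0 = (\<lambda>t. c *\<^sub>C y t)" using assms(2) by (auto simp: solution_def)
  then show ?thesis
    using state_solution(1)[of ?Y, OF Y bounded_linear.continuous_on[OF bounded_linear_scaleC_v assms(1)]] by simp
qed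

end

section \<open>Vector functions and operator functions\<close>

locale hilbert_expression = half_open_interval +
  fixes n :: nat and p q :: "nat \<Rightarrow> real \<Rightarrow> 'h::{complex_hilbert, second_countable_topology} \<Rightarrow>\<^sub>C\<^sub>L 'h"
  assumes coefficients: "coefficients_ok \<Delta> n p q" and n_pos: "0 < n"

sublocale hilbert_expression \<subseteq> differential_expression \<Delta> b "(*\<^sub>V)" n p q
  by (intro differential_expression.intro half_open_interval_axioms differential_expression_axioms.intro)
    (simp_all add: coefficients n_pos cblinfun_linear bounded_bilinear_cblinfun_apply)

context hilbert_expression
begin

lemma operator_expression: "differential_expression \<Delta> b ((o\<^sub>C\<^sub>L) :: _ \<Rightarrow> 'k::complex_hilbert \<Rightarrow>\<^sub>C\<^sub>L 'h \<Rightarrow> _) n p q"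
  by (intro differential_expression.intro half_open_interval_axioms differential_expression_axioms.intro)
    (auto simp: coefficients n_pos cblinfun_compose_linear cblinfun_compose_assoc bounded_bilinear_cblinfun_compose)

lemma op_solution_iff:
  fixes Y :: "real \<Rightarrow> 'k::complex_hilbert \<Rightarrow>\<^sub>C\<^sub>L 'h"
  shows "op_solution \<Delta> n p q z Y \<longleftrightarrow> differential_expression.solution \<Delta> (o\<^sub>C\<^sub>L) n p q z (\<lambda>t. 0) Y"
proof -
  interpret O: differential_expression \<Delta> b "(o\<^sub>C\<^sub>L) :: _ \<Rightarrow> 'k \<Rightarrow>\<^sub>C\<^sub>L 'h \<Rightarrow> _" n p q by (rule operator_expression)
  have "(\<forall>k\<le>2 * n - 1. P k) \<longleftrightarrow> (\<forall>k<2 * n. P k)" for P using n_pos by (metis One_nat_def Suc_pred less_Suc_eq_le mult_pos_pos pos2)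
  then show ?thesis unfolding op_solution_def O.solution_def by simp
qed

text \<open>Evaluation at h commutes with every ingredient of the system, so the evaluated
  quasi-derivatives form a solution of the vector system and \<open>state_solution\<close>
  identifies them.\<close>

lemma op_solution_apply:
  fixes Y :: "real \<Rightarrow> 'k::complex_hilbert \<Rightarrow>\<^sub>C\<^sub>L 'h"
  assumes Y: "op_solution \<Delta> n p q z Y"
  shows "solution z (\<lambda>t. 0) (\<lambda>t. Y t *\<^sub>V h)"
    and "\<And>k t. k < 2 * n \<Longrightarrow> t \<in> \<Delta> \<Longrightarrow> Q (\<lambda>t. Y t *\<^sub>V h) k t = quasi_deriv (o\<^sub>C\<^sub>L) \<Delta> n p q Y k t *\<^sub>V h"
proof -
  interpret O: differential_expression \<Delta> b "(o\<^sub>C\<^sub>L) :: _ \<Rightarrow> 'k \<Rightarrow>\<^sub>C\<^sub>L 'h \<Rightarrow> _" n p q by (rule operator_expression)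
  have Y': "O.solution z (\<lambda>t. 0) Y" using Y by (simp add: op_solution_iff)
  let ?Y = "\<lambda>k t. O.Q Y k t *\<^sub>V h"
  have field: "O.field z (\<lambda>t. 0) k t x *\<^sub>V h = field z (\<lambda>t. 0) k t (\<lambda>i. x i *\<^sub>V h)" for k t x
  proof -
    have top: "O.top t x *\<^sub>V h = top t (\<lambda>i. x i *\<^sub>V h)" by (simp add: O.top_def top_def cblinfun_linear)
    then have low: "O.low k t x *\<^sub>V h = low k t (\<lambda>i. x i *\<^sub>V h)" for k by (simp add: O.low_def low_def)
    have bulk: "O.bulk k t d *\<^sub>V h = bulk k t (\<lambda>i. d i *\<^sub>V h)" for k and d :: "nat \<Rightarrow> 'k \<Rightarrow>\<^sub>C\<^sub>L 'h"
      by (simp add: O.bulk_def bulk_def cblinfun_linear)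
    show ?thesis by (simp add: O.field_def field_def O.rhs_def rhs_def bulk low top cblinfun_linear)
  qed
  have "((\<lambda>t. O.Q Y k t *\<^sub>V h) has_vector_derivative O.field z (\<lambda>t. 0) k t (\<lambda>i. O.Q Y i t) *\<^sub>V h) (at t within \<Delta>)" if "k < 2 * n" "t \<in> \<Delta>" for k t
    by (rule bounded_linear.has_vector_derivative[OF bounded_bilinear.bounded_linear_left[OF bounded_bilinear_cblinfun_apply]])
      (rule O.solution_derivative[OF Y' that])
  then have der: "(?Y k has_vector_derivative field z (\<lambda>t. 0) k t (\<lambda>i. ?Y i t)) (at t within \<Delta>)" if "k < 2 * n" "t \<in> \<Delta>" for k t
    using that by (simp add: field)
  have off: "?Y 0 t = 0" if "t \<notin> \<Delta>" for t using Y that by (simp add: op_solution_def)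
  show "solution z (\<lambda>t. 0) (\<lambda>t. Y t *\<^sub>V h)"
    using state_solution(1)[of ?Y, OF der continuous_on_const off] by simp
  show "Q (\<lambda>t. Y t *\<^sub>V h) k t = O.Q Y k t *\<^sub>V h" if "k < 2 * n" "t \<in> \<Delta>" for k t
    using state_solution(2)[of ?Y, OF der continuous_on_const off that] by simp
qed

lemma op_solution_exists:
  fixes c :: "nat \<Rightarrow> 'k::complex_hilbert \<Rightarrow>\<^sub>C\<^sub>L 'h"
  obtains Y where "op_solution \<Delta> n p q z Y" "\<And>k. k < 2 * n \<Longrightarrow> quasi_deriv (o\<^sub>C\<^sub>L) \<Delta> n p q Y k 0 = c k"
proof -
  interpret O: differential_expression \<Delta> b "(o\<^sub>C\<^sub>L) :: _ \<Rightarrow> 'k \<Rightarrow>\<^sub>C\<^sub>L 'h \<Rightarrow> _" n p q by (rule operator_expression)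
  obtain Y where "O.solution z (\<lambda>t. 0) Y" "\<And>k. k < 2 * n \<Longrightarrow> O.Q Y k 0 = c k"
    by (rule O.solution_exists[OF continuous_on_const, of z 0 c]) blast
  then show thesis using that[of Y] by (simp add: op_solution_iff)
qed

lemma op_solution_continuous: "op_solution \<Delta> n p q z Y \<Longrightarrow> continuous_on \<Delta> Y"
  unfolding op_solution_def using Ck_on_continuous[of \<Delta> 1 "quasi_deriv (o\<^sub>C\<^sub>L) \<Delta> n p q Y 0"] by auto

end



section \<open>Absolutely continuous functions\<close>

lemma abs_cont_onE:
  assumes "abs_cont_on a b f" "0 < e"
  obtains d where "0 < d" "\<forall>(N::nat) \<alpha> \<beta>. (\<forall>i<N. a \<le> \<alpha> i \<and> \<alpha> i \<le> \<beta> i \<and> \<beta> i \<le> b) \<and>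
        (\<forall>i<N. \<forall>j<N. i \<noteq> j \<longrightarrow> {\<alpha> i<..<\<beta> i} \<inter> {\<alpha> j<..<\<beta> j} = {}) \<and>
        (\<Sum>i<N. \<beta> i - \<alpha> i) < d \<longrightarrow> (\<Sum>i<N. norm (f (\<beta> i) - f (\<alpha> i))) < e"
proof -
  define P where "P d \<longleftrightarrow> (\<forall>(N::nat) \<alpha> \<beta>. (\<forall>i<N. a \<le> \<alpha> i \<and> \<alpha> i \<le> \<beta> i \<and> \<beta> i \<le> b) \<and>
        (\<forall>i<N. \<forall>j<N. i \<noteq> j \<longrightarrow> {\<alpha> i<..<\<beta> i} \<inter> {\<alpha> j<..<\<beta> j} = {}) \<and>
        (\<Sum>i<N. \<beta> i - \<alpha> i) < d \<longrightarrow> (\<Sum>i<N. norm (f (\<beta> i) - f (\<alpha> i))) < e)" for d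
  have "\<exists>d>0. P d"
    unfolding P_def by (rule assms(1)[unfolded abs_cont_on_def, THEN spec, THEN mp, OF assms(2)])
  then obtain d where d: "0 < d" "P d" by blast
  show thesis by (rule that[OF d(1) d(2)[unfolded P_def]])
qed

text \<open>The fundamental theorem for absolutely continuous functions by a gauge argument. Near
  points of differentiability the increment is almost linear; intervals tagged in the exceptional
  null set have small total length, so absolute continuity controls the increments there.\<close>

lemma abs_cont_has_integral:
  fixes f :: "real \<Rightarrow> 'v::real_normed_vector"
  assumes ac: "abs_cont_on a b f" and ab: "a \<le> b" and E: "negligible E"
    and der: "\<And>t. t \<in> {a..b} - E \<Longrightarrow> (f has_vector_derivative f' t) (at t within {a..b})"
  shows "(f' has_integral f b - f a) {a..b}"
proof -
  define g where "g t = (if t \<in> E then 0 else f' t)" for t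
  have "(g has_integral f b - f a) (cbox a b)"
    unfolding has_integral
  proof (intro allI impI)
    fix e :: real assume e: "0 < e"
    obtain d where d: "0 < d" and ac_d: "\<forall>(N::nat) \<alpha> \<beta>. (\<forall>i<N. a \<le> \<alpha> i \<and> \<alpha> i \<le> \<beta> i \<and> \<beta> i \<le> b) \<and>
        (\<forall>i<N. \<forall>j<N. i \<noteq> j \<longrightarrow> {\<alpha> i<..<\<beta> i} \<inter> {\<alpha> j<..<\<beta> j} = {}) \<and>
        (\<Sum>i<N. \<beta> i - \<alpha> i) < d \<longrightarrow> (\<Sum>i<N. norm (f (\<beta> i) - f (\<alpha> i))) < e / 2"
      by (rule abs_cont_onE[OF ac half_gt_zero[OF e]]) (rule that)
    note d' = ac_d[THEN spec, THEN spec, THEN spec, THEN mp, OF conjI[OF _ conjI]]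
    have Enull: "E \<in> null_sets lebesgue" using E negligible_iff_null_sets by blast
    \<comment> \<open>An open neighbourhood of E. Since E is null, U has the same measure as U - E,
      hence less than d.\<close>
    obtain U where U: "open U" "E \<subseteq> U" "U - E \<in> lmeasurable" "emeasure lebesgue (U - E) < ennreal d"
      using sets_lebesgue_outer_open[of E d] Enull d by blast
    have U': "U \<in> lmeasurable" "measure lebesgue U < d"
    proof -
      have eq: "emeasure lebesgue U = emeasure lebesgue (U - E)"
        by (subst emeasure_Diff_null_set[OF Enull]) (use U(1) in auto)
      then show "U \<in> lmeasurable" using U(1,3) by (auto simp: fmeasurable_def)
      then show "measure lebesgue U < d" using U(4) d by (metis eq emeasure_eq_measure2 ennreal_less_iff measure_nonneg)
    qed
    \<comment> \<open>Summed over a division the linear approximation costs at most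
      \<open>\<epsilon> * (b - a)\<close>, which is at most half of e; the added 1 covers a =
      b.\<close>
    define \<epsilon> where "\<epsilon> = e / (2 * (b - a + 1))"
    have \<epsilon>: "0 < \<epsilon>" using e ab by (simp add: \<epsilon>_def)
    have "\<exists>r>0. \<forall>y\<in>{a..b}. \<bar>y - t\<bar> < r \<longrightarrow> norm (f y - f t - (y - t) *\<^sub>R f' t) \<le> \<epsilon> * \<bar>y - t\<bar>" if "t \<in> {a..b} - E" for t
      using der[OF that] \<epsilon> unfolding has_vector_derivative_def has_derivative_within_alt by (auto simp: dist_real_def)
    then obtain r where r: "\<And>t. t \<in> {a..b} - E \<Longrightarrow> 0 < r t"
      "\<And>t y. t \<in> {a..b} - E \<Longrightarrow> y \<in> {a..b} \<Longrightarrow> \<bar>y - t\<bar> < r t \<Longrightarrow> norm (f y - f t - (y - t) *\<^sub>R f' t) \<le> \<epsilon> * \<bar>y - t\<bar>"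
      by metis
    \<comment> \<open>Tags in E force their intervals into U, other tags force them into the range
      of the linear approximation. The radius 1 is a filler for points outside the interval.\<close>
    define \<gamma> where "\<gamma> t = (if t \<in> E then U else if t \<in> {a..b} then ball t (r t) else ball t 1)" for t
    have gauge: "gauge \<gamma>" unfolding gauge_def \<gamma>_def using U r(1) by auto
    have fine: "norm ((\<Sum>(x, k)\<in>D. measure lborel k *\<^sub>R g x) - (f b - f a)) < e"
      if D: "D tagged_division_of cbox a b" "\<gamma> fine D" for D
    proof -
      note Dp = tagged_division_ofD[OF D(1)]
      have int: "\<exists>u v. k = {u..v} \<and> u \<le> x \<and> x \<le> v \<and> a \<le> u \<and> v \<le> b \<and> k \<subseteq> \<gamma> x" if "(x, k) \<in> D" for x k
        using Dp(2,3,4)[OF that] fineD[OF D(2) that] by (auto simp: box_real)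
      define DE where "DE = {d \<in> D. fst d \<in> E}"
      have fin: "finite D" "finite DE" using Dp(1) by (auto simp: DE_def)
      have sumf: "(\<Sum>(x, k)\<in>D. f (Sup k) - f (Inf k)) = f b - f a"
        using additive_tagged_division_1[OF ab, of D f] D(1) by simp
      \<comment> \<open>Intervals tagged in E do not overlap and lie in U, so their total length is
        below d.\<close>
      have E_part: "(\<Sum>d\<in>DE. norm (f (Sup (snd d)) - f (Inf (snd d)))) < e / 2"
      proof -
        obtain h where h: "bij_betw h {0..<card DE} DE" using ex_bij_betw_nat_finite[OF fin(2)] by blast
        then have h': "bij_betw h {..<card DE} DE" by (simp add: atLeast0LessThan)
        have hD: "h i \<in> DE" if "i < card DE" for i using h' that by (auto simp: bij_betw_def)
        have hs: "\<exists>u v. snd (h i) = {u..v} \<and> u \<le> v \<and> a \<le> u \<and> v \<le> b \<and> {u..v} \<subseteq> U" if "i < card DE" for i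
          using int[of "fst (h i)" "snd (h i)"] hD[OF that] by (auto simp: DE_def \<gamma>_def)
        have disj: "interior (snd (h i)) \<inter> interior (snd (h j)) = {}" if "i < card DE" "j < card DE" "i \<noteq> j" for i j
        proof -
          have "h i \<noteq> h j" using h' that by (auto simp: bij_betw_def inj_on_def)
          then show ?thesis using Dp(5)[of "fst (h i)" "snd (h i)" "fst (h j)" "snd (h j)"] hD that by (auto simp: DE_def)
        qed
        have interior: "{Inf (snd (h i))<..<Sup (snd (h i))} = interior (snd (h i))" if "i < card DE" for i
          using hs[OF that] by (auto simp: interior_atLeastAtMost_real)
        have "(\<Sum>i<card DE. norm (f (Sup (snd (h i))) - f (Inf (snd (h i))))) < e / 2"
        proof (rule d')
          show "\<forall>i<card DE. a \<le> Inf (snd (h i)) \<and> Inf (snd (h i)) \<le> Sup (snd (h i)) \<and> Sup (snd (h i)) \<le> b"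
            using hs by fastforce
          show "\<forall>i<card DE. \<forall>j<card DE. i \<noteq> j \<longrightarrow> {Inf (snd (h i))<..<Sup (snd (h i))} \<inter> {Inf (snd (h j))<..<Sup (snd (h j))} = {}"
            using disj interior by simp
          have "(\<Sum>i<card DE. Sup (snd (h i)) - Inf (snd (h i))) = (\<Sum>i<card DE. measure lebesgue (interior (snd (h i))))"
          proof (rule sum.cong[OF refl])
            fix i assume "i \<in> {..<card DE}"
            then obtain u v where "snd (h i) = {u..v}" "u \<le> v" using hs by blast
            then show "Sup (snd (h i)) - Inf (snd (h i)) = measure lebesgue (interior (snd (h i)))"
              by (simp add: interior_atLeastAtMost_real)
          qed
          also have "\<dots> = measure lebesgue (\<Union>i<card DE. interior (snd (h i)))"
          proof (rule measure_finite_Union[symmetric])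
            show "disjoint_family_on (\<lambda>i. interior (snd (h i))) {..<card DE}"
              using disj by (auto simp: disjoint_family_on_def)
            show "emeasure lebesgue (interior (snd (h i))) \<noteq> \<infinity>" if "i \<in> {..<card DE}" for i
              using hs[of i] that by (auto simp: interior_atLeastAtMost_real)
          qed auto
          also have "\<dots> \<le> measure lebesgue U"
          proof (rule measure_mono_fmeasurable[OF _ _ U'(1)])
            show "(\<Union>i<card DE. interior (snd (h i))) \<subseteq> U" using hs interior_subset by fastforce
          qed auto
          also have "\<dots> < d" by (rule U'(2))
          finally show "(\<Sum>i<card DE. Sup (snd (h i)) - Inf (snd (h i))) < d" .
        qed
        then show ?thesis using sum.reindex_bij_betw[OF h', of "\<lambda>d. norm (f (Sup (snd d)) - f (Inf (snd d)))"] by simp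
      qed
      \<comment> \<open>The tag lies between the end points u and v; the approximation is used at
        both, and the two errors add up to a multiple of the length.\<close>
      have good: "norm (measure lborel k *\<^sub>R g x - (f (Sup k) - f (Inf k))) \<le> \<epsilon> * measure lborel k" if "(x, k) \<in> D" "x \<notin> E" for x k
      proof -
        note kD = that(1)
        obtain u v where k: "k = {u..v}" "u \<le> x" "x \<le> v" "a \<le> u" "v \<le> b" "k \<subseteq> \<gamma> x" using int[OF kD] by blast
        have x: "x \<in> {a..b} - E" using k that by auto
        have ball: "\<bar>s - x\<bar> < r x" if "s \<in> k" for s
          using subsetD[OF k(6) that] \<open>x \<in> {a..b} - E\<close> by (simp add: \<gamma>_def dist_real_def abs_minus_commute)
        have uv: "\<bar>v - x\<bar> < r x" "\<bar>u - x\<bar> < r x"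
          using ball[of v] ball[of u] k by auto
        have v: "norm (f v - f x - (v - x) *\<^sub>R f' x) \<le> \<epsilon> * (v - x)" using r(2)[OF x _ uv(1)] k by auto
        have u: "norm (f u - f x - (u - x) *\<^sub>R f' x) \<le> \<epsilon> * (x - u)" using r(2)[OF x _ uv(2)] k by auto
        have "measure lborel k *\<^sub>R g x - (f (Sup k) - f (Inf k)) = (f u - f x - (u - x) *\<^sub>R f' x) - (f v - f x - (v - x) *\<^sub>R f' x)"
          using k that(2) by (simp add: g_def algebra_simps)
        also have "norm \<dots> \<le> \<epsilon> * (x - u) + \<epsilon> * (v - x)"
          using norm_triangle_ineq4 u v by (meson add_mono order_trans)
        also have "\<dots> = \<epsilon> * measure lborel k" using k by (simp add: algebra_simps)
        finally show ?thesis .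
      qed
      have "(\<Sum>(x, k)\<in>D. measure lborel k *\<^sub>R g x) - (f b - f a) = (\<Sum>d\<in>D. measure lborel (snd d) *\<^sub>R g (fst d) - (f (Sup (snd d)) - f (Inf (snd d))))"
        unfolding sumf[symmetric] by (simp add: sum_subtractf case_prod_beta)
      also have "norm \<dots> \<le> (\<Sum>d\<in>D. norm (measure lborel (snd d) *\<^sub>R g (fst d) - (f (Sup (snd d)) - f (Inf (snd d)))))" by (rule norm_sum)
      also have "\<dots> = (\<Sum>d\<in>DE. norm (measure lborel (snd d) *\<^sub>R g (fst d) - (f (Sup (snd d)) - f (Inf (snd d)))))
          + (\<Sum>d\<in>D - DE. norm (measure lborel (snd d) *\<^sub>R g (fst d) - (f (Sup (snd d)) - f (Inf (snd d)))))"
        using sum.subset_diff[of DE D] fin by (simp add: DE_def add.commute)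
      also have "(\<Sum>d\<in>DE. norm (measure lborel (snd d) *\<^sub>R g (fst d) - (f (Sup (snd d)) - f (Inf (snd d))))) = (\<Sum>d\<in>DE. norm (f (Sup (snd d)) - f (Inf (snd d))))"
        by (rule sum.cong) (auto simp: DE_def g_def norm_minus_commute)
      also have "(\<Sum>d\<in>D - DE. norm (measure lborel (snd d) *\<^sub>R g (fst d) - (f (Sup (snd d)) - f (Inf (snd d))))) \<le> (\<Sum>d\<in>D - DE. \<epsilon> * measure lborel (snd d))"
        by (rule sum_mono) (use good in \<open>auto simp: DE_def\<close>)
      also have "\<dots> \<le> (\<Sum>d\<in>D. \<epsilon> * measure lborel (snd d))" by (rule sum_mono2) (use fin \<epsilon> in auto)
      also have "\<dots> = \<epsilon> * (\<Sum>(x, k)\<in>D. measure lborel k)" by (simp add: sum_distrib_left case_prod_beta)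
      also have "(\<Sum>(x, k)\<in>D. measure lborel k) = b - a" using additive_content_tagged_division[OF D(1)] ab by simp
      also have "\<epsilon> * (b - a) \<le> e / 2" using ab e by (simp add: \<epsilon>_def field_simps)
      finally show ?thesis using E_part by linarith
    qed
    show "\<exists>\<gamma>. gauge \<gamma> \<and> (\<forall>D. D tagged_division_of cbox a b \<and> \<gamma> fine D \<longrightarrow>
        norm ((\<Sum>(x, k)\<in>D. measure lborel k *\<^sub>R g x) - (f b - f a)) < e)"
    proof (intro exI conjI allI impI)
      show "gauge \<gamma>" by (rule gauge)
      fix D assume "D tagged_division_of cbox a b \<and> \<gamma> fine D"
      then show "norm ((\<Sum>(x, k)\<in>D. measure lborel k *\<^sub>R g x) - (f b - f a)) < e" by (elim conjE) (rule fine)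
    qed
  qed
  then show ?thesis
    using has_integral_spike[OF E, of "{a..b}" f' g] by (auto simp: g_def)
qed

lemma abs_cont_on_add:
  assumes "abs_cont_on a b f" "abs_cont_on a b g" shows "abs_cont_on a b (\<lambda>t. f t + g t)"
  unfolding abs_cont_on_def
proof (intro allI impI)
  fix e :: real assume "0 < e"
  then have e: "0 < e / 2" by simp
  obtain d where d: "0 < d" "\<forall>(N::nat) \<alpha> \<beta>. (\<forall>i<N. a \<le> \<alpha> i \<and> \<alpha> i \<le> \<beta> i \<and> \<beta> i \<le> b) \<and>
        (\<forall>i<N. \<forall>j<N. i \<noteq> j \<longrightarrow> {\<alpha> i<..<\<beta> i} \<inter> {\<alpha> j<..<\<beta> j} = {}) \<and>
        (\<Sum>i<N. \<beta> i - \<alpha> i) < d \<longrightarrow> (\<Sum>i<N. norm (f (\<beta> i) - f (\<alpha> i))) < e / 2"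
    by (rule abs_cont_onE[OF assms(1) e]) (rule that)
  obtain d' where d': "0 < d'" "\<forall>(N::nat) \<alpha> \<beta>. (\<forall>i<N. a \<le> \<alpha> i \<and> \<alpha> i \<le> \<beta> i \<and> \<beta> i \<le> b) \<and>
        (\<forall>i<N. \<forall>j<N. i \<noteq> j \<longrightarrow> {\<alpha> i<..<\<beta> i} \<inter> {\<alpha> j<..<\<beta> j} = {}) \<and>
        (\<Sum>i<N. \<beta> i - \<alpha> i) < d' \<longrightarrow> (\<Sum>i<N. norm (g (\<beta> i) - g (\<alpha> i))) < e / 2"
    by (rule abs_cont_onE[OF assms(2) e]) (rule that)
  show "\<exists>\<delta>>0. \<forall>(N::nat) \<alpha> \<beta>. (\<forall>i<N. a \<le> \<alpha> i \<and> \<alpha> i \<le> \<beta> i \<and> \<beta> i \<le> b) \<and>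
      (\<forall>i<N. \<forall>j<N. i \<noteq> j \<longrightarrow> {\<alpha> i<..<\<beta> i} \<inter> {\<alpha> j<..<\<beta> j} = {}) \<and> (\<Sum>i<N. \<beta> i - \<alpha> i) < \<delta> \<longrightarrow>
      (\<Sum>i<N. norm (f (\<beta> i) + g (\<beta> i) - (f (\<alpha> i) + g (\<alpha> i)))) < e"
  proof (intro exI conjI allI impI)
    show "0 < min d d'" using d(1) d'(1) by simp
    fix N :: nat and \<alpha> \<beta>
    assume *: "(\<forall>i<N. a \<le> \<alpha> i \<and> \<alpha> i \<le> \<beta> i \<and> \<beta> i \<le> b) \<and>
      (\<forall>i<N. \<forall>j<N. i \<noteq> j \<longrightarrow> {\<alpha> i<..<\<beta> i} \<inter> {\<alpha> j<..<\<beta> j} = {}) \<and> (\<Sum>i<N. \<beta> i - \<alpha> i) < min d d'"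
    have "(\<Sum>i<N. norm (f (\<beta> i) + g (\<beta> i) - (f (\<alpha> i) + g (\<alpha> i)))) \<le> (\<Sum>i<N. norm (f (\<beta> i) - f (\<alpha> i)) + norm (g (\<beta> i) - g (\<alpha> i)))"
      by (rule sum_mono) (metis add_diff_add norm_triangle_ineq)
    then show "(\<Sum>i<N. norm (f (\<beta> i) + g (\<beta> i) - (f (\<alpha> i) + g (\<alpha> i)))) < e"
      using d(2)[rule_format, of N \<alpha> \<beta>] d'(2)[rule_format, of N \<alpha> \<beta>] * by (simp add: sum.distrib)
  qed
qed

text \<open>Comparison of increments; negation, conjugation, products and glueing of absolutely
  continuous functions are all reduced to it.\<close>

lemma abs_cont_on_le:
  assumes f: "abs_cont_on a b f" and K: "0 \<le> K" "0 \<le> L"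
    and le: "\<And>s t. s \<in> {a..b} \<Longrightarrow> t \<in> {a..b} \<Longrightarrow> norm (g t - g s) \<le> K * norm (f t - f s) + L * \<bar>t - s\<bar>"
  shows "abs_cont_on a b g"
  unfolding abs_cont_on_def
proof (intro allI impI)
  fix e :: real assume e: "0 < e"
  have eK: "0 < e / (2 * (K + 1))" using e K by simp
  obtain d where d: "0 < d" "\<forall>(N::nat) \<alpha> \<beta>. (\<forall>i<N. a \<le> \<alpha> i \<and> \<alpha> i \<le> \<beta> i \<and> \<beta> i \<le> b) \<and>
        (\<forall>i<N. \<forall>j<N. i \<noteq> j \<longrightarrow> {\<alpha> i<..<\<beta> i} \<inter> {\<alpha> j<..<\<beta> j} = {}) \<and>
        (\<Sum>i<N. \<beta> i - \<alpha> i) < d \<longrightarrow> (\<Sum>i<N. norm (f (\<beta> i) - f (\<alpha> i))) < e / (2 * (K + 1))"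
    by (rule abs_cont_onE[OF f eK]) (rule that)
  show "\<exists>\<delta>>0. \<forall>(N::nat) \<alpha> \<beta>. (\<forall>i<N. a \<le> \<alpha> i \<and> \<alpha> i \<le> \<beta> i \<and> \<beta> i \<le> b) \<and>
      (\<forall>i<N. \<forall>j<N. i \<noteq> j \<longrightarrow> {\<alpha> i<..<\<beta> i} \<inter> {\<alpha> j<..<\<beta> j} = {}) \<and> (\<Sum>i<N. \<beta> i - \<alpha> i) < \<delta> \<longrightarrow>
      (\<Sum>i<N. norm (g (\<beta> i) - g (\<alpha> i))) < e"
  proof (intro exI conjI allI impI)
    show "0 < min d (e / (2 * (L + 1)))" using d(1) e K by simp
    fix N :: nat and \<alpha> \<beta>
    assume *: "(\<forall>i<N. a \<le> \<alpha> i \<and> \<alpha> i \<le> \<beta> i \<and> \<beta> i \<le> b) \<and>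
      (\<forall>i<N. \<forall>j<N. i \<noteq> j \<longrightarrow> {\<alpha> i<..<\<beta> i} \<inter> {\<alpha> j<..<\<beta> j} = {}) \<and> (\<Sum>i<N. \<beta> i - \<alpha> i) < min d (e / (2 * (L + 1)))"
    have ineq: "norm (g (\<beta> i) - g (\<alpha> i)) \<le> K * norm (f (\<beta> i) - f (\<alpha> i)) + L * (\<beta> i - \<alpha> i)" if "i < N" for i
    proof -
      have "a \<le> \<alpha> i" "\<alpha> i \<le> \<beta> i" "\<beta> i \<le> b" using * that by blast+
      then show ?thesis using le[of "\<alpha> i" "\<beta> i"] by simp
    qed
    have "(\<Sum>i<N. norm (g (\<beta> i) - g (\<alpha> i))) \<le> (\<Sum>i<N. K * norm (f (\<beta> i) - f (\<alpha> i)) + L * (\<beta> i - \<alpha> i))"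
      by (rule sum_mono) (use ineq in simp)
    also have "\<dots> = K * (\<Sum>i<N. norm (f (\<beta> i) - f (\<alpha> i))) + L * (\<Sum>i<N. \<beta> i - \<alpha> i)"
      by (simp add: sum.distrib sum_distrib_left)
    finally have 1: "(\<Sum>i<N. norm (g (\<beta> i) - g (\<alpha> i))) \<le> K * (\<Sum>i<N. norm (f (\<beta> i) - f (\<alpha> i))) + L * (\<Sum>i<N. \<beta> i - \<alpha> i)" .
    have "K * (\<Sum>i<N. norm (f (\<beta> i) - f (\<alpha> i))) \<le> K * (e / (2 * (K + 1)))"
      using d(2)[rule_format, of N \<alpha> \<beta>] * K by (intro mult_left_mono) auto
    also have "\<dots> < e / 2" using e K by (simp add: field_simps)
    finally have 2: "K * (\<Sum>i<N. norm (f (\<beta> i) - f (\<alpha> i))) < e / 2" .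
    have "L * (\<Sum>i<N. \<beta> i - \<alpha> i) \<le> L * (e / (2 * (L + 1)))"
      using * K by (intro mult_left_mono) auto
    also have "\<dots> \<le> e / 2" using e K by (simp add: field_simps)
    finally show "(\<Sum>i<N. norm (g (\<beta> i) - g (\<alpha> i))) < e" using 1 2 by linarith
  qed
qed

section \<open>Square integrable functions\<close>

text \<open>Square integrability on the whole line, because functions on the interval are extended
  by 0; \<open>cutoff\<close> then keeps restrictions to segments in the same space.\<close>

definition l2 :: "(real \<Rightarrow> 'h::{complex_hilbert, second_countable_topology}) \<Rightarrow> bool"
  where "l2 f \<longleftrightarrow> f \<in> borel_measurable lebesgue \<and> integrable lebesgue (\<lambda>t. (norm (f t))\<^sup>2)"

definition l2_inner :: "(real \<Rightarrow> 'h::{complex_hilbert, second_countable_topology}) \<Rightarrow> (real \<Rightarrow> 'h) \<Rightarrow> complex"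
  where "l2_inner f g = (LINT t|lebesgue. cinner (f t) (g t))"

definition l2_norm :: "(real \<Rightarrow> 'h::{complex_hilbert, second_countable_topology}) \<Rightarrow> real"
  where "l2_norm f = sqrt (LINT t|lebesgue. (norm (f t))\<^sup>2)"

definition cutoff :: "real set \<Rightarrow> (real \<Rightarrow> 'h::real_vector) \<Rightarrow> real \<Rightarrow> 'h"
  where "cutoff S f t = (if t \<in> S then f t else 0)"

lemma square_integrable_cut:
  assumes "S \<in> sets lebesgue" shows "square_integrable S f \<longleftrightarrow> l2 (cutoff S f)"
proof -
  have 1: "cutoff S f = (\<lambda>t. indicator S t *\<^sub>R f t)" by (auto simp: cutoff_def fun_eq_iff)
  have 2: "(\<lambda>t. (norm (cutoff S f t))\<^sup>2) = (\<lambda>t. indicator S t *\<^sub>R (norm (f t))\<^sup>2)" by (auto simp: cutoff_def fun_eq_iff)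
  show ?thesis
    unfolding square_integrable_def l2_def 2 unfolding 1
    using assms by (simp add: borel_measurable_restrict_space_iff integrable_restrict_space)
qed

lemma l2_measurable: "l2 f \<Longrightarrow> f \<in> borel_measurable lebesgue"
  by (simp add: l2_def)

lemma l2_add: assumes "l2 f" "l2 g" shows "l2 (\<lambda>t. f t + g t)"
proof -
  have m: "(\<lambda>t. f t + g t) \<in> borel_measurable lebesgue"
    using assms unfolding l2_def by (intro borel_measurable_add) auto
  have "integrable lebesgue (\<lambda>t. (norm (f t + g t))\<^sup>2)"
  proof (rule Bochner_Integration.integrable_bound)
    show "integrable lebesgue (\<lambda>t. 2 * (norm (f t))\<^sup>2 + 2 * (norm (g t))\<^sup>2)" using assms by (simp add: l2_def)
    show "AE t in lebesgue. norm ((norm (f t + g t))\<^sup>2) \<le> norm (2 * (norm (f t))\<^sup>2 + 2 * (norm (g t))\<^sup>2)"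
    proof (rule AE_I2)
      fix t
      have "(norm (f t + g t))\<^sup>2 \<le> (norm (f t) + norm (g t))\<^sup>2" by (simp add: power_mono norm_triangle_ineq)
      also have "\<dots> \<le> 2 * (norm (f t))\<^sup>2 + 2 * (norm (g t))\<^sup>2"
        using zero_le_power2[of "norm (f t) - norm (g t)"] by (simp add: power2_eq_square algebra_simps)
      finally show "norm ((norm (f t + g t))\<^sup>2) \<le> norm (2 * (norm (f t))\<^sup>2 + 2 * (norm (g t))\<^sup>2)" by simp
    qed
  qed (use m in measurable)
  then show ?thesis using m by (simp add: l2_def)
qed

lemma l2_scaleC: assumes "l2 f" shows "l2 (\<lambda>t. c *\<^sub>C f t)"
proof -
  have "(\<lambda>x::'a. c *\<^sub>C x) \<in> borel_measurable borel"
    by (intro borel_measurable_continuous_onI linear_continuous_on bounded_linear_scaleC)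
  then have "(\<lambda>t. c *\<^sub>C f t) \<in> borel_measurable lebesgue"
    using assms measurable_compose unfolding l2_def by blast
  then show ?thesis using assms by (simp add: l2_def norm_scaleC power_mult_distrib)
qed

lemma l2_diff: "l2 f \<Longrightarrow> l2 g \<Longrightarrow> l2 (\<lambda>t. f t - g t)"
  using l2_add[OF _ l2_scaleC[of g "-1"], of f] by (simp add: scaleC_minus_left)

lemma l2_zero: "l2 (\<lambda>t. 0)" by (simp add: l2_def)

lemma l2_cut: assumes "l2 f" "S \<in> sets lebesgue" shows "l2 (cutoff S f)"
proof -
  have 1: "cutoff S f = (\<lambda>t. indicator S t *\<^sub>R f t)" by (auto simp: cutoff_def fun_eq_iff)
  have 2: "(\<lambda>t. (norm (cutoff S f t))\<^sup>2) = (\<lambda>t. indicator S t *\<^sub>R (norm (f t))\<^sup>2)" by (auto simp: cutoff_def fun_eq_iff)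
  show ?thesis unfolding l2_def 2 unfolding 1
    using assms integrable_mult_indicator[of S lebesgue "\<lambda>t. (norm (f t))\<^sup>2"]
    unfolding l2_def by (intro conjI borel_measurable_scaleR) auto
qed

lemma measurable_cinner:
  fixes f g :: "real \<Rightarrow> 'h::{complex_hilbert, second_countable_topology}"
  assumes "f \<in> borel_measurable M" "g \<in> borel_measurable M"
  shows "(\<lambda>t. cinner (f t) (g t)) \<in> borel_measurable M"
  by (rule borel_measurable_continuous_Pair[OF assms])
    (intro bounded_bilinear.continuous_on[OF bounded_bilinear_cinner] continuous_intros)

lemma l2_integrable: assumes "l2 f" "l2 g" shows "integrable lebesgue (\<lambda>t. cinner (f t) (g t))"
proof (rule Bochner_Integration.integrable_bound)
  show "integrable lebesgue (\<lambda>t. (norm (f t))\<^sup>2 + (norm (g t))\<^sup>2)" using assms by (simp add: l2_def)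
  show "(\<lambda>t. cinner (f t) (g t)) \<in> borel_measurable lebesgue"
    using assms by (intro measurable_cinner l2_measurable)
  show "AE t in lebesgue. norm (cinner (f t) (g t)) \<le> norm ((norm (f t))\<^sup>2 + (norm (g t))\<^sup>2)"
  proof (rule AE_I2)
    fix t
    have "2 * (norm (f t) * norm (g t)) \<le> (norm (f t))\<^sup>2 + (norm (g t))\<^sup>2"
      using sum_squares_bound[of "norm (f t)" "norm (g t)"] by (simp add: mult.assoc)
    moreover have "0 \<le> norm (f t) * norm (g t)" by simp
    ultimately have "norm (f t) * norm (g t) \<le> (norm (f t))\<^sup>2 + (norm (g t))\<^sup>2" by linarith
    then show "norm (cinner (f t) (g t)) \<le> norm ((norm (f t))\<^sup>2 + (norm (g t))\<^sup>2)"
      using cmod_cinner_le[of "f t" "g t"] by simp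
  qed
qed

lemma l2_inner_add_left: "l2 f \<Longrightarrow> l2 g \<Longrightarrow> l2 h \<Longrightarrow> l2_inner (\<lambda>t. f t + g t) h = l2_inner f h + l2_inner g h"
  by (simp add: l2_inner_def cinner_add_left l2_integrable)

lemma l2_inner_diff_left: "l2 f \<Longrightarrow> l2 g \<Longrightarrow> l2 h \<Longrightarrow> l2_inner (\<lambda>t. f t - g t) h = l2_inner f h - l2_inner g h"
  by (simp add: l2_inner_def cinner_diff_left l2_integrable)

lemma l2_inner_scaleC_left: "l2_inner (\<lambda>t. c *\<^sub>C f t) h = c * l2_inner f h"
  by (simp add: l2_inner_def cinner_scaleC_left)

lemma l2_inner_commute: "l2_inner f g = cnj (l2_inner g f)"
proof -
  have "(\<lambda>t. cinner (f t) (g t)) = (\<lambda>t. cnj (cinner (g t) (f t)))" by (rule ext) (rule cinner_commute)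
  then show ?thesis by (simp only: l2_inner_def Bochner_Integration.integral_cnj)
qed

lemma l2_inner_add_right: "l2 f \<Longrightarrow> l2 g \<Longrightarrow> l2 h \<Longrightarrow> l2_inner h (\<lambda>t. f t + g t) = l2_inner h f + l2_inner h g"
  by (simp add: l2_inner_def cinner_add_right l2_integrable)

lemma l2_inner_scaleC_right: "l2_inner h (\<lambda>t. c *\<^sub>C f t) = cnj c * l2_inner h f"
  by (simp add: l2_inner_def cinner_scaleC_right)

lemma l2_norm_nonneg: "0 \<le> l2_norm f"
  by (simp add: l2_norm_def)

lemma l2_norm_sq: "(l2_norm f)\<^sup>2 = (LINT t|lebesgue. (norm (f t))\<^sup>2)"
  by (simp add: l2_norm_def)

lemma l2_inner_self: "l2_inner f f = of_real ((l2_norm f)\<^sup>2)"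
  unfolding l2_inner_def l2_norm_sq cinner_self by (rule integral_complex_of_real)

text \<open>The weighted inequality is optimal at \<open>r = G / F\<close>. It yields the
  Cauchy-Schwarz inequality for functions, where a vanishing norm does not mean a vanishing
  function; the degenerate cases need their own weights.\<close>

lemma le_sqrt_mult:
  fixes c F G :: real
  assumes "\<And>r. 0 < r \<Longrightarrow> 2 * c \<le> r * F\<^sup>2 + G\<^sup>2 / r" "0 \<le> F" "0 \<le> G" shows "c \<le> F * G"
proof (rule ccontr)
  assume "\<not> c \<le> F * G"
  define e where "e = c - F * G"
  have e: "0 < e" using \<open>\<not> c \<le> F * G\<close> by (simp add: e_def)
  show False
  proof (cases "F = 0 \<or> G = 0")
    case False
    then have "0 < F" "0 < G" using assms(2,3) by auto
    then show False using assms(1)[of "G / F"] e by (simp add: e_def power2_eq_square field_simps)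
  next
    case True
    then show False
    proof
      assume "F = 0"
      \<comment> \<open>For F = 0 only the second term remains, and this weight pushes it down to c.
        The case G = 0 uses a small weight in the same way.\<close>
      then have "2 * c \<le> G\<^sup>2 / (G\<^sup>2 / c + 1)" "0 < c" using assms(1)[of "G\<^sup>2 / c + 1"] e by (auto simp: e_def add_nonneg_pos)
      moreover have "G\<^sup>2 / (G\<^sup>2 / c + 1) \<le> c"
      proof -
        have "0 < G\<^sup>2 / c + 1" using \<open>0 < c\<close> by (simp add: add_nonneg_pos)
        then show ?thesis using \<open>0 < c\<close> by (simp add: divide_le_eq distrib_left)
      qed
      ultimately show False by simp
    next
      assume "G = 0"
      then have c: "0 < c" using e by (simp add: e_def)
      then have "0 < F\<^sup>2 + 1" "2 * c \<le> c / (F\<^sup>2 + 1) * F\<^sup>2" using assms(1)[of "c / (F\<^sup>2 + 1)"] \<open>G = 0\<close> by (auto simp: add_nonneg_pos)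
      moreover have "c / (F\<^sup>2 + 1) * F\<^sup>2 \<le> c" using c \<open>0 < F\<^sup>2 + 1\<close> by (simp add: divide_le_eq distrib_left)
      ultimately show False using c by linarith
    qed
  qed
qed

lemma l2_cauchy_schwarz: assumes "l2 f" "l2 g" shows "cmod (l2_inner f g) \<le> l2_norm f * l2_norm g"
proof (rule le_sqrt_mult)
  fix r :: real assume r: "0 < r"
  have int: "integrable lebesgue (\<lambda>t. (norm (f t))\<^sup>2)" "integrable lebesgue (\<lambda>t. (norm (g t))\<^sup>2)" using assms by (auto simp: l2_def)
  have "cmod (l2_inner f g) \<le> (LINT t|lebesgue. cmod (cinner (f t) (g t)))"
    unfolding l2_inner_def by (rule integral_norm_bound)
  also have "2 * \<dots> \<le> (LINT t|lebesgue. r * (norm (f t))\<^sup>2 + (norm (g t))\<^sup>2 / r)"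
    unfolding integral_mult_right_zero[symmetric]
  proof (rule integral_mono)
    fix t
    have "0 \<le> (sqrt r * norm (f t) - norm (g t) / sqrt r)\<^sup>2" by simp
    also have "\<dots> = r * (norm (f t))\<^sup>2 + (norm (g t))\<^sup>2 / r - 2 * (norm (f t) * norm (g t))"
      using r by (simp add: power2_diff power_mult_distrib power_divide)
    finally show "2 * cmod (cinner (f t) (g t)) \<le> r * (norm (f t))\<^sup>2 + (norm (g t))\<^sup>2 / r"
      using cmod_cinner_le[of "f t" "g t"] by linarith
  qed (use int l2_integrable[OF assms] in auto)
  also have "\<dots> = r * (l2_norm f)\<^sup>2 + (l2_norm g)\<^sup>2 / r" using int by (simp add: l2_norm_sq)
  finally show "2 * cmod (l2_inner f g) \<le> r * (l2_norm f)\<^sup>2 + (l2_norm g)\<^sup>2 / r" by simp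
qed (rule l2_norm_nonneg)+

lemma l2_norm_add_sq:
  assumes "l2 f" "l2 g"
  shows "(l2_norm (\<lambda>t. f t + g t))\<^sup>2 = (l2_norm f)\<^sup>2 + 2 * Re (l2_inner f g) + (l2_norm g)\<^sup>2"
proof -
  have "of_real ((l2_norm (\<lambda>t. f t + g t))\<^sup>2) = l2_inner (\<lambda>t. f t + g t) (\<lambda>t. f t + g t)" by (simp add: l2_inner_self)
  also have "\<dots> = l2_inner f f + (l2_inner f g + cnj (l2_inner f g)) + l2_inner g g"
    using assms l2_inner_commute[of g f] by (simp add: l2_inner_add_left l2_inner_add_right l2_add)
  also have "\<dots> = of_real ((l2_norm f)\<^sup>2 + 2 * Re (l2_inner f g) + (l2_norm g)\<^sup>2)"
    by (simp add: l2_inner_self complex_add_cnj)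
  finally show ?thesis using of_real_eq_iff by blast
qed

lemma l2_norm_triangle: assumes "l2 f" "l2 g" shows "l2_norm (\<lambda>t. f t + g t) \<le> l2_norm f + l2_norm g"
proof (rule power2_le_imp_le)
  show "(l2_norm (\<lambda>t. f t + g t))\<^sup>2 \<le> (l2_norm f + l2_norm g)\<^sup>2"
    using l2_norm_add_sq[OF assms] l2_cauchy_schwarz[OF assms] complex_Re_le_cmod[of "l2_inner f g"]
    by (simp add: power2_sum)
qed (simp add: l2_norm_nonneg)

lemma l2_norm_scaleC: "l2_norm (\<lambda>t. c *\<^sub>C f t) = cmod c * l2_norm f"
  by (simp add: l2_norm_def norm_scaleC power_mult_distrib real_sqrt_mult)

lemma l2_norm_mono: assumes "l2 f" "l2 g" "\<And>t. norm (f t) \<le> norm (g t)" shows "l2_norm f \<le> l2_norm g"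
  unfolding l2_norm_def
  using assms by (intro real_sqrt_le_mono integral_mono) (auto simp: l2_def power_mono)

lemma l2_norm_cut: "l2 f \<Longrightarrow> S \<in> sets lebesgue \<Longrightarrow> l2_norm (cutoff S f) \<le> l2_norm f"
  by (rule l2_norm_mono) (auto simp: l2_cut cutoff_def)

lemma l2_inner_cut:
  "l2_inner (cutoff S f) (cutoff S g) = l2_inner (cutoff S f) g" "l2_inner f (cutoff S g) = l2_inner (cutoff S f) g"
  unfolding l2_inner_def by (auto intro!: arg_cong[where f = "integral\<^sup>L lebesgue"] simp: cutoff_def)

lemma cut_cut: "cutoff S (cutoff T f) = cutoff (S \<inter> T) f"
  by (auto simp: cutoff_def)

lemma cut_simps: "cutoff S (\<lambda>t. f t + g t) = (\<lambda>t. cutoff S f t + cutoff S g t)" "cutoff S (\<lambda>t. f t - g t) = (\<lambda>t. cutoff S f t - cutoff S g t)"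
  "cutoff S (\<lambda>t. c *\<^sub>C (h t :: 'v::complex_vector)) = (\<lambda>t. c *\<^sub>C cutoff S h t)"
  by (auto simp: cutoff_def)

lemma l2_inner_AE: "l2 f \<Longrightarrow> l2 f' \<Longrightarrow> l2 g \<Longrightarrow> AE t in lebesgue. f t = f' t \<Longrightarrow> l2_inner f g = l2_inner f' g"
  unfolding l2_inner_def by (rule integral_cong_AE) (auto intro!: measurable_cinner l2_measurable)

lemma l2_cut_continuous:
  fixes f :: "real \<Rightarrow> 'h::{complex_hilbert, second_countable_topology}"
  assumes "continuous_on {a..b} f" shows "l2 (cutoff {a..b} f)"
proof -
  have 1: "cutoff {a..b} f = (\<lambda>t. indicator {a..b} t *\<^sub>R f t)" by (auto simp: cutoff_def fun_eq_iff)
  have 2: "(\<lambda>t. (norm (cutoff {a..b} f t))\<^sup>2) = (\<lambda>t. indicator {a..b} t *\<^sub>R (norm (f t))\<^sup>2)" by (auto simp: cutoff_def fun_eq_iff)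
  have m: "(\<lambda>t. indicator {a..b} t *\<^sub>R f t) \<in> borel_measurable borel"
    by (rule borel_measurable_continuous_on_indicator[OF _ assms]) simp
  have "continuous_on {a..b} (\<lambda>t. (norm (f t))\<^sup>2)" by (intro continuous_intros assms)
  then have i: "set_integrable lborel {a..b} (\<lambda>t. (norm (f t))\<^sup>2)" by (rule borel_integrable_atLeastAtMost')
  have "integrable lebesgue (\<lambda>t. indicator {a..b} t *\<^sub>R (norm (f t))\<^sup>2)"
    using i integrable_completion[of "\<lambda>t. indicator {a..b} t *\<^sub>R (norm (f t))\<^sup>2" lborel] unfolding set_integrable_def
    by (auto dest: borel_measurable_integrable)
  then show ?thesis unfolding l2_def 2 unfolding 1 using m by (simp add: measurable_completion)
qed

section \<open>Exhaustion of the interval and convergence at b\<close>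

context half_open_interval
begin

lemma Delta_measurable: "\<Delta> \<in> sets lebesgue"
  by (cases rule: Delta_cases) auto

text \<open>The convergence theorems for integrals need sequences, the boundary form needs the
  filter \<open>up_to b\<close>; this sequence mediates between them. The shift by 2 makes its first
  point positive when b is finite.\<close>

lemma exhaustion:
  obtains \<eta> :: "nat \<Rightarrow> real" where "\<And>k. 0 < \<eta> k" "\<And>k. ereal (\<eta> k) < b" "incseq \<eta>"
    "\<And>k. \<forall>\<^sub>F s in up_to b. \<eta> k \<le> s \<and> ereal s < b" "filterlim \<eta> (up_to b) sequentially"
    "\<And>t. ereal t < b \<Longrightarrow> \<exists>k. t \<le> \<eta> k"
proof -
  note intro = that
  have fin: thesis if r: "0 < r" "b = ereal r" for r
  proof -
    let ?\<eta> = "\<lambda>k. r - r / (real k + 2)"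
    show thesis
    proof (rule intro[of ?\<eta>])
    show "0 < ?\<eta> k" "ereal (?\<eta> k) < b" for k using r by (auto simp: field_simps intro: add_pos_nonneg)
    show "incseq ?\<eta>" using r by (auto simp: incseq_def frac_le)
    have lt: "?\<eta> k < r" for k using r by simp
    have "\<forall>\<^sub>F s in at_left r. ?\<eta> k \<le> s \<and> s < r" for k
      unfolding eventually_at_left_field using lt[of k] by (intro exI[of _ "?\<eta> k"]) auto
    then show "\<forall>\<^sub>F s in up_to b. ?\<eta> k \<le> s \<and> ereal s < b" for k using r by (simp add: up_to_def)
    have "(\<lambda>k. r / (real k + 2)) \<longlonglongrightarrow> 0"
      using LIMSEQ_ignore_initial_segment[OF lim_const_over_n[of r], of 2] by (simp add: add.commute)
    from tendsto_diff[OF tendsto_const[of r] this]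
    have lim: "?\<eta> \<longlonglongrightarrow> r" by simp
    then show "filterlim ?\<eta> (up_to b) sequentially"
      using r lt by (auto simp: up_to_def filterlim_at)
    show "\<exists>k. t \<le> ?\<eta> k" if "ereal t < b" for t
      using order_tendstoD(1)[OF lim, of t] that r by (auto simp: eventually_sequentially intro: less_imp_le)
    qed
  qed
  have inf: thesis if "b = \<infinity>"
  proof (rule intro[of "\<lambda>k. real k + 1"])
    show "incseq (\<lambda>k. real k + 1)" by (simp add: incseq_def)
    show "\<forall>\<^sub>F s in up_to b. real k + 1 \<le> s \<and> ereal s < b" for k
      using eventually_ge_at_top[of "real k + 1"] \<open>b = \<infinity>\<close> by (simp add: up_to_def)
    show "filterlim (\<lambda>k. real k + 1) (up_to b) sequentially"
      using filterlim_tendsto_add_at_top[OF tendsto_const[of 1] filterlim_real_sequentially] \<open>b = \<infinity>\<close>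
      by (simp add: up_to_def add.commute)
    show "\<exists>k. t \<le> real k + 1" for t using real_arch_simple[of t] by (metis add_increasing2 zero_le_one)
  qed (use \<open>b = \<infinity>\<close> in auto)
  show thesis by (cases rule: Delta_cases) (use fin inf in auto)
qed

lemma up_to_ne_bot: "up_to b \<noteq> bot"
  by (cases rule: Delta_cases) (auto simp: up_to_def trivial_limit_at_left_real)

text \<open>A finite b may belong to the interval, but it is a single point. For infinite b the
  excluded point is merely the default value 0 of \<open>real_of_ereal\<close>.\<close>

lemma AE_less_b: "AE t in lebesgue. t \<in> \<Delta> \<longrightarrow> ereal t < b"
proof -
  have "AE t in lebesgue. t \<noteq> real_of_ereal b"
    by (rule AE_I'[of "{real_of_ereal b}"]) auto
  then show ?thesis by eventually_elim (cases rule: Delta_cases, auto)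
qed

text \<open>Dominated convergence along the exhausting sequence; monotonicity of the tails then
  gives the limit along the filter.\<close>

lemma tail_tendsto:
  assumes f: "l2 f" "\<And>t. t \<notin> \<Delta> \<Longrightarrow> f t = 0"
  shows "((\<lambda>\<eta>. l2_norm (cutoff (- {0..\<eta>}) f)) \<longlongrightarrow> 0) (up_to b)"
proof -
  obtain \<eta> :: "nat \<Rightarrow> real" where \<eta>: "incseq \<eta>" "\<And>k. \<forall>\<^sub>F s in up_to b. \<eta> k \<le> s \<and> ereal s < b" "\<And>t. ereal t < b \<Longrightarrow> \<exists>k. t \<le> \<eta> k"
    by (rule exhaustion) blast
  have "(\<lambda>k. LINT t|lebesgue. (norm (cutoff (- {0..\<eta> k}) f t))\<^sup>2) \<longlonglongrightarrow> integral\<^sup>L lebesgue (\<lambda>t::real. 0::real)"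
  proof (rule Bochner_Integration.integral_dominated_convergence[where w = "\<lambda>t. (norm (f t))\<^sup>2"])
    show "integrable lebesgue (\<lambda>t. (norm (f t))\<^sup>2)" using f by (simp add: l2_def)
    show "(\<lambda>t. (norm (cutoff (- {0..\<eta> k}) f t))\<^sup>2) \<in> borel_measurable lebesgue" for k
      using l2_cut[OF f(1), of "- {0..\<eta> k}"] by (auto simp: l2_def)
    show "AE t in lebesgue. norm ((norm (cutoff (- {0..\<eta> k}) f t))\<^sup>2) \<le> (norm (f t))\<^sup>2" for k by (simp add: cutoff_def)
    show "AE t in lebesgue. (\<lambda>k. (norm (cutoff (- {0..\<eta> k}) f t))\<^sup>2) \<longlonglongrightarrow> 0"
      using AE_less_b
    proof eventually_elim
      fix t assume t: "t \<in> \<Delta> \<longrightarrow> ereal t < b"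
      have "\<forall>\<^sub>F k in sequentially. (norm (cutoff (- {0..\<eta> k}) f t))\<^sup>2 = 0"
      proof (cases "t \<in> \<Delta>")
        case True
        then obtain k where "t \<le> \<eta> k" using \<eta>(3) t by blast
        then have "t \<le> \<eta> m" if "k \<le> m" for m using incseqD[OF \<eta>(1) that] by linarith
        then show ?thesis using nonneg[OF True] unfolding eventually_sequentially by (intro exI[of _ k]) (auto simp: cutoff_def)
      qed (use f(2) in \<open>simp add: cutoff_def\<close>)
      then show "(\<lambda>k. (norm (cutoff (- {0..\<eta> k}) f t))\<^sup>2) \<longlonglongrightarrow> 0" by (rule tendsto_eventually)
    qed
  qed simp
  then have "(\<lambda>k. sqrt (LINT t|lebesgue. (norm (cutoff (- {0..\<eta> k}) f t))\<^sup>2)) \<longlonglongrightarrow> sqrt 0"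
    by (intro tendsto_real_sqrt) simp
  then have lim: "(\<lambda>k. l2_norm (cutoff (- {0..\<eta> k}) f)) \<longlonglongrightarrow> 0" by (simp add: l2_norm_def)
  show ?thesis
  proof (rule tendstoI)
    fix e :: real assume "0 < e"
    then obtain k where k: "l2_norm (cutoff (- {0..\<eta> k}) f) < e"
      using order_tendstoD(2)[OF lim] eventually_happens'[OF sequentially_bot] by blast
    show "\<forall>\<^sub>F s in up_to b. dist (l2_norm (cutoff (- {0..s}) f)) 0 < e"
      using \<eta>(2)[of k]
    proof eventually_elim
      fix s assume s: "\<eta> k \<le> s \<and> ereal s < b"
      have "l2_norm (cutoff (- {0..s}) f) \<le> l2_norm (cutoff (- {0..\<eta> k}) f)"
        by (rule l2_norm_mono) (use f s in \<open>auto intro!: l2_cut simp: cutoff_def\<close>)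
      then show "dist (l2_norm (cutoff (- {0..s}) f)) 0 < e" using k l2_norm_nonneg[of "cutoff (- {0..s}) f"] by (simp add: dist_real_def)
    qed
  qed
qed

lemma l2_inner_tendsto:
  assumes f: "l2 f" "\<And>t. t \<notin> \<Delta> \<Longrightarrow> f t = 0" and g: "l2 g"
  shows "((\<lambda>\<eta>. l2_inner (cutoff {0..\<eta>} f) g) \<longlongrightarrow> l2_inner f g) (up_to b)"
proof -
  have "((\<lambda>\<eta>. l2_norm (cutoff (- {0..\<eta>}) f) * l2_norm g) \<longlongrightarrow> 0) (up_to b)"
    by (rule tendsto_mult_left_zero[OF tail_tendsto[OF f]])
  then have "((\<lambda>\<eta>. l2_inner (cutoff {0..\<eta>} f) g - l2_inner f g) \<longlongrightarrow> 0) (up_to b)"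
  proof (rule Lim_null_comparison[rotated], intro always_eventually allI)
    fix \<eta>
    have c: "l2 (cutoff {0..\<eta>} f)" "l2 (cutoff (- {0..\<eta>}) f)" using f by (auto intro: l2_cut)
    have "f = (\<lambda>t. cutoff {0..\<eta>} f t + cutoff (- {0..\<eta>}) f t)" by (auto simp: cutoff_def)
    then have "l2_inner f g = l2_inner (cutoff {0..\<eta>} f) g + l2_inner (cutoff (- {0..\<eta>}) f) g"
      using l2_inner_add_left[OF c g] by metis
    then show "norm (l2_inner (cutoff {0..\<eta>} f) g - l2_inner f g) \<le> l2_norm (cutoff (- {0..\<eta>}) f) * l2_norm g"
      using l2_cauchy_schwarz[OF c(2) g] by simp
  qed
  then show ?thesis by (simp add: LIM_zero_iff)
qed

text \<open>Monotone convergence. This is how a solution known only on segments is recognised as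
  square integrable.\<close>

lemma l2_of_bounded_cuts:
  assumes f: "\<And>t. t \<notin> \<Delta> \<Longrightarrow> f t = 0" and loc: "\<And>\<eta>. \<eta> \<in> \<Delta> \<Longrightarrow> l2 (cutoff {0..\<eta>} f)"
    and bound: "\<And>\<eta>. 0 < \<eta> \<Longrightarrow> ereal \<eta> < b \<Longrightarrow> l2_norm (cutoff {0..\<eta>} f) \<le> C" and meas: "f \<in> borel_measurable lebesgue"
  shows "l2 f" "l2_norm f \<le> C"
proof -
  obtain \<eta> :: "nat \<Rightarrow> real" where \<eta>: "\<And>k. 0 < \<eta> k" "\<And>k. ereal (\<eta> k) < b" "incseq \<eta>" "\<And>t. ereal t < b \<Longrightarrow> \<exists>k. t \<le> \<eta> k"
    by (rule exhaustion) blast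
  have l2k: "l2 (cutoff {0..\<eta> k} f)" for k using loc less_b_in[OF less_imp_le[OF \<eta>(1)] \<eta>(2)] by blast
  have C: "0 \<le> C" using order_trans[OF l2_norm_nonneg bound[OF \<eta>(1,2)]] .
  let ?u = "\<lambda>k t. (norm (cutoff {0..\<eta> k} f t))\<^sup>2"
  have int: "integrable lebesgue (?u k)" for k using l2k by (simp add: l2_def)
  have mono: "mono (\<lambda>k. integral\<^sup>L lebesgue (?u k))"
    by (rule monoI, rule integral_mono[OF int int]) (auto simp: cutoff_def dest: incseqD[OF \<eta>(3)])
  have le: "integral\<^sup>L lebesgue (?u k) \<le> C\<^sup>2" for k
    using power_mono[OF bound[OF \<eta>(1,2)] l2_norm_nonneg, of k 2] by (simp add: l2_norm_sq)
  obtain L where L: "(\<lambda>k. integral\<^sup>L lebesgue (?u k)) \<longlonglongrightarrow> L"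
  proof (rule incseq_convergent)
    show "incseq (\<lambda>k. integral\<^sup>L lebesgue (?u k))" by (rule mono)
    show "\<forall>k. integral\<^sup>L lebesgue (?u k) \<le> C\<^sup>2" using le by blast
  qed blast
  have ae: "AE t in lebesgue. (\<lambda>k. ?u k t) \<longlonglongrightarrow> (norm (f t))\<^sup>2"
    using AE_less_b
  proof eventually_elim
    fix t assume t: "t \<in> \<Delta> \<longrightarrow> ereal t < b"
    have "\<forall>\<^sub>F k in sequentially. ?u k t = (norm (f t))\<^sup>2"
    proof (cases "t \<in> \<Delta>")
      case True
      then obtain k where "t \<le> \<eta> k" using \<eta>(4) t by blast
      then have "t \<le> \<eta> m" if "k \<le> m" for m using incseqD[OF \<eta>(3) that] by linarith
      then show ?thesis using nonneg[OF True] unfolding eventually_sequentially by (intro exI[of _ k]) (auto simp: cutoff_def)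
    qed (use f in \<open>simp add: cutoff_def\<close>)
    then show "(\<lambda>k. ?u k t) \<longlonglongrightarrow> (norm (f t))\<^sup>2" by (rule tendsto_eventually)
  qed
  have mono_ae: "AE t in lebesgue. mono (\<lambda>k. ?u k t)"
    by (intro AE_I2 monoI) (auto simp: cutoff_def dest: incseqD[OF \<eta>(3)])
  have meas': "(\<lambda>t. (norm (f t))\<^sup>2) \<in> borel_measurable lebesgue" using meas by measurable
  have "integrable lebesgue (\<lambda>t. (norm (f t))\<^sup>2)"
    by (rule integrable_monotone_convergence[OF int mono_ae ae L meas'])
  then show "l2 f" using meas by (simp add: l2_def)
  have "integral\<^sup>L lebesgue (\<lambda>t. (norm (f t))\<^sup>2) = L"
    by (rule integral_monotone_convergence[OF int mono_ae ae L meas'])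
  then have "(l2_norm f)\<^sup>2 \<le> C\<^sup>2" using LIMSEQ_le_const2[OF L, of "C\<^sup>2"] le by (auto simp: l2_norm_sq)
  then show "l2_norm f \<le> C" using C by (rule power2_le_imp_le)
qed

lemma continuous_measurable:
  fixes f :: "real \<Rightarrow> 'h::{complex_hilbert, second_countable_topology}"
  assumes "continuous_on \<Delta> f" "\<And>t. t \<notin> \<Delta> \<Longrightarrow> f t = 0" shows "f \<in> borel_measurable lebesgue"
proof -
  have "\<Delta> \<in> sets borel" by (cases rule: Delta_cases) auto
  then have "(\<lambda>t. indicator \<Delta> t *\<^sub>R f t) \<in> borel_measurable borel"
    by (rule borel_measurable_continuous_on_indicator[OF _ assms(1)])
  moreover have "(\<lambda>t. indicator \<Delta> t *\<^sub>R f t) = f" using assms(2) by (auto simp: fun_eq_iff indicator_def)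
  ultimately show ?thesis by (simp add: measurable_completion)
qed

lemma l2_cut_segment: "continuous_on \<Delta> f \<Longrightarrow> \<eta> \<in> \<Delta> \<Longrightarrow> l2 (cutoff {0..\<eta>} f)"
  by (rule l2_cut_continuous) (rule continuous_on_subset[OF _ segment])

end



section \<open>Lagrange's identity\<close>

text \<open>Measurability of g uses completeness of the Lebesgue measure. It is applied to l, which
  for sums and glued functions is known only off a null set.\<close>

lemma l2_AE:
  fixes f g :: "real \<Rightarrow> 'h::{complex_hilbert, second_countable_topology}"
  assumes f: "l2 f" and N: "N \<in> null_sets lebesgue" and eq: "\<And>t. t \<notin> N \<Longrightarrow> g t = f t"
  shows "l2 g"
proof -
  have sub: "A \<in> sets lebesgue" if "A \<subseteq> N" for A
    using null_sets_completion_subset[OF that] N by blast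
  have g: "g \<in> borel_measurable lebesgue"
  proof (rule measurableI)
    fix A :: "'h set" assume A: "A \<in> sets borel"
    have "g -` A \<inter> space lebesgue = (f -` A - N) \<union> (N \<inter> g -` A)" using eq by auto
    moreover have "f -` A \<in> sets lebesgue" using measurable_sets[OF l2_measurable[OF f] A] by simp
    then have "(f -` A - N) \<union> (N \<inter> g -` A) \<in> sets lebesgue"
      using null_setsD2[OF N] sub[of "N \<inter> g -` A"] by (intro sets.Un sets.Diff) auto
    ultimately show "g -` A \<inter> space lebesgue \<in> sets lebesgue" by (simp only:)
  qed simp
  have "AE t in lebesgue. (norm (f t))\<^sup>2 = (norm (g t))\<^sup>2"
    by (rule AE_I'[OF N], rule subsetI, rule ccontr) (simp add: eq)
  then have "integrable lebesgue (\<lambda>t. (norm (f t))\<^sup>2) \<longleftrightarrow> integrable lebesgue (\<lambda>t. (norm (g t))\<^sup>2)"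
    using f g by (intro integrable_cong_AE) (auto simp: l2_def)
  then show ?thesis using f g by (simp add: l2_def)
qed

lemma abs_cont_on_sum:
  assumes "finite I" "\<And>i. i \<in> I \<Longrightarrow> abs_cont_on a b (f i)" shows "abs_cont_on a b (\<lambda>t. \<Sum>i\<in>I. f i t)"
  using assms
proof (induction I rule: finite_induct)
  case empty
  show ?case unfolding abs_cont_on_def by (auto intro!: exI[of _ 1])
qed (simp add: abs_cont_on_add)

lemma abs_cont_on_minus: "abs_cont_on a b f \<Longrightarrow> abs_cont_on a b (\<lambda>t. - f t)"
  by (rule abs_cont_on_le[of a b f 1 0]) (simp_all add: norm_minus_commute)

lemma abs_cont_on_lipschitz:
  assumes "0 \<le> L" "\<And>s t. s \<in> {a..b} \<Longrightarrow> t \<in> {a..b} \<Longrightarrow> norm (f t - f s) \<le> L * \<bar>t - s\<bar>"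
  shows "abs_cont_on a b f"
proof (rule abs_cont_on_le[of a b "\<lambda>t. 0::real" 0 L])
  show "abs_cont_on a b (\<lambda>t. 0::real)" unfolding abs_cont_on_def by (auto intro!: exI[of _ 1])
qed (use assms in auto)

lemma abs_cont_on_continuous:
  assumes ac: "abs_cont_on a b f" shows "continuous_on {a..b} f"
  unfolding continuous_on_iff
proof (intro ballI allI impI)
  fix t e :: real assume t: "t \<in> {a..b}" and e: "0 < e"
  obtain d where d: "0 < d" "\<forall>(N::nat) \<alpha> \<beta>. (\<forall>i<N. a \<le> \<alpha> i \<and> \<alpha> i \<le> \<beta> i \<and> \<beta> i \<le> b) \<and>
        (\<forall>i<N. \<forall>j<N. i \<noteq> j \<longrightarrow> {\<alpha> i<..<\<beta> i} \<inter> {\<alpha> j<..<\<beta> j} = {}) \<and>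
        (\<Sum>i<N. \<beta> i - \<alpha> i) < d \<longrightarrow> (\<Sum>i<N. norm (f (\<beta> i) - f (\<alpha> i))) < e"
    by (rule abs_cont_onE[OF ac e]) (rule that)
  show "\<exists>d>0. \<forall>s\<in>{a..b}. dist s t < d \<longrightarrow> dist (f s) (f t) < e"
  proof (intro exI conjI ballI impI)
    fix s assume s: "s \<in> {a..b}" "dist s t < d"
    show "dist (f s) (f t) < e"
      using d(2)[rule_format, of 1 "\<lambda>i. min s t" "\<lambda>i. max s t"] s t
      by (cases "s \<le> t") (auto simp: dist_norm dist_real_def norm_minus_commute min_def max_def)
  qed (rule d(1))
qed

text \<open>Monotone nonexpansive changes of the variable freeze a function beyond a point or
  restrict it to a subinterval.\<close>

lemma abs_cont_on_reparametrize:
  assumes ac: "abs_cont_on a b f" and \<phi>: "mono \<phi>" "\<And>t. t \<in> {c..d} \<Longrightarrow> \<phi> t \<in> {a..b}" "\<And>s t. s \<le> t \<Longrightarrow> \<phi> t - \<phi> s \<le> t - s"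
  shows "abs_cont_on c d (\<lambda>t. f (\<phi> t))"
  unfolding abs_cont_on_def
proof (intro allI impI)
  fix e :: real assume e: "0 < e"
  obtain r where r: "0 < r" "\<forall>(N::nat) \<alpha> \<beta>. (\<forall>i<N. a \<le> \<alpha> i \<and> \<alpha> i \<le> \<beta> i \<and> \<beta> i \<le> b) \<and>
        (\<forall>i<N. \<forall>j<N. i \<noteq> j \<longrightarrow> {\<alpha> i<..<\<beta> i} \<inter> {\<alpha> j<..<\<beta> j} = {}) \<and>
        (\<Sum>i<N. \<beta> i - \<alpha> i) < r \<longrightarrow> (\<Sum>i<N. norm (f (\<beta> i) - f (\<alpha> i))) < e"
    by (rule abs_cont_onE[OF ac e]) (rule that)
  show "\<exists>\<delta>>0. \<forall>(N::nat) \<alpha> \<beta>. (\<forall>i<N. c \<le> \<alpha> i \<and> \<alpha> i \<le> \<beta> i \<and> \<beta> i \<le> d) \<and>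
      (\<forall>i<N. \<forall>j<N. i \<noteq> j \<longrightarrow> {\<alpha> i<..<\<beta> i} \<inter> {\<alpha> j<..<\<beta> j} = {}) \<and> (\<Sum>i<N. \<beta> i - \<alpha> i) < \<delta> \<longrightarrow>
      (\<Sum>i<N. norm (f (\<phi> (\<beta> i)) - f (\<phi> (\<alpha> i)))) < e"
  proof (intro exI[of _ r] conjI allI impI)
    fix N :: nat and \<alpha> \<beta>
    assume *: "(\<forall>i<N. c \<le> \<alpha> i \<and> \<alpha> i \<le> \<beta> i \<and> \<beta> i \<le> d) \<and>
      (\<forall>i<N. \<forall>j<N. i \<noteq> j \<longrightarrow> {\<alpha> i<..<\<beta> i} \<inter> {\<alpha> j<..<\<beta> j} = {}) \<and> (\<Sum>i<N. \<beta> i - \<alpha> i) < r"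
    then have ord: "c \<le> \<alpha> i" "\<alpha> i \<le> \<beta> i" "\<beta> i \<le> d" if "i < N" for i using that by blast+
    show "(\<Sum>i<N. norm (f (\<phi> (\<beta> i)) - f (\<phi> (\<alpha> i)))) < e"
    proof (rule r(2)[rule_format], intro conjI allI impI)
      fix i assume i: "i < N"
      show "a \<le> \<phi> (\<alpha> i)" "\<phi> (\<beta> i) \<le> b" using \<phi>(2)[of "\<alpha> i"] \<phi>(2)[of "\<beta> i"] ord[OF i] by auto
      show "\<phi> (\<alpha> i) \<le> \<phi> (\<beta> i)" using \<phi>(1) ord[OF i] by (simp add: monoD)
    next
      fix i j assume ij: "i < N" "j < N" "i \<noteq> j"
      then have dis: "{\<alpha> i<..<\<beta> i} \<inter> {\<alpha> j<..<\<beta> j} = {}" using * by blast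
      \<comment> \<open>Disjoint open intervals are degenerate or ordered, and both alternatives
        survive a monotone map, which need not be injective.\<close>
      have "\<alpha> i = \<beta> i \<or> \<alpha> j = \<beta> j \<or> \<beta> i \<le> \<alpha> j \<or> \<beta> j \<le> \<alpha> i"
      proof (rule ccontr)
        assume "\<not> ?thesis"
        then have "max (\<alpha> i) (\<alpha> j) < min (\<beta> i) (\<beta> j)" using ord(2)[OF ij(1)] ord(2)[OF ij(2)] by auto
        then obtain x where "max (\<alpha> i) (\<alpha> j) < x" "x < min (\<beta> i) (\<beta> j)" using dense by blast
        then have "x \<in> {\<alpha> i<..<\<beta> i} \<inter> {\<alpha> j<..<\<beta> j}" by auto
        then show False using dis by blast
      qed
      then show "{\<phi> (\<alpha> i)<..<\<phi> (\<beta> i)} \<inter> {\<phi> (\<alpha> j)<..<\<phi> (\<beta> j)} = {}"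
      proof (elim disjE)
        assume "\<beta> i \<le> \<alpha> j" from monoD[OF \<phi>(1) this] show ?thesis by auto
      next
        assume "\<beta> j \<le> \<alpha> i" from monoD[OF \<phi>(1) this] show ?thesis by auto
      qed auto
    next
      have "(\<Sum>i<N. \<phi> (\<beta> i) - \<phi> (\<alpha> i)) \<le> (\<Sum>i<N. \<beta> i - \<alpha> i)" by (rule sum_mono) (use \<phi>(3) ord in auto)
      then show "(\<Sum>i<N. \<phi> (\<beta> i) - \<phi> (\<alpha> i)) < r" using * by linarith
    qed
  qed (rule r(1))
qed

text \<open>The glued function has the same increments as \<open>f (min t c) + g (max t c)\<close>,
  because f and g agree at c.\<close>

lemma abs_cont_on_glue:
  assumes f: "abs_cont_on a b f" "abs_cont_on a b g" and c: "c \<in> {a..b}" "f c = g c"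
  shows "abs_cont_on a b (\<lambda>t. if t \<le> c then f t else g t)"
proof -
  have 1: "abs_cont_on a b (\<lambda>t. f (min t c))"
    by (rule abs_cont_on_reparametrize[OF f(1)]) (use c in \<open>auto simp: mono_def min_def\<close>)
  have 2: "abs_cont_on a b (\<lambda>t. g (max t c))"
    by (rule abs_cont_on_reparametrize[OF f(2)]) (use c in \<open>auto simp: mono_def max_def\<close>)
  show ?thesis
  proof (rule abs_cont_on_le[OF abs_cont_on_add[OF 1 2], of 1 0])
    show "norm ((if t \<le> c then f t else g t) - (if s \<le> c then f s else g s))
        \<le> 1 * norm (f (min t c) + g (max t c) - (f (min s c) + g (max s c))) + 0 * \<bar>t - s\<bar>" for s t
      using c(2) by (auto simp: min_def max_def)
  qed auto
qed

lemma has_vector_derivative_Un: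
  "(f has_vector_derivative d) (at x within S) \<Longrightarrow> (f has_vector_derivative d) (at x within T) \<Longrightarrow>
    (f has_vector_derivative d) (at x within S \<union> T)"
  unfolding has_vector_derivative_quotient by (subst at_within_union) (rule filterlim_sup)

context half_open_interval
begin

lemma has_vector_derivative_glue:
  assumes f: "t \<le> c \<Longrightarrow> (f has_vector_derivative d) (at t within \<Delta>)" and g: "c \<le> t \<Longrightarrow> (g has_vector_derivative d) (at t within \<Delta>)"
    and eq: "f c = g c" and t: "t \<in> \<Delta>"
  shows "((\<lambda>t. if t \<le> c then f t else g t) has_vector_derivative d) (at t within \<Delta>)"
proof -
  consider "t < c" | "t = c" | "c < t" by linarith
  then show ?thesis
  proof cases
    case 1
    show ?thesis
      by (rule has_vector_derivative_transform_within[OF f, of "c - t"]) (use 1 t in \<open>auto simp: dist_real_def\<close>)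
  next
    case 3
    show ?thesis
      by (rule has_vector_derivative_transform_within[OF g, of "t - c"]) (use 3 t in \<open>auto simp: dist_real_def\<close>)
  next
    case 2
    have "((\<lambda>t. if t \<le> c then f t else g t) has_vector_derivative d) (at t within \<Delta> \<inter> {..c})"
      by (rule has_vector_derivative_transform[of t "\<Delta> \<inter> {..c}" _ f])
        (use 2 t has_vector_derivative_within_subset[OF f] in auto)
    moreover have "((\<lambda>t. if t \<le> c then f t else g t) has_vector_derivative d) (at t within \<Delta> \<inter> {c..})"
      by (rule has_vector_derivative_transform[of t "\<Delta> \<inter> {c..}" _ g])
        (use 2 t eq has_vector_derivative_within_subset[OF g] in auto)
    moreover have "\<Delta> = (\<Delta> \<inter> {..c}) \<union> (\<Delta> \<inter> {c..})" by auto
    ultimately show ?thesis using has_vector_derivative_Un by metis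
  qed
qed

lemma Ck_on_lipschitz:
  fixes f :: "real \<Rightarrow> 'v::banach"
  assumes f: "Ck_on \<Delta> 1 f" and \<eta>: "\<eta> \<in> \<Delta>"
  obtains L where "0 \<le> L" "\<And>s t. s \<in> {0..\<eta>} \<Longrightarrow> t \<in> {0..\<eta>} \<Longrightarrow> norm (f t - f s) \<le> L * \<bar>t - s\<bar>"
proof -
  have f: "Ck_on \<Delta> (Suc 0) f" using f by simp
  have "continuous_on \<Delta> (Dx \<Delta> 1 f)" using f by (simp add: Ck_on_Suc Ck_on_0)
  then have "bounded (Dx \<Delta> 1 f ` {0..\<eta>})"
    by (intro compact_imp_bounded compact_continuous_image continuous_on_subset[OF _ segment[OF \<eta>]]) auto
  then obtain L where "\<forall>t\<in>{0..\<eta>}. norm (Dx \<Delta> 1 f t) \<le> L" unfolding bounded_iff by auto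
  then have L: "norm (Dx \<Delta> 1 f t) \<le> L" if "t \<in> {0..\<eta>}" for t using that by blast
  have L0: "0 \<le> L" using order_trans[OF norm_ge_zero L[of 0]] nonneg[OF \<eta>] by simp
  have le: "norm (f t - f s) \<le> L * (t - s)" if "s \<in> {0..\<eta>}" "t \<in> {0..\<eta>}" "s \<le> t" for s t
  proof -
    have "(Dx \<Delta> 1 f has_integral f t - f s) {s..t}"
    proof (rule fundamental_theorem_of_calculus[OF that(3)])
      fix x assume x: "x \<in> {s..t}"
      have "{s..t} \<subseteq> \<Delta>" using segment[OF \<eta>] that by auto
      then show "(f has_vector_derivative Dx \<Delta> 1 f x) (at x within {s..t})"
        using has_vector_derivative_within_subset[OF Ck_on_SucD[OF f]] x by blast
    qed
    from has_integral_bound_real[OF L0 finite.emptyI this] show ?thesis using L that by auto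
  qed
  show thesis
  proof (rule that[OF L0])
    show "norm (f t - f s) \<le> L * \<bar>t - s\<bar>" if "s \<in> {0..\<eta>}" "t \<in> {0..\<eta>}" for s t
      using le[of s t] le[of t s] that by (cases "s \<le> t") (auto simp: norm_minus_commute)
  qed
qed

end

section \<open>The Lagrange bracket and functions locally in the maximal domain\<close>

context hilbert_expression
begin

definition br :: "(real \<Rightarrow> 'h) \<Rightarrow> (real \<Rightarrow> 'h) \<Rightarrow> real \<Rightarrow> complex"
  where "br y w t = (\<Sum>k<n. cinner (Q y k t) (Q w (2 * n - 1 - k) t) - cinner (Q y (2 * n - 1 - k) t) (Q w k t))"

lemma p_selfadjoint: "k \<le> n \<Longrightarrow> t \<in> \<Delta> \<Longrightarrow> cinner (p k t *\<^sub>V x) y = cinner x (p k t *\<^sub>V y)"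
  using coefficients unfolding coefficients_ok_def by (metis cinner_adj)

text \<open>Lagrange's identity for arbitrary states, before any differentiation. Each summand is a
  difference of consecutive values of G + H, so the sum telescopes; the value at n vanishes because
  p 0 is selfadjoint, and there is no term at 0.\<close>

lemma lagrange_state:
  assumes t: "t \<in> \<Delta>"
  shows "(\<Sum>k<n. (cinner (rhs k t x) (u (2 * n - 1 - k)) + cinner (x k) (rhs (2 * n - 1 - k) t u))
    - (cinner (rhs (2 * n - 1 - k) t x) (u k) + cinner (x (2 * n - 1 - k)) (rhs k t u))) = 0"
proof -
  define d e where "d i = low i t x" and "e i = low i t u" for i
  define s where "s j = (\<i> / 2) *\<^sub>C q j t" for j
  \<comment> \<open>G pairs quasi-derivatives of the complementary orders k and 2n - k; H
    compensates the q terms, which couple neighbouring derivatives.\<close>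
  define G where "G k = cinner (d k) (u (2 * n - k)) - cinner (x (2 * n - k)) (e k)" for k
  define H where "H k = cinner (d k) (s (n - k) *\<^sub>V e (k - 1)) - cinner (s (n - k) *\<^sub>V d (k - 1)) (e k)" for k
  have step: "(cinner (rhs k t x) (u (2 * n - 1 - k)) + cinner (x k) (rhs (2 * n - 1 - k) t u))
      - (cinner (rhs (2 * n - 1 - k) t x) (u k) + cinner (x (2 * n - 1 - k)) (rhs k t u))
      = (G (Suc k) + H (Suc k)) - (if 0 < k then G k + H k else 0)" if k: "k < n" for k
  proof -
    have low: "rhs k t y = low (Suc k) t y" "y k = low k t y" for y
      using k by (auto simp: rhs_def low_def)
    have hi: "rhs (2 * n - 1 - k) t y = bulk k t (\<lambda>i. low i t y) - (if 0 < k then y (2 * n - k) else 0)" for y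
    proof -
      have "\<not> Suc (2 * n - 1 - k) < n" "Suc (2 * n - 1 - k) \<noteq> n \<or> n = 1 \<and> False" "2 * n - 1 - (2 * n - 1 - k) = k" "Suc (2 * n - 1 - k) = 2 * n - k" "2 * n - k < 2 * n \<longleftrightarrow> 0 < k"
        using k by auto
      then show ?thesis by (simp only: rhs_def) auto
    qed
    have bd: "bulk k t (\<lambda>i. low i t x) = p (n - k) t *\<^sub>V d k + ((\<i> / 2) *\<^sub>C adj (q (n - Suc k) t)) *\<^sub>V d (Suc k)
        - (if 0 < k then s (n - k) *\<^sub>V d (k - 1) else 0)"
      and be: "bulk k t (\<lambda>i. low i t u) = p (n - k) t *\<^sub>V e k + ((\<i> / 2) *\<^sub>C adj (q (n - Suc k) t)) *\<^sub>V e (Suc k)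
        - (if 0 < k then s (n - k) *\<^sub>V e (k - 1) else 0)"
      using k by (auto simp: bulk_def d_def e_def s_def)
    have q1: "cinner (d k) (((\<i> / 2) *\<^sub>C adj (q (n - Suc k) t)) *\<^sub>V e (Suc k)) = - cinner (s (n - Suc k) *\<^sub>V d k) (e (Suc k))"
      by (simp add: s_def cblinfun_linear cinner_linear cinner_adj)
    have q2: "cinner (((\<i> / 2) *\<^sub>C adj (q (n - Suc k) t)) *\<^sub>V d (Suc k)) (e k) = - cinner (d (Suc k)) (s (n - Suc k) *\<^sub>V e k)"
      by (simp add: s_def cblinfun_linear cinner_linear cinner_adj_left)
    have pp: "cinner (p (n - k) t *\<^sub>V d k) (e k) = cinner (d k) (p (n - k) t *\<^sub>V e k)"
      by (rule p_selfadjoint) (use t in auto)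
    have idx: "2 * n - 1 - k = 2 * n - Suc k" by simp
    show ?thesis
      unfolding idx unfolding hi[unfolded idx] low(1) unfolding bd be
      unfolding low(2)[of x] low(2)[of u] d_def[symmetric] e_def[symmetric]
      by (simp add: G_def H_def cinner_linear pp q1 q2)
  qed
  have "(\<Sum>k<n. (G (Suc k) + H (Suc k)) - (if 0 < k then G k + H k else 0)) = G n + H n"
  proof -
    have "(\<Sum>k<m. (G (Suc k) + H (Suc k)) - (if 0 < k then G k + H k else 0)) = (if 0 < m then G m + H m else 0)" for m
      by (induction m) auto
    then show ?thesis using n_pos by simp
  qed
  also have "G n + H n = 0"
  proof -
    have top: "y n = p 0 t *\<^sub>V low n t y - s 0 *\<^sub>V low (n - 1) t y" for y
      using n_pos p0_inv_act(2)[OF t] by (simp add: low_def top_def s_def)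
    have pp: "cinner (p 0 t *\<^sub>V d n) (e n) = cinner (d n) (p 0 t *\<^sub>V e n)"
      by (rule p_selfadjoint) (use t in auto)
    have "G n = cinner (d n) (u n) - cinner (x n) (e n)" by (simp add: G_def mult_2)
    then show ?thesis
      unfolding top[of u] top[of x] d_def[symmetric] e_def[symmetric]
      by (simp add: H_def cinner_linear pp)
  qed
  finally show ?thesis using step by simp
qed

text \<open>The local part of \<open>max_dom\<close>, without square integrability and vanishing off
  the interval, so that it also applies to solutions.\<close>

definition dom :: "(real \<Rightarrow> 'h) \<Rightarrow> bool"
  where "dom y \<longleftrightarrow> (\<forall>k\<le>2 * n - 2. Ck_on \<Delta> 1 (Q y k)) \<and> loc_abs_cont_on \<Delta> (Q y (2 * n - 1)) \<and>
    (AE t in lebesgue_on \<Delta>. Q y (2 * n - 1) differentiable (at t within \<Delta>))"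

lemma dom_exceptional:
  assumes "dom y"
  obtains N where "N \<in> null_sets lebesgue" "\<And>t. t \<in> \<Delta> - N \<Longrightarrow> Q y (2 * n - 1) differentiable (at t within \<Delta>)"
proof -
  have "AE t in lebesgue. t \<in> \<Delta> \<longrightarrow> Q y (2 * n - 1) differentiable (at t within \<Delta>)"
    using assms AE_restrict_space_iff[of \<Delta> lebesgue] Delta_measurable unfolding dom_def by auto
  then obtain N where "N \<in> null_sets lebesgue" "{t \<in> space lebesgue. \<not> (t \<in> \<Delta> \<longrightarrow> Q y (2 * n - 1) differentiable (at t within \<Delta>))} \<subseteq> N"
    unfolding eventually_ae_filter by blast
  then show thesis using that[of N] by auto
qed

lemma domI:
  assumes "\<And>k. k \<le> 2 * n - 2 \<Longrightarrow> Ck_on \<Delta> 1 (Q y k)" "loc_abs_cont_on \<Delta> (Q y (2 * n - 1))"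
    and "N \<in> null_sets lebesgue" "\<And>t. t \<in> \<Delta> - N \<Longrightarrow> Q y (2 * n - 1) differentiable (at t within \<Delta>)"
  shows "dom y"
proof -
  have "AE t in lebesgue. t \<in> \<Delta> \<longrightarrow> Q y (2 * n - 1) differentiable (at t within \<Delta>)"
    by (rule AE_I'[OF assms(3)]) (use assms(4) in auto)
  then show ?thesis using assms(1,2) AE_restrict_space_iff[of \<Delta> lebesgue] Delta_measurable unfolding dom_def by auto
qed

lemma max_dom_iff:
  "y \<in> max_dom \<Delta> n p q \<longleftrightarrow> (\<forall>t. t \<notin> \<Delta> \<longrightarrow> y t = 0) \<and> l2 y \<and> dom y \<and> l2 (cutoff \<Delta> (l y))"
proof -
  have "cutoff \<Delta> y = y" if "\<forall>t. t \<notin> \<Delta> \<longrightarrow> y t = 0" using that by (auto simp: cutoff_def)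
  then show ?thesis
    unfolding max_dom_def dom_def square_integrable_cut[OF Delta_measurable] by auto
qed

lemma dom_regular: "dom y \<Longrightarrow> regular y"
  unfolding dom_def regular_def
proof (elim conjE, intro conjI)
  assume "loc_abs_cont_on \<Delta> (Q y (2 * n - 1))"
  then show "continuous_on \<Delta> (Q y (2 * n - 1))"
    using zero_in unfolding loc_abs_cont_on_def by (intro continuous_on_segments abs_cont_on_continuous) blast
qed

lemma dom_abs_cont: assumes "dom y" "\<eta> \<in> \<Delta>" "k < 2 * n" shows "abs_cont_on 0 \<eta> (Q y k)"
proof (cases "k = 2 * n - 1")
  case True
  then show ?thesis using assms zero_in unfolding dom_def loc_abs_cont_on_def by blast
next
  case False
  then have "Ck_on \<Delta> 1 (Q y k)" using assms unfolding dom_def by auto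
  then obtain L where "0 \<le> L" "\<And>s t. s \<in> {0..\<eta>} \<Longrightarrow> t \<in> {0..\<eta>} \<Longrightarrow> norm (Q y k t - Q y k s) \<le> L * \<bar>t - s\<bar>"
    by (rule Ck_on_lipschitz[OF _ assms(2)]) (rule that)
  then show ?thesis by (rule abs_cont_on_lipschitz)
qed

text \<open>In every product of the bracket one factor has order below n and is continuously
  differentiable; only the other one may be the last quasi-derivative.\<close>

lemma abs_cont_on_cinner:
  assumes f: "Ck_on \<Delta> 1 f" and g: "abs_cont_on 0 \<eta> g" and \<eta>: "\<eta> \<in> \<Delta>"
  shows "abs_cont_on 0 \<eta> (\<lambda>t. cinner (f t :: 'h) (g t))"
proof -
  obtain L where L: "0 \<le> L" "\<And>s t. s \<in> {0..\<eta>} \<Longrightarrow> t \<in> {0..\<eta>} \<Longrightarrow> norm (f t - f s) \<le> L * \<bar>t - s\<bar>"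
    by (rule Ck_on_lipschitz[OF f \<eta>]) (rule that)
  have "bounded (f ` {0..\<eta>})" "bounded (g ` {0..\<eta>})"
    by (intro compact_imp_bounded compact_continuous_image continuous_on_subset[OF Ck_on_continuous[OF f] segment[OF \<eta>]] abs_cont_on_continuous[OF g]; simp)+
  then obtain A B where "\<forall>t\<in>{0..\<eta>}. norm (f t) \<le> A" "\<forall>t\<in>{0..\<eta>}. norm (g t) \<le> B"
    unfolding bounded_iff by auto
  then have A: "norm (f t) \<le> A" and B: "norm (g t) \<le> B" if "t \<in> {0..\<eta>}" for t using that by blast+
  have AB: "0 \<le> A" "0 \<le> B" using order_trans[OF norm_ge_zero A[of 0]] order_trans[OF norm_ge_zero B[of 0]] nonneg[OF \<eta>] by auto
  show ?thesis
  proof (rule abs_cont_on_le[OF g AB(1)])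
    show "0 \<le> B * L" using AB L by simp
    fix s t assume st: "s \<in> {0..\<eta>}" "t \<in> {0..\<eta>}"
    have "cinner (f t) (g t) - cinner (f s) (g s) = cinner (f t) (g t - g s) + cinner (f t - f s) (g s)"
      by (simp add: cinner_linear)
    also have "norm \<dots> \<le> norm (f t) * norm (g t - g s) + norm (f t - f s) * norm (g s)"
      by (intro order_trans[OF norm_triangle_ineq] add_mono cmod_cinner_le)
    also have "\<dots> \<le> A * norm (g t - g s) + (L * \<bar>t - s\<bar>) * B"
      using A[OF st(2)] B[OF st(1)] L(2)[OF st] L(1) AB by (intro add_mono mult_mono) auto
    finally show "norm (cinner (f t) (g t) - cinner (f s) (g s)) \<le> A * norm (g t - g s) + B * L * \<bar>t - s\<bar>"
      by (simp add: mult_ac)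
  qed
qed

lemma abs_cont_on_cnj: "abs_cont_on c d f \<Longrightarrow> abs_cont_on c d (\<lambda>t. cnj (f t))"
  by (rule abs_cont_on_le[of c d f 1 0]) (simp_all flip: complex_cnj_diff)

lemma br_abs_cont: assumes "dom y" "dom w" "\<eta> \<in> \<Delta>" shows "abs_cont_on 0 \<eta> (br y w)"
proof -
  have 1: "abs_cont_on 0 \<eta> (\<lambda>t. cinner (Q y k t) (Q w (2 * n - 1 - k) t))" if "dom y" "dom w" "k < n" for y w k
    by (rule abs_cont_on_cinner[OF _ dom_abs_cont[OF that(2) assms(3)] assms(3)]) (use that in \<open>auto simp: dom_def\<close>)
  have "abs_cont_on 0 \<eta> (\<lambda>t. cinner (Q y k t) (Q w (2 * n - 1 - k) t) - cinner (Q y (2 * n - 1 - k) t) (Q w k t))" if "k < n" for k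
  proof -
    have "(\<lambda>t. cinner (Q y (2 * n - 1 - k) t) (Q w k t)) = (\<lambda>t. cnj (cinner (Q w k t) (Q y (2 * n - 1 - k) t)))"
      by (rule ext) (rule cinner_commute)
    then have "abs_cont_on 0 \<eta> (\<lambda>t. cinner (Q y (2 * n - 1 - k) t) (Q w k t))"
      using abs_cont_on_cnj[OF 1[OF assms(2,1) that]] by simp
    from abs_cont_on_add[OF 1[OF assms(1,2) that] abs_cont_on_minus[OF this]] show ?thesis by simp
  qed
  then show ?thesis unfolding br_def[abs_def] by (intro abs_cont_on_sum) auto
qed

text \<open>The last quasi-derivative, whose derivative contains l, is paired with y itself in the
  term k = 0; the other terms cancel by \<open>lagrange_state\<close>.\<close>

lemma br_derivative:
  assumes reg: "regular y" "regular w" and t: "t \<in> \<Delta>"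
    and diff: "Q y (2 * n - 1) differentiable (at t within \<Delta>)" "Q w (2 * n - 1) differentiable (at t within \<Delta>)"
  shows "(br y w has_vector_derivative cinner (l y t) (w t) - cinner (y t) (l w t)) (at t within \<Delta>)"
proof -
  have k2: "2 * n - 1 < 2 * n" "Suc (2 * n - 1) = 2 * n" using n_pos by auto
  have der: "(Q v k has_vector_derivative rhs k t (\<lambda>i. Q v i t) - (if Suc k = 2 * n then l v t else 0)) (at t within \<Delta>)"
    if "regular v" "Q v (2 * n - 1) differentiable (at t within \<Delta>)" "k < 2 * n" for v k
  proof (cases "Suc k = 2 * n")
    case True
    then have "k = 2 * n - 1" by simp
    then show ?thesis using Q_last_derivative[OF that(1) t that(2)] k2 by simp
  next
    case False
    then show ?thesis using Q_derivative[OF that(1) t, of k] that(3) by simp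
  qed
  let ?y = "\<lambda>i. Q y i t" and ?w = "\<lambda>i. Q w i t"
  have "(br y w has_vector_derivative (\<Sum>k<n.
      (cinner (?y k) (rhs (2 * n - 1 - k) t ?w - (if Suc (2 * n - 1 - k) = 2 * n then l w t else 0)) + cinner (rhs k t ?y - (if Suc k = 2 * n then l y t else 0)) (?w (2 * n - 1 - k)))
      - (cinner (?y (2 * n - 1 - k)) (rhs k t ?w - (if Suc k = 2 * n then l w t else 0)) + cinner (rhs (2 * n - 1 - k) t ?y - (if Suc (2 * n - 1 - k) = 2 * n then l y t else 0)) (?w k))))
      (at t within \<Delta>)"
    unfolding br_def[abs_def]
    by (intro has_vector_derivative_sum has_vector_derivative_diff bounded_bilinear.has_vector_derivative[OF bounded_bilinear_cinner] der reg diff) auto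
  also have "(\<Sum>k<n.
      (cinner (?y k) (rhs (2 * n - 1 - k) t ?w - (if Suc (2 * n - 1 - k) = 2 * n then l w t else 0)) + cinner (rhs k t ?y - (if Suc k = 2 * n then l y t else 0)) (?w (2 * n - 1 - k)))
      - (cinner (?y (2 * n - 1 - k)) (rhs k t ?w - (if Suc k = 2 * n then l w t else 0)) + cinner (rhs (2 * n - 1 - k) t ?y - (if Suc (2 * n - 1 - k) = 2 * n then l y t else 0)) (?w k)))
    = (\<Sum>k<n. ((cinner (rhs k t ?y) (?w (2 * n - 1 - k)) + cinner (?y k) (rhs (2 * n - 1 - k) t ?w))
        - (cinner (rhs (2 * n - 1 - k) t ?y) (?w k) + cinner (?y (2 * n - 1 - k)) (rhs k t ?w)))
        + (if k = 0 then cinner (l y t) (w t) - cinner (y t) (l w t) else 0))"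
  proof (rule sum.cong[OF refl])
    fix k assume "k \<in> {..<n}"
    then have "Suc k \<noteq> 2 * n" "Suc (2 * n - 1 - k) = 2 * n \<longleftrightarrow> k = 0" using n_pos by auto
    then show "(cinner (?y k) (rhs (2 * n - 1 - k) t ?w - (if Suc (2 * n - 1 - k) = 2 * n then l w t else 0)) + cinner (rhs k t ?y - (if Suc k = 2 * n then l y t else 0)) (?w (2 * n - 1 - k)))
      - (cinner (?y (2 * n - 1 - k)) (rhs k t ?w - (if Suc k = 2 * n then l w t else 0)) + cinner (rhs (2 * n - 1 - k) t ?y - (if Suc (2 * n - 1 - k) = 2 * n then l y t else 0)) (?w k))
      = ((cinner (rhs k t ?y) (?w (2 * n - 1 - k)) + cinner (?y k) (rhs (2 * n - 1 - k) t ?w))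
        - (cinner (rhs (2 * n - 1 - k) t ?y) (?w k) + cinner (?y (2 * n - 1 - k)) (rhs k t ?w)))
        + (if k = 0 then cinner (l y t) (w t) - cinner (y t) (l w t) else 0)"
      by (cases "k = 0") (simp_all only: if_True if_False cinner_diff_left cinner_diff_right quasi_deriv.simps(1) diff_zero, simp_all)
  qed
  also have "\<dots> = cinner (l y t) (w t) - cinner (y t) (l w t)"
    using lagrange_state[OF t, of ?y ?w] n_pos by (simp add: sum.distrib)
  finally show ?thesis .
qed

text \<open>The bracket is absolutely continuous, so it is the gauge integral of its derivative,
  which is then compared with the Lebesgue integrals of the two products.\<close>

lemma green:
  assumes y: "dom y" and w: "dom w" and \<eta>: "\<eta> \<in> \<Delta>"
    and l2y: "l2 (cutoff {0..\<eta>} (l y))" and l2w: "l2 (cutoff {0..\<eta>} (l w))"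
  shows "br y w \<eta> - br y w 0 = l2_inner (cutoff {0..\<eta>} (l y)) (cutoff {0..\<eta>} w) - l2_inner (cutoff {0..\<eta>} y) (cutoff {0..\<eta>} (l w))"
proof -
  obtain N where N: "N \<in> null_sets lebesgue" "\<And>t. t \<in> \<Delta> - N \<Longrightarrow> Q y (2 * n - 1) differentiable (at t within \<Delta>)"
    by (rule dom_exceptional[OF y]) blast
  obtain N' where N': "N' \<in> null_sets lebesgue" "\<And>t. t \<in> \<Delta> - N' \<Longrightarrow> Q w (2 * n - 1) differentiable (at t within \<Delta>)"
    by (rule dom_exceptional[OF w]) blast
  have cont: "continuous_on \<Delta> y" "continuous_on \<Delta> w"
    using y w Ck_on_continuous[of \<Delta> 1 "Q y 0"] Ck_on_continuous[of \<Delta> 1 "Q w 0"] unfolding dom_def by auto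
  have l2c: "l2 (cutoff {0..\<eta>} y)" "l2 (cutoff {0..\<eta>} w)" using cont \<eta> by (auto intro: l2_cut_segment)
  let ?d = "\<lambda>t. cinner (l y t) (w t) - cinner (y t) (l w t)"
  have "(?d has_integral br y w \<eta> - br y w 0) {0..\<eta>}"
  proof (rule abs_cont_has_integral[OF br_abs_cont[OF y w \<eta>] nonneg[OF \<eta>]])
    show "negligible (N \<union> N')" using N(1) N'(1) by (auto simp: negligible_iff_null_sets)
    fix t assume t: "t \<in> {0..\<eta>} - (N \<union> N')"
    then have "t \<in> \<Delta>" using segment[OF \<eta>] by blast
    then have "(br y w has_vector_derivative ?d t) (at t within \<Delta>)"
      using t N(2) N'(2) by (intro br_derivative dom_regular y w) auto
    then show "(br y w has_vector_derivative ?d t) (at t within {0..\<eta>})"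
      by (rule has_vector_derivative_within_subset[OF _ segment[OF \<eta>]])
  qed
  moreover have "(?d has_integral l2_inner (cutoff {0..\<eta>} (l y)) (cutoff {0..\<eta>} w) - l2_inner (cutoff {0..\<eta>} y) (cutoff {0..\<eta>} (l w))) {0..\<eta>}"
  proof -
    let ?D = "\<lambda>t. cinner (cutoff {0..\<eta>} (l y) t) (cutoff {0..\<eta>} w t) - cinner (cutoff {0..\<eta>} y t) (cutoff {0..\<eta>} (l w) t)"
    have "integrable lebesgue ?D" by (intro Bochner_Integration.integrable_diff l2_integrable l2y l2w l2c)
    from has_integral_integral_lebesgue[OF this]
    have "(?D has_integral l2_inner (cutoff {0..\<eta>} (l y)) (cutoff {0..\<eta>} w) - l2_inner (cutoff {0..\<eta>} y) (cutoff {0..\<eta>} (l w))) UNIV"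
      by (simp add: l2_inner_def Bochner_Integration.integral_diff l2_integrable l2y l2w l2c)
    moreover have "?D = (\<lambda>t. if t \<in> {0..\<eta>} then ?d t else 0)" by (auto simp: cutoff_def)
    ultimately show ?thesis using has_integral_restrict_UNIV[of "{0..\<eta>}" ?d] by simp
  qed
  ultimately show ?thesis by (rule has_integral_unique)
qed

lemma dom_add: assumes "dom y" "dom w" shows "dom (\<lambda>t. y t + w t)"
proof -
  obtain N where N: "N \<in> null_sets lebesgue" "\<And>t. t \<in> \<Delta> - N \<Longrightarrow> Q y (2 * n - 1) differentiable (at t within \<Delta>)"
    by (rule dom_exceptional[OF assms(1)]) blast
  obtain N' where N': "N' \<in> null_sets lebesgue" "\<And>t. t \<in> \<Delta> - N' \<Longrightarrow> Q w (2 * n - 1) differentiable (at t within \<Delta>)"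
    by (rule dom_exceptional[OF assms(2)]) blast
  have reg: "regular y" "regular w" using assms dom_regular by auto
  have k: "2 * n - 1 < 2 * n" using n_pos by simp
  show ?thesis
  proof (rule domI)
    show "Ck_on \<Delta> 1 (Q (\<lambda>t. y t + w t) k)" if "k \<le> 2 * n - 2" for k
      using regular_add(2)[OF reg] that by (simp add: regular_def)
    show "N \<union> N' \<in> null_sets lebesgue" using N N' by auto
    show "Q (\<lambda>t. y t + w t) (2 * n - 1) differentiable (at t within \<Delta>)" if "t \<in> \<Delta> - (N \<union> N')" for t
      by (rule l_add(2)[OF reg]) (use that N N' in auto)
    have ac: "abs_cont_on c d (\<lambda>t. Q y (2 * n - 1) t + Q w (2 * n - 1) t)" if "c \<in> \<Delta>" "d \<in> \<Delta>" for c d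
      using assms that unfolding dom_def loc_abs_cont_on_def by (intro abs_cont_on_add) blast+
    have seg: "{c..d} \<subseteq> \<Delta>" if "c \<in> \<Delta>" "d \<in> \<Delta>" for c d using that nonneg down[OF that(2)] by fastforce
    show "loc_abs_cont_on \<Delta> (Q (\<lambda>t. y t + w t) (2 * n - 1))"
      unfolding loc_abs_cont_on_def
    proof (intro ballI)
      fix c d assume cd: "c \<in> \<Delta>" "d \<in> \<Delta>"
      show "abs_cont_on c d (Q (\<lambda>t. y t + w t) (2 * n - 1))"
        by (rule abs_cont_on_le[OF ac[OF cd], of 1 0]) (use seg[OF cd] regular_add(1)[OF reg k] in \<open>auto simp: subset_iff\<close>)
    qed
  qed
qed

lemma solution_dom: assumes "solution z f y" shows "dom y"
proof (rule domI)
  have k: "2 * n - 1 < 2 * n" using n_pos by simp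
  have C1: "Ck_on \<Delta> 1 (Q y k)" if "k < 2 * n" for k using assms that by (simp add: solution_def)
  show "Ck_on \<Delta> 1 (Q y k)" if "k \<le> 2 * n - 2" for k using C1[of k] that k by auto
  show "{} \<in> null_sets lebesgue" by simp
  show "Q y (2 * n - 1) differentiable (at t within \<Delta>)" if "t \<in> \<Delta> - {}" for t
    using C1[OF k] that by (simp add: Ck_on_Suc)
  show "loc_abs_cont_on \<Delta> (Q y (2 * n - 1))"
    unfolding loc_abs_cont_on_def
  proof (intro ballI)
    fix c d assume cd: "c \<in> \<Delta>" "d \<in> \<Delta>"
    obtain L where L: "0 \<le> L" "\<And>s t. s \<in> {0..d} \<Longrightarrow> t \<in> {0..d} \<Longrightarrow> norm (Q y (2 * n - 1) t - Q y (2 * n - 1) s) \<le> L * \<bar>t - s\<bar>"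
      by (rule Ck_on_lipschitz[OF C1[OF k] cd(2)]) (rule that)
    show "abs_cont_on c d (Q y (2 * n - 1))"
      by (rule abs_cont_on_lipschitz[OF L(1)]) (use L(2) nonneg[OF cd(1)] in auto)
  qed
qed

text \<open>If all 2n quasi-derivatives match at \<open>\<eta>\<close>, the glued states obey the
  first 2n - 1 equations and are thus the quasi-derivatives of the glued function. The last one is
  only absolutely continuous, since l may jump at \<open>\<eta>\<close>.\<close>

lemma glue:
  assumes v: "dom v" and y: "dom y" and \<eta>: "\<eta> \<in> \<Delta>" and match: "\<And>k. k < 2 * n \<Longrightarrow> Q v k \<eta> = Q y k \<eta>"
  defines "x \<equiv> \<lambda>t. if t \<le> \<eta> then v t else y t"
  shows "dom x"
    and "\<And>k t. k < 2 * n \<Longrightarrow> t \<in> \<Delta> \<Longrightarrow> Q x k t = (if t \<le> \<eta> then Q v k t else Q y k t)"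
    and "\<And>t. t \<in> \<Delta> \<Longrightarrow> t < \<eta> \<Longrightarrow> Q v (2 * n - 1) differentiable (at t within \<Delta>) \<Longrightarrow> l x t = l v t"
    and "\<And>t. t \<in> \<Delta> \<Longrightarrow> \<eta> < t \<Longrightarrow> Q y (2 * n - 1) differentiable (at t within \<Delta>) \<Longrightarrow> l x t = l y t"
proof -
  let ?Y = "\<lambda>k t. if t \<le> \<eta> then Q v k t else Q y k t"
  have reg: "regular v" "regular y" using v y dom_regular by auto
  have k2: "2 * n - 1 < 2 * n" using n_pos by simp
  have rhsY: "rhs k t (\<lambda>i. ?Y i t) = (if t \<le> \<eta> then rhs k t (\<lambda>i. Q v i t) else rhs k t (\<lambda>i. Q y i t))" for k t by simp
  have Y: "(?Y k has_vector_derivative rhs k t (\<lambda>i. ?Y i t)) (at t within \<Delta>)" if "Suc k < 2 * n" "t \<in> \<Delta>" for k t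
  proof (rule has_vector_derivative_glue)
    show "(Q v k has_vector_derivative rhs k t (\<lambda>i. ?Y i t)) (at t within \<Delta>)" if "t \<le> \<eta>"
      using Q_derivative[OF reg(1) \<open>t \<in> \<Delta>\<close> \<open>Suc k < 2 * n\<close>] that by simp
    show "(Q y k has_vector_derivative rhs k t (\<lambda>i. ?Y i t)) (at t within \<Delta>)" if "\<eta> \<le> t"
    proof (cases "t = \<eta>")
      case True
      have "rhs k t (\<lambda>i. ?Y i t) = rhs k t (\<lambda>i. Q y i t)"
        by (rule rhs_cong) (use match True \<open>Suc k < 2 * n\<close> in auto)
      then show ?thesis using Q_derivative[OF reg(2) \<open>t \<in> \<Delta>\<close> \<open>Suc k < 2 * n\<close>] by simp
    next
      case False
      then show ?thesis using Q_derivative[OF reg(2) \<open>t \<in> \<Delta>\<close> \<open>Suc k < 2 * n\<close>] that by simp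
    qed
  qed (use that match in auto)
  have x0: "?Y 0 = x" by (auto simp: x_def fun_eq_iff)
  show Qx: "Q x k t = ?Y k t" if "k < 2 * n" "t \<in> \<Delta>" for k t
    using state_Q[of ?Y, OF Y that] unfolding x0 by simp
  obtain N where N: "N \<in> null_sets lebesgue" "\<And>t. t \<in> \<Delta> - N \<Longrightarrow> Q v (2 * n - 1) differentiable (at t within \<Delta>)"
    by (rule dom_exceptional[OF v]) blast
  obtain N' where N': "N' \<in> null_sets lebesgue" "\<And>t. t \<in> \<Delta> - N' \<Longrightarrow> Q y (2 * n - 1) differentiable (at t within \<Delta>)"
    by (rule dom_exceptional[OF y]) blast
  have left: "(Q x (2 * n - 1) has_vector_derivative d) (at t within \<Delta>)"
    if "t \<in> \<Delta>" "t < \<eta>" "(Q v (2 * n - 1) has_vector_derivative d) (at t within \<Delta>)" for t d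
    by (rule has_vector_derivative_transform_within[OF that(3), of "\<eta> - t"]) (use that Qx[OF k2] in \<open>auto simp: dist_real_def\<close>)
  have right: "(Q x (2 * n - 1) has_vector_derivative d) (at t within \<Delta>)"
    if "t \<in> \<Delta>" "\<eta> < t" "(Q y (2 * n - 1) has_vector_derivative d) (at t within \<Delta>)" for t d
    by (rule has_vector_derivative_transform_within[OF that(3), of "t - \<eta>"]) (use that Qx[OF k2] in \<open>auto simp: dist_real_def\<close>)
  have C1: "Ck_on \<Delta> 1 (Q x k)" if k: "k \<le> 2 * n - 2" for k
    unfolding One_nat_def
  proof (rule Ck_on_SucI)
    have k': "Suc k < 2 * n" "k < 2 * n" using k n_pos by auto
    show "(Q x k has_vector_derivative rhs k t (\<lambda>i. ?Y i t)) (at t within \<Delta>)" if "t \<in> \<Delta>" for t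
      by (rule has_vector_derivative_transform[OF that Qx Y]) (use k' that in auto)
    have "continuous_on \<Delta> (?Y j)" if "j < 2 * n" for j
    proof -
      have "continuous_on \<Delta> (Q v j)" "continuous_on \<Delta> (Q y j)"
        using dom_abs_cont[OF v _ that] dom_abs_cont[OF y _ that] by (auto intro!: continuous_on_segments abs_cont_on_continuous)
      note cont = this
      have D: "(\<Delta> \<inter> {..\<eta>}) \<union> (\<Delta> \<inter> {\<eta>..}) = \<Delta>" by auto
      have "continuous_on ((\<Delta> \<inter> {..\<eta>}) \<union> (\<Delta> \<inter> {\<eta>..})) (\<lambda>t. if t \<le> \<eta> then Q v j t else Q y j t)"
      proof (rule continuous_on_cases_local)
        show "closedin (top_of_set ((\<Delta> \<inter> {..\<eta>}) \<union> (\<Delta> \<inter> {\<eta>..}))) (\<Delta> \<inter> {..\<eta>})"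
          "closedin (top_of_set ((\<Delta> \<inter> {..\<eta>}) \<union> (\<Delta> \<inter> {\<eta>..}))) (\<Delta> \<inter> {\<eta>..})"
          unfolding D by (simp_all add: closedin_closed_Int)
        show "continuous_on (\<Delta> \<inter> {..\<eta>}) (Q v j)" "continuous_on (\<Delta> \<inter> {\<eta>..}) (Q y j)"
          by (rule continuous_on_subset[OF cont(1)], blast) (rule continuous_on_subset[OF cont(2)], blast)
        show "Q v j t = Q y j t" if "t \<in> \<Delta> \<inter> {..\<eta>} \<and> \<not> t \<le> \<eta> \<or> t \<in> \<Delta> \<inter> {\<eta>..} \<and> t \<le> \<eta>" for t
        proof -
          have "t = \<eta>" using that by auto
          then show ?thesis using match[OF \<open>j < 2 * n\<close>] by simp
        qed
      qed
      then show ?thesis unfolding D .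
    qed
    then have "continuous_on \<Delta> (\<lambda>t. rhs k t (\<lambda>i. ?Y i t))"
      using admissible_rhs[OF k'(2)] segment unfolding admissible_def
      by (intro continuous_on_segments) (meson continuous_on_subset)
    then show "Ck_on \<Delta> 0 (\<lambda>t. rhs k t (\<lambda>i. ?Y i t))" by (simp add: Ck_on_0)
  qed
  show dom: "dom x"
  proof (rule domI[OF C1])
    \<comment> \<open>The seam joins the exceptional set, as the last quasi-derivative may have a
      corner there.\<close>
    show "N \<union> N' \<union> {\<eta>} \<in> null_sets lebesgue" using N N' by auto
    show "Q x (2 * n - 1) differentiable (at t within \<Delta>)" if t: "t \<in> \<Delta> - (N \<union> N' \<union> {\<eta>})" for t
    proof (cases "t < \<eta>")
      case True
      show ?thesis
        by (rule differentiableI_vector[OF left[OF _ True Dx_has_derivative[OF N(2)]]]) (use t in auto)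
    next
      case False
      then have "\<eta> < t" using t by auto
      show ?thesis
        by (rule differentiableI_vector[OF right[OF _ \<open>\<eta> < t\<close> Dx_has_derivative[OF N'(2)]]]) (use t in auto)
    qed
    show "loc_abs_cont_on \<Delta> (Q x (2 * n - 1))"
      unfolding loc_abs_cont_on_def
    proof (intro ballI)
      fix c d assume cd: "c \<in> \<Delta>" "d \<in> \<Delta>"
      define m where "m = max d \<eta>"
      have m: "m \<in> \<Delta>" using cd \<eta> by (simp add: m_def max_def)
      have "abs_cont_on 0 m (?Y (2 * n - 1))"
        by (rule abs_cont_on_glue[OF dom_abs_cont[OF v m k2] dom_abs_cont[OF y m k2]])
          (use match[OF k2] nonneg[OF \<eta>] in \<open>auto simp: m_def\<close>)
      \<comment> \<open>The clamp is the identity on the segment from c to d and acts as a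
        restriction from the longer segment.\<close>
      then have "abs_cont_on c d (\<lambda>t. ?Y (2 * n - 1) (max c (min d t)))" if "c \<le> d"
        by (rule abs_cont_on_reparametrize) (use cd nonneg[OF cd(1)] that in \<open>auto simp: mono_def m_def max_def min_def\<close>)
      note cont = this
      show "abs_cont_on c d (Q x (2 * n - 1))"
      proof (cases "c \<le> d")
        case True
        show ?thesis
        proof (rule abs_cont_on_le[OF cont[OF True], of 1 0])
          fix s t assume st: "s \<in> {c..d}" "t \<in> {c..d}"
          then have "s \<in> \<Delta>" "t \<in> \<Delta>" using cd nonneg[OF cd(1)] down[OF cd(2)] by auto
          then show "norm (Q x (2 * n - 1) t - Q x (2 * n - 1) s) \<le> 1 * norm (?Y (2 * n - 1) (max c (min d t)) - ?Y (2 * n - 1) (max c (min d s))) + 0 * \<bar>t - s\<bar>"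
            using st unfolding Qx[OF k2 \<open>s \<in> \<Delta>\<close>] Qx[OF k2 \<open>t \<in> \<Delta>\<close>] by (simp add: max_absorb2 min_absorb2)
        qed auto
      next
        case False
        then show ?thesis by (intro abs_cont_on_lipschitz[of 0]) auto
      qed
    qed
  qed
  show "l x t = l v t" if t: "t \<in> \<Delta>" "t < \<eta>" "Q v (2 * n - 1) differentiable (at t within \<Delta>)" for t
  proof -
    have "l x t = rhs (2 * n - 1) t (\<lambda>i. Q x i t) - (rhs (2 * n - 1) t (\<lambda>i. Q v i t) - l v t)"
      by (rule l_last[OF dom_regular[OF dom] t(1) left[OF t(1,2) Q_last_derivative[OF reg(1) t(1,3)]]])
    moreover have "rhs (2 * n - 1) t (\<lambda>i. Q x i t) = rhs (2 * n - 1) t (\<lambda>i. Q v i t)"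
      by (rule rhs_cong[OF _ k2]) (use Qx[OF _ t(1)] t(2) in auto)
    ultimately show ?thesis by simp
  qed
  show "l x t = l y t" if t: "t \<in> \<Delta>" "\<eta> < t" "Q y (2 * n - 1) differentiable (at t within \<Delta>)" for t
  proof -
    have "l x t = rhs (2 * n - 1) t (\<lambda>i. Q x i t) - (rhs (2 * n - 1) t (\<lambda>i. Q y i t) - l y t)"
      by (rule l_last[OF dom_regular[OF dom] t(1) right[OF t(1,2) Q_last_derivative[OF reg(2) t(1,3)]]])
    moreover have "rhs (2 * n - 1) t (\<lambda>i. Q x i t) = rhs (2 * n - 1) t (\<lambda>i. Q y i t)"
      by (rule rhs_cong[OF _ k2]) (use Qx[OF _ t(1)] t(2) in auto)
    ultimately show ?thesis by simp
  qed
qed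

end



section \<open>Initial data and observability\<close>

definition null_on :: "real \<Rightarrow> (nat \<Rightarrow> real \<Rightarrow> 'v::real_normed_vector) \<Rightarrow> bool"
  where "null_on \<eta> g \<longleftrightarrow> (\<forall>e>0. \<forall>\<^sub>F m in sequentially. \<forall>t\<in>{0..\<eta>}. norm (g m t) < e)"

lemma null_on_le:
  assumes "null_on \<eta> g" "\<And>m t. t \<in> {0..\<eta>} \<Longrightarrow> norm (h m t) \<le> K * norm (g m t)" shows "null_on \<eta> h"
  unfolding null_on_def
proof (intro allI impI)
  fix e :: real assume "0 < e"
  then have "0 < e / (\<bar>K\<bar> + 1)" by simp
  then have "\<forall>\<^sub>F m in sequentially. \<forall>t\<in>{0..\<eta>}. norm (g m t) < e / (\<bar>K\<bar> + 1)" using assms(1) unfolding null_on_def by blast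
  then show "\<forall>\<^sub>F m in sequentially. \<forall>t\<in>{0..\<eta>}. norm (h m t) < e"
  proof eventually_elim
    fix m assume *: "\<forall>t\<in>{0..\<eta>}. norm (g m t) < e / (\<bar>K\<bar> + 1)"
    show "\<forall>t\<in>{0..\<eta>}. norm (h m t) < e"
    proof
      fix t assume t: "t \<in> {0..\<eta>}"
      have "K * norm (g m t) \<le> (\<bar>K\<bar> + 1) * norm (g m t)" by (intro mult_right_mono) auto
      then have "norm (h m t) \<le> (\<bar>K\<bar> + 1) * norm (g m t)" using assms(2)[OF t, of m] by linarith
      also have "\<dots> < (\<bar>K\<bar> + 1) * (e / (\<bar>K\<bar> + 1))" using * t by (intro mult_strict_left_mono) auto
      finally show "norm (h m t) < e" by simp
    qed
  qed
qed

lemma null_on_add: assumes "null_on \<eta> g" "null_on \<eta> h" shows "null_on \<eta> (\<lambda>m t. g m t + h m t)"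
  unfolding null_on_def
proof (intro allI impI)
  fix e :: real assume e: "0 < e"
  have "\<forall>\<^sub>F m in sequentially. \<forall>t\<in>{0..\<eta>}. norm (g m t) < e / 2" "\<forall>\<^sub>F m in sequentially. \<forall>t\<in>{0..\<eta>}. norm (h m t) < e / 2"
    using assms e unfolding null_on_def by (meson half_gt_zero)+
  then show "\<forall>\<^sub>F m in sequentially. \<forall>t\<in>{0..\<eta>}. norm (g m t + h m t) < e"
  proof eventually_elim
    case (elim m)
    then show ?case using norm_triangle_ineq[of "g m _" "h m _"] by (smt (verit) field_sum_of_halves)
  qed
qed

lemma null_on_diff: "null_on \<eta> g \<Longrightarrow> null_on \<eta> h \<Longrightarrow> null_on \<eta> (\<lambda>m t. g m t - h m t)"
  using null_on_add[of \<eta> g "\<lambda>m t. - h m t"] null_on_le[of \<eta> h "\<lambda>m t. - h m t" 1] by simp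

lemma null_on_apply:
  fixes A :: "real \<Rightarrow> 'a::complex_hilbert \<Rightarrow>\<^sub>C\<^sub>L 'b::complex_hilbert"
  assumes "continuous_on {0..\<eta>} A" "null_on \<eta> g" shows "null_on \<eta> (\<lambda>m t. A t *\<^sub>V g m t)"
proof -
  have "bounded (A ` {0..\<eta>})" by (intro compact_imp_bounded compact_continuous_image assms) simp
  then obtain N where "\<forall>t\<in>{0..\<eta>}. norm (A t) \<le> N" unfolding bounded_iff by auto
  then have "norm (A t *\<^sub>V g m t) \<le> N * norm (g m t)" if "t \<in> {0..\<eta>}" for m t
    using that norm_cblinfun_apply[of "A t" "g m t"] by (meson mult_right_mono norm_ge_zero order_trans)
  then show ?thesis by (rule null_on_le[OF assms(2)])
qed

text \<open>Equicontinuity lets uniform convergence to 0 pass from functions to derivatives: over a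
  fixed short length the derivative is close to the difference quotient, whose numerator tends to
  0.\<close>

lemma null_on_derivative:
  fixes f :: "nat \<Rightarrow> real \<Rightarrow> 'v::banach"
  assumes \<eta>: "0 < \<eta>" and der: "\<And>m t. t \<in> {0..\<eta>} \<Longrightarrow> (f m has_vector_derivative D m t) (at t within {0..\<eta>})"
    and equi: "\<And>e. 0 < e \<Longrightarrow> \<exists>d>0. \<forall>m. \<forall>s\<in>{0..\<eta>}. \<forall>t\<in>{0..\<eta>}. \<bar>s - t\<bar> < d \<longrightarrow> norm (D m s - D m t) < e"
    and null: "null_on \<eta> f"
  shows "null_on \<eta> D"
  unfolding null_on_def
proof (intro allI impI)
  fix e :: real assume e: "0 < e"
  then have "0 < e / 2" by simp
  then obtain d where d: "0 < d" "\<And>m s t. s \<in> {0..\<eta>} \<Longrightarrow> t \<in> {0..\<eta>} \<Longrightarrow> \<bar>s - t\<bar> < d \<Longrightarrow> norm (D m s - D m t) < e / 2"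
    using equi by meson
  \<comment> \<open>Below the modulus d, and at most half of \<open>\<eta>\<close>, so that an
    interval of length r fits on one side of every t.\<close>
  define r where "r = min d \<eta> / 2"
  have r: "0 < r" "r < d" "2 * r \<le> \<eta>" using d(1) \<eta> by (auto simp: r_def)
  have lin: "norm (f m c - f m a - (c - a) *\<^sub>R D m t) \<le> e / 2 * (c - a)"
    if "a \<in> {0..\<eta>}" "c \<in> {0..\<eta>}" "a \<le> c" "c - a \<le> r" "t \<in> {a..c}" for m a c t
  proof -
    have sub: "{a..c} \<subseteq> {0..\<eta>}" using that by auto
    have "((\<lambda>s. D m s - D m t) has_integral (f m c - f m a) - (c - a) *\<^sub>R D m t) {a..c}"
    proof (rule has_integral_diff)
      show "(D m has_integral f m c - f m a) {a..c}"
        by (rule fundamental_theorem_of_calculus[OF that(3)])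
          (use has_vector_derivative_within_subset[OF der sub] sub in blast)
      show "((\<lambda>s. D m t) has_integral (c - a) *\<^sub>R D m t) {a..c}"
        using has_integral_const_real[of "D m t" a c] that(3) by simp
    qed
    moreover have "norm (D m s - D m t) \<le> e / 2" if "s \<in> {a..c} - {}" for s
      using d(2)[of s t m] that sub \<open>t \<in> {a..c}\<close> \<open>c - a \<le> r\<close> r(2) by (auto intro!: less_imp_le)
    ultimately have "norm (f m c - f m a - (c - a) *\<^sub>R D m t) \<le> e / 2 * Henstock_Kurzweil_Integration.content {a..c}"
      using e by (intro has_integral_bound_real[of "e / 2" "{}" "\<lambda>s. D m s - D m t"]) auto
    then show ?thesis using that(3) by simp
  qed
  have "0 < e * r / 4" using e r by simp
  then have "\<forall>\<^sub>F m in sequentially. \<forall>t\<in>{0..\<eta>}. norm (f m t) < e * r / 4" using null unfolding null_on_def by blast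
  then show "\<forall>\<^sub>F m in sequentially. \<forall>t\<in>{0..\<eta>}. norm (D m t) < e"
  proof eventually_elim
    fix m assume *: "\<forall>t\<in>{0..\<eta>}. norm (f m t) < e * r / 4"
    show "\<forall>t\<in>{0..\<eta>}. norm (D m t) < e"
    proof
      fix t assume t: "t \<in> {0..\<eta>}"
      \<comment> \<open>The interval starts at t, or ends there if t is too close to
        \<open>\<eta>\<close>.\<close>
      define a where "a = (if t + r \<le> \<eta> then t else t - r)"
      have a: "a \<in> {0..\<eta>}" "a + r \<in> {0..\<eta>}" "t \<in> {a..a + r}" using t r by (auto simp: a_def)
      have "norm (f m (a + r) - f m a - (a + r - a) *\<^sub>R D m t) \<le> e / 2 * (a + r - a)"
        by (rule lin) (use a r in auto)
      then have 1: "norm (f m (a + r) - f m a - r *\<^sub>R D m t) \<le> e / 2 * r" by simp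
      have "r *\<^sub>R D m t = (f m (a + r) - f m a) - (f m (a + r) - f m a - r *\<^sub>R D m t)" by simp
      then have "norm (r *\<^sub>R D m t) \<le> norm (f m (a + r) - f m a) + norm (f m (a + r) - f m a - r *\<^sub>R D m t)"
        by (metis norm_triangle_ineq4)
      also have "norm (f m (a + r) - f m a) \<le> norm (f m (a + r)) + norm (f m a)" by (rule norm_triangle_ineq4)
      finally have "norm (r *\<^sub>R D m t) < e * r / 4 + e * r / 4 + e / 2 * r"
        using bspec[OF * a(1)] bspec[OF * a(2)] 1 by linarith
      then have "r * norm (D m t) < e * r / 4 + e * r / 4 + e / 2 * r" using r(1) by simp
      then have "r * norm (D m t) < r * e" by (simp add: field_simps)
      then show "norm (D m t) < e" using r(1) by simp
    qed
  qed
qed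

lemma pos_bij: "bij_betw pos (UNIV :: 'n::{finite, linorder} set) {..<CARD('n)}"
proof -
  have mono: "pos i < pos j" if "i < j" for i j :: 'n
    unfolding pos_def by (rule psubset_card_mono) (use that in auto)
  have inj: "inj (pos :: 'n \<Rightarrow> nat)"
    by (rule injI) (metis mono less_irrefl linorder_neqE)
  have "pos i < CARD('n)" for i :: 'n
    unfolding pos_def by (rule psubset_card_mono) auto
  then have "range (pos :: 'n \<Rightarrow> nat) \<subseteq> {..<CARD('n)}" by auto
  then have "range (pos :: 'n \<Rightarrow> nat) = {..<CARD('n)}"
    by (intro card_subset_eq) (simp_all add: card_image[OF inj])
  then show ?thesis using inj by (simp add: bij_betw_def)
qed

lemma component_op: obtains T where "\<And>v :: ('h::complex_hilbert, 'n::finite) vec. T *\<^sub>V v = v $ i"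
  by (rule cblinfun_of_fun[of "\<lambda>v. v $ i"]) (auto simp: bounded_linear_vec_nth scaleC_vec_def)

text \<open>The parameter \<open>index\<close> only fixes the type of coordinates, whose cardinality
  is n.\<close>

locale indexed_expression = half_open_interval +
  fixes p q :: "nat \<Rightarrow> real \<Rightarrow> 'h::{complex_hilbert, second_countable_topology} \<Rightarrow>\<^sub>C\<^sub>L 'h"
    and index :: "'n::{finite, linorder} itself"
  assumes coefficients_ok: "coefficients_ok \<Delta> CARD('n) p q"

sublocale indexed_expression \<subseteq> hilbert_expression \<Delta> b "CARD('n)" p q
  by unfold_locales (simp_all add: coefficients_ok)

context indexed_expression
begin

definition idx :: "nat \<Rightarrow> 'n" where "idx = inv_into UNIV pos"

lemma pos_idx: "k < CARD('n) \<Longrightarrow> pos (idx k) = k"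
  unfolding idx_def using pos_bij[where 'n = 'n] by (intro f_inv_into_f) (auto simp: bij_betw_def)

lemma idx_pos: "idx (pos i) = i"
  unfolding idx_def using pos_bij[where 'n = 'n] by (intro inv_into_f_f) (auto simp: bij_betw_def)

lemma pos_less: "pos (i :: 'n) < CARD('n)"
  using pos_bij[where 'n = 'n] by (auto simp: bij_betw_def)

text \<open>Enumerates the data by the order of the quasi-derivative; the second component stores
  the orders from n to 2n - 1 in decreasing order.\<close>

definition coord :: "nat \<Rightarrow> ('h, 'n) vec \<times> ('h, 'n) vec \<Rightarrow> 'h"
  where "coord k c = (if k < CARD('n) then fst c $ idx k else snd c $ idx (2 * CARD('n) - 1 - k))"

definition data :: "(real \<Rightarrow> 'h) \<Rightarrow> real \<Rightarrow> ('h, 'n) vec \<times> ('h, 'n) vec"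
  where "data y t = (qd1 \<Delta> p q y t, qd2 \<Delta> p q y t)"

lemma coord_data: "k < 2 * CARD('n) \<Longrightarrow> coord k (data y t) = Q y k t"
  by (auto simp: coord_def data_def qd1_def qd2_def pos_idx)

lemma data_eqI:
  assumes "\<And>k. k < 2 * CARD('n) \<Longrightarrow> coord k c = coord k d" shows "c = d"
proof (rule prod_eqI)
  show "fst c = fst d"
  proof (subst vec_eq_iff, intro allI)
    fix i :: 'n
    have "pos i < 2 * CARD('n)" "pos i < CARD('n)" using pos_less[of i] by auto
    then show "fst c $ i = fst d $ i" using assms[of "pos i"] by (simp only: coord_def if_True idx_pos)
  qed
  show "snd c = snd d"
  proof (subst vec_eq_iff, intro allI)
    fix i :: 'n
    have "2 * CARD('n) - 1 - pos i < 2 * CARD('n)" "\<not> 2 * CARD('n) - 1 - pos i < CARD('n)" "2 * CARD('n) - 1 - (2 * CARD('n) - 1 - pos i) = pos i" using pos_less[of i] by auto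
    then show "snd c $ i = snd d $ i" using assms[of "2 * CARD('n) - 1 - pos i"] by (simp only: coord_def if_False idx_pos)
  qed
qed

lemma coord_op: obtains T where "\<And>c. T *\<^sub>V c = coord k c"
proof -
  obtain S :: "('h, 'n) vec \<Rightarrow>\<^sub>C\<^sub>L 'h" where S: "\<And>v. S *\<^sub>V v = v $ idx k" by (rule component_op) (rule that)
  obtain S' :: "('h, 'n) vec \<Rightarrow>\<^sub>C\<^sub>L 'h" where S': "\<And>v. S' *\<^sub>V v = v $ idx (2 * CARD('n) - 1 - k)" by (rule component_op) (rule that)
  show thesis
    by (rule that[of "if k < CARD('n) then S o\<^sub>C\<^sub>L fst_op else S' o\<^sub>C\<^sub>L snd_op"]) (simp add: coord_def S S')
qed

lemma norm_le_coord: "norm c \<le> (\<Sum>k<2 * CARD('n). norm (coord k c))"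
proof -
  have split: "{..<2 * CARD('n)} = {..<CARD('n)} \<union> {CARD('n)..<2 * CARD('n)}" by auto
  have "norm (fst c) \<le> (\<Sum>i\<in>UNIV. norm (fst c $ i))" unfolding norm_vec_def by (rule L2_set_le_sum) simp
  also have "\<dots> = (\<Sum>k<CARD('n). norm (coord k c))"
    using sum.reindex_bij_betw[OF pos_bij[where 'n = 'n], of "\<lambda>k. norm (coord k c)"] pos_less by (simp add: coord_def idx_pos)
  finally have 1: "norm (fst c) \<le> (\<Sum>k<CARD('n). norm (coord k c))" .
  have "norm (snd c) \<le> (\<Sum>i\<in>UNIV. norm (snd c $ i))" unfolding norm_vec_def by (rule L2_set_le_sum) simp
  also have "\<dots> = (\<Sum>k<CARD('n). norm (snd c $ idx k))"
    using sum.reindex_bij_betw[OF pos_bij[where 'n = 'n], of "\<lambda>k. norm (snd c $ idx k)"] by (simp add: idx_pos)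
  also have "\<dots> = (\<Sum>k\<in>{CARD('n)..<2 * CARD('n)}. norm (coord k c))"
    by (rule sum.reindex_bij_witness[of _ "\<lambda>k. 2 * CARD('n) - 1 - k" "\<lambda>k. 2 * CARD('n) - 1 - k"]) (auto simp: coord_def)
  finally have 2: "norm (snd c) \<le> (\<Sum>k\<in>{CARD('n)..<2 * CARD('n)}. norm (coord k c))" .
  have "norm c \<le> norm (fst c) + norm (snd c)" by (metis norm_Pair_le prod.collapse)
  then show ?thesis using 1 2 unfolding split by (subst sum.union_disjoint) auto
qed

definition form :: "('h, 'n) vec \<times> ('h, 'n) vec \<Rightarrow> ('h, 'n) vec \<times> ('h, 'n) vec \<Rightarrow> complex"
  where "form c d = cinner (fst c) (snd d) - cinner (snd c) (fst d)"

lemma bracket_form: "bracket index \<Delta> p q y w t = form (data y t) (data w t)"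
  by (simp add: bracket_def form_def data_def)

lemma br_form: "br y w t = form (data y t) (data w t)"
proof -
  have "form (data y t) (data w t) = (\<Sum>i\<in>(UNIV :: 'n set). cinner (Q y (pos i) t) (Q w (2 * CARD('n) - 1 - pos i) t) - cinner (Q y (2 * CARD('n) - 1 - pos i) t) (Q w (pos i) t))"
    by (simp add: form_def data_def qd1_def qd2_def cinner_vec_def sum_subtractf)
  also have "\<dots> = br y w t"
    unfolding br_def using sum.reindex_bij_betw[OF pos_bij[where 'n = 'n],
        of "\<lambda>k. cinner (Q y k t) (Q w (2 * CARD('n) - 1 - k) t) - cinner (Q y (2 * CARD('n) - 1 - k) t) (Q w k t)"] by simp
  finally show ?thesis by simp
qed

lemma form_eq_0: assumes "\<And>d. form c d = 0" shows "c = 0"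
proof -
  have "cinner (fst c) x = 0" "cinner (snd c) x = 0" for x
    using assms[of "(0, x)"] assms[of "(x, 0)"] by (simp_all add: form_def)
  then have "fst c = 0" "snd c = 0" by (auto intro: cinner_ext)
  then show ?thesis by (simp add: prod_eq_iff)
qed

lemma form_diff: "form (c - c') d = form c d - form c' d"
  by (simp add: form_def cinner_linear)

text \<open>The fundamental operator solution, whose initial data are the identity. Every solution
  is \<open>Phi\<close> applied to its initial data, which gives bounds and continuity uniform in
  the data.\<close>

definition Phi :: "complex \<Rightarrow> real \<Rightarrow> (('h, 'n) vec \<times> ('h, 'n) vec) \<Rightarrow>\<^sub>C\<^sub>L 'h"
  where "Phi z = (SOME Y. op_solution \<Delta> CARD('n) p q z Y \<and> (\<forall>k<2 * CARD('n). \<forall>c. quasi_deriv (o\<^sub>C\<^sub>L) \<Delta> CARD('n) p q Y k 0 *\<^sub>V c = coord k c))"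

lemma op_solution_data:
  fixes W :: "'k::complex_hilbert \<Rightarrow>\<^sub>C\<^sub>L (('h, 'n) vec \<times> ('h, 'n) vec)"
  obtains Y where "op_solution \<Delta> CARD('n) p q z Y" "\<And>k c. k < 2 * CARD('n) \<Longrightarrow> quasi_deriv (o\<^sub>C\<^sub>L) \<Delta> CARD('n) p q Y k 0 *\<^sub>V c = coord k (W *\<^sub>V c)"
proof -
  have "\<forall>k. \<exists>T. \<forall>c. T *\<^sub>V c = coord k c" using coord_op by metis
  then obtain T where T: "\<And>k c. T k *\<^sub>V c = coord k c" by metis
  obtain Y :: "real \<Rightarrow> 'k \<Rightarrow>\<^sub>C\<^sub>L 'h" where Y: "op_solution \<Delta> CARD('n) p q z Y" "\<And>k. k < 2 * CARD('n) \<Longrightarrow> quasi_deriv (o\<^sub>C\<^sub>L) \<Delta> CARD('n) p q Y k 0 = T k o\<^sub>C\<^sub>L W"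
    by (rule op_solution_exists[of z "\<lambda>k. T k o\<^sub>C\<^sub>L W"]) (rule that)
  show thesis by (rule that[OF Y(1)]) (simp add: Y(2) T)
qed

lemma Phi: "op_solution \<Delta> CARD('n) p q z (Phi z)" "k < 2 * CARD('n) \<Longrightarrow> quasi_deriv (o\<^sub>C\<^sub>L) \<Delta> CARD('n) p q (Phi z) k 0 *\<^sub>V c = coord k c"
proof -
  have ex: "\<exists>Y. op_solution \<Delta> CARD('n) p q z Y \<and> (\<forall>k<2 * CARD('n). \<forall>c. quasi_deriv (o\<^sub>C\<^sub>L) \<Delta> CARD('n) p q Y k 0 *\<^sub>V c = coord k c)"
    by (rule op_solution_data[of z cblinfun_id]) auto
  show "op_solution \<Delta> CARD('n) p q z (Phi z)" "k < 2 * CARD('n) \<Longrightarrow> quasi_deriv (o\<^sub>C\<^sub>L) \<Delta> CARD('n) p q (Phi z) k 0 *\<^sub>V c = coord k c"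
    using someI_ex[OF ex, folded Phi_def] by blast+
qed

abbreviation phi :: "complex \<Rightarrow> ('h, 'n) vec \<times> ('h, 'n) vec \<Rightarrow> real \<Rightarrow> 'h"
  where "phi z c \<equiv> \<lambda>t. Phi z t *\<^sub>V c"

lemma phi_solution: "solution z (\<lambda>t. 0) (phi z c)"
  by (rule op_solution_apply(1)[OF Phi(1)])

lemma phi_Q: "k < 2 * CARD('n) \<Longrightarrow> t \<in> \<Delta> \<Longrightarrow> Q (phi z c) k t = quasi_deriv (o\<^sub>C\<^sub>L) \<Delta> CARD('n) p q (Phi z) k t *\<^sub>V c"
  by (rule op_solution_apply(2)[OF Phi(1)])

lemma phi_data: "data (phi z c) 0 = c"
  by (rule data_eqI) (simp add: coord_data phi_Q zero_in Phi(2))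

lemma solution_phi: "solution z (\<lambda>t. 0) y \<Longrightarrow> y = phi z (data y 0)"
  by (rule solution_fun_eq[OF continuous_on_const _ phi_solution])
    (simp_all flip: coord_data add: phi_data)

lemma phi_dom: "dom (phi z c)"
  by (rule solution_dom[OF phi_solution])

lemma phi_l: "t \<in> \<Delta> \<Longrightarrow> l (phi z c) t = z *\<^sub>C phi z c t"
  using phi_solution[of z c] by (simp add: solution_def)

lemma phi_off: "t \<notin> \<Delta> \<Longrightarrow> phi z c t = 0"
  using phi_solution[of z c] by (simp add: solution_def)

lemma solution_continuous:
  assumes "solution z f y" shows "continuous_on \<Delta> y"
proof -
  have "Ck_on \<Delta> 1 (Q y 0)" using assms n_pos by (simp only: solution_def)
  then show ?thesis using Ck_on_continuous by fastforce
qed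

lemma phi_l2: "\<eta> \<in> \<Delta> \<Longrightarrow> l2 (cutoff {0..\<eta>} (phi z c))"
  by (rule l2_cut_segment[OF solution_continuous[OF phi_solution]])

lemma phi_l_cut: "\<eta> \<in> \<Delta> \<Longrightarrow> cutoff {0..\<eta>} (l (phi z c)) = (\<lambda>t. z *\<^sub>C cutoff {0..\<eta>} (phi z c) t)"
proof
  fix t
  assume \<eta>: "\<eta> \<in> \<Delta>"
  show "cutoff {0..\<eta>} (l (phi z c)) t = z *\<^sub>C cutoff {0..\<eta>} (phi z c) t"
  proof (cases "t \<in> {0..\<eta>}")
    case True
    then have "t \<in> \<Delta>" using segment[OF \<eta>] by blast
    then show ?thesis using phi_l True by (simp add: cutoff_def)
  qed (auto simp: cutoff_def)
qed

lemma l2_norm_cutoff_le: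
  assumes "l2 (cutoff {0..\<eta>} f)" "\<And>t. t \<in> {0..\<eta>} \<Longrightarrow> norm (f t) \<le> B" "0 \<le> \<eta>" "0 \<le> B"
  shows "l2_norm (cutoff {0..\<eta>} f) \<le> sqrt \<eta> * B"
proof -
  have "(LINT t|lebesgue. (norm (cutoff {0..\<eta>} f t))\<^sup>2) \<le> (LINT t|lebesgue. indicator {0..\<eta>} t * B\<^sup>2)"
  proof (rule integral_mono)
    show "integrable lebesgue (\<lambda>t. (norm (cutoff {0..\<eta>} f t))\<^sup>2)" using assms(1) by (simp add: l2_def)
    show "integrable lebesgue (\<lambda>t. indicator {0..\<eta>} t * B\<^sup>2)"
      by (intro integrable_mult_left integrable_real_indicator) (auto simp: emeasure_lborel_Icc_eq)
  qed (use assms in \<open>auto simp: cutoff_def indicator_def intro!: power_mono\<close>)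
  also have "\<dots> = \<eta> * B\<^sup>2" using assms by simp
  finally show ?thesis unfolding l2_norm_def using assms by (metis real_sqrt_le_mono real_sqrt_mult real_sqrt_abs abs_of_nonneg)
qed

lemma phi_bounded:
  assumes \<eta>: "\<eta> \<in> \<Delta>" obtains K where "0 \<le> K" "\<And>c. l2_norm (cutoff {0..\<eta>} (phi z c)) \<le> K * norm c"
proof -
  have "bounded (Phi z ` {0..\<eta>})"
    by (intro compact_imp_bounded compact_continuous_image continuous_on_subset[OF op_solution_continuous[OF Phi(1)] segment[OF \<eta>]]) simp
  then obtain K where "\<forall>t\<in>{0..\<eta>}. norm (Phi z t) \<le> K" unfolding bounded_iff by auto
  then have K: "norm (Phi z t) \<le> K" if "t \<in> {0..\<eta>}" for t using that by blast
  have K0: "0 \<le> K" using order_trans[OF norm_ge_zero K[of 0]] nonneg[OF \<eta>] by simp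
  have "l2_norm (cutoff {0..\<eta>} (phi z c)) \<le> sqrt \<eta> * (K * norm c)" for c
  proof (rule l2_norm_cutoff_le[OF phi_l2[OF \<eta>] _ nonneg[OF \<eta>]])
    show "norm (phi z c t) \<le> K * norm c" if "t \<in> {0..\<eta>}" for t
      using order_trans[OF norm_cblinfun_apply mult_right_mono[OF K[OF that] norm_ge_zero]] .
  qed (use K0 in simp)
  then show thesis using that[of "sqrt \<eta> * K"] K0 nonneg[OF \<eta>] by (simp add: mult.assoc)
qed

lemma l2_integral:
  assumes "continuous_on {0..\<eta>} f"
  shows "integral {0..\<eta>} (\<lambda>t. (norm (f t :: 'h))\<^sup>2) = (l2_norm (cutoff {0..\<eta>} f))\<^sup>2"
proof -
  have "integrable lebesgue (\<lambda>t. (norm (cutoff {0..\<eta>} f t))\<^sup>2)" using l2_cut_continuous[OF assms] by (simp add: l2_def)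
  from has_integral_integral_lebesgue[OF this]
  have "((\<lambda>t. (norm (cutoff {0..\<eta>} f t))\<^sup>2) has_integral (l2_norm (cutoff {0..\<eta>} f))\<^sup>2) UNIV" by (simp add: l2_norm_sq)
  moreover have "(\<lambda>t. (norm (cutoff {0..\<eta>} f t))\<^sup>2) = (\<lambda>t. if t \<in> {0..\<eta>} then (norm (f t))\<^sup>2 else 0)" by (auto simp: cutoff_def)
  ultimately show ?thesis using has_integral_restrict_UNIV[of "{0..\<eta>}" "\<lambda>t. (norm (f t))\<^sup>2"] by (simp add: integral_unique)
qed

text \<open>Solutions are controlled by their \<open>L\<^sub>2\<close> norm on an initial interval: otherwise there are normalised
  solutions tending to \<open>0\<close> in \<open>L\<^sub>2\<close>, hence uniformly, and the triangular shape of the first order system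
  lets this pass from each quasi-derivative to the next.\<close>

lemma observability:
  assumes \<eta>: "\<eta> \<in> \<Delta>" "0 < \<eta>"
  obtains \<kappa> where "0 < \<kappa>" "\<And>c. \<kappa> * norm c \<le> l2_norm (cutoff {0..\<eta>} (phi z c))"
proof (rule ccontr)
  assume neg: "\<not> thesis"
  have "\<exists>c. l2_norm (cutoff {0..\<eta>} (phi z c)) < 1 / Suc m * norm c" for m
    using that[of "1 / Suc m"] neg by (metis not_le of_nat_0_less_iff zero_less_Suc zero_less_divide_1_iff)
  then obtain c' where c': "\<And>m. l2_norm (cutoff {0..\<eta>} (phi z (c' m))) < 1 / Suc m * norm (c' m)" by metis
  define c where "c m = (1 / norm (c' m)) *\<^sub>R c' m" for m
  have c'0: "c' m \<noteq> 0" for m using c'[of m] l2_norm_nonneg[of "cutoff {0..\<eta>} (phi z (c' m))"] by auto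
  have norm_c: "norm (c m) = 1" for m using c'0[of m] by (simp add: c_def)
  have small: "l2_norm (cutoff {0..\<eta>} (phi z (c m))) < 1 / Suc m" for m
  proof -
    have "cutoff {0..\<eta>} (phi z (c m)) = (\<lambda>t. complex_of_real (1 / norm (c' m)) *\<^sub>C cutoff {0..\<eta>} (phi z (c' m)) t)"
      by (auto simp: c_def cutoff_def scaleC_of_real cblinfun_linear simp del: of_real_divide)
    then have "l2_norm (cutoff {0..\<eta>} (phi z (c m))) = 1 / norm (c' m) * l2_norm (cutoff {0..\<eta>} (phi z (c' m)))"
      by (simp only: l2_norm_scaleC) (simp add: norm_divide)
    moreover have "\<dots> < 1 / norm (c' m) * (1 / Suc m * norm (c' m))"
      using c'[of m] c'0[of m] by (intro mult_strict_left_mono) auto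
    ultimately show ?thesis using c'0[of m] by simp
  qed
  let ?O = "\<lambda>k. quasi_deriv (o\<^sub>C\<^sub>L) \<Delta> CARD('n) p q (Phi z) k"
  have O_C1: "Ck_on \<Delta> 1 (?O k)" if "k < 2 * CARD('n)" for k
    using Phi(1)[of z] that by (simp add: op_solution_def)
  have Y: "Q (phi z (c m)) k t = ?O k t *\<^sub>V c m" if "k < 2 * CARD('n)" "t \<in> {0..\<eta>}" for m k t
    using phi_Q[OF that(1)] segment[OF \<eta>(1)] that(2) by blast
  \<comment> \<open>Norm continuity of the operator function and normalisation of \<open>c m\<close>
    give a modulus independent of m; no compactness of the unit ball is needed.\<close>
  have equi_apply: "\<exists>d>0. \<forall>m. \<forall>s\<in>{0..\<eta>}. \<forall>t\<in>{0..\<eta>}. \<bar>s - t\<bar> < d \<longrightarrow> norm (\<Psi> s *\<^sub>V c m - \<Psi> t *\<^sub>V c m) < e"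
    if "continuous_on \<Delta> \<Psi>" "0 < e" for \<Psi> :: "real \<Rightarrow> _ \<Rightarrow>\<^sub>C\<^sub>L 'h" and e
  proof -
    note e = that(2)
    have "uniformly_continuous_on {0..\<eta>} \<Psi>"
      by (rule compact_uniformly_continuous[OF continuous_on_subset[OF that(1) segment[OF \<eta>(1)]]]) simp
    then obtain d where d: "0 < d" "\<And>s t. s \<in> {0..\<eta>} \<Longrightarrow> t \<in> {0..\<eta>} \<Longrightarrow> \<bar>s - t\<bar> < d \<Longrightarrow> norm (\<Psi> s - \<Psi> t) < e"
      using e unfolding uniformly_continuous_on_def dist_norm real_norm_def by (metis abs_minus_commute norm_minus_commute)
    have "norm (\<Psi> s *\<^sub>V c m - \<Psi> t *\<^sub>V c m) \<le> norm (\<Psi> s - \<Psi> t)" for m s t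
      using norm_cblinfun_apply[of "\<Psi> s - \<Psi> t" "c m"] by (simp add: cblinfun_linear norm_c)
    then show ?thesis using d by (intro exI[of _ d]) (meson le_less_trans)
  qed
  have null0: "null_on \<eta> (\<lambda>m. phi z (c m))"
  proof -
    let ?h = "\<lambda>m t. (norm (phi z (c m) t))\<^sup>2"
    have cont: "continuous_on {0..\<eta>} (phi z (c m))" for m
      by (rule continuous_on_subset[OF solution_continuous[OF phi_solution] segment[OF \<eta>(1)]])
    have conth: "continuous_on {0..\<eta>} (?h m)" for m by (intro continuous_intros cont)
    have "bounded (Phi z ` {0..\<eta>})"
      by (intro compact_imp_bounded compact_continuous_image continuous_on_subset[OF op_solution_continuous[OF Phi(1)] segment[OF \<eta>(1)]]) simp
    then obtain K where "\<forall>t\<in>{0..\<eta>}. norm (Phi z t) \<le> K" unfolding bounded_iff by auto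
    then have K: "norm (phi z (c m) t) \<le> K" if "t \<in> {0..\<eta>}" for m t
      using order_trans[OF norm_cblinfun_apply[of "Phi z t" "c m"]] that by (simp add: norm_c)
    have K0: "0 \<le> K" using order_trans[OF norm_ge_zero K[of 0 0]] \<eta>(2) by simp
    \<comment> \<open>The squared norms are the derivatives of their primitives, and these are
      bounded by squared L2 norms below \<open>1 / Suc m\<close>.\<close>
    have "null_on \<eta> ?h"
    proof (rule null_on_derivative[OF \<eta>(2)])
      show "((\<lambda>t. integral {0..t} (?h m)) has_vector_derivative ?h m t) (at t within {0..\<eta>})" if "t \<in> {0..\<eta>}" for m t
        by (rule integral_has_vector_derivative[OF conth that])
      show "\<exists>d>0. \<forall>m. \<forall>s\<in>{0..\<eta>}. \<forall>t\<in>{0..\<eta>}. \<bar>s - t\<bar> < d \<longrightarrow> norm (?h m s - ?h m t) < e" if e: "0 < e" for e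
      proof -
        have "0 < e / (2 * K + 1)" using e K0 by simp
        from equi_apply[OF op_solution_continuous[OF Phi(1)] this] obtain d where d: "0 < d"
          "\<forall>m. \<forall>s\<in>{0..\<eta>}. \<forall>t\<in>{0..\<eta>}. \<bar>s - t\<bar> < d \<longrightarrow> norm (phi z (c m) s - phi z (c m) t) < e / (2 * K + 1)" by blast
        have "norm (?h m s - ?h m t) < e" if st: "s \<in> {0..\<eta>}" "t \<in> {0..\<eta>}" "\<bar>s - t\<bar> < d" for m s t
        proof -
          let ?a = "norm (phi z (c m) s)" and ?b = "norm (phi z (c m) t)"
          have ab: "\<bar>?a - ?b\<bar> < e / (2 * K + 1)"
            using d(2) st norm_triangle_ineq3[of "phi z (c m) s" "phi z (c m) t"] by (meson le_less_trans)
          have "norm (?h m s - ?h m t) = \<bar>?a - ?b\<bar> * (?a + ?b)"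
            by (simp add: power2_eq_square square_diff_square_factored abs_mult)
          also have "\<dots> \<le> \<bar>?a - ?b\<bar> * (2 * K + 1)" using K[OF st(1), of m] K[OF st(2), of m] by (intro mult_left_mono) auto
          also have "\<dots> < e / (2 * K + 1) * (2 * K + 1)" using ab K0 by (intro mult_strict_right_mono) auto
          finally show ?thesis using K0 by simp
        qed
        then show ?thesis using d(1) by blast
      qed
      show "null_on \<eta> (\<lambda>m t. integral {0..t} (?h m))"
        unfolding null_on_def
      proof (intro allI impI)
        fix e :: real assume "0 < e"
        then obtain M where M: "inverse (real (Suc M)) < e" using reals_Archimedean by blast
        have "norm (integral {0..t} (?h m)) < e" if "M \<le> m" "t \<in> {0..\<eta>}" for m t
        proof -
          have i: "?h m integrable_on {0..\<eta>}" "?h m integrable_on {0..t}"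
            by (auto intro!: integrable_continuous_interval continuous_on_subset[OF conth] simp del: continuous_on_power) (use that in auto)
          have "integral {0..t} (?h m) \<le> integral {0..\<eta>} (?h m)" using i that by (intro integral_subset_le) auto
          also have "\<dots> = (l2_norm (cutoff {0..\<eta>} (phi z (c m))))\<^sup>2" by (rule l2_integral[OF cont])
          also have "\<dots> \<le> (1 / Suc m)\<^sup>2" using small[of m] by (intro power_mono l2_norm_nonneg) simp
          also have "\<dots> \<le> 1 / Suc m"
            unfolding power2_eq_square by (rule mult_left_le) auto
          also have "\<dots> \<le> inverse (real (Suc M))" using that(1) by (simp add: inverse_eq_divide frac_le)
          finally have "integral {0..t} (?h m) < e" using M by simp
          moreover have "0 \<le> integral {0..t} (?h m)" using i by (intro integral_nonneg) auto
          ultimately show ?thesis by simp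
        qed
        then show "\<forall>\<^sub>F m in sequentially. \<forall>t\<in>{0..\<eta>}. norm (integral {0..t} (?h m)) < e"
          unfolding eventually_sequentially by blast
      qed
    qed
    then show ?thesis
      unfolding null_on_def
    proof (intro allI impI)
      fix e :: real assume h: "\<forall>e>0. \<forall>\<^sub>F m in sequentially. \<forall>t\<in>{0..\<eta>}. norm (?h m t) < e" and e: "0 < e"
      have "\<forall>\<^sub>F m in sequentially. \<forall>t\<in>{0..\<eta>}. norm (?h m t) < e\<^sup>2" using h e by simp
      then show "\<forall>\<^sub>F m in sequentially. \<forall>t\<in>{0..\<eta>}. norm (phi z (c m) t) < e"
        by (rule eventually_mono) (use e in \<open>auto intro: power2_less_imp_less\<close>)
    qed
  qed
  have null: "null_on \<eta> (\<lambda>m. Q (phi z (c m)) k)" if "k < 2 * CARD('n)" for k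
    using that
  proof (induction k rule: less_induct)
    case (less k)
    show ?case
    proof (cases k)
      case 0
      then show ?thesis using null0 by simp
    next
      case (Suc j)
      then have j: "j < 2 * CARD('n)" "Suc j < 2 * CARD('n)" "j < k" using less.prems by auto
      let ?D = "\<lambda>m t. rhs j t (\<lambda>i. Q (phi z (c m)) i t)"
      have D_eq: "?D m t = Dx \<Delta> 1 (?O j) t *\<^sub>V c m" if "t \<in> {0..\<eta>}" for m t
      proof -
        have t: "t \<in> \<Delta>" using that segment[OF \<eta>(1)] by blast
        have O: "(?O j has_vector_derivative Dx \<Delta> 1 (?O j) t) (at t within \<Delta>)"
          using O_C1[OF j(1)] by (intro Ck_on_SucD[of 0]) (auto simp: t)
        have "((\<lambda>t. ?O j t *\<^sub>V c m) has_vector_derivative Dx \<Delta> 1 (?O j) t *\<^sub>V c m) (at t within \<Delta>)"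
          by (rule bounded_linear.has_vector_derivative[OF bounded_bilinear.bounded_linear_left[OF bounded_bilinear_cblinfun_apply] O])
        then have "(Q (phi z (c m)) j has_vector_derivative Dx \<Delta> 1 (?O j) t *\<^sub>V c m) (at t within \<Delta>)"
          by (rule has_vector_derivative_transform[OF t phi_Q[OF j(1)], rotated])
        moreover have "(Q (phi z (c m)) j has_vector_derivative ?D m t) (at t within \<Delta>)"
          by (rule Q_derivative[OF solution_regular[OF phi_solution] t j(2)])
        ultimately show ?thesis using Dx1_eq t by metis
      qed
      have nD: "null_on \<eta> ?D"
      proof (rule null_on_derivative[OF \<eta>(2) _ _ less.IH[OF j(3,1)]])
        show "(Q (phi z (c m)) j has_vector_derivative ?D m t) (at t within {0..\<eta>})" if "t \<in> {0..\<eta>}" for m t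
          by (rule has_vector_derivative_within_subset[OF Q_derivative[OF solution_regular[OF phi_solution] _ j(2)] segment[OF \<eta>(1)]])
            (use that segment[OF \<eta>(1)] in blast)
        show "\<exists>d>0. \<forall>m. \<forall>s\<in>{0..\<eta>}. \<forall>t\<in>{0..\<eta>}. \<bar>s - t\<bar> < d \<longrightarrow> norm (?D m s - ?D m t) < e" if "0 < e" for e
        proof -
          have "continuous_on \<Delta> (Dx \<Delta> 1 (?O j))" using O_C1[OF j(1)] by (simp add: Ck_on_Suc Ck_on_0)
          from equi_apply[OF this that] show ?thesis by (simp add: D_eq)
        qed
      qed
      have coef: "continuous_on {0..\<eta>} A" if "continuous_on \<Delta> A" for A :: "real \<Rightarrow> 'h \<Rightarrow>\<^sub>C\<^sub>L 'h"
        by (rule continuous_on_subset[OF that segment[OF \<eta>(1)]])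
      have IH: "null_on \<eta> (\<lambda>m. Q (phi z (c m)) i)" if "i \<le> j" for i by (rule less.IH) (use that j in auto)
      \<comment> \<open>The j-th equation is solved for the next quasi-derivative: it is the
        derivative just treated, or p 0 times it minus a q term, or a combination of lower orders
        minus it.\<close>
      consider "Suc j < CARD('n)" | "Suc j = CARD('n)" | "CARD('n) \<le> j" by linarith
      then show ?thesis
      proof cases
        case 1
        show ?thesis by (rule null_on_le[OF nD, of _ 1]) (use 1 Suc in \<open>simp add: rhs_def\<close>)
      next
        case 2
        have "null_on \<eta> (\<lambda>m t. p (CARD('n) - CARD('n)) t *\<^sub>V ?D m t - ((\<i> / 2) *\<^sub>C q (CARD('n) - CARD('n)) t) *\<^sub>V Q (phi z (c m)) j t)"
          by (intro null_on_diff null_on_apply coef coefficient_continuous nD IH) auto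
        then show ?thesis
        proof (rule null_on_le[of _ _ _ 1])
          fix m t assume "t \<in> {0..\<eta>}"
          then have t: "t \<in> \<Delta>" using segment[OF \<eta>(1)] by blast
          have j': "CARD('n) - Suc 0 = j" using 2 by simp
          show "norm (Q (phi z (c m)) k t) \<le> 1 * norm (p (CARD('n) - CARD('n)) t *\<^sub>V ?D m t - ((\<i> / 2) *\<^sub>C q (CARD('n) - CARD('n)) t) *\<^sub>V Q (phi z (c m)) j t)"
            using 2 Suc p0_inv_act(2)[OF t] j' by (auto simp: rhs_def top_def)
        qed
      next
        case 3
        let ?\<kappa> = "2 * CARD('n) - 1 - j"
        have \<kappa>: "?\<kappa> < CARD('n)" "Suc ?\<kappa> \<le> CARD('n)" "0 < ?\<kappa>" using 3 j by auto
        have low: "null_on \<eta> (\<lambda>m t. low i t (\<lambda>i. Q (phi z (c m)) i t))" if "i \<le> CARD('n)" for i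
        proof (cases "i < CARD('n)")
          case True
          then show ?thesis using IH[of i] 3 by (simp add: low_def)
        next
          case False
          have "null_on \<eta> (\<lambda>m t. inv_op (p 0 t) *\<^sub>V (Q (phi z (c m)) CARD('n) t + ((\<i> / 2) *\<^sub>C q (CARD('n) - CARD('n)) t) *\<^sub>V Q (phi z (c m)) (CARD('n) - 1) t))"
            using 3 by (intro null_on_add null_on_apply coef coefficient_continuous IH) auto
          then show ?thesis using False by (simp add: low_def top_def)
        qed
        have b: "bulk ?\<kappa> t d = p (CARD('n) - ?\<kappa>) t *\<^sub>V d ?\<kappa> + ((\<i> / 2) *\<^sub>C adj (q (CARD('n) - Suc ?\<kappa>) t)) *\<^sub>V d (Suc ?\<kappa>)
            - ((\<i> / 2) *\<^sub>C q (CARD('n) - ?\<kappa>) t) *\<^sub>V d (?\<kappa> - 1)" for t d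
          unfolding bulk_def using \<kappa> by (simp only: if_True simp_thms)
        have nb: "null_on \<eta> (\<lambda>m t. bulk ?\<kappa> t (\<lambda>i. low i t (\<lambda>i. Q (phi z (c m)) i t)))"
          unfolding b using \<kappa> by (intro null_on_diff null_on_add null_on_apply coef coefficient_continuous low) auto
        show ?thesis
        proof (rule null_on_le[OF null_on_diff[OF nb nD], of _ 1])
          fix m t
          have "?D m t = bulk ?\<kappa> t (\<lambda>i. low i t (\<lambda>i. Q (phi z (c m)) i t)) - Q (phi z (c m)) k t"
            using 3 j Suc by (simp add: rhs_def)
          then show "norm (Q (phi z (c m)) k t) \<le> 1 * norm (bulk ?\<kappa> t (\<lambda>i. low i t (\<lambda>i. Q (phi z (c m)) i t)) - ?D m t)" by simp
        qed
      qed
    qed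
  qed
  \<comment> \<open>There are 2n coordinates, so this bound for each of them leaves a unit vector
    with norm at most one half.\<close>
  have "0 < 1 / (4 * real CARD('n))" using n_pos by simp
  then have "\<forall>\<^sub>F m in sequentially. \<forall>k\<in>{..<2 * CARD('n)}. \<forall>t\<in>{0..\<eta>}. norm (Q (phi z (c m)) k t) < 1 / (4 * real CARD('n))"
    using null unfolding null_on_def by (intro eventually_ball_finite) auto
  then obtain m where m: "\<And>k t. k < 2 * CARD('n) \<Longrightarrow> t \<in> {0..\<eta>} \<Longrightarrow> norm (Q (phi z (c m)) k t) < 1 / (4 * real CARD('n))"
    using eventually_happens'[OF sequentially_bot] by fastforce
  have "norm (c m) \<le> (\<Sum>k<2 * CARD('n). norm (coord k (c m)))" by (rule norm_le_coord)
  also have "\<dots> \<le> (\<Sum>k<2 * CARD('n). 1 / (4 * real CARD('n)))"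
  proof (rule sum_mono)
    fix k assume "k \<in> {..<2 * CARD('n)}"
    then show "norm (coord k (c m)) \<le> 1 / (4 * real CARD('n))"
      using m[of k 0] \<eta>(2) coord_data[of k "phi z (c m)" 0] by (simp add: phi_data less_imp_le)
  qed
  also have "\<dots> < 1" using n_pos by simp
  finally show False by (simp add: norm_c)
qed

text \<open>The Gram form of the solutions on the segment is bounded above by
  \<open>phi_bounded\<close> and below by \<open>observability\<close>, so bounded antilinear
  functionals are represented by it.\<close>

lemma gram_solve:
  fixes \<psi> :: "('h, 'n) vec \<times> ('h, 'n) vec \<Rightarrow> complex"
  assumes \<eta>: "\<eta> \<in> \<Delta>" "0 < \<eta>"
    and \<psi>: "\<And>x y. \<psi> (x + y) = \<psi> x + \<psi> y" "\<And>c x. \<psi> (c *\<^sub>C x) = cnj c * \<psi> x" "\<And>x. cmod (\<psi> x) \<le> N * norm x"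
  obtains a where "\<And>d. l2_inner (cutoff {0..\<eta>} (phi z a)) (cutoff {0..\<eta>} (phi z d)) = \<psi> d"
proof -
  obtain \<kappa> where \<kappa>: "0 < \<kappa>" "\<And>c. \<kappa> * norm c \<le> l2_norm (cutoff {0..\<eta>} (phi z c))" by (rule observability[OF \<eta>]) (rule that)
  obtain K where K: "0 \<le> K" "\<And>c. l2_norm (cutoff {0..\<eta>} (phi z c)) \<le> K * norm c" by (rule phi_bounded[OF \<eta>(1)]) (rule that)
  let ?B = "\<lambda>c d. l2_inner (cutoff {0..\<eta>} (phi z c)) (cutoff {0..\<eta>} (phi z d))"
  note l2 = phi_l2[OF \<eta>(1), of z]
  have add: "cutoff {0..\<eta>} (phi z (c + d)) = (\<lambda>t. cutoff {0..\<eta>} (phi z c) t + cutoff {0..\<eta>} (phi z d) t)" for c d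
    by (auto simp: cutoff_def cblinfun_linear)
  have scale: "cutoff {0..\<eta>} (phi z (r *\<^sub>C c)) = (\<lambda>t. r *\<^sub>C cutoff {0..\<eta>} (phi z c) t)" for r c
    by (auto simp: cutoff_def cblinfun_linear)
  show thesis
  proof (rule form_representation[of UNIV ?B "K * K" "\<kappa>\<^sup>2" \<psi> N])
    show "?B (x + y) d = ?B x d + ?B y d" for x y d unfolding add by (rule l2_inner_add_left[OF l2 l2 l2])
    show "?B (r *\<^sub>C x) d = r * ?B x d" for r x d unfolding scale by (rule l2_inner_scaleC_left)
    show "?B x y = cnj (?B y x)" for x y by (rule l2_inner_commute)
    show "cmod (?B x y) \<le> K * K * norm x * norm y" for x y
    proof -
      have "cmod (?B x y) \<le> l2_norm (cutoff {0..\<eta>} (phi z x)) * l2_norm (cutoff {0..\<eta>} (phi z y))" by (rule l2_cauchy_schwarz[OF l2 l2])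
      also have "\<dots> \<le> (K * norm x) * (K * norm y)" using K by (intro mult_mono l2_norm_nonneg) auto
      finally show ?thesis by (simp add: mult_ac)
    qed
    show "\<kappa>\<^sup>2 * (norm x)\<^sup>2 \<le> Re (?B x x)" for x
      using power_mono[OF \<kappa>(2)[of x], of 2] \<kappa>(1) by (simp add: l2_inner_self power_mult_distrib)
    fix x assume "\<And>y. y \<in> UNIV \<Longrightarrow> ?B x y = \<psi> y"
    then show thesis by (intro that[of x]) simp
  qed (use \<kappa>(1) \<psi> in auto)
qed

text \<open>On \<open>[0, \<eta>]\<close> the initial data of \<open>y\<close> can be replaced by arbitrary ones without changing \<open>y\<close> at \<open>\<eta>\<close>,
  and \<open>(l - z) v\<close> can be taken to be a solution of the conjugate equation.\<close>

lemma control: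
  fixes z :: complex
  assumes \<eta>: "\<eta> \<in> \<Delta>" "0 < \<eta>" and y: "dom y" "l2 (cutoff {0..\<eta>} (l y))"
  defines "f \<equiv> \<lambda>t. cutoff {0..\<eta>} (l y) t - z *\<^sub>C cutoff {0..\<eta>} y t"
  obtains a v where "solution z (phi (cnj z) a) v" "data v 0 = c" "data v \<eta> = data y \<eta>"
    "\<And>d. l2_inner (cutoff {0..\<eta>} (phi (cnj z) a)) (cutoff {0..\<eta>} (phi (cnj z) d)) =
      l2_inner f (cutoff {0..\<eta>} (phi (cnj z) d)) - form (c - data y 0) d"
proof -
  let ?C = "cutoff {0..\<eta>}" and ?u = "phi (cnj z)"
  obtain K where K: "0 \<le> K" "\<And>c. l2_norm (?C (?u c)) \<le> K * norm c" by (rule phi_bounded[OF \<eta>(1)]) (rule that)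
  have l2u: "l2 (?C (?u d))" for d by (rule phi_l2[OF \<eta>(1)])
  have "Ck_on \<Delta> 1 (Q y 0)" using y(1) unfolding dom_def by blast
  then have cont_y: "continuous_on \<Delta> y" using Ck_on_continuous by fastforce
  have l2y: "l2 (?C y)" by (rule l2_cut_segment[OF cont_y \<eta>(1)])
  have l2f: "l2 f" unfolding f_def by (intro l2_diff l2_scaleC y(2) l2y)
  let ?\<psi> = "\<lambda>d. l2_inner f (?C (?u d)) - form (c - data y 0) d"
  \<comment> \<open>Green's identity against solutions of the conjugate equation expresses the
    wanted data at \<open>\<eta>\<close> as a prescribed inner product of the steering term with all
    these solutions.\<close>
  obtain a where a: "\<And>d. l2_inner (?C (?u a)) (?C (?u d)) = ?\<psi> d"
  proof (rule gram_solve[OF \<eta>, of ?\<psi> "l2_norm f * K + 2 * norm (c - data y 0)" "cnj z"])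
    show "?\<psi> (d + d') = ?\<psi> d + ?\<psi> d'" for d d'
    proof -
      have "?C (?u (d + d')) = (\<lambda>t. ?C (?u d) t + ?C (?u d') t)" by (auto simp: cutoff_def cblinfun_linear)
      then show ?thesis using l2_inner_add_right[OF l2u l2u l2f, of d d'] by (simp add: form_def cinner_linear)
    qed
    show "?\<psi> (r *\<^sub>C d) = cnj r * ?\<psi> d" for r d
    proof -
      have "?C (?u (r *\<^sub>C d)) = (\<lambda>t. r *\<^sub>C ?C (?u d) t)" by (auto simp: cutoff_def cblinfun_linear)
      then show ?thesis by (simp add: form_def cinner_linear l2_inner_scaleC_right scaleC_prod_def algebra_simps)
    qed
    show "cmod (?\<psi> d) \<le> (l2_norm f * K + 2 * norm (c - data y 0)) * norm d" for d
    proof -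
      have i: "cmod (l2_inner f (?C (?u d))) \<le> l2_norm f * (K * norm d)"
        using l2_cauchy_schwarz[OF l2f l2u] mult_left_mono[OF K(2) l2_norm_nonneg] order_trans by blast
      have bound: "cmod (form x d) \<le> 2 * norm x * norm d" for x
      proof -
        have "cmod (form x d) \<le> norm (fst x) * norm (snd d) + norm (snd x) * norm (fst d)"
          unfolding form_def by (intro order_trans[OF norm_triangle_ineq4] add_mono cmod_cinner_le)
        also have "\<dots> \<le> norm x * norm d + norm x * norm d"
          by (intro add_mono mult_mono norm_fst_le norm_snd_le norm_ge_zero) (metis norm_fst_le norm_snd_le prod.collapse)+
        finally show ?thesis by linarith
      qed
      have "cmod (l2_inner f (?C (?u d))) + cmod (form (c - data y 0) d) \<le> l2_norm f * (K * norm d) + 2 * norm (c - data y 0) * norm d"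
        by (intro add_mono i bound)
      then show ?thesis unfolding distrib_right mult.assoc[of "l2_norm f"]
        by (rule order_trans[OF norm_triangle_ineq4])
    qed
    fix a assume "\<And>d. l2_inner (?C (?u a)) (?C (?u d)) = ?\<psi> d"
    then show thesis by (rule that)
  qed
  have cont_u: "continuous_on \<Delta> (?u d)" for d by (rule solution_continuous[OF phi_solution])
  obtain v where v: "solution z (?u a) v" "\<And>k. k < 2 * CARD('n) \<Longrightarrow> Q v k 0 = coord k c"
    by (rule solution_exists[OF cont_u, of z a "\<lambda>k. coord k c"]) (rule that)
  have v0: "data v 0 = c" by (rule data_eqI) (simp add: coord_data v(2))
  have cont_v: "continuous_on \<Delta> v" by (rule solution_continuous[OF v(1)])
  have l2v: "l2 (?C v)" by (rule l2_cut_segment[OF cont_v \<eta>(1)])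
  have lv: "?C (l v) = (\<lambda>t. z *\<^sub>C ?C v t + ?C (?u a) t)"
    using v(1) segment[OF \<eta>(1)] by (auto simp: solution_def cutoff_def fun_eq_iff)
  have ly: "?C (l y) = (\<lambda>t. z *\<^sub>C ?C y t + f t)" by (simp add: f_def)
  \<comment> \<open>Against a solution with parameter \<open>cnj z\<close> the spectral terms cancel
    and only the inhomogeneity remains.\<close>
  have green_u: "br w (?u d) \<eta> - br w (?u d) 0 = l2_inner g (?C (?u d))"
    if w: "dom w" "l2 (?C w)" "?C (l w) = (\<lambda>t. z *\<^sub>C ?C w t + g t)" "l2 g" for w g d
  proof -
    have "br w (?u d) \<eta> - br w (?u d) 0 = l2_inner (?C (l w)) (?C (?u d)) - l2_inner (?C w) (?C (l (?u d)))"
    proof (rule green[OF w(1) phi_dom \<eta>(1)])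
      show "l2 (?C (l w))" unfolding w(3) by (intro l2_add l2_scaleC w)
      show "l2 (?C (l (?u d)))" unfolding phi_l_cut[OF \<eta>(1)] by (intro l2_scaleC l2u)
    qed
    also have "\<dots> = l2_inner g (?C (?u d))"
      unfolding w(3) phi_l_cut[OF \<eta>(1)] l2_inner_add_left[OF l2_scaleC[OF w(2)] w(4) l2u]
      by (simp add: l2_inner_scaleC_left l2_inner_scaleC_right)
    finally show ?thesis .
  qed
  \<comment> \<open>Every e is the data at \<open>\<eta>\<close> of a solution with parameter
    \<open>cnj z\<close>, so the nondegenerate form is tested on all data.\<close>
  have "form (data v \<eta> - data y \<eta>) e = 0" for e
  proof -
    obtain w where w: "solution (cnj z) (\<lambda>t. 0) w" "\<And>k. k < 2 * CARD('n) \<Longrightarrow> Q w k \<eta> = coord k e"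
      by (rule solution_onto[OF continuous_on_const \<eta>, of "cnj z" 0 "\<lambda>k. coord k e"]) (rule that)
    have we: "data w \<eta> = e" by (rule data_eqI) (simp add: coord_data w(2))
    define d where "d = data w 0"
    have wd: "w = ?u d" unfolding d_def by (rule solution_phi[OF w(1)])
    have 1: "form (data v \<eta>) e - form c d = l2_inner (?C (?u a)) (?C (?u d))"
      using green_u[OF solution_dom[OF v(1)] l2v lv l2u, of d] by (simp add: br_form phi_data v0 we[unfolded wd])
    have 2: "form (data y \<eta>) e - form (data y 0) d = l2_inner f (?C (?u d))"
      using green_u[OF y(1) l2y ly l2f, of d] by (simp add: br_form phi_data we[unfolded wd])
    show ?thesis using 1 2 a[of d] by (simp add: form_diff algebra_simps)
  qed
  then have "data v \<eta> = data y \<eta>" using form_eq_0 by fastforce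
  then show thesis using that[OF v(1) v0 _ a] by simp
qed

end



section \<open>The maximal operator and its defect spaces\<close>

context hilbert_expression
begin

abbreviation "\<D> \<equiv> max_dom \<Delta> n p q"
abbreviation "\<NN> \<equiv> defect \<Delta> n p q"
abbreviation "L y \<equiv> cutoff \<Delta> (l y)"

lemma max_domD:
  assumes "y \<in> \<D>" shows "\<And>t. t \<notin> \<Delta> \<Longrightarrow> y t = 0" "l2 y" "dom y" "l2 (L y)"
  using assms unfolding max_dom_iff by blast+

lemma L_off: "t \<notin> \<Delta> \<Longrightarrow> L y t = 0"
  by (simp add: cutoff_def)

lemma max_dom_add:
  assumes y: "y \<in> \<D>" and w: "w \<in> \<D>" shows "(\<lambda>t. y t + w t) \<in> \<D>"
proof -
  obtain N where N: "N \<in> null_sets lebesgue" "\<And>t. t \<in> \<Delta> - N \<Longrightarrow> Q y (2 * n - 1) differentiable (at t within \<Delta>)"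
    by (rule dom_exceptional[OF max_domD(3)[OF y]]) (rule that)
  obtain N' where N': "N' \<in> null_sets lebesgue" "\<And>t. t \<in> \<Delta> - N' \<Longrightarrow> Q w (2 * n - 1) differentiable (at t within \<Delta>)"
    by (rule dom_exceptional[OF max_domD(3)[OF w]]) (rule that)
  have "l2 (L (\<lambda>t. y t + w t))"
  proof (rule l2_AE[OF l2_add[OF max_domD(4)[OF y] max_domD(4)[OF w]] null_sets.Un[OF N(1) N'(1)]])
    fix t assume t: "t \<notin> N \<union> N'"
    show "L (\<lambda>t. y t + w t) t = L y t + L w t"
    proof (cases "t \<in> \<Delta>")
      case True
      then have "l (\<lambda>t. y t + w t) t = l y t + l w t"
        using t by (intro l_add(1) dom_regular max_domD y w N(2) N'(2)) auto
      then show ?thesis by (simp add: cutoff_def True)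
    qed (simp add: cutoff_def)
  qed
  then show ?thesis
    unfolding max_dom_iff using dom_add[OF max_domD(3)[OF y] max_domD(3)[OF w]] l2_add[OF max_domD(2)[OF y] max_domD(2)[OF w]]
    by (simp add: max_domD(1)[OF y] max_domD(1)[OF w])
qed

lemma continuous_on_Q: "dom y \<Longrightarrow> k < 2 * n \<Longrightarrow> continuous_on \<Delta> (Q y k)"
  by (intro continuous_on_segments abs_cont_on_continuous dom_abs_cont)

text \<open>Membership gives \<open>l[y] = z y\<close> only almost everywhere. But then the last
  quasi-derivative is the integral of a continuous function, hence continuously differentiable, and
  the equation holds at every point.\<close>

lemma defect_iff: "y \<in> \<NN> z \<longleftrightarrow> solution z (\<lambda>t. 0) y \<and> l2 y"
proof
  assume y: "y \<in> \<NN> z"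
  then have D: "y \<in> \<D>" and ae: "AE t in lebesgue_on \<Delta>. l y t = z *\<^sub>C y t" by (auto simp: defect_def)
  note dom = max_domD(3)[OF D] and reg = dom_regular[OF max_domD(3)[OF D]]
  obtain N where N: "N \<in> null_sets lebesgue" "\<And>t. t \<in> \<Delta> - N \<Longrightarrow> Q y (2 * n - 1) differentiable (at t within \<Delta>)"
    by (rule dom_exceptional[OF dom]) (rule that)
  have "AE t in lebesgue. t \<in> \<Delta> \<longrightarrow> l y t = z *\<^sub>C y t"
    using ae by (subst (asm) AE_restrict_space_iff) (auto simp: Delta_measurable)
  then obtain N' where N': "N' \<in> null_sets lebesgue" "{t. \<not> (t \<in> \<Delta> \<longrightarrow> l y t = z *\<^sub>C y t)} \<subseteq> N'"
    by (auto simp: eventually_ae_filter)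
  let ?last = "2 * n - 1" and ?g = "\<lambda>t. rhs (2 * n - 1) t (\<lambda>i. Q y i t) - z *\<^sub>C y t"
  have last: "?last < 2 * n" "Suc ?last = 2 * n" using n_pos by auto
  have contQ: "continuous_on \<Delta> (Q y k)" if "k < 2 * n" for k using that by (rule continuous_on_Q[OF dom])
  have "continuous_on \<Delta> (\<lambda>t. rhs ?last t (\<lambda>i. Q y i t))"
  proof (rule continuous_on_segments)
    fix \<eta> assume \<eta>: "\<eta> \<in> \<Delta>"
    show "continuous_on {0..\<eta>} (\<lambda>t. rhs ?last t (\<lambda>i. Q y i t))"
      using admissible_rhs[OF last(1)] \<eta> continuous_on_subset[OF contQ segment[OF \<eta>]] unfolding admissible_def by blast
  qed
  moreover have "continuous_on \<Delta> y" using contQ[of 0] n_pos by simp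
  ultimately have g: "continuous_on \<Delta> ?g"
    by (intro continuous_on_diff bounded_linear.continuous_on[OF bounded_linear_scaleC])
  \<comment> \<open>The derivative is replaced by the continuous expression in which
    \<open>l[y]\<close> has become z y; off both null sets they agree.\<close>
  have int: "(?g has_integral Q y ?last \<eta> - Q y ?last 0) {0..\<eta>}" if \<eta>: "\<eta> \<in> \<Delta>" for \<eta>
  proof (rule abs_cont_has_integral)
    show "abs_cont_on 0 \<eta> (Q y ?last)" by (rule dom_abs_cont[OF dom \<eta> last(1)])
    show "0 \<le> \<eta>" by (rule nonneg[OF \<eta>])
    show "negligible (N \<union> N')" using N(1) N'(1) by (auto simp: negligible_iff_null_sets)
    fix t assume t: "t \<in> {0..\<eta>} - (N \<union> N')"
    then have t': "t \<in> \<Delta>" using segment[OF \<eta>] by auto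
    have "(Q y ?last has_vector_derivative rhs ?last t (\<lambda>i. Q y i t) - l y t) (at t within \<Delta>)"
      by (rule Q_last_derivative[OF reg t' N(2)]) (use t t' in auto)
    moreover have "l y t = z *\<^sub>C y t" using N'(2) t t' by auto
    ultimately have "(Q y ?last has_vector_derivative ?g t) (at t within \<Delta>)" by simp
    then show "(Q y ?last has_vector_derivative ?g t) (at t within {0..\<eta>})"
      by (rule has_vector_derivative_within_subset[OF _ segment[OF \<eta>]])
  qed
  have der: "(Q y ?last has_vector_derivative ?g t) (at t within \<Delta>)" if t: "t \<in> \<Delta>" for t
  proof (rule has_vector_derivative_transform[OF t])
    show "((\<lambda>\<eta>. Q y ?last 0 + integral {0..\<eta>} ?g) has_vector_derivative ?g t) (at t within \<Delta>)"
      using has_vector_derivative_add[OF has_vector_derivative_const integral_derivative[OF g t]] by simp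
  qed (simp only: integral_unique[OF int], simp)
  have "l y t = z *\<^sub>C y t" if "t \<in> \<Delta>" for t
    using l_last[OF reg that der[OF that]] by simp
  moreover have "Ck_on \<Delta> 1 (Q y k)" if "k < 2 * n" for k
  proof (cases "k = ?last")
    case True
    have "Ck_on \<Delta> (Suc 0) (Q y ?last)" by (rule Ck_on_SucI[OF der]) (simp_all only: Ck_on_0 g)
    then show ?thesis using True by simp
  next
    case False
    then show ?thesis using reg that by (auto simp: regular_def)
  qed
  ultimately show "solution z (\<lambda>t. 0) y \<and> l2 y" using max_domD[OF D] by (simp add: solution_def)
next
  assume y: "solution z (\<lambda>t. 0) y \<and> l2 y"
  then have l: "l y t = z *\<^sub>C y t" if "t \<in> \<Delta>" for t using that by (simp add: solution_def)
  have off: "y t = 0" if "t \<notin> \<Delta>" for t using y that by (simp add: solution_def)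
  have "L y = (\<lambda>t. z *\<^sub>C y t)" by (rule ext) (auto simp: cutoff_def l off)
  then have "l2 (L y)" using y by (simp add: l2_scaleC)
  then have "y \<in> \<D>" unfolding max_dom_iff using y off solution_dom by blast
  then show "y \<in> \<NN> z" using l by (auto simp: defect_def intro!: AE_I2)
qed

lemma defect_L: "u \<in> \<NN> z \<Longrightarrow> L u = (\<lambda>t. z *\<^sub>C u t)"
  by (rule ext) (simp add: cutoff_def defect_iff solution_def)

lemma defect_max_dom: "u \<in> \<NN> z \<Longrightarrow> u \<in> \<D>"
  by (simp add: defect_def)

lemma defect_add: "u \<in> \<NN> z \<Longrightarrow> w \<in> \<NN> z \<Longrightarrow> (\<lambda>t. u t + w t) \<in> \<NN> z"
  unfolding defect_iff using solution_add[of "\<lambda>t. 0" "\<lambda>t. 0"] by (auto intro: l2_add)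

lemma defect_scaleC: "u \<in> \<NN> z \<Longrightarrow> (\<lambda>t. c *\<^sub>C u t) \<in> \<NN> z"
  unfolding defect_iff using solution_scaleC[of "\<lambda>t. 0"] by (auto intro: l2_scaleC)

end

section \<open>Square integrable solutions and projections onto solutions\<close>

context indexed_expression
begin

lemma defect_phi: "u \<in> \<NN> z \<Longrightarrow> u = phi z (data u 0)"
  using solution_phi unfolding defect_iff by blast

lemma phi_defect: "l2 (phi z c) \<Longrightarrow> phi z c \<in> \<NN> z"
  by (simp add: defect_iff phi_solution)

lemma segment_cut_mono:
  assumes "\<eta> \<le> \<zeta>" "l2 (cutoff {0..\<zeta>} f)" shows "l2_norm (cutoff {0..\<eta>} f) \<le> l2_norm (cutoff {0..\<zeta>} f)"
proof -
  have "cutoff {0..\<eta>} f = cutoff {0..\<eta>} (cutoff {0..\<zeta>} f)" using assms(1) by (auto simp: cutoff_def)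
  then show ?thesis using l2_norm_cut[OF assms(2), of "{0..\<eta>}"] by simp
qed

text \<open>Norm bounds on a segment survive limits of initial data, since solutions depend
  boundedly on their data there.\<close>

lemma phi_tendsto:
  assumes c: "c \<longlonglongrightarrow> c'" and \<eta>: "\<eta> \<in> \<Delta>"
    and bound: "\<And>k. N \<le> k \<Longrightarrow> l2_norm (cutoff {0..\<eta>} (phi z (c k))) \<le> B"
  shows "l2_norm (cutoff {0..\<eta>} (phi z c')) \<le> B"
proof -
  obtain K where K: "0 \<le> K" "\<And>c. l2_norm (cutoff {0..\<eta>} (phi z c)) \<le> K * norm c" by (rule phi_bounded[OF \<eta>(1)]) (rule that)
  have "(\<lambda>k. B + K * norm (c' - c k)) \<longlonglongrightarrow> B + K * norm (c' - c')" by (intro tendsto_intros c)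
  then have lim: "(\<lambda>k. B + K * norm (c' - c k)) \<longlonglongrightarrow> B" by simp
  have "l2_norm (cutoff {0..\<eta>} (phi z c')) \<le> B + K * norm (c' - c k)" if "N \<le> k" for k
  proof -
    have "cutoff {0..\<eta>} (phi z c') = (\<lambda>t. cutoff {0..\<eta>} (phi z (c k)) t + cutoff {0..\<eta>} (phi z (c' - c k)) t)"
      by (auto simp: cutoff_def cblinfun_linear)
    then have "l2_norm (cutoff {0..\<eta>} (phi z c')) \<le> l2_norm (cutoff {0..\<eta>} (phi z (c k))) + l2_norm (cutoff {0..\<eta>} (phi z (c' - c k)))"
      using l2_norm_triangle[OF phi_l2[OF \<eta>] phi_l2[OF \<eta>]] by simp
    then show ?thesis using bound[OF that] K(2)[of "c' - c k"] by linarith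
  qed
  then show ?thesis by (intro LIMSEQ_le_const[OF lim]) auto
qed

lemma phi_l2_of_bounded:
  assumes "\<And>\<eta>. 0 < \<eta> \<Longrightarrow> ereal \<eta> < b \<Longrightarrow> l2_norm (cutoff {0..\<eta>} (phi z c)) \<le> B"
  shows "l2 (phi z c)" "l2_norm (phi z c) \<le> B"
  using l2_of_bounded_cuts[of "phi z c" B, OF phi_off phi_l2 assms
      continuous_measurable[OF solution_continuous[OF phi_solution] phi_off]] by blast+

text \<open>The orthogonal projections of \<open>f\<close> onto the solutions on \<open>[0, \<eta> k]\<close> converge to a square integrable
  solution because their residuals increase; so they tend to \<open>0\<close> if \<open>f\<close> is orthogonal to all of these.\<close>

lemma projections_vanish:
  assumes f: "l2 f" "\<And>t. t \<notin> \<Delta> \<Longrightarrow> f t = 0"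
    and \<eta>: "\<And>k. 0 < \<eta> k" "\<And>k. ereal (\<eta> k) < b" "incseq \<eta>" "filterlim \<eta> (up_to b) sequentially"
      "\<And>t. ereal t < b \<Longrightarrow> \<exists>k. t \<le> \<eta> k"
    and a: "\<And>k d. l2_inner (cutoff {0..\<eta> k} (phi z (a k))) (cutoff {0..\<eta> k} (phi z d)) = l2_inner (cutoff {0..\<eta> k} f) (cutoff {0..\<eta> k} (phi z d))"
    and perp: "\<And>c. l2 (phi z c) \<Longrightarrow> l2_inner f (phi z c) = 0"
  shows "(\<lambda>k. (l2_norm (cutoff {0..\<eta> k} (phi z (a k))))\<^sup>2) \<longlonglongrightarrow> 0"
proof -
  let ?C = "\<lambda>k. cutoff {0..\<eta> k}"
  define N where "N k g = l2_norm (cutoff {0..\<eta> k} g)" for k and g :: "real \<Rightarrow> 'h"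
  have \<eta>in: "\<eta> k \<in> \<Delta>" for k using \<eta>(1)[of k] \<eta>(2)[of k] by (intro less_b_in) auto
  have l2p: "l2 (?C k (phi z c))" for k c by (rule phi_l2[OF \<eta>in])
  have l2f: "l2 (?C k f)" for k by (rule l2_cut[OF f(1)]) simp
  have l2d: "l2 (?C k (\<lambda>t. f t - phi z d t))" for k d unfolding cut_simps by (rule l2_diff[OF l2f l2p])
  have N0: "0 \<le> N k g" for k g by (simp add: N_def l2_norm_nonneg)
  define F where "F = l2_norm f"
  have Nf: "N k f \<le> F" for k unfolding N_def F_def by (rule l2_norm_cut[OF f(1)]) simp
  \<comment> \<open>The squared distance of f to the solutions on the k-th segment.\<close>
  define r where "r k = (N k (\<lambda>t. f t - phi z (a k) t))\<^sup>2" for k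
  have pyth: "(N k (\<lambda>t. f t - phi z d t))\<^sup>2 = r k + (N k (phi z (a k - d)))\<^sup>2" for k d
  proof -
    let ?u = "?C k (\<lambda>t. f t - phi z (a k) t)" and ?v = "?C k (phi z (a k - d))"
    have "?C k (\<lambda>t. f t - phi z d t) = (\<lambda>t. ?u t + ?v t)" by (auto simp: cutoff_def cblinfun_linear)
    moreover have "l2_inner ?u ?v = 0"
      unfolding cut_simps l2_inner_diff_left[OF l2f l2p l2p] by (simp add: a)
    ultimately show ?thesis unfolding r_def N_def using l2_norm_add_sq[OF l2d l2p] by simp
  qed
  \<comment> \<open>The k-th projection is a competitor on the shorter segment j, and by Pythagoras
    its distance to the j-th projection is bounded by the growth of the residual.\<close>
  have mono: "N j (phi z (a j - a k)) \<le> sqrt (r k - r j)" if "j \<le> k" for j k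
  proof -
    have "N j (\<lambda>t. f t - phi z (a k) t) \<le> N k (\<lambda>t. f t - phi z (a k) t)"
      unfolding N_def by (rule segment_cut_mono[OF incseqD[OF \<eta>(3) that] l2d])
    then have "(N j (\<lambda>t. f t - phi z (a k) t))\<^sup>2 \<le> r k" unfolding r_def by (rule power_mono) (rule N0)
    then show ?thesis using pyth[of j "a k"] by (intro real_le_rsqrt) simp
  qed
  have r_le: "r k \<le> F\<^sup>2" for k
  proof -
    have "(N k f)\<^sup>2 = r k + (N k (phi z (a k)))\<^sup>2" using pyth[of k 0] by simp
    moreover have "(N k f)\<^sup>2 \<le> F\<^sup>2" by (rule power_mono[OF Nf N0])
    ultimately show ?thesis using zero_le_power2[of "N k (phi z (a k))"] by linarith
  qed
  have "incseq r"
  proof (rule incseq_SucI)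
    fix k
    have "0 \<le> sqrt (r (Suc k) - r k)" using mono[of k "Suc k"] N0[of k "phi z (a k - a (Suc k))"] by linarith
    then show "r k \<le> r (Suc k)" by simp
  qed
  then obtain R where R: "r \<longlonglongrightarrow> R" "\<And>k. r k \<le> R" using incseq_convergent[of r "F\<^sup>2"] r_le by blast
  have sqrt0: "(\<lambda>k. sqrt (R - r k)) \<longlonglongrightarrow> 0"
    using tendsto_real_sqrt[OF tendsto_diff[OF tendsto_const[of R] R(1)]] by simp
  have mono': "N j (phi z (a j - a k)) \<le> sqrt (R - r j)" if "j \<le> k" for j k
    by (rule order_trans[OF mono[OF that]]) (simp add: R(2))
  \<comment> \<open>Observability on the first segment alone converts smallness of the norms into
    smallness of the initial data.\<close>
  have "Cauchy a"
    unfolding Cauchy_altdef2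
  proof (intro allI impI)
    fix e :: real assume e: "0 < e"
    obtain \<kappa> where \<kappa>: "0 < \<kappa>" "\<And>c. \<kappa> * norm c \<le> l2_norm (cutoff {0..\<eta> 0} (phi z c))" by (rule observability[OF \<eta>in \<eta>(1)]) (rule that)
    have "\<forall>\<^sub>F k in sequentially. sqrt (R - r k) < \<kappa> * e" using e \<kappa>(1) by (intro order_tendstoD(2)[OF sqrt0]) simp
    then obtain j where j: "sqrt (R - r j) < \<kappa> * e" unfolding eventually_sequentially by blast
    have "dist (a k) (a j) < e" if "j \<le> k" for k
    proof -
      have "\<kappa> * norm (a j - a k) \<le> N 0 (phi z (a j - a k))" unfolding N_def by (rule \<kappa>(2))
      also have "\<dots> \<le> N j (phi z (a j - a k))" unfolding N_def by (rule segment_cut_mono[OF incseqD[OF \<eta>(3)] l2p]) simp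
      finally have "\<kappa> * norm (a j - a k) < \<kappa> * e" using mono'[OF that] j by linarith
      then show ?thesis using \<kappa>(1) by (simp add: dist_norm norm_minus_commute)
    qed
    then show "\<exists>j. \<forall>k\<ge>j. dist (a k) (a j) < e" by blast
  qed
  then obtain A where A: "a \<longlonglongrightarrow> A" using Cauchy_convergent convergent_def by blast
  have NA: "N j (phi z (a j - A)) \<le> sqrt (R - r j)" for j
    unfolding N_def
  proof (rule phi_tendsto[OF tendsto_diff[OF tendsto_const A] \<eta>in, of j])
    show "l2_norm (?C j (phi z (a j - a k))) \<le> sqrt (R - r j)" if "j \<le> k" for k using mono'[OF that] by (simp add: N_def)
  qed
  have Na: "N k (phi z (a k)) \<le> F" for k
  proof -
    have "(N k f)\<^sup>2 = r k + (N k (phi z (a k)))\<^sup>2" using pyth[of k 0] by simp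
    then have "(N k (phi z (a k)))\<^sup>2 \<le> (N k f)\<^sup>2" by (simp add: r_def)
    then have "N k (phi z (a k)) \<le> N k f" by (rule power2_le_imp_le) (rule N0)
    then show ?thesis using Nf[of k] by linarith
  qed
  have NA_bound: "N k (phi z A) \<le> F + sqrt (R - r 0)" for k
  proof -
    have "?C k (phi z A) = (\<lambda>t. ?C k (phi z (a k)) t - ?C k (phi z (a k - A)) t)" by (auto simp: cutoff_def cblinfun_linear)
    then have "N k (phi z A) \<le> N k (phi z (a k)) + N k (phi z (a k - A))"
      using l2_norm_triangle[OF l2p l2_scaleC[OF l2p], of k "a k" "-1" k "a k - A"] l2_norm_scaleC[of "-1" "?C k (phi z (a k - A))"]
      by (simp add: N_def scaleC_minus_left)
    also have "\<dots> \<le> F + sqrt (R - r k)" by (intro add_mono Na NA)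
    also have "\<dots> \<le> F + sqrt (R - r 0)" using incseqD[OF \<open>incseq r\<close>, of 0 k] by simp
    finally show ?thesis .
  qed
  have A_l2: "l2 (phi z A)"
  proof (rule phi_l2_of_bounded(1))
    fix t assume t: "0 < t" "ereal t < b"
    obtain k where k: "t \<le> \<eta> k" using \<eta>(5)[OF t(2)] by blast
    show "l2_norm (cutoff {0..t} (phi z A)) \<le> F + sqrt (R - r 0)"
      using segment_cut_mono[OF k l2p] NA_bound[of k] unfolding N_def by (rule order_trans)
  qed
  \<comment> \<open>The squared norm of a projection is its inner product with f. Splitting off the
    limit A leaves a small difference and a term that tends to the inner product of f with a square
    integrable solution, which is 0.\<close>
  have main: "(N k (phi z (a k)))\<^sup>2 \<le> F * sqrt (R - r k) + cmod (l2_inner (?C k f) (phi z A))" for k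
  proof -
    have "of_real ((N k (phi z (a k)))\<^sup>2) = l2_inner (?C k f) (?C k (phi z (a k)))"
      using a[of k "a k"] by (simp add: l2_inner_self N_def)
    also have "?C k (phi z (a k)) = (\<lambda>t. ?C k (phi z (a k - A)) t + ?C k (phi z A) t)" by (auto simp: cutoff_def cblinfun_linear)
    also have "l2_inner (?C k f) \<dots> = l2_inner (?C k f) (?C k (phi z (a k - A))) + l2_inner (?C k f) (phi z A)"
      unfolding l2_inner_add_right[OF l2p l2p l2f] by (simp add: l2_inner_cut cut_cut)
    finally have "(N k (phi z (a k)))\<^sup>2 = cmod (l2_inner (?C k f) (?C k (phi z (a k - A))) + l2_inner (?C k f) (phi z A))"
      by (metis norm_of_real abs_of_nonneg zero_le_power2)
    also have "\<dots> \<le> cmod (l2_inner (?C k f) (?C k (phi z (a k - A)))) + cmod (l2_inner (?C k f) (phi z A))" by (rule norm_triangle_ineq)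
    also have "cmod (l2_inner (?C k f) (?C k (phi z (a k - A)))) \<le> N k f * N k (phi z (a k - A))"
      unfolding N_def by (rule l2_cauchy_schwarz[OF l2f l2p])
    also have "\<dots> \<le> F * sqrt (R - r k)" by (intro mult_mono Nf NA N0) (simp add: F_def l2_norm_nonneg)
    finally show ?thesis by simp
  qed
  have "(\<lambda>k. l2_inner (?C k f) (phi z A)) \<longlonglongrightarrow> l2_inner f (phi z A)"
    by (rule filterlim_compose[OF l2_inner_tendsto[OF f A_l2] \<eta>(4)])
  then have "(\<lambda>k. F * sqrt (R - r k) + cmod (l2_inner (?C k f) (phi z A))) \<longlonglongrightarrow> F * 0 + cmod (l2_inner f (phi z A))"
    by (intro tendsto_add tendsto_mult tendsto_const sqrt0 tendsto_norm)
  then have "(\<lambda>k. F * sqrt (R - r k) + cmod (l2_inner (?C k f) (phi z A))) \<longlonglongrightarrow> 0" by (simp add: perp[OF A_l2])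
  then have "(\<lambda>k. (N k (phi z (a k)))\<^sup>2) \<longlonglongrightarrow> 0"
    by (rule tendsto_sandwich[rotated 2, OF tendsto_const]) (use main in auto)
  then show ?thesis by (simp add: N_def)
qed

end



section \<open>The Weyl function of a decomposing boundary triplet\<close>

locale boundary_triplet = indexed_expression \<Delta> b p q index
  for \<Delta> :: "real set" and b :: ereal
    and p q :: "nat \<Rightarrow> real \<Rightarrow> 'h::{complex_hilbert, second_countable_topology} \<Rightarrow>\<^sub>C\<^sub>L 'h"
    and index :: "'n::{finite, linorder} itself" +
  fixes \<Gamma>0' \<Gamma>1' :: "(real \<Rightarrow> 'h) \<Rightarrow> 'g::complex_hilbert"
  assumes triplet: "decomposing_triplet index \<Delta> b p q \<Gamma>0' \<Gamma>1'"
begin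

abbreviation G0 :: "(real \<Rightarrow> 'h) \<Rightarrow> ('h, 'n) vec \<times> 'g" where "G0 \<equiv> Gamma0 \<Delta> p q \<Gamma>0'"
abbreviation G1 :: "(real \<Rightarrow> 'h) \<Rightarrow> ('h, 'n) vec \<times> 'g" where "G1 \<equiv> Gamma1 \<Delta> p q \<Gamma>1'"

lemma G_data: "G0 y = (snd (data y 0), \<Gamma>0' y)" "G1 y = (- fst (data y 0), \<Gamma>1' y)"
  by (simp_all add: Gamma0_def Gamma1_def data_def)

lemma data_G: "data y 0 = (- fst (G1 y), fst (G0 y))"
  by (simp add: G_data)

lemma Gamma'_add: "y \<in> \<D> \<Longrightarrow> w \<in> \<D> \<Longrightarrow> \<Gamma>0' (\<lambda>t. y t + w t) = \<Gamma>0' y + \<Gamma>0' w"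
  "y \<in> \<D> \<Longrightarrow> w \<in> \<D> \<Longrightarrow> \<Gamma>1' (\<lambda>t. y t + w t) = \<Gamma>1' y + \<Gamma>1' w"
  using triplet unfolding decomposing_triplet_def Let_def by blast+

lemma Gamma'_scaleC: "y \<in> \<D> \<Longrightarrow> \<Gamma>0' (\<lambda>t. c *\<^sub>C y t) = c *\<^sub>C \<Gamma>0' y"
  "y \<in> \<D> \<Longrightarrow> \<Gamma>1' (\<lambda>t. c *\<^sub>C y t) = c *\<^sub>C \<Gamma>1' y"
  using triplet unfolding decomposing_triplet_def Let_def by blast+

lemma Gamma'_surj: obtains y where "y \<in> \<D>" "\<Gamma>0' y = x0" "\<Gamma>1' y = x1"
proof -
  have "(x0, x1) \<in> (\<lambda>y. (\<Gamma>0' y, \<Gamma>1' y)) ` \<D>" using triplet unfolding decomposing_triplet_def Let_def by blast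
  then show thesis using that by auto
qed

lemma form_limit:
  assumes "y \<in> \<D>" "w \<in> \<D>"
  shows "((\<lambda>t. form (data y t) (data w t)) \<longlongrightarrow> cinner (\<Gamma>1' y) (\<Gamma>0' w) - cinner (\<Gamma>0' y) (\<Gamma>1' w)) (up_to b)"
  using triplet assms unfolding decomposing_triplet_def Let_def by (simp flip: bracket_form)

lemma data_add:
  assumes "dom y" "dom w" "t \<in> \<Delta>" shows "data (\<lambda>t. y t + w t) t = data y t + data w t"
proof (rule data_eqI)
  fix k assume k: "k < 2 * CARD('n)"
  have "coord k (data y t + data w t) = coord k (data y t) + coord k (data w t)" by (simp add: coord_def)
  then show "coord k (data (\<lambda>t. y t + w t) t) = coord k (data y t + data w t)"
    using regular_add(1)[OF dom_regular[OF assms(1)] dom_regular[OF assms(2)] k assms(3)] by (simp add: coord_data[OF k])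
qed

lemma data_scaleC:
  assumes "dom y" "t \<in> \<Delta>" shows "data (\<lambda>t. c *\<^sub>C y t) t = c *\<^sub>C data y t"
proof (rule data_eqI)
  fix k assume k: "k < 2 * CARD('n)"
  have "coord k (c *\<^sub>C data y t) = c *\<^sub>C coord k (data y t)" by (simp add: coord_def scaleC_prod_def scaleC_vec_def)
  then show "coord k (data (\<lambda>t. c *\<^sub>C y t) t) = coord k (c *\<^sub>C data y t)"
    using regular_scaleC(1)[OF dom_regular[OF assms(1)] k assms(2)] by (simp add: coord_data[OF k])
qed

lemma G_add: assumes "y \<in> \<D>" "w \<in> \<D>" shows "G0 (\<lambda>t. y t + w t) = G0 y + G0 w" "G1 (\<lambda>t. y t + w t) = G1 y + G1 w"
  using assms by (simp_all add: G_data data_add max_domD zero_in Gamma'_add)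

lemma G_scaleC: assumes "y \<in> \<D>" shows "G0 (\<lambda>t. c *\<^sub>C y t) = c *\<^sub>C G0 y" "G1 (\<lambda>t. c *\<^sub>C y t) = c *\<^sub>C G1 y"
  using assms by (simp_all add: G_data data_scaleC max_domD zero_in Gamma'_scaleC scaleC_prod_def scaleC_minus_right)

lemma up_to_in: "\<eta> \<in> \<Delta> \<Longrightarrow> ereal \<eta> < b \<Longrightarrow> \<forall>\<^sub>F t in up_to b. t \<in> \<Delta> \<and> \<eta> \<le> t"
proof -
  assume \<eta>: "\<eta> \<in> \<Delta>" "ereal \<eta> < b"
  obtain x :: "nat \<Rightarrow> real" where x: "\<And>k. 0 < x k" "\<And>k. \<forall>\<^sub>F s in up_to b. x k \<le> s \<and> ereal s < b" "\<And>t. ereal t < b \<Longrightarrow> \<exists>k. t \<le> x k"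
    by (rule exhaustion) (rule that)
  obtain k where k: "\<eta> \<le> x k" using x(3)[OF \<eta>(2)] by blast
  show "\<forall>\<^sub>F t in up_to b. t \<in> \<Delta> \<and> \<eta> \<le> t"
    using x(2)[of k] by (rule eventually_mono) (use k x(1)[of k] in \<open>auto intro: less_b_in\<close>)
qed

text \<open>The identity on segments in the limit at b: the integrals converge by square
  integrability and the boundary form by the defining property of the triplet.\<close>

lemma Green:
  assumes y: "y \<in> \<D>" and w: "w \<in> \<D>"
  shows "l2_inner (L y) w - l2_inner y (L w) = cinner (G1 y) (G0 w) - cinner (G0 y) (G1 w)"
proof -
  have "((\<lambda>\<eta>. form (data y 0) (data w 0) + (l2_inner (cutoff {0..\<eta>} (L y)) w - l2_inner (cutoff {0..\<eta>} y) (L w)))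
      \<longlongrightarrow> form (data y 0) (data w 0) + (l2_inner (L y) w - l2_inner y (L w))) (up_to b)"
    by (intro tendsto_intros l2_inner_tendsto max_domD y w L_off)
  moreover have "\<forall>\<^sub>F \<eta> in up_to b. form (data y 0) (data w 0) + (l2_inner (cutoff {0..\<eta>} (L y)) w - l2_inner (cutoff {0..\<eta>} y) (L w))
      = form (data y \<eta>) (data w \<eta>)"
  proof -
    obtain e where e: "e \<in> \<Delta>" "ereal e < b" by (rule positive_in)
    show ?thesis
      using up_to_in[OF e]
    proof eventually_elim
      case (elim \<eta>)
      then have \<eta>: "\<eta> \<in> \<Delta>" by blast
      have cut: "cutoff {0..\<eta>} (l u) = cutoff {0..\<eta>} (L u)" for u
        using segment[OF \<eta>] by (auto simp: cutoff_def fun_eq_iff)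
      have "br y w \<eta> - br y w 0 = l2_inner (cutoff {0..\<eta>} (l y)) (cutoff {0..\<eta>} w) - l2_inner (cutoff {0..\<eta>} y) (cutoff {0..\<eta>} (l w))"
        by (rule green[OF max_domD(3)[OF y] max_domD(3)[OF w] \<eta>]) (unfold cut, (intro l2_cut max_domD y w; simp)+)
      then show ?case unfolding cut l2_inner_cut(1) by (simp add: br_form algebra_simps)
    qed
  qed
  ultimately have "((\<lambda>\<eta>. form (data y \<eta>) (data w \<eta>)) \<longlongrightarrow> form (data y 0) (data w 0) + (l2_inner (L y) w - l2_inner y (L w))) (up_to b)"
    by (rule Lim_transform_eventually)
  from tendsto_unique[OF up_to_ne_bot this form_limit[OF y w]]
  show ?thesis by (simp add: G_data form_def cinner_prod_def cinner_minus_left cinner_minus_right algebra_simps)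
qed

text \<open>Near b the glued function is y, so its bracket with every w has the same limit;
  surjectivity of the primed maps lets w test each component, whence the boundary values at b agree.
  The image under L is known off the exceptional set of y and the seam.\<close>

lemma glue_max_dom:
  assumes y: "y \<in> \<D>" and v: "solution z g v" and g: "continuous_on \<Delta> g" and \<eta>: "\<eta> \<in> \<Delta>" "0 < \<eta>" "ereal \<eta> < b"
    and match: "data v \<eta> = data y \<eta>"
  defines "x \<equiv> \<lambda>t. if t \<le> \<eta> then v t else y t"
  obtains "x \<in> \<D>" "data x 0 = data v 0" "\<Gamma>0' x = \<Gamma>0' y" "\<Gamma>1' x = \<Gamma>1' y"
    "\<And>f. l2 f \<Longrightarrow> l2_inner (L x) f = l2_inner (\<lambda>t. cutoff {0..\<eta>} (l v) t + cutoff (- {0..\<eta>}) (L y) t) f"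
    "AE t in lebesgue. L x t = cutoff {0..\<eta>} (l v) t + cutoff (- {0..\<eta>}) (L y) t"
proof -
  have vo: "v t = 0" if "t \<notin> \<Delta>" for t using v that by (simp add: solution_def)
  note x = x_def
  have Qmatch: "Q v k \<eta> = Q y k \<eta>" if "k < 2 * CARD('n)" for k
    using match by (simp flip: coord_data[OF that])
  note glue = glue[OF solution_dom[OF v] max_domD(3)[OF y] \<eta>(1) Qmatch, folded x]
  obtain N where N: "N \<in> null_sets lebesgue" "\<And>t. t \<in> \<Delta> - N \<Longrightarrow> Q y (2 * CARD('n) - 1) differentiable (at t within \<Delta>)"
    by (rule dom_exceptional[OF max_domD(3)[OF y]]) (rule that)
  let ?f = "\<lambda>t. cutoff {0..\<eta>} (l v) t + cutoff (- {0..\<eta>}) (L y) t"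
  have null: "N \<union> {\<eta>} \<in> null_sets lebesgue"
    using N(1) by (intro null_sets.Un) (auto simp flip: negligible_iff_null_sets)
  have eq: "L x t = ?f t" if "t \<notin> N \<union> {\<eta>}" for t
  proof (cases "t \<in> \<Delta>")
    case True
    have "Q v (2 * CARD('n) - 1) differentiable (at t within \<Delta>)"
      using v True n_pos by (auto simp: solution_def Ck_on_Suc)
    then show ?thesis
      using glue(3)[OF _ True] glue(4)[OF _ True] N(2)[of t] that True nonneg[OF True] by (cases "t < \<eta>") (auto simp: cutoff_def)
  next
    case False
    then show ?thesis using segment[OF \<eta>(1)] by (auto simp: cutoff_def)
  qed
  have contv: "continuous_on \<Delta> v" by (rule solution_continuous[OF v])
  have "cutoff {0..\<eta>} (l v) = cutoff {0..\<eta>} (\<lambda>t. z *\<^sub>C v t + g t)"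
    using v segment[OF \<eta>(1)] by (auto simp: cutoff_def solution_def fun_eq_iff)
  moreover have "l2 (cutoff {0..\<eta>} (\<lambda>t. z *\<^sub>C v t + g t))"
    by (intro l2_cut_segment \<eta> continuous_on_add g bounded_linear.continuous_on[OF bounded_linear_scaleC] contv)
  moreover have l2y: "l2 (cutoff (- {0..\<eta>}) (L y))" by (intro l2_cut max_domD y) auto
  ultimately have l2f: "l2 ?f" by (simp add: l2_add)
  have l2x: "l2 (L x)" by (rule l2_AE[OF l2f null eq])
  have "x = (\<lambda>t. cutoff {0..\<eta>} v t + cutoff (- {0..\<eta>}) y t)"
  proof
    fix t
    have "t < 0 \<Longrightarrow> v t = 0" "t < 0 \<Longrightarrow> y t = 0" using vo max_domD(1)[OF y] nonneg[of t] by fastforce+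
    then show "x t = cutoff {0..\<eta>} v t + cutoff (- {0..\<eta>}) y t" using \<eta>(2) by (auto simp: x_def cutoff_def)
  qed
  moreover have "l2 (cutoff (- {0..\<eta>}) y)" by (intro l2_cut max_domD y) auto
  ultimately have "l2 x" using l2_cut_segment[OF contv \<eta>(1)] by (simp add: l2_add)
  moreover have "x t = 0" if "t \<notin> \<Delta>" for t using vo[OF that] max_domD(1)[OF y that] by (simp add: x)
  ultimately have D: "x \<in> \<D>" unfolding max_dom_iff using glue(1) l2x by blast
  have data: "data x t = (if t \<le> \<eta> then data v t else data y t)" if "t \<in> \<Delta>" for t
    by (rule data_eqI) (simp add: coord_data glue(2)[OF _ _ that])
  have "\<forall>\<^sub>F t in up_to b. data x t = data y t"
    using up_to_in[OF \<eta>(1,3)] by eventually_elim (auto simp: data match)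
  then have "\<forall>\<^sub>F t in up_to b. form (data x t) (data w t) = form (data y t) (data w t)" for w
    by eventually_elim simp
  from tendsto_unique[OF up_to_ne_bot Lim_transform_eventually[OF form_limit[OF D] this] form_limit[OF y]]
  have lim: "cinner (\<Gamma>1' x) (\<Gamma>0' w) - cinner (\<Gamma>0' x) (\<Gamma>1' w) = cinner (\<Gamma>1' y) (\<Gamma>0' w) - cinner (\<Gamma>0' y) (\<Gamma>1' w)"
    if "w \<in> \<D>" for w using that by blast
  have "cinner (\<Gamma>1' x) h = cinner (\<Gamma>1' y) h" for h
  proof -
    obtain w where "w \<in> \<D>" "\<Gamma>0' w = h" "\<Gamma>1' w = 0" by (rule Gamma'_surj)
    then show ?thesis using lim[of w] by simp
  qed
  then have 1: "\<Gamma>1' x = \<Gamma>1' y" by (rule cinner_ext)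
  have "cinner (\<Gamma>0' x) h = cinner (\<Gamma>0' y) h" for h
  proof -
    obtain w where "w \<in> \<D>" "\<Gamma>0' w = 0" "\<Gamma>1' w = h" by (rule Gamma'_surj)
    then show ?thesis using lim[of w] by simp
  qed
  then have 0: "\<Gamma>0' x = \<Gamma>0' y" by (rule cinner_ext)
  have ae: "AE t in lebesgue. L x t = ?f t" by (rule AE_I'[OF null]) (use eq in blast)
  show thesis
  proof (rule that[OF D _ 0 1 _ ae])
    show "data x 0 = data v 0" using data[OF zero_in] \<eta>(2) by simp
    show "l2_inner (L x) f = l2_inner ?f f" if "l2 f" for f by (rule l2_inner_AE[OF l2x l2f that ae])
  qed
qed

lemma zero_max_dom: "(\<lambda>t. 0) \<in> \<D>"
proof -
  have "phi 0 0 \<in> \<NN> 0" by (rule phi_defect) (simp add: l2_zero)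
  then show ?thesis using defect_max_dom by simp
qed

text \<open>The zero function is steered from \<open>\<eta>\<close> back to prescribed initial data.
  The result vanishes beyond \<open>\<eta>\<close> and therefore has zero boundary values at b; the
  spectral parameter 0 is an arbitrary choice.\<close>

lemma compact_element:
  obtains x where "x \<in> \<D>" "data x 0 = c" "\<Gamma>0' x = 0" "\<Gamma>1' x = 0"
proof -
  obtain \<eta> where \<eta>: "0 < \<eta>" "\<eta> \<in> \<Delta>" "ereal \<eta> < b" by (rule positive_in)
  note zero = max_domD[OF zero_max_dom]
  have "l2 (cutoff {0..\<eta>} (l (\<lambda>t. 0)))"
  proof -
    have "cutoff {0..\<eta>} (l (\<lambda>t. 0)) = cutoff {0..\<eta>} (L (\<lambda>t. 0))" using segment[OF \<eta>(2)] by (auto simp: cutoff_def fun_eq_iff)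
    then show ?thesis using l2_cut[OF zero(4), of "{0..\<eta>}"] by simp
  qed
  then obtain a v where v: "solution 0 (phi (cnj 0) a) v" "data v 0 = c" "data v \<eta> = data (\<lambda>t. 0) \<eta>"
    by (rule control[OF \<eta>(2,1) zero(3), of 0 c]) (rule that)
  have "\<Gamma>0' (\<lambda>t. 0) = 0" "\<Gamma>1' (\<lambda>t. 0) = 0"
    using Gamma'_scaleC[OF zero_max_dom, of 0] by simp_all
  then show thesis
    by (rule_tac glue_max_dom[OF zero_max_dom v(1) solution_continuous[OF phi_solution] \<eta>(2,1,3) v(3)]) (rule that; simp add: v(2))
qed

lemma G_surj: obtains y where "y \<in> \<D>" "G0 y = h0" "G1 y = h1"
proof -
  obtain y where y: "y \<in> \<D>" "\<Gamma>0' y = snd h0" "\<Gamma>1' y = snd h1" by (rule Gamma'_surj)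
  obtain x where x: "x \<in> \<D>" "data x 0 = (- fst h1, fst h0) - data y 0" "\<Gamma>0' x = 0" "\<Gamma>1' x = 0" by (rule compact_element)
  have "data (\<lambda>t. y t + x t) 0 = (- fst h1, fst h0)"
    by (simp add: data_add max_domD(3)[OF y(1)] max_domD(3)[OF x(1)] zero_in x(2))
  then show thesis
    by (intro that[of "\<lambda>t. y t + x t"] max_dom_add x(1) y(1)) (simp_all add: G_data Gamma'_add[OF y(1) x(1)] x y prod_eq_iff)
qed

lemma defect_identity:
  assumes u: "u \<in> \<NN> z" and w: "w \<in> \<NN> \<mu>"
  shows "(z - cnj \<mu>) * l2_inner u w = cinner (G1 u) (G0 w) - cinner (G0 u) (G1 w)"
  using Green[OF defect_max_dom[OF u] defect_max_dom[OF w]] unfolding defect_L[OF u] defect_L[OF w]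
  by (simp add: l2_inner_scaleC_left l2_inner_scaleC_right algebra_simps)

text \<open>The boundary maps are not given as bounded. Any test vector is the pair of boundary
  values of some y, and Green's identity bounds its pairing with those of u by the norm of u;
  uniform boundedness concludes.\<close>

lemma defect_G_bounded:
  obtains C where "0 < C" "\<And>u. u \<in> \<NN> z \<Longrightarrow> norm (G0 u) \<le> C * l2_norm u" "\<And>u. u \<in> \<NN> z \<Longrightarrow> norm (G1 u) \<le> C * l2_norm u"
proof -
  \<comment> \<open>Swapped and signed so that the inner product with the boundary values of y is
    the negative of the form in Green's identity.\<close>
  let ?S = "(\<lambda>u. (G1 u, - G0 u)) ` {u \<in> \<NN> z. l2_norm u \<le> 1}"
  have "\<exists>C. \<forall>s\<in>?S. cmod (cinner x s) \<le> C" for x :: "(('h, 'n) vec \<times> 'g) \<times> (('h, 'n) vec \<times> 'g)"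
  proof -
    obtain y where y: "y \<in> \<D>" "G0 y = fst x" "G1 y = snd x" by (rule G_surj)
    have "cmod (cinner x (G1 u, - G0 u)) \<le> l2_norm (L y) + l2_norm y * cmod z" if u: "u \<in> \<NN> z" "l2_norm u \<le> 1" for u
    proof -
      note uD = defect_max_dom[OF u(1)]
      have "cinner x (G1 u, - G0 u) = l2_inner y (L u) - l2_inner (L y) u"
        using Green[OF y(1) uD] by (simp add: cinner_prod_def[of x] cinner_minus_right y algebra_simps)
      also have "cmod \<dots> \<le> cmod (l2_inner y (L u)) + cmod (l2_inner (L y) u)" by (rule norm_triangle_ineq4)
      also have "\<dots> \<le> l2_norm y * l2_norm (L u) + l2_norm (L y) * l2_norm u"
        by (intro add_mono l2_cauchy_schwarz max_domD y(1) uD)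
      also have "\<dots> \<le> l2_norm y * cmod z + l2_norm (L y)"
        using u(2) by (intro add_mono mult_left_mono l2_norm_nonneg mult_left_le)
          (simp_all add: defect_L[OF u(1)] l2_norm_scaleC mult_left_le)
      finally show ?thesis by simp
    qed
    then show ?thesis by blast
  qed
  then obtain B where B: "0 \<le> B" "\<forall>s\<in>?S. norm s \<le> B" using uniform_boundedness[of ?S] by blast
  have main: "norm (G1 u, - G0 u) \<le> (B + 1) * l2_norm u" if u: "u \<in> \<NN> z" for u
  proof (rule field_le_epsilon)
    fix e :: real assume e: "0 < e"
    \<comment> \<open>Slightly larger than the norm, so that u can be normalised even if its norm is
      0; the excess costs exactly e in the end.\<close>
    define r where "r = l2_norm u + e / (B + 1)"
    have r: "0 < r" "l2_norm u \<le> r" using e B(1) by (simp_all add: r_def add_nonneg_pos l2_norm_nonneg)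
    let ?u = "\<lambda>t. complex_of_real (1 / r) *\<^sub>C u t"
    have "l2_norm ?u \<le> 1" unfolding l2_norm_scaleC using r by (simp add: norm_divide)
    then have le: "norm (G1 ?u, - G0 ?u) \<le> B" using B(2) defect_scaleC[OF u] by blast
    have "G1 ?u = (1 / r) *\<^sub>R G1 u" "G0 ?u = (1 / r) *\<^sub>R G0 u"
      using G_scaleC[OF defect_max_dom[OF u], of "complex_of_real (1 / r)"] by (simp_all only: scaleC_of_real)
    then have "(G1 ?u, - G0 ?u) = (1 / r) *\<^sub>R (G1 u, - G0 u)" by (simp only: scaleR_Pair scaleR_minus_right)
    then have "norm ((1 / r) *\<^sub>R (G1 u, - G0 u)) \<le> B" using le by simp
    then have "norm (G1 u, - G0 u) / r \<le> B" using r by (simp only: norm_scaleR) simp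
    then have "norm (G1 u, - G0 u) \<le> B * r" using r by (simp add: field_simps)
    also have "\<dots> \<le> (B + 1) * r" using r by (intro mult_right_mono) auto
    also have "\<dots> = (B + 1) * l2_norm u + e" using B(1) by (simp add: r_def field_simps)
    finally show "norm (G1 u, - G0 u) \<le> (B + 1) * l2_norm u + e" .
  qed
  show thesis
  proof (rule that[of "B + 1"])
    show "norm (G0 u) \<le> (B + 1) * l2_norm u" "norm (G1 u) \<le> (B + 1) * l2_norm u" if "u \<in> \<NN> z" for u
      using main[OF that] norm_fst_le[of "G1 u" "- G0 u"] norm_snd_le[of "- G0 u" "G1 u"] by simp_all
  qed (use B in simp)
qed

lemma nonreal_Im: "z \<in> nonreal \<Longrightarrow> Im z \<noteq> 0"
  by (auto simp: nonreal_def)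

lemma defect_norm:
  assumes u: "u \<in> \<NN> z" shows "Im z * (l2_norm u)\<^sup>2 = Im (cinner (G1 u) (G0 u))"
proof -
  have "(z - cnj z) * of_real ((l2_norm u)\<^sup>2) = cinner (G1 u) (G0 u) - cnj (cinner (G1 u) (G0 u))"
    using defect_identity[OF u u] by (simp add: l2_inner_self flip: cinner_commute)
  then have "Im ((z - cnj z) * of_real ((l2_norm u)\<^sup>2)) = Im (cinner (G1 u) (G0 u) - cnj (cinner (G1 u) (G0 u)))" by simp
  then show ?thesis by simp
qed

text \<open>For u in the defect space \<open>Im z\<close> times the squared norm is the imaginary
  part of a product of boundary values. One factor is bounded by the norm of u itself and
  cancels.\<close>

lemma defect_norm_bounded:
  assumes z: "z \<in> nonreal"
  obtains C where "0 \<le> C" "\<And>u. u \<in> \<NN> z \<Longrightarrow> l2_norm u \<le> C * norm (G0 u)"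
proof -
  obtain C where C: "0 < C" "\<And>u. u \<in> \<NN> z \<Longrightarrow> norm (G0 u) \<le> C * l2_norm u" "\<And>u. u \<in> \<NN> z \<Longrightarrow> norm (G1 u) \<le> C * l2_norm u"
    by (rule defect_G_bounded) (rule that)
  have "l2_norm u \<le> C / \<bar>Im z\<bar> * norm (G0 u)" if u: "u \<in> \<NN> z" for u
  proof (cases "l2_norm u = 0")
    case False
    then have pos: "0 < l2_norm u" using l2_norm_nonneg[of u] by linarith
    have "\<bar>Im z\<bar> * (l2_norm u)\<^sup>2 = \<bar>Im (cinner (G1 u) (G0 u))\<bar>"
      using defect_norm[OF u] by (metis abs_mult abs_power2)
    also have "\<dots> \<le> norm (G1 u) * norm (G0 u)" using abs_Im_le_cmod cmod_cinner_le order_trans by blast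
    also have "\<dots> \<le> C * l2_norm u * norm (G0 u)" by (intro mult_right_mono C(3) u) simp
    finally have "\<bar>Im z\<bar> * l2_norm u * l2_norm u \<le> C * norm (G0 u) * l2_norm u" by (simp add: power2_eq_square mult_ac)
    then have "\<bar>Im z\<bar> * l2_norm u \<le> C * norm (G0 u)" using pos by simp
    then show ?thesis using nonreal_Im[OF z] by (simp add: field_simps)
  qed (use C(1) in simp)
  then show thesis using that[of "C / \<bar>Im z\<bar>"] C(1) by simp
qed

text \<open>Converging boundary values make the solutions Cauchy in norm, hence by observability
  their initial data Cauchy; the solution with the limit data is the preimage.\<close>

lemma defect_range_closed:
  assumes z: "z \<in> nonreal" shows "closed (G0 ` \<NN> z)"
  unfolding closed_sequential_limits
proof (intro allI impI, elim conjE)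
  fix x h assume x: "\<forall>k. x k \<in> G0 ` \<NN> z" and lim: "x \<longlonglongrightarrow> h"
  obtain C where C: "0 < C" "\<And>u. u \<in> \<NN> z \<Longrightarrow> norm (G0 u) \<le> C * l2_norm u" by (rule defect_G_bounded) (rule that)
  obtain C' where C': "0 \<le> C'" "\<And>u. u \<in> \<NN> z \<Longrightarrow> l2_norm u \<le> C' * norm (G0 u)" by (rule defect_norm_bounded[OF z]) (rule that)
  obtain \<eta> where \<eta>: "0 < \<eta>" "\<eta> \<in> \<Delta>" "ereal \<eta> < b" by (rule positive_in)
  obtain \<kappa> where \<kappa>: "0 < \<kappa>" "\<And>c. \<kappa> * norm c \<le> l2_norm (cutoff {0..\<eta>} (phi z c))" by (rule observability[OF \<eta>(2,1)]) (rule that)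
  have "\<exists>c. phi z c \<in> \<NN> z \<and> x k = G0 (phi z c)" for k
  proof -
    obtain u where "u \<in> \<NN> z" "x k = G0 u" using x by blast
    then show ?thesis using defect_phi[of u z] by metis
  qed
  then obtain c where c: "\<And>k. phi z (c k) \<in> \<NN> z" "\<And>k. x k = G0 (phi z (c k))" by metis
  have diff: "phi z (d - d') \<in> \<NN> z \<and> G0 (phi z (d - d')) = G0 (phi z d) - G0 (phi z d')"
    if d: "phi z d \<in> \<NN> z" "phi z d' \<in> \<NN> z" for d d'
  proof -
    have "phi z (d - d') = (\<lambda>t. phi z d t + (-1) *\<^sub>C phi z d' t)" by (simp add: cblinfun_linear scaleC_minus_left)
    moreover note m = defect_scaleC[OF d(2), of "-1"]
    ultimately show ?thesis
      using defect_add[OF d(1) m] G_add(1)[OF defect_max_dom[OF d(1)] defect_max_dom[OF m]] G_scaleC(1)[OF defect_max_dom[OF d(2)], of "-1"]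
      by (simp add: scaleC_minus_left)
  qed
  have small: "l2_norm (phi z (c j - c k)) \<le> C' * norm (x j - x k)" for j k
    using C'(2)[of "phi z (c j - c k)"] diff[OF c(1) c(1), of j k] by (simp add: c(2))
  have l2c: "l2 (phi z (c j - c k))" for j k using diff[OF c(1) c(1), of j k] by (simp add: defect_iff)
  have "Cauchy x" using lim by (simp add: LIMSEQ_imp_Cauchy)
  have close: "\<exists>M. \<forall>j\<ge>M. \<forall>k\<ge>M. l2_norm (phi z (c j - c k)) < e" if e: "0 < e" for e
  proof -
    have "0 < e / (C' + 1)" using e C'(1) by simp
    then obtain M where M: "\<forall>j\<ge>M. \<forall>k\<ge>M. norm (x j - x k) < e / (C' + 1)" using \<open>Cauchy x\<close> unfolding Cauchy_def dist_norm by blast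
    have "l2_norm (phi z (c j - c k)) < e" if "M \<le> j" "M \<le> k" for j k
    proof -
      have "l2_norm (phi z (c j - c k)) \<le> (C' + 1) * norm (x j - x k)"
        by (rule order_trans[OF small]) (intro mult_right_mono; simp)
      also have "\<dots> < (C' + 1) * (e / (C' + 1))" using M that C'(1) by (intro mult_strict_left_mono) auto
      finally show ?thesis using C'(1) by simp
    qed
    then show ?thesis by blast
  qed
  have "Cauchy c"
    unfolding Cauchy_def dist_norm
  proof (intro allI impI)
    fix e :: real assume "0 < e"
    then have "0 < \<kappa> * e" using \<kappa>(1) by simp
    from close[OF this] obtain M where M: "\<forall>j\<ge>M. \<forall>k\<ge>M. l2_norm (phi z (c j - c k)) < \<kappa> * e" by blast
    have "norm (c j - c k) < e" if "M \<le> j" "M \<le> k" for j k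
    proof -
      have "\<kappa> * norm (c j - c k) \<le> l2_norm (phi z (c j - c k))" by (rule order_trans[OF \<kappa>(2) l2_norm_cut[OF l2c]]) simp
      also have "\<dots> < \<kappa> * e" using M that by blast
      finally show ?thesis using \<kappa>(1) by simp
    qed
    then show "\<exists>M. \<forall>j\<ge>M. \<forall>k\<ge>M. norm (c j - c k) < e" by blast
  qed
  then obtain c' where c': "c \<longlonglongrightarrow> c'" using Cauchy_convergent convergent_def by blast
  \<comment> \<open>The estimate passes to the limit data on each segment, and then to the whole
    interval by monotone convergence.\<close>
  have near: "l2 (phi z (c' - c k)) \<and> l2_norm (phi z (c' - c k)) \<le> e"
    if M: "\<forall>j\<ge>M. \<forall>k\<ge>M. l2_norm (phi z (c j - c k)) < e" "M \<le> k" for e M k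
  proof -
    have "l2_norm (cutoff {0..s} (phi z (c' - c k))) \<le> e" if s: "0 < s" "ereal s < b" for s
    proof (rule phi_tendsto[OF tendsto_diff[OF c' tendsto_const], of _ M])
      show "s \<in> \<Delta>" using s by (intro less_b_in) auto
      show "l2_norm (cutoff {0..s} (phi z (c j - c k))) \<le> e" if "M \<le> j" for j
      proof -
        have "l2_norm (cutoff {0..s} (phi z (c j - c k))) \<le> l2_norm (phi z (c j - c k))" by (rule l2_norm_cut[OF l2c]) simp
        also have "\<dots> < e" using M that by blast
        finally show ?thesis by simp
      qed
    qed
    then show ?thesis using phi_l2_of_bounded by blast
  qed
  obtain M where "\<forall>j\<ge>M. \<forall>k\<ge>M. l2_norm (phi z (c j - c k)) < 1" using close[of 1] by auto
  then have "phi z (c' - c M) \<in> \<NN> z" using near[of M 1 M] by (simp add: phi_defect)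
  moreover have "phi z c' = (\<lambda>t. phi z (c' - c M) t + phi z (c M) t)" by (simp add: cblinfun_linear)
  ultimately have c'_defect: "phi z c' \<in> \<NN> z" using defect_add[OF _ c(1)] by simp
  have "x \<longlonglongrightarrow> G0 (phi z c')"
    unfolding lim_sequentially dist_norm
  proof (intro allI impI)
    fix e :: real assume e: "0 < e"
    then have "0 < e / (2 * C)" using C(1) by simp
    from close[OF this] obtain M where M: "\<forall>j\<ge>M. \<forall>k\<ge>M. l2_norm (phi z (c j - c k)) < e / (2 * C)" by blast
    have "norm (x k - G0 (phi z c')) < e" if "M \<le> k" for k
    proof -
      have "norm (x k - G0 (phi z c')) = norm (G0 (phi z (c' - c k)))"
        using diff[OF c'_defect c(1), of k] by (simp add: c(2) norm_minus_commute)
      also have "\<dots> \<le> C * l2_norm (phi z (c' - c k))" using C(2) diff[OF c'_defect c(1)] by blast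
      also have "\<dots> \<le> C * (e / (2 * C))" using near[OF M that] C(1) by (intro mult_left_mono) auto
      also have "\<dots> < e" using C(1) e by simp
      finally show ?thesis .
    qed
    then show "\<exists>M. \<forall>k\<ge>M. norm (x k - G0 (phi z c')) < e" by blast
  qed
  then have "h = G0 (phi z c')" using LIMSEQ_unique[OF lim] by blast
  then show "h \<in> G0 ` \<NN> z" using c'_defect by blast
qed


text \<open>If \<open>h\<close> is orthogonal to the boundary values, an element with boundary values \<open>(0, h)\<close> can be changed on
  \<open>[0, \<eta>\<^sub>k]\<close> so that its image under \<open>L - cnj z\<close>, hence the element itself, tends to \<open>0\<close>.\<close>

lemma defect_range_dense:
  assumes z: "z \<in> nonreal" and perp: "\<And>u. u \<in> \<NN> z \<Longrightarrow> cinner h (G0 u) = 0"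
  shows "h = 0"
proof -
  obtain y where y: "y \<in> \<D>" "G0 y = 0" "G1 y = h" by (rule G_surj)
  obtain w where w: "w \<in> \<D>" "G0 w = h" "G1 w = 0" by (rule G_surj)
  note yD = max_domD[OF y(1)] and wD = max_domD[OF w(1)]
  define f where "f t = L y t - cnj z *\<^sub>C y t" for t
  have f: "l2 f" unfolding f_def[abs_def] by (intro l2_diff l2_scaleC yD)
  have f_off: "f t = 0" if "t \<notin> \<Delta>" for t using that yD(1) by (simp add: f_def L_off)
  \<comment> \<open>Green's identity leaves only the pairing of h with the boundary value of the
    solution, which is zero by assumption.\<close>
  have f_perp: "l2_inner f (phi z c) = 0" if "l2 (phi z c)" for c
  proof -
    have u: "phi z c \<in> \<NN> z" by (rule phi_defect[OF that])
    have "l2_inner f (phi z c) = l2_inner (L y) (phi z c) - l2_inner y (L (phi z c))"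
      unfolding f_def[abs_def] defect_L[OF u]
      using l2_inner_diff_left[OF yD(4) l2_scaleC[OF yD(2)] that] by (simp add: l2_inner_scaleC_left l2_inner_scaleC_right)
    also have "\<dots> = 0" using Green[OF y(1) defect_max_dom[OF u]] y perp[OF u] by simp
    finally show ?thesis .
  qed
  obtain \<eta> :: "nat \<Rightarrow> real" where \<eta>: "\<And>k. 0 < \<eta> k" "\<And>k. ereal (\<eta> k) < b" "incseq \<eta>"
    "filterlim \<eta> (up_to b) sequentially" "\<And>t. ereal t < b \<Longrightarrow> \<exists>k. t \<le> \<eta> k"
    by (rule exhaustion) (rule that)
  have \<eta>in: "\<eta> k \<in> \<Delta>" for k using \<eta>(1)[of k] \<eta>(2)[of k] by (intro less_b_in) auto
  let ?C = "\<lambda>k. cutoff {0..\<eta> k}" and ?T = "\<lambda>k. cutoff (- {0..\<eta> k})"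
  have cut: "?C k (l u) = ?C k (L u)" for k u using segment[OF \<eta>in] by (auto simp: cutoff_def fun_eq_iff subset_eq)
  have "\<exists>a v. solution (cnj z) (phi z a) v \<and> data v 0 = data y 0 \<and> data v (\<eta> k) = data y (\<eta> k) \<and>
    (\<forall>d. l2_inner (?C k (phi z a)) (?C k (phi z d)) = l2_inner (?C k f) (?C k (phi z d)))" for k
  proof -
    have l2: "l2 (?C k (l y))" unfolding cut by (intro l2_cut yD) simp
    have "(\<lambda>t. ?C k (l y) t - cnj z *\<^sub>C ?C k y t) = ?C k f"
      unfolding cut f_def[abs_def] cut_simps by simp
    \<comment> \<open>The parameter is \<open>cnj z\<close>, so the steering terms are solutions for
      z. The initial data are kept, so the boundary contribution in \<open>control\<close>
      vanishes.\<close>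
    moreover obtain a v where "solution (cnj z) (phi (cnj (cnj z)) a) v" "data v 0 = data y 0" "data v (\<eta> k) = data y (\<eta> k)"
      "\<And>d. l2_inner (?C k (phi (cnj (cnj z)) a)) (?C k (phi (cnj (cnj z)) d)) =
        l2_inner (\<lambda>t. ?C k (l y) t - cnj z *\<^sub>C ?C k y t) (?C k (phi (cnj (cnj z)) d)) - form (data y 0 - data y 0) d"
      by (rule control[OF \<eta>in \<eta>(1) yD(3) l2, of "cnj z" "data y 0"]) (rule that)
    moreover have "form 0 d = 0" for d by (simp add: form_def)
    ultimately show ?thesis by (intro exI[of _ a] exI[of _ v]) simp
  qed
  then obtain a v where v: "\<And>k. solution (cnj z) (phi z (a k)) (v k)" "\<And>k. data (v k) 0 = data y 0" "\<And>k. data (v k) (\<eta> k) = data y (\<eta> k)"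
    and a: "\<And>k d. l2_inner (?C k (phi z (a k))) (?C k (phi z d)) = l2_inner (?C k f) (?C k (phi z d))"
    by metis
  define x where "x k t = (if t \<le> \<eta> k then v k t else y t)" for k t
  have x: "x k \<in> \<D> \<and> G0 (x k) = 0 \<and> G1 (x k) = h \<and>
      (AE t in lebesgue. L (x k) t = ?C k (l (v k)) t + ?T k (L y) t)" for k
  proof (rule glue_max_dom[OF y(1) v(1) solution_continuous[OF phi_solution] \<eta>in \<eta>(1,2) v(3), folded x_def])
    assume "x k \<in> \<D>" "data (x k) 0 = data (v k) 0" "\<Gamma>0' (x k) = \<Gamma>0' y" "\<Gamma>1' (x k) = \<Gamma>1' y"
      "AE t in lebesgue. L (x k) t = ?C k (l (v k)) t + ?T k (L y) t"
    then show ?thesis using y(2,3) by (simp add: G_data v(2) prod_eq_iff)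
  qed
  define g where "g k t = L (x k) t - cnj z *\<^sub>C x k t" for k t
  have l2x: "l2 (x k)" "l2 (L (x k))" for k using x max_domD by blast+
  have l2g: "l2 (g k)" for k unfolding g_def[abs_def] by (intro l2_diff l2_scaleC l2x)
  \<comment> \<open>The two pieces of g have disjoint supports: the steering solution on the segment
    and f beyond it.\<close>
  have g_norm: "(l2_norm (g k))\<^sup>2 = (l2_norm (?C k (phi z (a k))))\<^sup>2 + (l2_norm (?T k f))\<^sup>2" for k
  proof -
    let ?p = "?C k (phi z (a k))"
    have eq: "AE t in lebesgue. g k t = ?p t + ?T k f t"
    proof -
      have "AE t in lebesgue. L (x k) t = ?C k (l (v k)) t + ?T k (L y) t" using x by blast
      then show ?thesis
      proof eventually_elim
        case (elim t)
        show ?case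
        proof (cases "t \<in> {0..\<eta> k}")
          case True
          then have "t \<in> \<Delta>" using segment[OF \<eta>in] by blast
          then show ?thesis using elim True v(1)[of k] by (simp add: g_def x_def cutoff_def solution_def)
        next
          case False
          have "x k t = y t"
          proof (cases "t < 0")
            case True
            then have "t \<notin> \<Delta>" using nonneg by force
            then show ?thesis using yD(1) x[of k] max_domD(1) by metis
          qed (use False in \<open>simp add: x_def\<close>)
          then show ?thesis using elim False by (auto simp: g_def f_def cutoff_def)
        qed
      qed
    qed
    have "(l2_norm (g k))\<^sup>2 = (l2_norm (\<lambda>t. ?p t + ?T k f t))\<^sup>2"
      unfolding l2_norm_sq
    proof (rule integral_cong_AE)
      show "AE t in lebesgue. (norm (g k t))\<^sup>2 = (norm (?p t + ?T k f t))\<^sup>2" using eq by eventually_elim simp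
      show "(\<lambda>t. (norm (g k t))\<^sup>2) \<in> borel_measurable lebesgue" using l2g by (auto simp: l2_def)
      have "l2 (\<lambda>t. ?p t + ?T k f t)" by (intro l2_add phi_l2 \<eta>in l2_cut f) auto
      then show "(\<lambda>t. (norm (?p t + ?T k f t))\<^sup>2) \<in> borel_measurable lebesgue" by (auto simp: l2_def)
    qed
    also have "\<dots> = (l2_norm ?p)\<^sup>2 + 2 * Re (l2_inner ?p (?T k f)) + (l2_norm (?T k f))\<^sup>2"
      by (intro l2_norm_add_sq phi_l2 \<eta>in l2_cut f) auto
    also have "l2_inner ?p (?T k f) = 0"
    proof -
      have "(\<lambda>t. cinner (?p t) (?T k f t)) = (\<lambda>t. 0)" by (auto simp: cutoff_def)
      then show ?thesis by (simp add: l2_inner_def)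
    qed
    finally show ?thesis by simp
  qed
  have lim1: "(\<lambda>k. (l2_norm (?C k (phi z (a k))))\<^sup>2) \<longlonglongrightarrow> 0"
    by (rule projections_vanish[OF f f_off \<eta> a f_perp])
  have lim2: "(\<lambda>k. l2_norm (?T k f)) \<longlonglongrightarrow> 0" by (rule filterlim_compose[OF tail_tendsto[OF f f_off] \<eta>(4)])
  have "(\<lambda>k. (l2_norm (g k))\<^sup>2) \<longlonglongrightarrow> 0" unfolding g_norm using tendsto_add[OF lim1 tendsto_power[OF lim2, of 2]] by simp
  from tendsto_real_sqrt[OF this] have g0: "(\<lambda>k. l2_norm (g k)) \<longlonglongrightarrow> 0" by (simp add: l2_norm_nonneg)
  \<comment> \<open>Since G0 vanishes on x k, Green's identity makes the inner product of L (x k)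
    with x k real; the imaginary part of the pairing of g k with x k is then \<open>Im z\<close>
    times the squared norm.\<close>
  have gx: "\<bar>Im z\<bar> * l2_norm (x k) \<le> l2_norm (g k)" for k
  proof -
    have "l2_inner (L (x k)) (x k) = l2_inner (x k) (L (x k))"
      using Green[of "x k" "x k"] x[of k] by simp
    then have real: "Im (l2_inner (L (x k)) (x k)) = 0"
      using l2_inner_commute[of "L (x k)" "x k"] by (metis complex_cnj_cancel_iff Reals_cnj_iff complex_is_Real_iff)
    have "l2_inner (g k) (x k) = l2_inner (L (x k)) (x k) - cnj z * of_real ((l2_norm (x k))\<^sup>2)"
      unfolding g_def[abs_def] l2_inner_diff_left[OF l2x(2) l2_scaleC[OF l2x(1)] l2x(1)] by (simp add: l2_inner_scaleC_left l2_inner_self)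
    then have "Im (l2_inner (g k) (x k)) = Im z * (l2_norm (x k))\<^sup>2" using real by simp
    then have "\<bar>Im z\<bar> * (l2_norm (x k))\<^sup>2 = \<bar>Im (l2_inner (g k) (x k))\<bar>" by (simp add: abs_mult)
    also have "\<dots> \<le> l2_norm (g k) * l2_norm (x k)" using abs_Im_le_cmod l2_cauchy_schwarz[OF l2g l2x(1)] order_trans by blast
    finally have le: "\<bar>Im z\<bar> * l2_norm (x k) * l2_norm (x k) \<le> l2_norm (g k) * l2_norm (x k)" by (simp add: power2_eq_square)
    show ?thesis
    proof (cases "l2_norm (x k) = 0")
      case False
      then have "0 < l2_norm (x k)" using l2_norm_nonneg[of "x k"] by linarith
      then show ?thesis using le by simp
    qed (simp add: l2_norm_nonneg)
  qed
  have "(\<lambda>k. \<bar>Im z\<bar> * l2_norm (x k)) \<longlonglongrightarrow> 0"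
    by (rule tendsto_sandwich[OF _ _ tendsto_const g0]) (use gx in \<open>auto intro!: always_eventually mult_nonneg_nonneg l2_norm_nonneg\<close>)
  from tendsto_mult_left[OF this, of "1 / \<bar>Im z\<bar>"] have x0: "(\<lambda>k. l2_norm (x k)) \<longlonglongrightarrow> 0"
    using nonreal_Im[OF z] by simp
  \<comment> \<open>Green's identity with w, whose boundary values are h and 0, reads off the norm
    of h.\<close>
  have "(norm h)\<^sup>2 \<le> (l2_norm (g k) + cmod z * l2_norm (x k)) * l2_norm w + l2_norm (x k) * l2_norm (L w)" for k
  proof -
    have "cinner h h = l2_inner (L (x k)) w - l2_inner (x k) (L w)" using Green[of "x k" w] x[of k] w by simp
    then have "(norm h)\<^sup>2 = cmod (l2_inner (L (x k)) w - l2_inner (x k) (L w))" by (metis cinner_self norm_of_real abs_power2)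
    also have "\<dots> \<le> cmod (l2_inner (L (x k)) w) + cmod (l2_inner (x k) (L w))" by (rule norm_triangle_ineq4)
    also have "\<dots> \<le> l2_norm (L (x k)) * l2_norm w + l2_norm (x k) * l2_norm (L w)"
      by (intro add_mono l2_cauchy_schwarz l2x wD)
    also have "l2_norm (L (x k)) \<le> l2_norm (g k) + cmod z * l2_norm (x k)"
    proof -
      have "L (x k) = (\<lambda>t. g k t + cnj z *\<^sub>C x k t)" by (simp add: g_def)
      then show ?thesis using l2_norm_triangle[OF l2g l2_scaleC[OF l2x(1)], of k "cnj z" k] by (simp add: l2_norm_scaleC)
    qed
    finally show ?thesis by (simp add: mult_right_mono l2_norm_nonneg)
  qed
  moreover have "(\<lambda>k. (l2_norm (g k) + cmod z * l2_norm (x k)) * l2_norm w + l2_norm (x k) * l2_norm (L w))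
      \<longlonglongrightarrow> (0 + cmod z * 0) * l2_norm w + 0 * l2_norm (L w)"
    by (intro tendsto_intros g0 x0)
  ultimately have "(norm h)\<^sup>2 \<le> (0 + cmod z * 0) * l2_norm w + 0 * l2_norm (L w)"
    by (intro LIMSEQ_le_const) auto
  then show ?thesis by simp
qed

lemma G0_onto: assumes z: "z \<in> nonreal" shows "G0 ` \<NN> z = UNIV"
proof (rule dense_closed_subspace)
  have "phi z 0 \<in> \<NN> z" by (rule phi_defect) (simp add: l2_zero)
  then have "(\<lambda>t. 0) \<in> \<NN> z" by simp
  moreover have "G0 (\<lambda>t. 0) = 0" using G_scaleC(1)[OF zero_max_dom, of 0] by simp
  ultimately show "0 \<in> G0 ` \<NN> z" by (metis image_eqI)
  show "closed (G0 ` \<NN> z)" by (rule defect_range_closed[OF z])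
  show "x + y \<in> G0 ` \<NN> z" if xy: "x \<in> G0 ` \<NN> z" "y \<in> G0 ` \<NN> z" for x y
  proof -
    obtain u w where u: "u \<in> \<NN> z" "x = G0 u" and w: "w \<in> \<NN> z" "y = G0 w" using xy by blast
    have "x + y = G0 (\<lambda>t. u t + w t)" unfolding G_add(1)[OF defect_max_dom[OF u(1)] defect_max_dom[OF w(1)]] u(2) w(2) ..
    then show ?thesis using defect_add[OF u(1) w(1)] by blast
  qed
  show "c *\<^sub>C x \<in> G0 ` \<NN> z" if xy: "x \<in> G0 ` \<NN> z" for c x
  proof -
    obtain u where u: "u \<in> \<NN> z" "x = G0 u" using xy by blast
    have "c *\<^sub>C x = G0 (\<lambda>t. c *\<^sub>C u t)" unfolding G_scaleC(1)[OF defect_max_dom[OF u(1)]] u(2) ..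
    then show ?thesis using defect_scaleC[OF u(1)] by blast
  qed
  show "h = 0" if "\<And>x. x \<in> G0 ` \<NN> z \<Longrightarrow> cinner h x = 0" for h
    by (rule defect_range_dense[OF z]) (use that in blast)
qed

section \<open>The gamma-field and the Weyl function\<close>

abbreviation gamma :: "complex \<Rightarrow> ('h, 'n) vec \<times> 'g \<Rightarrow> real \<Rightarrow> 'h"
  where "gamma z \<equiv> gamma_field \<Delta> p q \<Gamma>0' z"
abbreviation M :: "complex \<Rightarrow> (('h, 'n) vec \<times> 'g) \<Rightarrow>\<^sub>C\<^sub>L (('h, 'n) vec \<times> 'g)"
  where "M z \<equiv> weyl \<Delta> p q \<Gamma>0' \<Gamma>1' z"
abbreviation Z :: "complex \<Rightarrow> real \<Rightarrow> (('h, 'n) vec \<times> 'g) \<Rightarrow>\<^sub>C\<^sub>L 'h"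
  where "Z z \<equiv> Z0 \<Delta> p q \<Gamma>0' z"

lemma G0_inj: assumes z: "z \<in> nonreal" shows "inj_on G0 (\<NN> z)"
proof (rule inj_onI)
  fix u w assume u: "u \<in> \<NN> z" and w: "w \<in> \<NN> z" and eq: "G0 u = G0 w"
  note w' = defect_scaleC[OF w, of "-1"]
  have d: "(\<lambda>t. u t + (-1) *\<^sub>C w t) \<in> \<NN> z" (is "?d \<in> _") by (rule defect_add[OF u w'])
  have "G0 ?d = 0"
    unfolding G_add(1)[OF defect_max_dom[OF u] defect_max_dom[OF w']] G_scaleC(1)[OF defect_max_dom[OF w]] eq by (simp add: scaleC_minus_left)
  then have "l2_norm ?d \<le> 0" using defect_norm_bounded[OF z] d by (metis mult_zero_right norm_zero)
  moreover obtain C where "norm (G1 ?d) \<le> C * l2_norm ?d" by (rule defect_G_bounded[of z]) (use d in blast)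
  ultimately have "G1 ?d = 0" using l2_norm_nonneg[of ?d] by simp
  \<comment> \<open>A vanishing norm gives equality almost everywhere only; vanishing initial data
    give it at every point.\<close>
  then have "?d = phi z 0" using defect_phi[OF d] data_G[of ?d] \<open>G0 ?d = 0\<close> by (simp add: zero_prod_def)
  then have "u t = w t" for t using fun_cong[of ?d "phi z 0" t] by (simp add: scaleC_minus_left)
  then show "u = w" by auto
qed

lemma gamma: assumes "z \<in> nonreal" shows "gamma z h \<in> \<NN> z" "G0 (gamma z h) = h"
  using the_inv_into_into[OF G0_inj[OF assms], of h "\<NN> z"] f_the_inv_into_f[OF G0_inj[OF assms], of h] G0_onto[OF assms]
  unfolding gamma_field_def by simp_all

lemma gamma_eqI: "z \<in> nonreal \<Longrightarrow> u \<in> \<NN> z \<Longrightarrow> G0 u = h \<Longrightarrow> gamma z h = u"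
  using inj_onD[OF G0_inj, of z "gamma z h" u] gamma by simp

lemma gamma_add: assumes z: "z \<in> nonreal" shows "gamma z (h + h') = (\<lambda>t. gamma z h t + gamma z h' t)"
  using gamma[OF z] defect_max_dom[OF gamma(1)[OF z]] by (intro gamma_eqI[OF z defect_add]) (simp_all add: G_add)

lemma gamma_scaleC: assumes z: "z \<in> nonreal" shows "gamma z (c *\<^sub>C h) = (\<lambda>t. c *\<^sub>C gamma z h t)"
  using gamma[OF z] defect_max_dom[OF gamma(1)[OF z]] by (intro gamma_eqI[OF z defect_scaleC]) (simp_all add: G_scaleC)

text \<open>The second boundary value of \<open>gamma z h\<close> depends linearly and boundedly on
  h. This operator satisfies the description of the Weyl function, and it is the only one because G0
  is onto.\<close>

lemma weyl: assumes z: "z \<in> nonreal" and u: "u \<in> \<NN> z" shows "G1 u = M z *\<^sub>V G0 u"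
proof -
  obtain C where C: "0 < C" "\<And>u. u \<in> \<NN> z \<Longrightarrow> norm (G1 u) \<le> C * l2_norm u" by (rule defect_G_bounded) (rule that)
  obtain C' where C': "0 \<le> C'" "\<And>u. u \<in> \<NN> z \<Longrightarrow> l2_norm u \<le> C' * norm (G0 u)" by (rule defect_norm_bounded[OF z]) (rule that)
  note g = gamma[OF z] and gD = defect_max_dom[OF gamma(1)[OF z]]
  note add = gamma_add[OF z] and scale = gamma_scaleC[OF z]
  have scale1: "G1 (gamma z (c *\<^sub>C h)) = c *\<^sub>C G1 (gamma z h)" for c h unfolding scale by (rule G_scaleC(2)[OF gD])
  have "bounded_linear (\<lambda>h. G1 (gamma z h))"
  proof (rule bounded_linear_intro[where K = "C * C'"])
    show "G1 (gamma z (h + h')) = G1 (gamma z h) + G1 (gamma z h')" for h h' unfolding add by (rule G_add(2)[OF gD gD])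
    show "G1 (gamma z (r *\<^sub>R h)) = r *\<^sub>R G1 (gamma z h)" for r h
      using scale1[of "complex_of_real r" h] by (simp add: scaleC_of_real)
    show "norm (G1 (gamma z h)) \<le> norm h * (C * C')" for h
    proof -
      have "norm (G1 (gamma z h)) \<le> C * (C' * norm h)"
        using mult_left_mono[OF C'(2)[OF g(1)], of C h] C(1) by (intro order_trans[OF C(2)[OF g(1)]]) (simp add: g(2))
      then show ?thesis by (simp add: mult_ac)
    qed
  qed
  then obtain T where T: "\<And>h. T *\<^sub>V h = G1 (gamma z h)" using scale1 by (rule cblinfun_of_fun) (rule that)
  have ex: "\<forall>y\<in>\<NN> z. G1 y = T *\<^sub>V G0 y" using gamma_eqI[OF z _ refl] by (auto simp: T)
  have "M z = T"
    unfolding weyl_def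
  proof (rule the_equality[where P = "\<lambda>M. \<forall>y\<in>\<NN> z. G1 y = M *\<^sub>V G0 y", OF ex])
    fix S assume S: "\<forall>y\<in>\<NN> z. G1 y = S *\<^sub>V G0 y"
    show "S = T" by (rule cblinfun_eqI) (metis S T g)
  qed
  then show ?thesis using ex u by simp
qed

text \<open>The initial data of \<open>gamma z (R *\<^sub>V h)\<close> depend boundedly on h through
  the Weyl function, so an operator solution with these data exists. R is left general to cover both
  \<open>Z0\<close> and the solutions of the boundary problem.\<close>

lemma gamma_operator:
  fixes R :: "'k::complex_hilbert \<Rightarrow>\<^sub>C\<^sub>L (('h, 'n) vec \<times> 'g)"
  assumes z: "z \<in> nonreal"
  obtains Y where "op_solution \<Delta> CARD('n) p q z Y" "\<And>t h. Y t *\<^sub>V h = gamma z (R *\<^sub>V h) t"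
proof -
  let ?W = "(inl_op o\<^sub>C\<^sub>L (- (fst_op o\<^sub>C\<^sub>L M z)) + inr_op o\<^sub>C\<^sub>L fst_op) o\<^sub>C\<^sub>L R"
  obtain Y where Y: "op_solution \<Delta> CARD('n) p q z Y"
    "\<And>k c. k < 2 * CARD('n) \<Longrightarrow> quasi_deriv (o\<^sub>C\<^sub>L) \<Delta> CARD('n) p q Y k 0 *\<^sub>V c = coord k (?W *\<^sub>V c)"
    by (rule op_solution_data) (rule that)
  have "Y t *\<^sub>V h = gamma z (R *\<^sub>V h) t" for t h
  proof -
    let ?u = "gamma z (R *\<^sub>V h)"
    have u: "?u \<in> \<NN> z" by (rule gamma(1)[OF z])
    have "data (\<lambda>t. Y t *\<^sub>V h) 0 = ?W *\<^sub>V h"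
      by (rule data_eqI) (simp only: coord_data op_solution_apply(2)[OF Y(1) _ zero_in] Y(2))
    also have "\<dots> = data ?u 0"
      by (simp add: data_G weyl[OF z u] gamma(2)[OF z] cblinfun_add_left cblinfun_minus_left)
    finally have "(\<lambda>t. Y t *\<^sub>V h) = phi z (data ?u 0)" using solution_phi[OF op_solution_apply(1)[OF Y(1)], of h] by simp
    then show ?thesis using defect_phi[OF u] by metis
  qed
  then show thesis using that Y(1) by blast
qed

lemma Z_solution: assumes z: "z \<in> nonreal" shows "op_solution \<Delta> CARD('n) p q z (Z z)" "Z z t *\<^sub>V h = gamma z h t"
proof -
  obtain Y where Y: "op_solution \<Delta> CARD('n) p q z Y" and Y_id: "\<And>t h. Y t *\<^sub>V h = gamma z (cblinfun_id *\<^sub>V h) t"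
    by (rule gamma_operator[OF z, of cblinfun_id]) (rule that)
  have Yg: "Y t *\<^sub>V h = gamma z h t" for t h using Y_id by simp
  have "Z z = Y"
    unfolding Z0_def
  proof (rule the_equality)
    show "op_solution \<Delta> CARD('n) p q z Y \<and> (\<forall>t\<in>\<Delta>. \<forall>h. Y t *\<^sub>V h = gamma z h t)" using Y Yg by blast
    fix X assume X: "op_solution \<Delta> CARD('n) p q z X \<and> (\<forall>t\<in>\<Delta>. \<forall>h. X t *\<^sub>V h = gamma z h t)"
    show "X = Y"
    proof
      fix t
      show "X t = Y t"
      proof (cases "t \<in> \<Delta>")
        case True
        then have "X t *\<^sub>V h = gamma z h t" for h using X by blast
        then show ?thesis by (intro cblinfun_eqI) (simp only: Yg)
      next
        case False
        then show ?thesis using X Y by (simp add: op_solution_def)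
      qed
    qed
  qed
  then show "op_solution \<Delta> CARD('n) p q z (Z z)" "Z z t *\<^sub>V h = gamma z h t" using Y Yg by simp_all
qed

text \<open>The imaginary form of M z is \<open>Im z\<close> times the squared norm of
  \<open>gamma z x\<close>, which is bounded below because G0 is bounded on the defect
  space.\<close>

lemma weyl_coercive:
  assumes z: "z \<in> nonreal"
  obtains c where "0 < c" "\<And>x. c * (norm x)\<^sup>2 \<le> sgn (Im z) * Im (cinner (M z *\<^sub>V x) x)"
proof -
  obtain C where C: "0 < C" "\<And>u. u \<in> \<NN> z \<Longrightarrow> norm (G0 u) \<le> C * l2_norm u" by (rule defect_G_bounded) (rule that)
  have "\<bar>Im z\<bar> / C\<^sup>2 * (norm x)\<^sup>2 \<le> sgn (Im z) * Im (cinner (M z *\<^sub>V x) x)" for x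
  proof -
    note g = gamma[OF z, of x]
    have "sgn (Im z) * (Im z * (l2_norm (gamma z x))\<^sup>2) = sgn (Im z) * Im (cinner (M z *\<^sub>V x) x)"
      using defect_norm[OF g(1)] by (simp add: weyl[OF z g(1)] g(2))
    then have eq: "\<bar>Im z\<bar> * (l2_norm (gamma z x))\<^sup>2 = sgn (Im z) * Im (cinner (M z *\<^sub>V x) x)"
      by (simp add: mult_sgn_abs abs_sgn mult_ac)
    have "norm x \<le> C * l2_norm (gamma z x)" using C(2)[OF g(1)] g(2) by simp
    then have "(norm x)\<^sup>2 \<le> C\<^sup>2 * (l2_norm (gamma z x))\<^sup>2" using power_mono[of "norm x" "C * l2_norm (gamma z x)" 2] by (simp add: power_mult_distrib)
    then have "\<bar>Im z\<bar> / C\<^sup>2 * (norm x)\<^sup>2 \<le> \<bar>Im z\<bar> / C\<^sup>2 * (C\<^sup>2 * (l2_norm (gamma z x))\<^sup>2)" by (intro mult_left_mono) auto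
    then show ?thesis using C(1) eq by simp
  qed
  then show thesis using that[of "\<bar>Im z\<bar> / C\<^sup>2"] C(1) nonreal_Im[OF z] by simp
qed

end



section \<open>Solutions with parameter-dependent boundary conditions\<close>

locale nevanlinna_triplet = boundary_triplet \<Delta> b p q index \<Gamma>0' \<Gamma>1'
  for \<Delta> :: "real set" and b :: ereal
    and p q :: "nat \<Rightarrow> real \<Rightarrow> 'h::{complex_hilbert, second_countable_topology} \<Rightarrow>\<^sub>C\<^sub>L 'h"
    and index :: "'n::{finite, linorder} itself"
    and \<Gamma>0' \<Gamma>1' :: "(real \<Rightarrow> 'h) \<Rightarrow> 'g::complex_hilbert" +
  fixes C0 C1 :: "complex \<Rightarrow> (('h, 'n) vec \<times> 'g) \<Rightarrow>\<^sub>C\<^sub>L 'k::complex_hilbert"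
    and Ch :: "nat \<Rightarrow> complex \<Rightarrow> ('h, 'n) vec \<Rightarrow>\<^sub>C\<^sub>L 'k"
    and C0' C1' :: "complex \<Rightarrow> 'g \<Rightarrow>\<^sub>C\<^sub>L 'k"
    and \<tau> :: "complex \<Rightarrow> ((('h, 'n) vec \<times> 'g) \<times> (('h, 'n) vec \<times> 'g)) set"
    and K0 K1 :: "complex \<Rightarrow> 'k1::complex_hilbert \<Rightarrow>\<^sub>C\<^sub>L (('h, 'n) vec \<times> 'g)"
  assumes pair: "nevanlinna_pair C0 C1"
    and tau: "\<And>z. z \<in> nonreal \<Longrightarrow> \<tau> z = pair_rel (C0 z) (C1 z)"
    and C0_row: "\<And>z. z \<in> nonreal \<Longrightarrow> C0 z = row_op (Ch 2 z) (C0' z)"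
    and C1_row: "\<And>z. z \<in> nonreal \<Longrightarrow> C1 z = row_op (Ch 1 z) (C1' z)"
    and repr: "equiv_repr \<tau> K0 K1"
begin

abbreviation T where "T z \<equiv> C0 z - C1 z o\<^sub>C\<^sub>L M z"
abbreviation E where "E z \<equiv> K1 z + M z o\<^sub>C\<^sub>L K0 z"
abbreviation beta :: "complex \<Rightarrow> (('h, 'n) vec \<times> ('h, 'n) vec) \<Rightarrow>\<^sub>C\<^sub>L 'k1"
  where "beta z \<equiv> row_op (- (inv_op (E z) o\<^sub>C\<^sub>L M z o\<^sub>C\<^sub>L inl_op)) (inv_op (E z) o\<^sub>C\<^sub>L inl_op)"
abbreviation Omega :: "complex \<Rightarrow> (('h, 'n) vec \<times> ('h, 'n) vec) \<Rightarrow>\<^sub>C\<^sub>L (('h, 'n) vec \<times> ('h, 'n) vec)"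
  where "Omega z \<equiv> char_matrix (\<tau> z) (M z)"
abbreviation is_tau_solution where "is_tau_solution \<equiv> tau_solution \<Delta> p q \<Gamma>0' \<Gamma>1' Ch C0' C1'"

lemma invertible_T: assumes z: "z \<in> nonreal" shows "invertible_op (T z)"
proof -
  obtain c where c: "0 < c" "\<And>x. c * (norm x)\<^sup>2 \<le> sgn (Im z) * Im (cinner (M z *\<^sub>V x) x)" by (rule weyl_coercive[OF z]) (rule that)
  show ?thesis by (rule nevanlinna_point.invertible_minus_Weyl[OF nevanlinna_pointI[OF pair z] c])
qed

lemma tau_range: "z \<in> nonreal \<Longrightarrow> \<tau> z = range (\<lambda>k. (K0 z *\<^sub>V k, K1 z *\<^sub>V k))"
  using repr by (simp add: equiv_repr_def)

lemma tau_member: assumes "z \<in> nonreal" shows "C0 z *\<^sub>V (K0 z *\<^sub>V k) + C1 z *\<^sub>V (K1 z *\<^sub>V k) = 0"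
proof -
  have "(K0 z *\<^sub>V k, K1 z *\<^sub>V k) \<in> pair_rel (C0 z) (C1 z)" using tau[OF assms] tau_range[OF assms] by blast
  then show ?thesis by (simp add: pair_rel_def)
qed

lemma invertible_E: assumes z: "z \<in> nonreal" shows "invertible_op (E z)"
proof (rule invertible_plus_Weyl[OF invertible_T[OF z]])
  show "pair_rel (C0 z) (C1 z) = range (\<lambda>k. (K0 z *\<^sub>V k, K1 z *\<^sub>V k))" using tau[OF z] tau_range[OF z] by simp
  show "k = 0" if "K0 z *\<^sub>V k = 0" "K1 z *\<^sub>V k = 0" for k
    using repr z that unfolding equiv_repr_def by blast
qed

text \<open>The minus sign in the first component of \<open>Gamma1\<close> turns
  \<open>C0 Gamma0 - C1 Gamma1\<close> into the left-hand side of the boundary condition.\<close>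

lemma boundary_condition:
  assumes z: "z \<in> nonreal" and u: "op_solution \<Delta> CARD('n) p q z u" and y: "(\<lambda>t. u t *\<^sub>V h) \<in> \<NN> z"
  shows "(Ch 1 z o\<^sub>C\<^sub>L qd1_op \<Delta> p q u 0 + Ch 2 z o\<^sub>C\<^sub>L qd2_op \<Delta> p q u 0) *\<^sub>V h
      + (C0' z *\<^sub>V \<Gamma>0' (\<lambda>t. u t *\<^sub>V h) - C1' z *\<^sub>V \<Gamma>1' (\<lambda>t. u t *\<^sub>V h)) = T z *\<^sub>V G0 (\<lambda>t. u t *\<^sub>V h)"
proof -
  let ?y = "\<lambda>t. u t *\<^sub>V h"
  have "qd1_op \<Delta> p q u 0 *\<^sub>V h = (qd1 \<Delta> p q ?y 0 :: ('h, 'n) vec)"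
  proof (subst vec_eq_iff, intro allI)
    fix i :: 'n
    have "pos i < 2 * CARD('n)" using pos_less[of i] by simp
    then show "(qd1_op \<Delta> p q u 0 *\<^sub>V h) $ i = (qd1 \<Delta> p q ?y 0 :: ('h, 'n) vec) $ i"
      using op_solution_apply(2)[OF u _ zero_in, of "pos i" h] by (simp add: qd1_op_def qd1_def)
  qed
  moreover have "qd2_op \<Delta> p q u 0 *\<^sub>V h = (qd2 \<Delta> p q ?y 0 :: ('h, 'n) vec)"
  proof (subst vec_eq_iff, intro allI)
    fix i :: 'n
    have "2 * CARD('n) - 1 - pos i < 2 * CARD('n)" using pos_less[of i] by simp
    then show "(qd2_op \<Delta> p q u 0 *\<^sub>V h) $ i = (qd2 \<Delta> p q ?y 0 :: ('h, 'n) vec) $ i"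
      using op_solution_apply(2)[OF u _ zero_in, of "2 * CARD('n) - 1 - pos i" h] by (simp add: qd2_op_def qd2_def)
  qed
  moreover have "T z *\<^sub>V G0 ?y = C0 z *\<^sub>V G0 ?y - C1 z *\<^sub>V G1 ?y"
    by (simp add: cblinfun_diff_left weyl[OF z y])
  ultimately show ?thesis
    by (simp add: cblinfun_add_left C0_row[OF z] C1_row[OF z] Gamma0_def Gamma1_def cblinfun_minus_right algebra_simps)
qed

text \<open>Existence, uniqueness and the formula at once. The equality extends to the whole line
  because both sides vanish off the interval.\<close>

lemma tau_solution_iff:
  assumes z: "z \<in> nonreal"
  shows "is_tau_solution j z u \<longleftrightarrow> (\<forall>t. u t = (-1) ^ (j - 1) *\<^sub>R (Z z t o\<^sub>C\<^sub>L inv_op (T z) o\<^sub>C\<^sub>L Ch j z))" (is "?L \<longleftrightarrow> ?R")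
proof -
  let ?R' = "(-1) ^ (j - 1) *\<^sub>R (inv_op (T z) o\<^sub>C\<^sub>L Ch j z)"
  note inv = inv_op_apply[OF invertible_T[OF z]]
  have off: "cutoff \<Delta> y = y" if "solution z (\<lambda>t. 0) y" for y using that by (auto simp: cutoff_def solution_def fun_eq_iff)
  have apply_R: "((-1) ^ (j - 1) *\<^sub>R (Z z t o\<^sub>C\<^sub>L inv_op (T z) o\<^sub>C\<^sub>L Ch j z)) *\<^sub>V h = gamma z (?R' *\<^sub>V h) t" for t h
    unfolding Z_solution(2)[OF z, symmetric] by (simp add: cblinfun_scaleR_left cblinfun_scaleR_right)
  have TR: "T z *\<^sub>V (?R' *\<^sub>V h) = (-1) ^ (j - 1) *\<^sub>R (Ch j z *\<^sub>V h)" for h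
    unfolding cblinfun_scaleR_left cblinfun_scaleR_right cblinfun_compose_apply inv(2) ..
  show ?thesis
  proof
    assume L: ?L
    then have sol: "op_solution \<Delta> CARD('n) p q z u" and l2': "u \<in> L2' \<Delta>" by (simp_all add: tau_solution_def)
    show ?R
    proof (intro allI cblinfun_eqI)
      fix t h
      let ?y = "\<lambda>t. u t *\<^sub>V h"
      note y_sol = op_solution_apply(1)[OF sol, of h]
      have "square_integrable \<Delta> ?y" using l2' by (simp add: L2'_def)
      then have "l2 ?y" unfolding square_integrable_cut[OF Delta_measurable] off[OF y_sol] .
      then have y: "?y \<in> \<NN> z" using y_sol by (simp add: defect_iff)
      have "T z *\<^sub>V G0 ?y = (-1) ^ (j - 1) *\<^sub>R (Ch j z *\<^sub>V h)"
        using L boundary_condition[OF z sol y] by (simp add: tau_solution_def)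
      then have "T z *\<^sub>V G0 ?y = T z *\<^sub>V (?R' *\<^sub>V h)" using TR by simp
      then have "G0 ?y = ?R' *\<^sub>V h" using inv(1) by metis
      then have "gamma z (?R' *\<^sub>V h) = ?y" by (rule gamma_eqI[OF z y])
      then show "u t *\<^sub>V h = ((-1) ^ (j - 1) *\<^sub>R (Z z t o\<^sub>C\<^sub>L inv_op (T z) o\<^sub>C\<^sub>L Ch j z)) *\<^sub>V h"
        unfolding apply_R by simp
    qed
  next
    assume R: ?R
    obtain Y where Y: "op_solution \<Delta> CARD('n) p q z Y" "\<And>t h. Y t *\<^sub>V h = gamma z (?R' *\<^sub>V h) t"
      by (rule gamma_operator[OF z, of ?R']) (rule that)
    have "u t = Y t" for t using R by (intro cblinfun_eqI) (simp only: apply_R Y(2))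
    then have u: "u = Y" by auto
    have y: "(\<lambda>t. Y t *\<^sub>V h) = gamma z (?R' *\<^sub>V h)" for h by (simp only: Y(2))
    have yN: "(\<lambda>t. Y t *\<^sub>V h) \<in> \<NN> z" for h unfolding y by (rule gamma(1)[OF z])
    have "Y \<in> L2' \<Delta>"
      unfolding L2'_def
    proof (intro CollectI allI)
      fix h
      show "square_integrable \<Delta> (\<lambda>t. Y t *\<^sub>V h)"
        using yN[of h] off unfolding square_integrable_cut[OF Delta_measurable] defect_iff by simp
    qed
    moreover have "G0 (\<lambda>t. Y t *\<^sub>V h) = ?R' *\<^sub>V h" for h unfolding y by (rule gamma(2)[OF z])
    ultimately show ?L
      unfolding u tau_solution_def using Y(1) boundary_condition[OF z Y(1) yN] TR by simp
  qed
qed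

text \<open>Sends a to the first boundary value of the solution U a, expressed through the parameter
  \<open>beta z *\<^sub>V a\<close> of the relation.\<close>

definition data_op :: "complex \<Rightarrow> (('h, 'n) vec \<times> ('h, 'n) vec) \<Rightarrow>\<^sub>C\<^sub>L (('h, 'n) vec \<times> 'g)"
  where "data_op z = - (K0 z o\<^sub>C\<^sub>L beta z) - inl_op o\<^sub>C\<^sub>L fst_op"

lemma data_op_apply: "data_op z *\<^sub>V a = - (K0 z *\<^sub>V (beta z *\<^sub>V a)) - (fst a, 0)"
  by (simp only: data_op_def cblinfun_diff_left cblinfun_minus_left cblinfun_compose_apply inl_op_apply fst_op_apply)

lemma beta_apply: "beta z *\<^sub>V a = inv_op (E z) *\<^sub>V ((snd a, 0) - M z *\<^sub>V (fst a, 0))"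
  by (simp add: cblinfun_diff_right cblinfun_minus_left)

text \<open>The sign belonging to j = 2 supplies the minus in front of C0, so
  \<open>relation_solve\<close> applies with the two components of a.\<close>

lemma U_apply:
  assumes z: "z \<in> nonreal" and u: "is_tau_solution 1 z u1" "is_tau_solution 2 z u2"
  shows "row_op (u2 t) (u1 t) = Z z t o\<^sub>C\<^sub>L data_op z"
proof (rule cblinfun_eqI)
  fix a :: "('h, 'n) vec \<times> ('h, 'n) vec"
  note E = invertible_E[OF z] and rel = tau_range[OF z]
  have M_eq: "M z *\<^sub>V (- (K0 z *\<^sub>V (beta z *\<^sub>V a)) - (fst a, 0)) = K1 z *\<^sub>V (beta z *\<^sub>V a) - (snd a, 0)"
    by (rule char_matrix_apply(2)[OF E rel, of _ "snd a" "fst a"]) (rule beta_apply)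
  have "row_op (u2 t) (u1 t) *\<^sub>V a = Z z t *\<^sub>V (inv_op (T z) *\<^sub>V (C1 z *\<^sub>V (snd a, 0) - C0 z *\<^sub>V (fst a, 0)))"
    using u unfolding tau_solution_iff[OF z]
    by (simp add: C0_row[OF z] C1_row[OF z] cblinfun_diff_right cblinfun_scaleR_left cblinfun_minus_left)
  also have "\<dots> = (Z z t o\<^sub>C\<^sub>L data_op z) *\<^sub>V a"
    unfolding relation_solve[OF invertible_T[OF z] tau_member[OF z] M_eq] cblinfun_compose_apply data_op_apply ..
  finally show "row_op (u2 t) (u1 t) *\<^sub>V a = (Z z t o\<^sub>C\<^sub>L data_op z) *\<^sub>V a" .
qed

section \<open>The identity and the inequality for the characteristic matrix\<close>

lemma gamma_data_identity:
  assumes \<mu>: "\<mu> \<in> nonreal" and z: "z \<in> nonreal"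
  shows "cinner (Omega \<mu> *\<^sub>V a) c - cinner a (Omega z *\<^sub>V c) =
    (\<mu> - cnj z) * l2_inner (gamma \<mu> (data_op \<mu> *\<^sub>V a)) (gamma z (data_op z *\<^sub>V c))
    + cinner (K1 \<mu> *\<^sub>V (beta \<mu> *\<^sub>V a)) (K0 z *\<^sub>V (beta z *\<^sub>V c)) - cinner (K0 \<mu> *\<^sub>V (beta \<mu> *\<^sub>V a)) (K1 z *\<^sub>V (beta z *\<^sub>V c))"
proof -
  let ?g = "data_op \<mu> *\<^sub>V a" and ?g' = "data_op z *\<^sub>V c"
  have "(\<mu> - cnj z) * l2_inner (gamma \<mu> ?g) (gamma z ?g') = cinner (M \<mu> *\<^sub>V ?g) ?g' - cinner ?g (M z *\<^sub>V ?g')"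
    using defect_identity[OF gamma(1)[OF \<mu>] gamma(1)[OF z], of ?g ?g']
    by (simp only: weyl[OF \<mu> gamma(1)[OF \<mu>]] weyl[OF z gamma(1)[OF z]] gamma(2)[OF \<mu>] gamma(2)[OF z])
  then show ?thesis
    using char_matrix_identity[OF invertible_E[OF \<mu>] invertible_E[OF z] tau_range[OF \<mu>] tau_range[OF z]
        beta_apply beta_apply data_op_apply data_op_apply] by simp
qed

text \<open>J is first defined weakly as the operator of the sesquilinear form of the solutions. The
  partial integrals exist in operator norm because the integrand is norm continuous on segments;
  their strong convergence to J follows from the tails of the single function belonging to
  a.\<close>

lemma gamma_integral:
  assumes \<mu>: "\<mu> \<in> nonreal" and z: "z \<in> nonreal"
  obtains J where "has_strong_integral (\<lambda>t. adj (Z z t o\<^sub>C\<^sub>L data_op z) o\<^sub>C\<^sub>L (Z \<mu> t o\<^sub>C\<^sub>L data_op \<mu>)) b J"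
    and "\<And>a c. cinner (J *\<^sub>V a) c = l2_inner (gamma \<mu> (data_op \<mu> *\<^sub>V a)) (gamma z (data_op z *\<^sub>V c))"
proof -
  let ?u = "\<lambda>w a. gamma w (data_op w *\<^sub>V a)"
  have l2u: "l2 (?u w a)" if "w \<in> nonreal" for w a using gamma(1)[OF that] by (simp add: defect_iff)
  have bound: "\<exists>C\<ge>0. \<forall>a. l2_norm (?u w a) \<le> C * norm a" if w: "w \<in> nonreal" for w
  proof -
    obtain C where C: "0 \<le> C" "\<And>u. u \<in> \<NN> w \<Longrightarrow> l2_norm u \<le> C * norm (G0 u)" by (rule defect_norm_bounded[OF w]) (rule that)
    have "l2_norm (?u w a) \<le> C * norm (data_op w) * norm a" for a
    proof -
      have "l2_norm (?u w a) \<le> C * norm (data_op w *\<^sub>V a)" using C(2)[OF gamma(1)[OF w]] by (simp only: gamma(2)[OF w])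
      also have "\<dots> \<le> C * (norm (data_op w) * norm a)" by (intro mult_left_mono norm_cblinfun_apply C(1))
      finally show ?thesis by (simp add: mult.assoc)
    qed
    then show ?thesis using C(1) by (intro exI[of _ "C * norm (data_op w)"]) simp
  qed
  obtain C where C: "0 \<le> C" "\<And>a. l2_norm (?u \<mu> a) \<le> C * norm a" using bound[OF \<mu>] by blast
  obtain C' where C': "0 \<le> C'" "\<And>a. l2_norm (?u z a) \<le> C' * norm a" using bound[OF z] by blast
  have u_add: "?u w (a + a') = (\<lambda>t. ?u w a t + ?u w a' t)" if "w \<in> nonreal" for w a a'
    unfolding cblinfun_add_right by (rule gamma_add[OF that])
  have u_scale: "?u w (r *\<^sub>C a) = (\<lambda>t. r *\<^sub>C ?u w a t)" if "w \<in> nonreal" for w r a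
    unfolding cblinfun_scaleC_right by (rule gamma_scaleC[OF that])
  obtain J where J: "\<And>a c. cinner (J *\<^sub>V a) c = l2_inner (?u \<mu> a) (?u z c)"
  proof (rule form_operator[of "\<lambda>a c. l2_inner (?u \<mu> a) (?u z c)" "C * C'"])
    show "l2_inner (?u \<mu> (x + x')) (?u z y) = l2_inner (?u \<mu> x) (?u z y) + l2_inner (?u \<mu> x') (?u z y)" for x x' y
      unfolding u_add[OF \<mu>] by (rule l2_inner_add_left[OF l2u[OF \<mu>] l2u[OF \<mu>] l2u[OF z]])
    show "l2_inner (?u \<mu> x) (?u z (y + y')) = l2_inner (?u \<mu> x) (?u z y) + l2_inner (?u \<mu> x) (?u z y')" for x y y'
      unfolding u_add[OF z] by (rule l2_inner_add_right[OF l2u[OF z] l2u[OF z] l2u[OF \<mu>]])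
    show "l2_inner (?u \<mu> (r *\<^sub>C x)) (?u z y) = r * l2_inner (?u \<mu> x) (?u z y)" for r x y
      unfolding u_scale[OF \<mu>] by (rule l2_inner_scaleC_left)
    show "l2_inner (?u \<mu> x) (?u z (r *\<^sub>C y)) = cnj r * l2_inner (?u \<mu> x) (?u z y)" for r x y
      unfolding u_scale[OF z] by (rule l2_inner_scaleC_right)
    show "cmod (l2_inner (?u \<mu> x) (?u z y)) \<le> C * C' * norm x * norm y" for x y
    proof -
      have "cmod (l2_inner (?u \<mu> x) (?u z y)) \<le> l2_norm (?u \<mu> x) * l2_norm (?u z y)" by (rule l2_cauchy_schwarz[OF l2u[OF \<mu>] l2u[OF z]])
      also have "\<dots> \<le> (C * norm x) * (C' * norm y)" using C by (intro mult_mono C C' l2_norm_nonneg) auto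
      finally show ?thesis by (simp add: mult_ac)
    qed
    show "0 \<le> C * C'" using C(1) C'(1) by simp
    fix J assume "\<And>x y. cinner (J *\<^sub>V x) y = l2_inner (?u \<mu> x) (?u z y)"
    then show thesis by (rule that)
  qed
  let ?F = "\<lambda>t. adj (Z z t o\<^sub>C\<^sub>L data_op z) o\<^sub>C\<^sub>L (Z \<mu> t o\<^sub>C\<^sub>L data_op \<mu>)"
  have cont: "continuous_on \<Delta> ?F"
    by (intro bounded_bilinear.continuous_on[OF bounded_bilinear_cblinfun_compose] bounded_linear.continuous_on[OF bounded_linear_adj]
        continuous_on_const op_solution_continuous[OF Z_solution(1)] \<mu> z)
  define I where "I \<eta> = integral {0..\<eta>} ?F" for \<eta>
  have I: "(?F has_integral I \<eta>) {0..\<eta>}" if "\<eta> \<in> \<Delta>" for \<eta>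
    unfolding I_def by (intro integrable_integral integrable_continuous_interval continuous_on_subset[OF cont segment[OF that]])
  have I_inner: "cinner (I \<eta> *\<^sub>V a) c = l2_inner (cutoff {0..\<eta>} (?u \<mu> a)) (?u z c)" if \<eta>: "\<eta> \<in> \<Delta>" for \<eta> a c
  proof -
    have "bounded_linear (\<lambda>S. cinner (S *\<^sub>V a) c)"
      by (rule bounded_linear_compose[OF bounded_bilinear.bounded_linear_left[OF bounded_bilinear_cinner]
            bounded_bilinear.bounded_linear_left[OF bounded_bilinear_cblinfun_apply]])
    from has_integral_linear[OF I[OF \<eta>] this]
    have 1: "((\<lambda>t. cinner (?u \<mu> a t) (?u z c t)) has_integral cinner (I \<eta> *\<^sub>V a) c) {0..\<eta>}"
      by (simp add: o_def cinner_adj_left Z_solution(2) \<mu> z)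
    have "integrable lebesgue (\<lambda>t. cinner (cutoff {0..\<eta>} (?u \<mu> a) t) (?u z c t))"
      by (intro l2_integrable l2_cut l2u \<mu> z) simp
    from has_integral_integral_lebesgue[OF this]
    have "((\<lambda>t. cinner (cutoff {0..\<eta>} (?u \<mu> a) t) (?u z c t)) has_integral l2_inner (cutoff {0..\<eta>} (?u \<mu> a)) (?u z c)) UNIV"
      by (simp add: l2_inner_def)
    moreover have "(\<lambda>t. cinner (cutoff {0..\<eta>} (?u \<mu> a) t) (?u z c t)) = (\<lambda>t. if t \<in> {0..\<eta>} then cinner (?u \<mu> a t) (?u z c t) else 0)"
      by (auto simp: cutoff_def)
    ultimately have "((\<lambda>t. cinner (?u \<mu> a t) (?u z c t)) has_integral l2_inner (cutoff {0..\<eta>} (?u \<mu> a)) (?u z c)) {0..\<eta>}"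
      using has_integral_restrict_UNIV[of "{0..\<eta>}" "\<lambda>t. cinner (?u \<mu> a t) (?u z c t)"] by simp
    then show ?thesis by (rule has_integral_unique[OF 1])
  qed
  have lim: "((\<lambda>\<eta>. I \<eta> *\<^sub>V a) \<longlongrightarrow> J *\<^sub>V a) (up_to b)" for a
  proof (rule Lim_null[THEN iffD2], rule tendsto_norm_zero_cancel)
    have tail: "((\<lambda>\<eta>. l2_norm (cutoff (- {0..\<eta>}) (?u \<mu> a)) * C') \<longlongrightarrow> 0 * C') (up_to b)"
    proof (intro tendsto_mult tendsto_const tail_tendsto l2u \<mu>)
      fix t assume "t \<notin> \<Delta>"
      then show "?u \<mu> a t = 0" using gamma(1)[OF \<mu>] unfolding defect_iff solution_def by blast
    qed
    obtain e where e: "e \<in> \<Delta>" "ereal e < b" by (rule positive_in)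
    have up: "\<forall>\<^sub>F \<eta> in up_to b. norm (I \<eta> *\<^sub>V a - J *\<^sub>V a) \<le> l2_norm (cutoff (- {0..\<eta>}) (?u \<mu> a)) * C'"
      using up_to_in[OF e]
    proof eventually_elim
      case (elim \<eta>)
      then have \<eta>: "\<eta> \<in> \<Delta>" by blast
      let ?v = "I \<eta> *\<^sub>V a - J *\<^sub>V a" and ?t = "cutoff (- {0..\<eta>}) (?u \<mu> a)"
      have l2t: "l2 ?t" by (intro l2_cut l2u \<mu>) auto
      have "?u \<mu> a = (\<lambda>t. cutoff {0..\<eta>} (?u \<mu> a) t + ?t t)" by (auto simp: cutoff_def)
      then have "l2_inner (?u \<mu> a) (?u z c) = l2_inner (cutoff {0..\<eta>} (?u \<mu> a)) (?u z c) + l2_inner ?t (?u z c)" for c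
        using l2_inner_add_left[OF l2_cut[OF l2u[OF \<mu>]] l2t l2u[OF z], of "{0..\<eta>}" a c] by simp
      then have eq: "cinner ?v ?v = - l2_inner ?t (?u z ?v)"
        by (simp add: cinner_diff_left[of "I \<eta> *\<^sub>V a"] I_inner[OF \<eta>] J)
      \<comment> \<open>Testing the difference on itself turns the weak identity into a norm
        estimate: the solution with data v is bounded by C' times the norm of v, and one factor
        cancels.\<close>
      have "(norm ?v)\<^sup>2 = cmod (cinner ?v ?v)" unfolding cinner_self norm_of_real by simp
      also have "\<dots> = cmod (l2_inner ?t (?u z ?v))" unfolding eq by (rule norm_minus_cancel)
      also have "\<dots> \<le> l2_norm ?t * l2_norm (?u z ?v)" by (rule l2_cauchy_schwarz[OF l2t l2u[OF z]])
      also have "\<dots> \<le> l2_norm ?t * (C' * norm ?v)" by (intro mult_left_mono C' l2_norm_nonneg)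
      finally have le: "norm ?v * norm ?v \<le> l2_norm ?t * C' * norm ?v" by (simp add: power2_eq_square mult_ac)
      show ?case
      proof (cases "?v = 0")
        case False
        then show ?thesis using le by simp
      qed (simp add: C'(1) l2_norm_nonneg)
    qed
    show "((\<lambda>\<eta>. norm (I \<eta> *\<^sub>V a - J *\<^sub>V a)) \<longlongrightarrow> 0) (up_to b)"
    proof (rule tendsto_sandwich[OF _ up tendsto_const])
      show "\<forall>\<^sub>F \<eta> in up_to b. 0 \<le> norm (I \<eta> *\<^sub>V a - J *\<^sub>V a)" by simp
      show "((\<lambda>\<eta>. l2_norm (cutoff (- {0..\<eta>}) (?u \<mu> a)) * C') \<longlongrightarrow> 0) (up_to b)" using tail by simp
    qed
  qed
  show thesis
  proof (rule that[OF _ J])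
    show "has_strong_integral ?F b J"
      unfolding has_strong_integral_def
    proof (intro exI[of _ I] conjI allI impI lim)
      fix \<eta> assume "0 \<le> \<eta>" "ereal \<eta> < b"
      then show "(?F has_integral I \<eta>) {0..\<eta>}" by (intro I less_b_in)
    qed
  qed
qed

lemma char_matrix_integral:
  assumes \<mu>: "\<mu> \<in> nonreal" and z: "z \<in> nonreal"
    and J: "\<And>a c. cinner (J *\<^sub>V a) c = l2_inner (gamma \<mu> (data_op \<mu> *\<^sub>V a)) (gamma z (data_op z *\<^sub>V c))"
  shows "Omega \<mu> - adj (Omega z) = (\<mu> - cnj z) *\<^sub>C J
    + adj (beta z) o\<^sub>C\<^sub>L (adj (K0 z) o\<^sub>C\<^sub>L K1 \<mu> - adj (K1 z) o\<^sub>C\<^sub>L K0 \<mu>) o\<^sub>C\<^sub>L beta \<mu>" (is "?L = ?R")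
proof (intro cblinfun_eqI cinner_ext)
  fix a c
  have "cinner (?L *\<^sub>V a) c = cinner (Omega \<mu> *\<^sub>V a) c - cinner a (Omega z *\<^sub>V c)"
    by (simp only: cblinfun_diff_left cinner_diff_left cinner_adj_left)
  also have "\<dots> = cinner (?R *\<^sub>V a) c"
    unfolding gamma_data_identity[OF \<mu> z]
    by (simp only: cblinfun_add_left cblinfun_diff_left cblinfun_scaleC_left cblinfun_compose_apply cinner_add_left cinner_scaleC_left
        cinner_diff_left cinner_adj_left J add_diff_eq)
  finally show "cinner (?L *\<^sub>V a) c = cinner (?R *\<^sub>V a) c" .
qed

text \<open>For equal parameters the identity has the squared norm of the solution and the form of
  the pair \<open>(K0 k, K1 k)\<close> as imaginary parts; this pair lies in the relation, so its
  sign is known.\<close>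

lemma char_matrix_le:
  assumes \<mu>: "\<mu> \<in> nonreal"
    and J: "\<And>a c. cinner (J *\<^sub>V a) c = l2_inner (gamma \<mu> (data_op \<mu> *\<^sub>V a)) (gamma \<mu> (data_op \<mu> *\<^sub>V c))"
  shows "J \<le>\<^sub>o\<^sub>p (1 / Im \<mu>) *\<^sub>R Im_op (Omega \<mu>)"
  unfolding op_le_def
proof
  fix a
  let ?k = "beta \<mu> *\<^sub>V a" and ?r = "(l2_norm (gamma \<mu> (data_op \<mu> *\<^sub>V a)))\<^sup>2"
  have "cinner (Omega \<mu> *\<^sub>V a) a - cnj (cinner (Omega \<mu> *\<^sub>V a) a) = (\<mu> - cnj \<mu>) * of_real ?r
      + (cinner (K1 \<mu> *\<^sub>V ?k) (K0 \<mu> *\<^sub>V ?k) - cnj (cinner (K1 \<mu> *\<^sub>V ?k) (K0 \<mu> *\<^sub>V ?k)))"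
    using gamma_data_identity[OF \<mu> \<mu>, of a a] unfolding l2_inner_self cinner_commute[symmetric] by simp
  from arg_cong[OF this, of Im]
  have im: "Im (cinner (Omega \<mu> *\<^sub>V a) a) = Im \<mu> * ?r + Im (cinner (K1 \<mu> *\<^sub>V ?k) (K0 \<mu> *\<^sub>V ?k))" by simp
  have "0 \<le> sgn (Im \<mu>) * Im (cinner (K1 \<mu> *\<^sub>V ?k) (K0 \<mu> *\<^sub>V ?k))"
    by (rule nevanlinna_point.relation_dissipative[OF nevanlinna_pointI[OF pair \<mu>] tau_member[OF \<mu>]])
  then have nonneg: "0 \<le> 1 / Im \<mu> * Im (cinner (K1 \<mu> *\<^sub>V ?k) (K0 \<mu> *\<^sub>V ?k))"
    using nonreal_Im[OF \<mu>] by (cases "0 < Im \<mu>") (auto simp: sgn_if divide_nonpos_neg)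
  have "cinner (((1 / Im \<mu>) *\<^sub>R Im_op (Omega \<mu>) - J) *\<^sub>V a) a
      = of_real (1 / Im \<mu> * Im (cinner (Omega \<mu> *\<^sub>V a) a)) - of_real ?r"
    unfolding cblinfun_diff_left cblinfun_scaleR_left cinner_diff_left cinner_scaleR_left cinner_Im_op J l2_inner_self by simp
  also have "\<dots> = of_real (1 / Im \<mu> * Im (cinner (K1 \<mu> *\<^sub>V ?k) (K0 \<mu> *\<^sub>V ?k)))"
    unfolding im using nonreal_Im[OF \<mu>] by (simp add: field_simps flip: of_real_diff)
  finally have eq: "cinner (((1 / Im \<mu>) *\<^sub>R Im_op (Omega \<mu>) - J) *\<^sub>V a) a = of_real (1 / Im \<mu> * Im (cinner (K1 \<mu> *\<^sub>V ?k) (K0 \<mu> *\<^sub>V ?k)))" .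
  show "Im (cinner (((1 / Im \<mu>) *\<^sub>R Im_op (Omega \<mu>) - J) *\<^sub>V a) a) = 0 \<and>
      0 \<le> Re (cinner (((1 / Im \<mu>) *\<^sub>R Im_op (Omega \<mu>) - J) *\<^sub>V a) a)"
    unfolding eq using nonneg by (simp only: Im_complex_of_real Re_complex_of_real)
qed

end

theorem proposition5p14:
  fixes \<Delta> :: "real set" and b :: ereal
    and p q :: "nat \<Rightarrow> real \<Rightarrow> 'h::{complex_hilbert, second_countable_topology} \<Rightarrow>\<^sub>C\<^sub>L 'h"
    and \<Gamma>0' \<Gamma>1' :: "(real \<Rightarrow> 'h) \<Rightarrow> 'g::complex_hilbert"
    and M :: "complex \<Rightarrow> (('h, 'n::{finite, linorder}) vec \<times> 'g) \<Rightarrow>\<^sub>C\<^sub>L (('h, 'n) vec \<times> 'g)"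
    and C0 C1 :: "complex \<Rightarrow> (('h, 'n) vec \<times> 'g) \<Rightarrow>\<^sub>C\<^sub>L 'k::complex_hilbert"
    and Ch :: "nat \<Rightarrow> complex \<Rightarrow> ('h, 'n) vec \<Rightarrow>\<^sub>C\<^sub>L 'k"
    and C0' C1' :: "complex \<Rightarrow> 'g \<Rightarrow>\<^sub>C\<^sub>L 'k"
    and \<tau> :: "complex \<Rightarrow> ((('h, 'n) vec \<times> 'g) \<times> (('h, 'n) vec \<times> 'g)) set"
    and K0 K1 :: "complex \<Rightarrow> 'k1::complex_hilbert \<Rightarrow>\<^sub>C\<^sub>L (('h, 'n) vec \<times> 'g)"
    and \<Omega> :: "complex \<Rightarrow> (('h, 'n) vec \<times> ('h, 'n) vec) \<Rightarrow>\<^sub>C\<^sub>L (('h, 'n) vec \<times> ('h, 'n) vec)"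
    and \<beta> :: "complex \<Rightarrow> (('h, 'n) vec \<times> ('h, 'n) vec) \<Rightarrow>\<^sub>C\<^sub>L 'k1"
  assumes "is_Delta \<Delta> b"
    and "coefficients_ok \<Delta> CARD('n) p q"
    and "decomposing_triplet TYPE('n) \<Delta> b p q \<Gamma>0' \<Gamma>1'"
    and M: "M = weyl \<Delta> p q \<Gamma>0' \<Gamma>1'"
    and "nevanlinna_pair C0 C1"
    and "\<And>z. z \<in> nonreal \<Longrightarrow> \<tau> z = pair_rel (C0 z) (C1 z)"
    and "\<And>z. z \<in> nonreal \<Longrightarrow> C0 z = row_op (Ch 2 z) (C0' z)"
    and "\<And>z. z \<in> nonreal \<Longrightarrow> C1 z = row_op (Ch 1 z) (C1' z)"
    and "equiv_repr \<tau> K0 K1"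
    and \<Omega>: "\<Omega> = (\<lambda>z. char_matrix (\<tau> z) (M z))"
    and \<beta>: "\<beta> = (\<lambda>z. row_op
          (- (inv_op (K1 z + M z o\<^sub>C\<^sub>L K0 z) o\<^sub>C\<^sub>L M z o\<^sub>C\<^sub>L inl_op))
          (inv_op (K1 z + M z o\<^sub>C\<^sub>L K0 z) o\<^sub>C\<^sub>L inl_op))"
  shows
    "(\<forall>z\<in>nonreal. \<exists>!u :: (real \<Rightarrow> ('h, 'n) vec \<Rightarrow>\<^sub>C\<^sub>L 'h) \<times> (real \<Rightarrow> ('h, 'n) vec \<Rightarrow>\<^sub>C\<^sub>L 'h).
        tau_solution \<Delta> p q \<Gamma>0' \<Gamma>1' Ch C0' C1' 1 z (fst u) \<and>
        tau_solution \<Delta> p q \<Gamma>0' \<Gamma>1' Ch C0' C1' 2 z (snd u)) \<and>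
     (\<forall>(u :: nat \<Rightarrow> real \<Rightarrow> complex \<Rightarrow> ('h, 'n) vec \<Rightarrow>\<^sub>C\<^sub>L 'h) U.
        (\<forall>z\<in>nonreal. \<forall>j\<in>{1, 2}.
           tau_solution \<Delta> p q \<Gamma>0' \<Gamma>1' Ch C0' C1' j z (\<lambda>t. u j t z)) \<and>
        U = (\<lambda>t z. row_op (u 2 t z) (u 1 t z))
        \<longrightarrow>
        (\<forall>j\<in>{1, 2}. \<forall>z\<in>nonreal. \<forall>t\<in>\<Delta>.
           u j t z = (-1) ^ (j - 1) *\<^sub>R
             (Z0 \<Delta> p q \<Gamma>0' z t o\<^sub>C\<^sub>L inv_op (C0 z - C1 z o\<^sub>C\<^sub>L M z) o\<^sub>C\<^sub>L Ch j z)) \<and>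
        (\<forall>\<mu>\<in>nonreal. \<forall>z\<in>nonreal. \<exists>J.
           has_strong_integral (\<lambda>t. adj (U t z) o\<^sub>C\<^sub>L U t \<mu>) b J \<and>
           \<Omega> \<mu> - adj (\<Omega> z) = (\<mu> - cnj z) *\<^sub>C J
             + adj (\<beta> z) o\<^sub>C\<^sub>L (adj (K0 z) o\<^sub>C\<^sub>L K1 \<mu> - adj (K1 z) o\<^sub>C\<^sub>L K0 \<mu>) o\<^sub>C\<^sub>L \<beta> \<mu>) \<and>
        (\<forall>\<mu>\<in>nonreal. \<exists>J.
           has_strong_integral (\<lambda>t. adj (U t \<mu>) o\<^sub>C\<^sub>L U t \<mu>) b J \<and>
           J \<le>\<^sub>o\<^sub>p (1 / Im \<mu>) *\<^sub>R Im_op (\<Omega> \<mu>)))"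
proof -
  interpret nevanlinna_triplet \<Delta> b p q "TYPE('n)" \<Gamma>0' \<Gamma>1' C0 C1 Ch C0' C1' \<tau> K0 K1
  proof unfold_locales
    show "is_Delta \<Delta> b" "coefficients_ok \<Delta> CARD('n) p q" "decomposing_triplet TYPE('n) \<Delta> b p q \<Gamma>0' \<Gamma>1'"
      "nevanlinna_pair C0 C1" "equiv_repr \<tau> K0 K1"
      by fact+
  qed (use assms in auto)
  let ?v = "\<lambda>j z t. (-1) ^ (j - 1) *\<^sub>R (Z0 \<Delta> p q \<Gamma>0' z t o\<^sub>C\<^sub>L inv_op (C0 z - C1 z o\<^sub>C\<^sub>L M z) o\<^sub>C\<^sub>L Ch j z)"
  \<comment> \<open>Each boundary problem has exactly one solution, the explicit function
    \<open>?v j z\<close>, so uniqueness of the pair and the formula are both read off.\<close>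
  have iff: "tau_solution \<Delta> p q \<Gamma>0' \<Gamma>1' Ch C0' C1' j z u \<longleftrightarrow> u = ?v j z" if "z \<in> nonreal" for j z u
    unfolding tau_solution_iff[OF that] M by auto
  show ?thesis
  proof (intro conjI ballI allI impI)
    fix z :: complex assume z: "z \<in> nonreal"
    show "\<exists>!u. tau_solution \<Delta> p q \<Gamma>0' \<Gamma>1' Ch C0' C1' 1 z (fst u) \<and> tau_solution \<Delta> p q \<Gamma>0' \<Gamma>1' Ch C0' C1' 2 z (snd u)"
      unfolding iff[OF z] by (rule ex1I[of _ "(?v 1 z, ?v 2 z)"]) (auto simp: prod_eq_iff)
  next
    fix u U z t and j :: nat
    assume "(\<forall>z\<in>nonreal. \<forall>j\<in>{1, 2}. tau_solution \<Delta> p q \<Gamma>0' \<Gamma>1' Ch C0' C1' j z (\<lambda>t. u j t z)) \<and> U = (\<lambda>t z. row_op (u 2 t z) (u 1 t z))"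
      and "j \<in> {1, 2}" "z \<in> nonreal"
    then have "(\<lambda>t. u j t z) = ?v j z" using iff by blast
    then show "u j t z = ?v j z t" by (rule fun_cong)
  next
    fix u U \<mu> z
    assume u: "(\<forall>z\<in>nonreal. \<forall>j\<in>{1, 2}. tau_solution \<Delta> p q \<Gamma>0' \<Gamma>1' Ch C0' C1' j z (\<lambda>t. u j t z)) \<and> U = (\<lambda>t z. row_op (u 2 t z) (u 1 t z))"
      and \<mu>: "\<mu> \<in> nonreal" and z: "z \<in> nonreal"
    have U: "U t w = Z0 \<Delta> p q \<Gamma>0' w t o\<^sub>C\<^sub>L data_op w" if "w \<in> nonreal" for t w
      using u U_apply[OF that, of "\<lambda>t. u 1 t w" "\<lambda>t. u 2 t w"] that by simp
    obtain J where J: "has_strong_integral (\<lambda>t. adj (Z z t o\<^sub>C\<^sub>L data_op z) o\<^sub>C\<^sub>L (Z \<mu> t o\<^sub>C\<^sub>L data_op \<mu>)) b J"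
      "\<And>a c. cinner (J *\<^sub>V a) c = l2_inner (gamma \<mu> (data_op \<mu> *\<^sub>V a)) (gamma z (data_op z *\<^sub>V c))"
      by (rule gamma_integral[OF \<mu> z]) (rule that)
    show "\<exists>J. has_strong_integral (\<lambda>t. adj (U t z) o\<^sub>C\<^sub>L U t \<mu>) b J \<and>
       \<Omega> \<mu> - adj (\<Omega> z) = (\<mu> - cnj z) *\<^sub>C J
         + adj (\<beta> z) o\<^sub>C\<^sub>L (adj (K0 z) o\<^sub>C\<^sub>L K1 \<mu> - adj (K1 z) o\<^sub>C\<^sub>L K0 \<mu>) o\<^sub>C\<^sub>L \<beta> \<mu>"
      unfolding \<Omega> \<beta> M U[OF z] U[OF \<mu>] using J(1) char_matrix_integral[OF \<mu> z J(2)] by (intro exI[of _ J] conjI)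
  next
    fix u U \<mu>
    assume u: "(\<forall>z\<in>nonreal. \<forall>j\<in>{1, 2}. tau_solution \<Delta> p q \<Gamma>0' \<Gamma>1' Ch C0' C1' j z (\<lambda>t. u j t z)) \<and> U = (\<lambda>t z. row_op (u 2 t z) (u 1 t z))"
      and \<mu>: "\<mu> \<in> nonreal"
    have U: "U t w = Z0 \<Delta> p q \<Gamma>0' w t o\<^sub>C\<^sub>L data_op w" if "w \<in> nonreal" for t w
      using u U_apply[OF that, of "\<lambda>t. u 1 t w" "\<lambda>t. u 2 t w"] that by simp
    obtain J where J: "has_strong_integral (\<lambda>t. adj (Z \<mu> t o\<^sub>C\<^sub>L data_op \<mu>) o\<^sub>C\<^sub>L (Z \<mu> t o\<^sub>C\<^sub>L data_op \<mu>)) b J"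
      "\<And>a c. cinner (J *\<^sub>V a) c = l2_inner (gamma \<mu> (data_op \<mu> *\<^sub>V a)) (gamma \<mu> (data_op \<mu> *\<^sub>V c))"
      by (rule gamma_integral[OF \<mu> \<mu>]) (rule that)
    show "\<exists>J. has_strong_integral (\<lambda>t. adj (U t \<mu>) o\<^sub>C\<^sub>L U t \<mu>) b J \<and> J \<le>\<^sub>o\<^sub>p (1 / Im \<mu>) *\<^sub>R Im_op (\<Omega> \<mu>)"
      unfolding \<Omega> M U[OF \<mu>] using J(1) char_matrix_le[OF \<mu> J(2)] by (intro exI[of _ J] conjI)
  qed
qed

end
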